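(* Let $G$ be a Lie group, let $S$ be a simplicial set, let $\{v_\sigma\}_{\sigma\in S}$ be a set of compatible transition functions on $S$ with values in $G$, and let $F\to|S|$ be the principal $G$-bundle associated to $\{v_\sigma\}$. Let $\bar P_\cdot S$ be the prismatic star of $S$, let $P_\cdot BG$ be the prismatic model of the classifying space, and let $\mathrm{proj}\circ L:\|\,|\bar P_\cdot S|\,\|\to|S|$ and $ev:\|\,|P_\cdot BG|\,\|\to BG$ be the maps defined in the context. Then: 1) There is a canonical prismatic map $m:\bar P_\cdot S\to P_\cdot BG$ determined by $\{v_\sigma\}$. 2) The induced map of geometric realizations $$\bar m=ev\circ\|\,|m|\,\|:\ \|\,|\bar P_\cdot S|\,\|\xrightarrow{\ \|\,|m|\,\|\ }\|\,|P_\cdot BG|\,\|\xrightarrow{\ ev\ }BG$$ is a classifying map for the principal $G$-bundle $(\mathrm{proj}\circ L)^*F$ over $\|\,|\bar P_\cdot S|\,\|$; that is, the pullback under $\bar m$ of the universal bundle $EG\to BG=EG/G$ is isomorphic to $(\mathrm{proj}\circ L)^*F$.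
   Context: Simplices. $\Delta^p$ is the standard $p$-simplex with barycentric coordinates, $\varepsilon^i:\Delta^{p-1}\to\Delta^p$ and $\eta^i:\Delta^{p+1}\to\Delta^p$ the standard coface and codegeneracy maps, $\Delta^{q_0\dots q_p}=\Delta^{q_0}\times\dots\times\Delta^{q_p}$. Throughout $q=q_0+\dots+q_p$. Prismatic sets. A prismatic set $P$ is a sequence, $p\ge0$, of $(p+1)$-multi-simplicial sets $P_{p,q_0,\dots,q_p}$, with operators $d^i_j:P_{p,q_0,\dots,q_p}\to P_{p,q_0,\dots,q_i-1,\dots,q_p}$ and $s^i_j:P_{p,q_0,\dots,q_p}\to P_{p,q_0,\dots,q_i+1,\dots,q_p}$ ($0\le i\le p$, $0\le j\le q_i$), satisfying the simplicial identities for fixed $i$ and commuting for different $i$, together with face operators $d_k:P_{p,q_0,\dots,q_p}\to P_{p-1,q_0,\dots,\hat q_k,\dots,q_p}$ ($0\le k\le p$) satisfying $d_id_j=d_{j-1}d_i$ for $i<j$ and commuting with the $d^i_j,s^i_j$ (where operators in the deleted $k$-th direction become the identity after applying $d_k$, and directions $i>k$ are renumbered $i-1$). A prismatic map is a family of maps $P_{p,q_0,\dots,q_p}\to P'_{p,q_0,\dots,q_p}$ commuting with all $d^i_j,s^i_j,d_k$. The realization is obtained in two steps: $|P_{p}|=\bigsqcup_{q_0,\dots,q_p}\Delta^{q_0\dots q_p}\times P_{p,q_0,\dots,q_p}/\!\sim$, with $\sim$ generated by the face and degeneracy operators $d^i_j,s^i_j$ as usual for multi-simplicial sets; then $\|\,|P_\cdot|\,\|=\bigsqcup_p\Delta^p\times|P_p|/\!\sim$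 with $(\varepsilon^kt,s,x)\sim(t,\pi_ks,d_kx)$ for $t\in\Delta^{p-1}$, $s\in\Delta^{q_0\dots q_p}$, $x\in P_{p,q_0,\dots,q_p}$, where $\pi_k$ deletes the $k$-th factor. A prismatic map $m$ induces $\|\,|m|\,\|(t,s,x)=(t,s,m(x))$. Compatible transition functions. A set of compatible transition functions on $S$ is a family of continuous maps $v_\sigma:\Delta^{p-1}\to G$, one for each $\sigma\in S_p$, $p\ge1$, such that for $\sigma\in S_p$, $p\geq 2$: $v_\sigma\circ\varepsilon^i=v_{d_i\sigma}$ for $i<p-1$ and $v_\sigma\circ\varepsilon^{p-1}=v_{d_{p-1}\sigma}\cdot(v_{d_p\sigma})^{-1}$; and for $\sigma\in S_p$: $v_{s_j\sigma}=v_\sigma\circ\eta^j$ for $0\le j\le p-1$ and $v_{s_p\sigma}=1$. Associated bundle. $F\to|S|$ is the principal (right) $G$-bundle obtained from $\bigsqcup_p\bigsqcup_{\sigma\in S_p}\Delta^p\times\{\sigma\}\times G$ by the identifications $(t,d_i\sigma,g)\sim(\varepsilon^it,\sigma,v_{\sigma,d_i\sigma}(t)g)$ for $t\in\Delta^{p-1}$, $\sigma\in S_p$, where $v_{\sigma,d_i\sigma}=1$ for $i<p$ and $v_{\sigma,d_p\sigma}=v_\sigma$, and $(t,s_i\sigma,g)\sim(\eta^it,\sigma,g)$ for $t\in\Delta^{p+1}$, $\sigma\in S_p$. Prismatic star. $\bar P_pS_{q_0,\dots,q_p}=S_{q+2p+1}$, with $d_j^{i}=d_{q_0+\dots+q_{i-1}+2i+j}$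 and $s_j^{i}=s_{q_0+\dots+q_{i-1}+2i+j}$ for $0\le j\le q_i$, and with $d_{k}$ in the $p$-direction given by $d_{q_0+\dots+q_{k-1}+2k}\circ\dots\circ d_{q_0+\dots+q_k+2k+1}$ (deleting $q_k+2$ consecutive vertices). The map $\mathrm{proj}\circ L$. It sends the class of $(t,s^0,\dots,s^p,x)\in\Delta^p\times\Delta^{q_0\dots q_p}\times S_{q+2p+1}$ to the class in $|S|$ of $\big((t_0s^0,\dots,t_ps^p),\,d_{q_0+1}\circ d_{q_0+q_1+3}\circ\dots\circ d_{q+2p+1}x\big)\in\Delta^{q+p}\times S_{q+p}$, where $t=(t_0,\dots,t_p)$ and $s^i\in\Delta^{q_i}$ are in barycentric coordinates. Prismatic classifying space. $EG$ is the geometric realization of the simplicial space $EG_p=G^{p+1}$ (faces delete, degeneracies repeat a factor), with $G$ acting diagonally on the right, and $BG=EG/G$. $P_pEG_{q_0,\dots,q_p}$ is the set of continuous maps $a=(a_0,\dots,a_p):\Delta^p\times\Delta^{q_0\dots q_p}\to G^{p+1}$ of the form $a(t,s^0,\dots,s^p)=(a_0(t,s^0),a_1(t,s^0,s^1),\dots,a_p(t,s^0,\dots,s^p))$ such that for all $i$ and all $j\ne i$, $a_j(\varepsilon^it,s)$ is independent of $s^i$. The operators $d^i_j,s^i_j$ are precomposition with the coface and codegeneracy maps in the $i$-th factor $\Delta^{q_i}$; $d_k$ restricts $a$ along $\varepsilon^k\times\mathrm{id}$ and drops the component $a_k$ (the remaining components being then independent of $s^k$). Let $S_pG=\mathrm{Map}(\Delta^p,G)$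 (continuous maps) act on $P_pEG_{q_0,\dots,q_p}$ by $(a\cdot g)_j(t,s)=a_j(t,s)g(t)$, and put $P_pBG_{q_0,\dots,q_p}=P_pEG_{q_0,\dots,q_p}/S_pG$ with the induced operators. The evaluation map $ev:\|\,|P_\cdot BG|\,\|\to BG$ sends the class of $(t,s,[a])$ to the class of $(t,a(t,s))\in\Delta^p\times G^{p+1}$ in $BG=EG/G$. *)

theory Defs
  imports "HOL-Analysis.Analysis" "HOL-Algebra.Group" "HOL-Homology.Simplices"
begin

section \<open>Lie groups\<close>

fun times_differentiable_on :: "nat \<Rightarrow> 'a::real_normed_vector set \<Rightarrow> ('a \<Rightarrow> 'b::real_normed_vector) \<Rightarrow> bool"
  where
    "times_differentiable_on 0 U f \<longleftrightarrow> continuous_on U f"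
  | "times_differentiable_on (Suc k) U f \<longleftrightarrow>
       (\<forall>x\<in>U. f differentiable (at x)) \<and>
       (\<forall>v. times_differentiable_on k U (\<lambda>x. frechet_derivative f (at x) v))"

definition smooth_on :: "'a::real_normed_vector set \<Rightarrow> ('a \<Rightarrow> 'b::real_normed_vector) \<Rightarrow> bool" where
  "smooth_on U f \<longleftrightarrow> open U \<and> (\<forall>k. times_differentiable_on k U f)"

text \<open>Charts take values in a finite-dimensional normed space \<open>'e\<close>. The class
  \<open>real_normed_vector\<close> is used rather than \<open>euclidean_space\<close> because the latter excludes
  dimension 0, i.e. discrete groups.\<close>

definition smooth_atlas :: "'g topology \<Rightarrow> ('g set \<times> ('g \<Rightarrow> 'e::real_normed_vector)) set \<Rightarrow> bool" where
  "smooth_atlas T A \<longleftrightarrow>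
     (\<exists>B::'e set. finite B \<and> span B = UNIV) \<and>
     (\<Union>(U, \<phi>)\<in>A. U) = topspace T \<and>
     (\<forall>(U, \<phi>)\<in>A. openin T U \<and> open (\<phi> ` U) \<and>
        homeomorphic_map (subtopology T U) (top_of_set (\<phi> ` U)) \<phi>) \<and>
     (\<forall>(U, \<phi>)\<in>A. \<forall>(V, \<psi>)\<in>A. smooth_on (\<phi> ` (U \<inter> V)) (\<lambda>y. \<psi> (inv_into U \<phi> y)))"

definition lie_group ::
  "'g monoid \<Rightarrow> 'g topology \<Rightarrow> ('g set \<times> ('g \<Rightarrow> 'e::real_normed_vector)) set \<Rightarrow> bool" where
  "lie_group G T A \<longleftrightarrow>
     group G \<and> topspace T = carrier G \<and> Hausdorff_space T \<and> second_countable T \<and>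
     smooth_atlas T A \<and>
     continuous_map (prod_topology T T) T (\<lambda>(x, y). x \<otimes>\<^bsub>G\<^esub> y) \<and>
     (\<forall>(U, \<phi>)\<in>A. \<forall>(V, \<psi>)\<in>A. \<forall>(W, \<theta>)\<in>A.
        smooth_on {(\<phi> x, \<psi> y) | x y. x \<in> U \<and> y \<in> V \<and> x \<otimes>\<^bsub>G\<^esub> y \<in> W}
          (\<lambda>(a, b). \<theta> (inv_into U \<phi> a \<otimes>\<^bsub>G\<^esub> inv_into V \<psi> b))) \<and>
     continuous_map T T (\<lambda>x. inv\<^bsub>G\<^esub> x) \<and>
     (\<forall>(U, \<phi>)\<in>A. \<forall>(V, \<psi>)\<in>A.
        smooth_on {\<phi> x | x. x \<in> U \<and> inv\<^bsub>G\<^esub> x \<in> V} (\<lambda>a. \<psi> (inv\<^bsub>G\<^esub> (inv_into U \<phi> a))))"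

section \<open>Quotient spaces\<close>

text \<open>The quotient of a space by the equivalence relation generated by \<open>R\<close>; its points are the
  equivalence classes.\<close>

definition glue_rel :: "'a topology \<Rightarrow> ('a \<times> 'a) set \<Rightarrow> ('a \<times> 'a) set" where
  "glue_rel X R = {(x, y). x \<in> topspace X \<and> y \<in> topspace X \<and> equivclp (\<lambda>a b. (a, b) \<in> R) x y}"

definition glue_class :: "'a topology \<Rightarrow> ('a \<times> 'a) set \<Rightarrow> 'a \<Rightarrow> 'a set" where
  "glue_class X R x = glue_rel X R `` {x}"

definition glue :: "'a topology \<Rightarrow> ('a \<times> 'a) set \<Rightarrow> 'a set topology" where
  "glue X R = topology (\<lambda>\<U>. \<U> \<subseteq> topspace X // glue_rel X R \<and> openin X (\<Union>\<U>))"

lemma equiv_glue_rel: "equiv (topspace X) (glue_rel X R)"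
  by (rule equivI)
    (auto simp: glue_rel_def refl_on_def sym_def trans_def
      intro: equivclp_sym equivclp_trans)

lemma openin_glue:
  "openin (glue X R) \<U> \<longleftrightarrow> \<U> \<subseteq> topspace X // glue_rel X R \<and> openin X (\<Union>\<U>)"
proof -
  define Q where "Q = topspace X // glue_rel X R"
  have int: "\<Union>(\<U> \<inter> \<V>) = \<Union>\<U> \<inter> \<Union>\<V>" if "\<U> \<subseteq> Q" "\<V> \<subseteq> Q" for \<U> \<V>
  proof (intro equalityI subsetI)
    fix x assume "x \<in> \<Union>\<U> \<inter> \<Union>\<V>"
    then obtain c c' where c: "c \<in> \<U>" "c' \<in> \<V>" "x \<in> c" "x \<in> c'"
      by auto
    moreover have "c = c'"
      using quotient_disj[OF equiv_glue_rel, of c X R c'] c that unfolding Q_def by blast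
    ultimately show "x \<in> \<Union>(\<U> \<inter> \<V>)"
      by auto
  qed auto
  have Un: "\<Union>(\<Union>\<K>) = \<Union>(Union ` \<K>)" for \<K> :: "'a set set set"
    by blast
  have "istopology (\<lambda>\<U>. \<U> \<subseteq> Q \<and> openin X (\<Union>\<U>))"
    unfolding istopology_def
  proof (intro conjI allI impI)
    fix \<U> \<V> assume "\<U> \<subseteq> Q \<and> openin X (\<Union>\<U>)" "\<V> \<subseteq> Q \<and> openin X (\<Union>\<V>)"
    then show "openin X (\<Union>(\<U> \<inter> \<V>))"
      by (subst int) auto
  next
    fix \<K> assume "\<forall>K\<in>\<K>. K \<subseteq> Q \<and> openin X (\<Union>K)"
    then show "openin X (\<Union>(\<Union>\<K>))"
      unfolding Un by (intro openin_Union) auto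
  qed auto
  then show ?thesis
    unfolding glue_def Q_def by simp
qed

text \<open>The value on an equivalence class of a function that is constant on it.\<close>

definition lift :: "('a \<Rightarrow> 'b) \<Rightarrow> 'a set \<Rightarrow> 'b" where
  "lift f c = the_elem (f ` c)"

section \<open>Simplices\<close>

text \<open>The coface \<open>\<epsilon>\<^sup>i\<close> is the library's \<open>simplical_face i\<close>. Points of a product
  \<open>\<Delta>\<^sup>q\<^sup>0 \<times> \<dots> \<times> \<Delta>\<^sup>q\<^sup>p\<close> are extensional functions on \<open>{..<p+1}\<close>, indexed by
  the list \<open>[q0, \<dots>, qp]\<close>.\<close>

abbreviation std_simplex :: "nat \<Rightarrow> (nat \<Rightarrow> real) topology" where
  "std_simplex p \<equiv> subtopology (powertop_real UNIV) (standard_simplex p)"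

definition codegen :: "nat \<Rightarrow> (nat \<Rightarrow> real) \<Rightarrow> nat \<Rightarrow> real" where
  "codegen j t = (\<lambda>i. if i < j then t i else if i = j then t j + t (Suc j) else t (Suc i))"

definition multisimplex :: "nat list \<Rightarrow> (nat \<Rightarrow> nat \<Rightarrow> real) topology" where
  "multisimplex qs = product_topology (\<lambda>i. std_simplex (qs ! i)) {..<length qs}"

definition delete_at :: "nat \<Rightarrow> (nat \<Rightarrow> 'a) \<Rightarrow> nat \<Rightarrow> 'a" where
  "delete_at k f = (\<lambda>i. if i < k then f i else f (Suc i))"

definition repeat_at :: "nat \<Rightarrow> (nat \<Rightarrow> 'a) \<Rightarrow> nat \<Rightarrow> 'a" where
  "repeat_at k f = (\<lambda>i. if i \<le> k then f i else f (i - 1))"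

definition insert_at :: "nat \<Rightarrow> 'a \<Rightarrow> (nat \<Rightarrow> 'a) \<Rightarrow> nat \<Rightarrow> 'a" where
  "insert_at k c f = (\<lambda>i. if i < k then f i else if i = k then c else f (i - 1))"

definition remove_nth :: "nat \<Rightarrow> 'a list \<Rightarrow> 'a list" where
  "remove_nth k xs = take k xs @ drop (Suc k) xs"

section \<open>Simplicial sets and realization of simplicial spaces\<close>

text \<open>In \<open>d n j\<close> and \<open>s n j\<close> the index \<open>n\<close> is the dimension of the argument.\<close>

definition simplicial_identities ::
  "(nat \<Rightarrow> 'x set) \<Rightarrow> (nat \<Rightarrow> nat \<Rightarrow> 'x \<Rightarrow> 'x) \<Rightarrow> (nat \<Rightarrow> nat \<Rightarrow> 'x \<Rightarrow> 'x) \<Rightarrow> bool" where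
  "simplicial_identities C d s \<longleftrightarrow>
     (\<forall>n. \<forall>x\<in>C (Suc n). \<forall>j\<le>Suc n. d (Suc n) j x \<in> C n) \<and>
     (\<forall>n. \<forall>x\<in>C n. \<forall>j\<le>n. s n j x \<in> C (Suc n)) \<and>
     (\<forall>n. \<forall>x\<in>C (Suc (Suc n)). \<forall>i j. i < j \<and> j \<le> Suc (Suc n) \<longrightarrow>
        d (Suc n) i (d (Suc (Suc n)) j x) = d (Suc n) (j - 1) (d (Suc (Suc n)) i x)) \<and>
     (\<forall>n. \<forall>x\<in>C n. \<forall>i j. i \<le> j \<and> j \<le> n \<longrightarrow>
        s (Suc n) i (s n j x) = s (Suc n) (Suc j) (s n i x)) \<and>
     (\<forall>n. \<forall>x\<in>C n. \<forall>i j. i < j \<and> j \<le> n \<longrightarrow>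
        d (Suc n) i (s n j x) = s (n - 1) (j - 1) (d n i x)) \<and>
     (\<forall>n. \<forall>x\<in>C n. \<forall>j\<le>n. d (Suc n) j (s n j x) = x \<and> d (Suc n) (Suc j) (s n j x) = x) \<and>
     (\<forall>n. \<forall>x\<in>C n. \<forall>i j. Suc j < i \<and> i \<le> Suc n \<longrightarrow>
        d (Suc n) i (s n j x) = s (n - 1) j (d n (i - 1) x))"

record 's sset =
  ssimp :: "nat \<Rightarrow> 's set"
  sface :: "nat \<Rightarrow> nat \<Rightarrow> 's \<Rightarrow> 's"
  sdegen :: "nat \<Rightarrow> nat \<Rightarrow> 's \<Rightarrow> 's"

definition simplicial_set :: "'s sset \<Rightarrow> bool" where
  "simplicial_set S \<longleftrightarrow> simplicial_identities (ssimp S) (sface S) (sdegen S)"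

definition simplicial_map :: "'s sset \<Rightarrow> 's sset \<Rightarrow> (nat \<Rightarrow> 's \<Rightarrow> 's) \<Rightarrow> bool" where
  "simplicial_map S S' f \<longleftrightarrow>
     (\<forall>n. \<forall>x\<in>ssimp S n. f n x \<in> ssimp S' n) \<and>
     (\<forall>n. \<forall>x\<in>ssimp S (Suc n). \<forall>j\<le>Suc n. f n (sface S (Suc n) j x) = sface S' (Suc n) j (f (Suc n) x)) \<and>
     (\<forall>n. \<forall>x\<in>ssimp S n. \<forall>j\<le>n. f (Suc n) (sdegen S n j x) = sdegen S' n j (f n x))"

text \<open>\<open>sfaces S n [i1, \<dots>, ik]\<close> applies first \<open>d_i1\<close>, then \<open>d_i2\<close>, and so on.\<close>

fun sfaces :: "'s sset \<Rightarrow> nat \<Rightarrow> nat list \<Rightarrow> 's \<Rightarrow> 's" where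
  "sfaces S n [] x = x"
| "sfaces S n (i # js) x = sfaces S (n - 1) js (sface S n i x)"

definition level_sum :: "(nat \<Rightarrow> 'x topology) \<Rightarrow> (nat \<times> (nat \<Rightarrow> real) \<times> 'x) topology" where
  "level_sum X = sum_topology (\<lambda>n. prod_topology (std_simplex n) (X n)) UNIV"

definition realization_rel ::
  "(nat \<Rightarrow> 'x topology) \<Rightarrow> (nat \<Rightarrow> nat \<Rightarrow> 'x \<Rightarrow> 'x) \<Rightarrow> (nat \<Rightarrow> nat \<Rightarrow> 'x \<Rightarrow> 'x)
     \<Rightarrow> ((nat \<times> (nat \<Rightarrow> real) \<times> 'x) \<times> (nat \<times> (nat \<Rightarrow> real) \<times> 'x)) set" where
  "realization_rel X d s =
     {((Suc n, simplical_face i t, x), (n, t, d (Suc n) i x)) | n i t x.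
        i \<le> Suc n \<and> t \<in> standard_simplex n \<and> x \<in> topspace (X (Suc n))} \<union>
     {((n, codegen i t, x), (Suc n, t, s n i x)) | n i t x.
        i \<le> n \<and> t \<in> standard_simplex (Suc n) \<and> x \<in> topspace (X n)}"

definition sset_levels :: "'s sset \<Rightarrow> nat \<Rightarrow> 's topology" where
  "sset_levels S n = discrete_topology (ssimp S n)"

definition sset_real :: "'s sset \<Rightarrow> (nat \<times> (nat \<Rightarrow> real) \<times> 's) set topology" where
  "sset_real S = glue (level_sum (sset_levels S))
     (realization_rel (sset_levels S) (sface S) (sdegen S))"

definition sset_class :: "'s sset \<Rightarrow> nat \<times> (nat \<Rightarrow> real) \<times> 's \<Rightarrow> (nat \<times> (nat \<Rightarrow> real) \<times> 's) set" where
  "sset_class S = glue_class (level_sum (sset_levels S))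
     (realization_rel (sset_levels S) (sface S) (sdegen S))"

section \<open>Prismatic sets\<close>

text \<open>Multidegrees \<open>(q0, \<dots>, qp)\<close> are nonempty lists; the first argument of each operator is the
  multidegree of its argument. Thus \<open>dface P qs i j\<close> is \<open>d\<^sup>i_j\<close>, \<open>ddegen P qs i j\<close> is
  \<open>s\<^sup>i_j\<close>, and \<open>bface P qs k\<close> is \<open>d_k\<close>.\<close>

record 'x prismatic =
  cells :: "nat list \<Rightarrow> 'x set"
  dface :: "nat list \<Rightarrow> nat \<Rightarrow> nat \<Rightarrow> 'x \<Rightarrow> 'x"
  ddegen :: "nat list \<Rightarrow> nat \<Rightarrow> nat \<Rightarrow> 'x \<Rightarrow> 'x"
  bface :: "nat list \<Rightarrow> nat \<Rightarrow> 'x \<Rightarrow> 'x"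

abbreviation down :: "nat list \<Rightarrow> nat \<Rightarrow> nat list" where
  "down qs i \<equiv> qs[i := qs ! i - 1]"

abbreviation up :: "nat list \<Rightarrow> nat \<Rightarrow> nat list" where
  "up qs i \<equiv> qs[i := Suc (qs ! i)]"

definition multisimplicial :: "'x prismatic \<Rightarrow> bool" where
  "multisimplicial P \<longleftrightarrow>
     (\<forall>qs. \<forall>i<length qs.
        simplicial_identities (\<lambda>n. cells P (qs[i := n]))
          (\<lambda>n j. dface P (qs[i := n]) i j) (\<lambda>n j. ddegen P (qs[i := n]) i j)) \<and>
     (\<forall>qs. \<forall>x\<in>cells P qs. \<forall>i<length qs. \<forall>i'<length qs. i \<noteq> i' \<longrightarrow>
        (\<forall>j\<le>qs ! i. \<forall>j'\<le>qs ! i'.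
           (1 \<le> qs ! i \<and> 1 \<le> qs ! i' \<longrightarrow>
              dface P (down qs i') i j (dface P qs i' j' x)
                = dface P (down qs i) i' j' (dface P qs i j x)) \<and>
           (1 \<le> qs ! i \<longrightarrow>
              dface P (up qs i') i j (ddegen P qs i' j' x)
                = ddegen P (down qs i) i' j' (dface P qs i j x)) \<and>
           ddegen P (up qs i') i j (ddegen P qs i' j' x)
             = ddegen P (up qs i) i' j' (ddegen P qs i j x)))"

definition prismatic_set :: "'x prismatic \<Rightarrow> bool" where
  "prismatic_set P \<longleftrightarrow>
     multisimplicial P \<and>
     (\<forall>qs. 2 \<le> length qs \<longrightarrow> (\<forall>x\<in>cells P qs. \<forall>k<length qs. bface P qs k x \<in> cells P (remove_nth k qs))) \<and>
     (\<forall>qs. 3 \<le> length qs \<longrightarrow> (\<forall>x\<in>cells P qs. \<forall>k l. k < l \<and> l < length qs \<longrightarrow>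
        bface P (remove_nth l qs) k (bface P qs l x)
          = bface P (remove_nth k qs) (l - 1) (bface P qs k x))) \<and>
     (\<forall>qs. 2 \<le> length qs \<longrightarrow> (\<forall>x\<in>cells P qs. \<forall>k<length qs. \<forall>i<length qs. \<forall>j\<le>qs ! i.
        (1 \<le> qs ! i \<longrightarrow>
          bface P (down qs i) k (dface P qs i j x) =
            (if i = k then bface P qs k x
             else dface P (remove_nth k qs) (if i < k then i else i - 1) j (bface P qs k x))) \<and>
        bface P (up qs i) k (ddegen P qs i j x) =
          (if i = k then bface P qs k x
           else ddegen P (remove_nth k qs) (if i < k then i else i - 1) j (bface P qs k x))))"

definition prismatic_map :: "'x prismatic \<Rightarrow> 'y prismatic \<Rightarrow> (nat list \<Rightarrow> 'x \<Rightarrow> 'y) \<Rightarrow> bool" where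
  "prismatic_map P P' m \<longleftrightarrow>
     prismatic_set P \<and> prismatic_set P' \<and>
     (\<forall>qs. qs \<noteq> [] \<longrightarrow> (\<forall>x\<in>cells P qs.
        m qs x \<in> cells P' qs \<and>
        (\<forall>i<length qs. \<forall>j\<le>qs ! i.
           (1 \<le> qs ! i \<longrightarrow> m (down qs i) (dface P qs i j x) = dface P' qs i j (m qs x)) \<and>
           m (up qs i) (ddegen P qs i j x) = ddegen P' qs i j (m qs x)) \<and>
        (2 \<le> length qs \<longrightarrow> (\<forall>k<length qs. m (remove_nth k qs) (bface P qs k x) = bface P' qs k (m qs x)))))"

subsection \<open>Realization\<close>

type_synonym 'x mpoint = "nat list \<times> (nat \<Rightarrow> nat \<Rightarrow> real) \<times> 'x"
type_synonym 'x ppoint = "nat \<times> (nat \<Rightarrow> real) \<times> 'x mpoint set"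

definition multi_sum :: "'x prismatic \<Rightarrow> nat \<Rightarrow> 'x mpoint topology" where
  "multi_sum P p = sum_topology
     (\<lambda>qs. prod_topology (multisimplex qs) (discrete_topology (cells P qs))) {qs. length qs = Suc p}"

definition multi_rel :: "'x prismatic \<Rightarrow> nat \<Rightarrow> ('x mpoint \<times> 'x mpoint) set" where
  "multi_rel P p =
     {((qs, s(i := simplical_face j (s i)), x), (down qs i, s, dface P qs i j x)) | qs s i j x.
        length qs = Suc p \<and> i \<le> p \<and> 1 \<le> qs ! i \<and> j \<le> qs ! i \<and>
        s \<in> topspace (multisimplex (down qs i)) \<and> x \<in> cells P qs} \<union>
     {((qs, s(i := codegen j (s i)), x), (up qs i, s, ddegen P qs i j x)) | qs s i j x.
        length qs = Suc p \<and> i \<le> p \<and> j \<le> qs ! i \<and>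
        s \<in> topspace (multisimplex (up qs i)) \<and> x \<in> cells P qs}"

definition multi_real :: "'x prismatic \<Rightarrow> nat \<Rightarrow> 'x mpoint set topology" where
  "multi_real P p = glue (multi_sum P p) (multi_rel P p)"

definition multi_class :: "'x prismatic \<Rightarrow> nat \<Rightarrow> 'x mpoint \<Rightarrow> 'x mpoint set" where
  "multi_class P p = glue_class (multi_sum P p) (multi_rel P p)"

text \<open>No degeneracies in the \<open>p\<close>-direction: this is a fat realization.\<close>

definition prism_rel :: "'x prismatic \<Rightarrow> ('x ppoint \<times> 'x ppoint) set" where
  "prism_rel P =
     {((Suc p, simplical_face k t, multi_class P (Suc p) (qs, s, x)),
       (p, t, multi_class P p (remove_nth k qs, delete_at k s, bface P qs k x))) | p k t qs s x.
        length qs = Suc (Suc p) \<and> k \<le> Suc p \<and> t \<in> standard_simplex p \<and>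
        s \<in> topspace (multisimplex qs) \<and> x \<in> cells P qs}"

definition prism_real :: "'x prismatic \<Rightarrow> 'x ppoint set topology" where
  "prism_real P = glue (level_sum (multi_real P)) (prism_rel P)"

definition prism_class :: "'x prismatic \<Rightarrow> 'x ppoint \<Rightarrow> 'x ppoint set" where
  "prism_class P = glue_class (level_sum (multi_real P)) (prism_rel P)"

definition lift_prism :: "(nat \<Rightarrow> (nat \<Rightarrow> real) \<Rightarrow> 'x mpoint \<Rightarrow> 'b) \<Rightarrow> 'x ppoint set \<Rightarrow> 'b" where
  "lift_prism f = lift (\<lambda>(p, t, z). lift (f p t) z)"

definition prism_real_map ::
  "'y prismatic \<Rightarrow> (nat list \<Rightarrow> 'x \<Rightarrow> 'y) \<Rightarrow> 'x ppoint set \<Rightarrow> 'y ppoint set" where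
  "prism_real_map P' m =
     lift_prism (\<lambda>p t (qs, s, x). prism_class P' (p, t, multi_class P' p (qs, s, m qs x)))"

section \<open>The prismatic star\<close>

definition block_start :: "nat list \<Rightarrow> nat \<Rightarrow> nat" where
  "block_start qs i = (\<Sum>l<i. qs ! l + 2)"

definition star_dim :: "nat list \<Rightarrow> nat" where
  "star_dim qs = sum_list qs + 2 * (length qs - 1) + 1"

definition prism_star :: "'s sset \<Rightarrow> 's prismatic" where
  "prism_star S =
     \<lparr> cells = (\<lambda>qs. if qs = [] then {} else ssimp S (star_dim qs)),
       dface = (\<lambda>qs i j. sface S (star_dim qs) (block_start qs i + j)),
       ddegen = (\<lambda>qs i j. sdegen S (star_dim qs) (block_start qs i + j)),
       bface = (\<lambda>qs k. sfaces S (star_dim qs)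
          (rev [block_start qs k ..< block_start qs k + qs ! k + 2])) \<rparr>"

text \<open>The point \<open>(t0 s\<^sup>0, \<dots>, tp s\<^sup>p)\<close> in barycentric coordinates: block \<open>i\<close> occupies the
  \<open>qi + 1\<close> coordinates starting at \<open>q0 + \<dots> + q(i-1) + i\<close>.\<close>

definition join_point :: "nat list \<Rightarrow> (nat \<Rightarrow> real) \<Rightarrow> (nat \<Rightarrow> nat \<Rightarrow> real) \<Rightarrow> nat \<Rightarrow> real" where
  "join_point qs t s = (\<lambda>n. \<Sum>i<length qs.
     let b = (\<Sum>l<i. qs ! l + 1) in if b \<le> n \<and> n \<le> b + qs ! i then t i * s i (n - b) else 0)"

definition proj_L :: "'s sset \<Rightarrow> 's ppoint set \<Rightarrow> (nat \<times> (nat \<Rightarrow> real) \<times> 's) set" where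
  "proj_L S = lift_prism (\<lambda>p t (qs, s, x).
     sset_class S (sum_list qs + p, join_point qs t s,
       sfaces S (star_dim qs) (rev (map (\<lambda>i. block_start qs i + qs ! i + 1) [0..<Suc p])) x))"

section \<open>Bundles\<close>

record ('e, 'b, 'g) gbundle =
  total :: "'e topology"
  base :: "'b topology"
  projection :: "'e \<Rightarrow> 'b"
  action :: "'e \<Rightarrow> 'g \<Rightarrow> 'e"

definition pullback_bundle ::
  "'z topology \<Rightarrow> ('z \<Rightarrow> 'b) \<Rightarrow> ('e, 'b, 'g) gbundle \<Rightarrow> ('z \<times> 'e, 'z, 'g) gbundle" where
  "pullback_bundle Z f E =
     \<lparr> total = subtopology (prod_topology Z (total E)) {(z, e). f z = projection E e},
       base = Z, projection = fst, action = (\<lambda>(z, e) g. (z, action E e g)) \<rparr>"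

definition bundle_isomorphic ::
  "'g monoid \<Rightarrow> ('e, 'b, 'g) gbundle \<Rightarrow> ('f, 'b, 'g) gbundle \<Rightarrow> bool" where
  "bundle_isomorphic G E E' \<longleftrightarrow> base E = base E' \<and>
     (\<exists>h. homeomorphic_map (total E) (total E') h \<and>
        (\<forall>e\<in>topspace (total E). projection E' (h e) = projection E e \<and>
           (\<forall>g\<in>carrier G. h (action E e g) = action E' (h e) g)))"

text \<open>\<open>f\<close> is a classifying map for \<open>E\<close>, with respect to the universal bundle \<open>U\<close>.\<close>

definition classifying_map ::
  "'g monoid \<Rightarrow> ('u, 'c, 'g) gbundle \<Rightarrow> ('e, 'b, 'g) gbundle \<Rightarrow> ('b \<Rightarrow> 'c) \<Rightarrow> bool" where
  "classifying_map G U E f \<longleftrightarrow> continuous_map (base E) (base U) f \<and>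
     bundle_isomorphic G (pullback_bundle (base E) f U) E"

subsection \<open>Transition functions and the associated bundle\<close>

definition compatible_transition_functions ::
  "'g monoid \<Rightarrow> 'g topology \<Rightarrow> 's sset \<Rightarrow> (nat \<Rightarrow> 's \<Rightarrow> (nat \<Rightarrow> real) \<Rightarrow> 'g) \<Rightarrow> bool" where
  "compatible_transition_functions G T S v \<longleftrightarrow>
     (\<forall>n. \<forall>\<sigma>\<in>ssimp S (Suc n). continuous_map (std_simplex n) T (v (Suc n) \<sigma>)) \<and>
     (\<forall>n. \<forall>\<sigma>\<in>ssimp S (Suc (Suc n)). \<forall>t\<in>standard_simplex n.
        (\<forall>i<Suc n. v (Suc (Suc n)) \<sigma> (simplical_face i t)
           = v (Suc n) (sface S (Suc (Suc n)) i \<sigma>) t) \<and>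
        v (Suc (Suc n)) \<sigma> (simplical_face (Suc n) t)
          = v (Suc n) (sface S (Suc (Suc n)) (Suc n) \<sigma>) t
            \<otimes>\<^bsub>G\<^esub> inv\<^bsub>G\<^esub> (v (Suc n) (sface S (Suc (Suc n)) (Suc (Suc n)) \<sigma>) t)) \<and>
     (\<forall>n. \<forall>\<sigma>\<in>ssimp S (Suc n). \<forall>t\<in>standard_simplex (Suc n). \<forall>j\<le>n.
        v (Suc (Suc n)) (sdegen S (Suc n) j \<sigma>) t = v (Suc n) \<sigma> (codegen j t)) \<and>
     (\<forall>n. \<forall>\<sigma>\<in>ssimp S n. \<forall>t\<in>standard_simplex n. v (Suc n) (sdegen S n n \<sigma>) t = \<one>\<^bsub>G\<^esub>)"

definition assoc_levels :: "'g topology \<Rightarrow> 's sset \<Rightarrow> nat \<Rightarrow> ('s \<times> 'g) topology" where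
  "assoc_levels T S n = prod_topology (discrete_topology (ssimp S n)) T"

definition assoc_rel ::
  "'g monoid \<Rightarrow> 's sset \<Rightarrow> (nat \<Rightarrow> 's \<Rightarrow> (nat \<Rightarrow> real) \<Rightarrow> 'g)
     \<Rightarrow> ((nat \<times> (nat \<Rightarrow> real) \<times> 's \<times> 'g) \<times> (nat \<times> (nat \<Rightarrow> real) \<times> 's \<times> 'g)) set" where
  "assoc_rel G S v =
     {((n, t, sface S (Suc n) i \<sigma>, g),
       (Suc n, simplical_face i t, \<sigma>, (if i \<le> n then \<one>\<^bsub>G\<^esub> else v (Suc n) \<sigma> t) \<otimes>\<^bsub>G\<^esub> g)) | n i t \<sigma> g.
        i \<le> Suc n \<and> t \<in> standard_simplex n \<and> \<sigma> \<in> ssimp S (Suc n) \<and> g \<in> carrier G} \<union>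
     {((Suc n, t, sdegen S n i \<sigma>, g), (n, codegen i t, \<sigma>, g)) | n i t \<sigma> g.
        i \<le> n \<and> t \<in> standard_simplex (Suc n) \<and> \<sigma> \<in> ssimp S n \<and> g \<in> carrier G}"

definition assoc_class ::
  "'g monoid \<Rightarrow> 'g topology \<Rightarrow> 's sset \<Rightarrow> (nat \<Rightarrow> 's \<Rightarrow> (nat \<Rightarrow> real) \<Rightarrow> 'g)
     \<Rightarrow> nat \<times> (nat \<Rightarrow> real) \<times> 's \<times> 'g \<Rightarrow> (nat \<times> (nat \<Rightarrow> real) \<times> 's \<times> 'g) set" where
  "assoc_class G T S v = glue_class (level_sum (assoc_levels T S)) (assoc_rel G S v)"

definition assoc_bundle ::
  "'g monoid \<Rightarrow> 'g topology \<Rightarrow> 's sset \<Rightarrow> (nat \<Rightarrow> 's \<Rightarrow> (nat \<Rightarrow> real) \<Rightarrow> 'g)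
     \<Rightarrow> ((nat \<times> (nat \<Rightarrow> real) \<times> 's \<times> 'g) set, (nat \<times> (nat \<Rightarrow> real) \<times> 's) set, 'g) gbundle" where
  "assoc_bundle G T S v =
     \<lparr> total = glue (level_sum (assoc_levels T S)) (assoc_rel G S v),
       base = sset_real S,
       projection = lift (\<lambda>(n, t, \<sigma>, g). sset_class S (n, t, \<sigma>)),
       action = (\<lambda>e h. lift (\<lambda>(n, t, \<sigma>, g). assoc_class G T S v (n, t, \<sigma>, g \<otimes>\<^bsub>G\<^esub> h)) e) \<rparr>"

section \<open>The universal bundle\<close>

definition EG_levels :: "'g topology \<Rightarrow> nat \<Rightarrow> (nat \<Rightarrow> 'g) topology" where
  "EG_levels T p = product_topology (\<lambda>_. T) {..p}"

definition EG_rel :: "'g topology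
     \<Rightarrow> ((nat \<times> (nat \<Rightarrow> real) \<times> (nat \<Rightarrow> 'g)) \<times> (nat \<times> (nat \<Rightarrow> real) \<times> (nat \<Rightarrow> 'g))) set" where
  "EG_rel T = realization_rel (EG_levels T) (\<lambda>n. delete_at) (\<lambda>n. repeat_at)"

definition EG :: "'g topology \<Rightarrow> (nat \<times> (nat \<Rightarrow> real) \<times> (nat \<Rightarrow> 'g)) set topology" where
  "EG T = glue (level_sum (EG_levels T)) (EG_rel T)"

definition EG_class :: "'g topology
     \<Rightarrow> nat \<times> (nat \<Rightarrow> real) \<times> (nat \<Rightarrow> 'g) \<Rightarrow> (nat \<times> (nat \<Rightarrow> real) \<times> (nat \<Rightarrow> 'g)) set" where
  "EG_class T = glue_class (level_sum (EG_levels T)) (EG_rel T)"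

definition EG_act :: "'g monoid \<Rightarrow> 'g topology
     \<Rightarrow> (nat \<times> (nat \<Rightarrow> real) \<times> (nat \<Rightarrow> 'g)) set \<Rightarrow> 'g \<Rightarrow> (nat \<times> (nat \<Rightarrow> real) \<times> (nat \<Rightarrow> 'g)) set" where
  "EG_act G T e g = lift (\<lambda>(p, t, x). EG_class T (p, t, \<lambda>j\<in>{..p}. x j \<otimes>\<^bsub>G\<^esub> g)) e"

definition BG_rel :: "'g monoid \<Rightarrow> 'g topology
     \<Rightarrow> ((nat \<times> (nat \<Rightarrow> real) \<times> (nat \<Rightarrow> 'g)) set \<times> (nat \<times> (nat \<Rightarrow> real) \<times> (nat \<Rightarrow> 'g)) set) set" where
  "BG_rel G T = {(e, EG_act G T e g) | e g. e \<in> topspace (EG T) \<and> g \<in> carrier G}"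

definition BG :: "'g monoid \<Rightarrow> 'g topology
     \<Rightarrow> (nat \<times> (nat \<Rightarrow> real) \<times> (nat \<Rightarrow> 'g)) set set topology" where
  "BG G T = glue (EG T) (BG_rel G T)"

definition BG_class :: "'g monoid \<Rightarrow> 'g topology
     \<Rightarrow> (nat \<times> (nat \<Rightarrow> real) \<times> (nat \<Rightarrow> 'g)) set \<Rightarrow> (nat \<times> (nat \<Rightarrow> real) \<times> (nat \<Rightarrow> 'g)) set set" where
  "BG_class G T = glue_class (EG T) (BG_rel G T)"

definition universal_bundle :: "'g monoid \<Rightarrow> 'g topology
     \<Rightarrow> ((nat \<times> (nat \<Rightarrow> real) \<times> (nat \<Rightarrow> 'g)) set, (nat \<times> (nat \<Rightarrow> real) \<times> (nat \<Rightarrow> 'g)) set set, 'g) gbundle" where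
  "universal_bundle G T =
     \<lparr> total = EG T, base = BG G T, projection = BG_class G T, action = EG_act G T \<rparr>"

section \<open>The prismatic classifying space\<close>

type_synonym 'g pmap = "(nat \<Rightarrow> real) \<times> (nat \<Rightarrow> nat \<Rightarrow> real) \<Rightarrow> nat \<Rightarrow> 'g"

abbreviation pdomain :: "nat list \<Rightarrow> ((nat \<Rightarrow> real) \<times> (nat \<Rightarrow> nat \<Rightarrow> real)) topology" where
  "pdomain qs \<equiv> prod_topology (std_simplex (length qs - 1)) (multisimplex qs)"

definition PEG_cells :: "'g topology \<Rightarrow> nat list \<Rightarrow> 'g pmap set" where
  "PEG_cells T qs = {a. qs \<noteq> [] \<and>
     a \<in> extensional (topspace (pdomain qs)) \<and>
     continuous_map (pdomain qs) (EG_levels T (length qs - 1)) a \<and>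
     (\<forall>t\<in>standard_simplex (length qs - 1).
        \<forall>s\<in>topspace (multisimplex qs). \<forall>s'\<in>topspace (multisimplex qs). \<forall>j<length qs.
          (\<forall>i\<le>j. s i = s' i) \<longrightarrow> a (t, s) j = a (t, s') j) \<and>
     (2 \<le> length qs \<longrightarrow>
       (\<forall>t\<in>standard_simplex (length qs - 2).
          \<forall>s\<in>topspace (multisimplex qs). \<forall>s'\<in>topspace (multisimplex qs). \<forall>i<length qs.
            (\<forall>l. l \<noteq> i \<longrightarrow> s l = s' l) \<longrightarrow>
            (\<forall>j<length qs. j \<noteq> i \<longrightarrow>
               a (simplical_face i t, s) j = a (simplical_face i t, s') j)))}"

text \<open>In \<open>d_k\<close> the remaining components do not depend on \<open>s\<^sup>k\<close>; their value is computed at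
  the vertex 0 of \<open>\<Delta>\<^sup>q\<^sup>k\<close>.\<close>

definition prism_EG :: "'g topology \<Rightarrow> 'g pmap prismatic" where
  "prism_EG T =
     \<lparr> cells = PEG_cells T,
       dface = (\<lambda>qs i j a. \<lambda>(t, s)\<in>topspace (pdomain (down qs i)). a (t, s(i := simplical_face j (s i)))),
       ddegen = (\<lambda>qs i j a. \<lambda>(t, s)\<in>topspace (pdomain (up qs i)). a (t, s(i := codegen j (s i)))),
       bface = (\<lambda>qs k a. \<lambda>(t, s)\<in>topspace (pdomain (remove_nth k qs)).
          delete_at k (a (simplical_face k t, insert_at k (\<lambda>n. if n = 0 then 1 else 0) s))) \<rparr>"

definition PEG_act :: "'g monoid \<Rightarrow> nat list \<Rightarrow> 'g pmap \<Rightarrow> ((nat \<Rightarrow> real) \<Rightarrow> 'g) \<Rightarrow> 'g pmap" where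
  "PEG_act G qs a g = (\<lambda>(t, s)\<in>topspace (pdomain qs). \<lambda>j\<in>{..<length qs}. a (t, s) j \<otimes>\<^bsub>G\<^esub> g t)"

definition PBG_class :: "'g monoid \<Rightarrow> 'g topology \<Rightarrow> nat list \<Rightarrow> 'g pmap \<Rightarrow> 'g pmap set" where
  "PBG_class G T qs a = {PEG_act G qs a g | g. continuous_map (std_simplex (length qs - 1)) T g}"

definition prism_BG :: "'g monoid \<Rightarrow> 'g topology \<Rightarrow> 'g pmap set prismatic" where
  "prism_BG G T =
     \<lparr> cells = (\<lambda>qs. PBG_class G T qs ` PEG_cells T qs),
       dface = (\<lambda>qs i j. lift (\<lambda>a. PBG_class G T (down qs i) (dface (prism_EG T) qs i j a))),
       ddegen = (\<lambda>qs i j. lift (\<lambda>a. PBG_class G T (up qs i) (ddegen (prism_EG T) qs i j a))),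
       bface = (\<lambda>qs k. lift (\<lambda>a. PBG_class G T (remove_nth k qs) (bface (prism_EG T) qs k a))) \<rparr>"

definition ev :: "'g monoid \<Rightarrow> 'g topology
     \<Rightarrow> 'g pmap set ppoint set \<Rightarrow> (nat \<times> (nat \<Rightarrow> real) \<times> (nat \<Rightarrow> 'g)) set set" where
  "ev G T = lift_prism (\<lambda>p t (qs, s, c). lift (\<lambda>a. BG_class G T (EG_class T (p, t, a (t, s)))) c)"

end

theory Submission
  imports Defs
begin

text \<open>Over a simplex \<open>\<sigma>\<close> the bundle \<open>F\<close> has one trivialization for each vertex, and these are compatible
  with faces and degeneracies. A simplex \<open>x\<close> of the prismatic star has \<open>p + 1\<close> extra vertices, one after
  each block; the components of \<open>m x\<close> compare the trivializations at successive extra vertices, at points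
  whose later blocks have been collapsed to their extra vertices, which makes the \<open>j\<close>-th component
  depend only on the \<open>s\<^sup>i\<close> with \<open>i < j\<close>.

  Before gluing, \<open>proj \<circ> L\<close> and \<open>ev \<circ> \<parallel>|m|\<parallel>\<close> lift to \<open>F\<close> and \<open>EG\<close>. The gluing changes both lifts by the
  same gauge transformation, which is removed by passing from the last extra vertex to one chosen from the
  coordinates \<open>t\<close>, locally continuously. Hence a point of one pullback is carried to the other by its
  difference from the lift. That this is a homeomorphism does not require \<open>EG \<rightarrow> BG\<close> to be locally
  trivial, only that its translation function is continuous. The quotients involved are multiplied only by
  simplices and by \<open>G\<close>, which are locally compact, so that the products are again quotients.\<close>

section \<open>Glued spaces\<close>

text \<open>A cell of \<open>prism_EG\<close> must satisfy two conditions: component j may use only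
  s^0, ..., s^j, and on the face t_i = 0 the components other than i must forget s^i. Transport
  between extra vertices at the point itself would in general violate the first. At a stage with the
  later blocks collapsed both hold, the second since a block of weight zero does not influence the
  point. Starting the transports at the extra vertex 0 costs compatibility with d_0, which shifts
  the start. The correction depends on t alone, so it dies in \<open>prism_BG\<close>; hence m takes
  its values there and not in \<open>prism_EG\<close>. The last extra vertex is the last vertex of
  the simplex, the one trivializing F. Only the d_k that deletes the last block removes it, and only
  there do the lifts jump. The choice by the first coordinate exceeding some c > 0 survives because
  cofaces insert zeros; degeneracies in the p-direction would merge coordinates and spoil it, but
  this realization has none. No local trivializations of F are built: an equivariant map F -> EG
  pulls the translation function back.\<close>

lemma equivclp_invariant:
  assumes "equivclp r x y" and "\<And>a b. r a b \<Longrightarrow> f a = f b"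
  shows "f x = f y"
  using assms(1) by (induction rule: equivclp_induct) (use assms(2) in metis)+

lemma topspace_glue: "topspace (glue X R) = glue_class X R ` topspace X"
proof -
  have "topspace X // glue_rel X R = glue_class X R ` topspace X"
    by (auto simp: quotient_def glue_class_def)
  moreover have "openin (glue X R) (topspace X // glue_rel X R)"
    using Union_quotient[OF equiv_glue_rel[of X R]] by (simp add: openin_glue)
  ultimately show ?thesis
    by (metis openin_glue openin_subset openin_topspace subset_antisym)
qed

lemma glue_class_eq_iff:
  assumes "x \<in> topspace X" "y \<in> topspace X"
  shows "glue_class X R x = glue_class X R y \<longleftrightarrow> equivclp (\<lambda>a b. (a, b) \<in> R) x y"
  using eq_equiv_class_iff[OF equiv_glue_rel assms, of R] assms
  by (auto simp: glue_class_def glue_rel_def)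

lemma glue_class_eqI:
  assumes "(x, y) \<in> R" "x \<in> topspace X" "y \<in> topspace X"
  shows "glue_class X R x = glue_class X R y"
  using assms by (simp add: glue_class_eq_iff r_into_equivclp)

lemma lift_glue_class:
  assumes "x \<in> topspace X" and inv: "\<And>a b. (a, b) \<in> R \<Longrightarrow> f a = f b"
  shows "lift f (glue_class X R x) = f x"
proof -
  have "f y = f x" if "y \<in> glue_class X R x" for y
    using that equivclp_invariant[of "\<lambda>a b. (a, b) \<in> R" x y f] inv
    by (auto simp: glue_class_def glue_rel_def)
  moreover have "x \<in> glue_class X R x"
    using assms(1) by (simp add: glue_class_def glue_rel_def)
  ultimately have "f ` glue_class X R x = {f x}"
    by blast
  then show ?thesis
    by (simp add: lift_def)
qed

lemma quotient_map_glue: "quotient_map X (glue X R) (glue_class X R)"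
  unfolding quotient_map_def topspace_glue
proof (intro conjI allI impI refl)
  fix \<U> assume sub: "\<U> \<subseteq> glue_class X R ` topspace X"
  have "{x \<in> topspace X. glue_class X R x \<in> \<U>} = \<Union>\<U>"
  proof (intro equalityI subsetI)
    fix x assume "x \<in> {x \<in> topspace X. glue_class X R x \<in> \<U>}"
    then show "x \<in> \<Union>\<U>"
      by (auto simp: glue_class_def glue_rel_def intro!: bexI[of _ "glue_class X R x"])
  next
    fix x assume "x \<in> \<Union>\<U>"
    then obtain c where c: "c \<in> \<U>" "x \<in> c"
      by blast
    then obtain y where y: "y \<in> topspace X" "c = glue_class X R y"
      using sub by blast
    with c have "x \<in> topspace X" "equivclp (\<lambda>a b. (a, b) \<in> R) y x"
      by (auto simp: glue_class_def glue_rel_def)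
    then show "x \<in> {x \<in> topspace X. glue_class X R x \<in> \<U>}"
      using c y glue_class_eq_iff[of y X x R] by auto
  qed
  moreover have "\<U> \<subseteq> topspace X // glue_rel X R"
    using sub by (auto simp: quotient_def glue_class_def)
  ultimately show "openin X {x \<in> topspace X. glue_class X R x \<in> \<U>} = openin (glue X R) \<U>"
    by (simp add: openin_glue)
qed

lemma glue_class_in_topspace: "x \<in> topspace X \<Longrightarrow> glue_class X R x \<in> topspace (glue X R)"
  by (simp add: topspace_glue)

lemma continuous_map_glue_class: "continuous_map X (glue X R) (glue_class X R)"
  by (rule quotient_imp_continuous_map[OF quotient_map_glue])

lemma continuous_map_lift:
  assumes "continuous_map X Y f" and "\<And>a b. (a, b) \<in> R \<Longrightarrow> f a = f b"
  shows "continuous_map (glue X R) Y (lift f)"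
proof (rule continuous_compose_quotient_map[OF quotient_map_glue])
  show "continuous_map X Y (lift f \<circ> glue_class X R)"
    by (rule continuous_map_eq[OF assms(1)]) (simp add: lift_glue_class assms(2))
qed

section \<open>Continuity on open pieces\<close>

text \<open>The maps \<open>i k\<close> parametrize open pieces of \<open>X\<close>. Openness and
  joint surjectivity are enough for the test, so sums, products with sums and open subspaces can all
  be examined in their parametrizations.\<close>

lemma openin_open_pieces:
  assumes "\<And>k. k \<in> K \<Longrightarrow> open_map (A k) X (i k)"
    and "topspace X \<subseteq> (\<Union>k\<in>K. i k ` topspace (A k))"
    and "U \<subseteq> topspace X"
    and "\<And>k. k \<in> K \<Longrightarrow> openin (A k) {a \<in> topspace (A k). i k a \<in> U}"
  shows "openin X U"
proof -
  have "U = (\<Union>k\<in>K. i k ` {a \<in> topspace (A k). i k a \<in> U})"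
    using assms(2,3) by blast
  moreover have "openin X (\<Union>k\<in>K. i k ` {a \<in> topspace (A k). i k a \<in> U})"
    using assms(1,4) by (intro openin_Union) (auto simp: open_map_def)
  ultimately show ?thesis
    by simp
qed

lemma continuous_map_open_pieces:
  assumes "\<And>k. k \<in> K \<Longrightarrow> open_map (A k) X (i k)"
    and cov: "topspace X \<subseteq> (\<Union>k\<in>K. i k ` topspace (A k))"
    and f: "\<And>k. k \<in> K \<Longrightarrow> continuous_map (A k) Y (\<lambda>a. f (i k a))"
  shows "continuous_map X Y f"
  unfolding continuous_map_def
proof (intro conjI allI impI)
  show "f \<in> topspace X \<rightarrow> topspace Y"
    using cov f by (fastforce simp: continuous_map_def Pi_iff)
  fix V assume V: "openin Y V"
  show "openin X {x \<in> topspace X. f x \<in> V}"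
  proof (rule openin_open_pieces[OF assms(1) cov])
    fix k assume k: "k \<in> K"
    have "i k ` topspace (A k) \<subseteq> topspace X"
      using assms(1)[OF k] open_map_imp_subset_topspace by blast
    then have "{a \<in> topspace (A k). i k a \<in> {x \<in> topspace X. f x \<in> V}}
        = {a \<in> topspace (A k). f (i k a) \<in> V}"
      by auto
    then show "openin (A k) {a \<in> topspace (A k). i k a \<in> {x \<in> topspace X. f x \<in> V}}"
      using f[OF k] V by (simp add: openin_continuous_map_preimage)
  qed auto
qed

lemma continuous_map_local:
  assumes "\<And>x. x \<in> topspace X \<Longrightarrow> \<exists>U. openin X U \<and> x \<in> U \<and> continuous_map (subtopology X U) Y f"
  shows "continuous_map X Y f"
proof (rule continuous_map_open_pieces[where K = "{U. openin X U \<and> continuous_map (subtopology X U) Y f}"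
      and A = "\<lambda>U. subtopology X U" and i = "\<lambda>_ x. x"])
  show "topspace X \<subseteq> (\<Union>U\<in>{U. openin X U \<and> continuous_map (subtopology X U) Y f}.
      (\<lambda>x. x) ` topspace (subtopology X U))"
    using assms by fastforce
qed (auto simp: open_map_def openin_open_subtopology)

lemma open_map_prod_id:
  assumes "open_map A X i"
  shows "open_map (prod_topology A B) (prod_topology X B) (\<lambda>(a, b). (i a, b))"
  unfolding open_map_def
proof (intro allI impI)
  fix U assume U: "openin (prod_topology A B) U"
  show "openin (prod_topology X B) ((\<lambda>(a, b). (i a, b)) ` U)"
    unfolding openin_prod_topology_alt
  proof (intro allI impI)
    fix x b assume "(x, b) \<in> (\<lambda>(a, b). (i a, b)) ` U"
    then obtain a where a: "(a, b) \<in> U" "x = i a"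
      by auto
    with U obtain V W where VW: "openin A V" "openin B W" "a \<in> V" "b \<in> W" "V \<times> W \<subseteq> U"
      unfolding openin_prod_topology_alt by meson
    then show "\<exists>V W. openin X V \<and> openin B W \<and> x \<in> V \<and> b \<in> W
        \<and> V \<times> W \<subseteq> (\<lambda>(a, b). (i a, b)) ` U"
      using assms a by (intro exI[of _ "i ` V"] exI[of _ W]) (force simp: open_map_def)
  qed
qed

lemma open_map_id_prod:
  assumes "open_map A X i"
  shows "open_map (prod_topology B A) (prod_topology B X) (\<lambda>(b, a). (b, i a))"
  unfolding open_map_def
proof (intro allI impI)
  fix U assume U: "openin (prod_topology B A) U"
  show "openin (prod_topology B X) ((\<lambda>(b, a). (b, i a)) ` U)"
    unfolding openin_prod_topology_alt
  proof (intro allI impI)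
    fix b x assume "(b, x) \<in> (\<lambda>(b, a). (b, i a)) ` U"
    then obtain a where a: "(b, a) \<in> U" "x = i a"
      by auto
    with U obtain V W where VW: "openin A V" "openin B W" "a \<in> V" "b \<in> W" "W \<times> V \<subseteq> U"
      unfolding openin_prod_topology_alt by meson
    then show "\<exists>W V. openin B W \<and> openin X V \<and> b \<in> W \<and> x \<in> V
        \<and> W \<times> V \<subseteq> (\<lambda>(b, a). (b, i a)) ` U"
      using assms a by (intro exI[of _ "i ` V"] exI[of _ W]) (force simp: open_map_def)
  qed
qed

lemma open_map_discrete_slice_right:
  assumes "d \<in> D"
  shows "open_map A (prod_topology A (discrete_topology D)) (\<lambda>a. (a, d))"
  unfolding open_map_def
proof (intro allI impI)
  fix U assume "openin A U"
  moreover have "(\<lambda>a. (a, d)) ` U = U \<times> {d}"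
    by auto
  ultimately show "openin (prod_topology A (discrete_topology D)) ((\<lambda>a. (a, d)) ` U)"
    using assms by (simp add: openin_prod_Times_iff)
qed

lemma quotient_map_sum_topology:
  assumes "\<And>i. i \<in> I \<Longrightarrow> quotient_map (X i) (Y i) (f i)"
  shows "quotient_map (sum_topology X I) (sum_topology Y I) (\<lambda>(i, x). (i, f i x))"
  unfolding quotient_map_def
proof (intro conjI allI impI)
  have im: "f i ` topspace (X i) = topspace (Y i)" if "i \<in> I" for i
    using assms[OF that] by (simp add: quotient_map_def)
  show "(\<lambda>(i, x). (i, f i x)) ` topspace (sum_topology X I) = topspace (sum_topology Y I)"
  proof (intro equalityI subsetI)
    fix z assume "z \<in> topspace (sum_topology Y I)"
    then obtain i y where "z = (i, y)" "i \<in> I" "y \<in> topspace (Y i)"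
      by auto
    with im[of i] show "z \<in> (\<lambda>(i, x). (i, f i x)) ` topspace (sum_topology X I)"
      by force
  qed (use im in force)
  fix U assume U: "U \<subseteq> topspace (sum_topology Y I)"
  have "openin (X i) {x \<in> topspace (X i). (i, f i x) \<in> U} \<longleftrightarrow> openin (Y i) {y. (i, y) \<in> U}" if "i \<in> I" for i
  proof -
    have "{y. (i, y) \<in> U} \<subseteq> topspace (Y i)"
      using U that by auto
    then show ?thesis
      using assms[OF that, unfolded quotient_map_def, THEN conjunct2, rule_format, of "{y. (i, y) \<in> U}"]
      by simp
  qed
  moreover have "{x. (i, x) \<in> {x \<in> topspace (sum_topology X I). (case x of (i, x) \<Rightarrow> (i, f i x)) \<in> U}}
      = {x \<in> topspace (X i). (i, f i x) \<in> U}" if "i \<in> I" for i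
    using that by auto
  ultimately show "openin (sum_topology X I) {x \<in> topspace (sum_topology X I). (case x of (i, x) \<Rightarrow> (i, f i x)) \<in> U}
      = openin (sum_topology Y I) U"
    unfolding openin_sum_topology using U by auto
qed

section \<open>Maps of simplices\<close>

lemma standard_simplex_iff:
  "t \<in> standard_simplex n \<longleftrightarrow> (\<forall>i. 0 \<le> t i) \<and> (\<forall>i>n. t i = 0) \<and> (\<Sum>i\<le>n. t i) = 1"
proof -
  have "t i \<le> 1" if "\<forall>i. 0 \<le> t i" "\<forall>i>n. t i = 0" "(\<Sum>i\<le>n. t i) = 1" for i
  proof (cases "i \<le> n")
    case True
    then have "t i \<le> (\<Sum>i\<le>n. t i)"
      by (intro member_le_sum) (use that in auto)
    with that show ?thesis by simp
  qed (use that in auto)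
  then show ?thesis
    by (auto simp: standard_simplex_def)
qed

lemma face_in_simplex:
  "t \<in> standard_simplex n \<Longrightarrow> k \<le> Suc n \<Longrightarrow> simplical_face k t \<in> standard_simplex (Suc n)"
  using simplical_face_in_standard_simplex[of "Suc n" k t] by simp

text \<open>The affine map Delta^(n+1) -> Delta^n that sends the last vertex to \<open>i\<close> and
  fixes the others. For \<open>i = n\<close> it agrees on the simplex with the last codegeneracy;
  for smaller \<open>i\<close> it is not monotone on vertices and hence no simplicial
  operator.\<close>

definition push :: "nat \<Rightarrow> nat \<Rightarrow> (nat \<Rightarrow> real) \<Rightarrow> nat \<Rightarrow> real" where
  "push i n t = (\<lambda>l. if l = i then t i + t (Suc n) else if l = Suc n then 0 else t l)"

lemma push_in_simplex:
  assumes "t \<in> standard_simplex (Suc n)" "i \<le> n"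
  shows "push i n t \<in> standard_simplex n"
proof -
  have "(\<Sum>l\<le>n. push i n t l) = (\<Sum>l\<le>n. t l + (if l = i then t (Suc n) else 0))"
    by (rule sum.cong) (auto simp: push_def)
  also have "\<dots> = (\<Sum>l\<le>Suc n. t l)"
    using assms(2) by (simp add: sum.distrib)
  finally show ?thesis
    using assms by (auto simp: standard_simplex_iff push_def)
qed

lemma codegen_in_simplex:
  assumes t: "t \<in> standard_simplex (Suc n)" and "j \<le> n"
  shows "codegen j t \<in> standard_simplex n"
proof -
  have "(\<Sum>l\<le>n. codegen j t l) = (\<Sum>l\<le>Suc n. t l)"
  proof -
    have split: "{..n} = {..<j} \<union> {j} \<union> {Suc j..n}" "{..Suc n} = {..<j} \<union> {j, Suc j} \<union> {Suc (Suc j)..Suc n}"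
      using \<open>j \<le> n\<close> by auto
    have "(\<Sum>l\<le>n. codegen j t l) = (\<Sum>l<j. t l) + (t j + t (Suc j)) + (\<Sum>l = Suc j..n. t (Suc l))"
      unfolding split by (subst sum.union_disjoint, auto)+ (auto simp: codegen_def)
    also have "(\<Sum>l = Suc j..n. t (Suc l)) = (\<Sum>l = Suc (Suc j)..Suc n. t l)"
      by (subst sum.shift_bounds_cl_Suc_ivl) simp
    also have "(\<Sum>l<j. t l) + (t j + t (Suc j)) + \<dots> = (\<Sum>l\<le>Suc n. t l)"
      unfolding split by (subst sum.union_disjoint, auto)+
    finally show ?thesis .
  qed
  with assms show ?thesis
    by (auto simp: standard_simplex_iff codegen_def)
qed

lemma continuous_map_into_simplex:
  "continuous_map X (std_simplex n) f \<longleftrightarrow>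
     f \<in> topspace X \<rightarrow> standard_simplex n \<and> (\<forall>i. continuous_map X euclideanreal (\<lambda>x. f x i))"
  by (auto simp: continuous_map_in_subtopology continuous_map_componentwise_UNIV)

lemma continuous_map_simplex_coordinate:
  "continuous_map X (std_simplex n) f \<Longrightarrow> continuous_map X euclideanreal (\<lambda>x. f x i)"
  by (simp add: continuous_map_into_simplex)

lemma simplex_coordinate [continuous_intros]: "continuous_map (std_simplex n) euclideanreal (\<lambda>t. t i)"
  by (rule continuous_map_simplex_coordinate) (rule continuous_map_id[unfolded id_def])

lemma continuous_map_face:
  "k \<le> Suc n \<Longrightarrow> continuous_map (std_simplex n) (std_simplex (Suc n)) (simplical_face k)"
  unfolding continuous_map_into_simplex
proof (intro conjI allI)
  fix i show "continuous_map (std_simplex n) euclideanreal (\<lambda>x. simplical_face k x i)"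
    unfolding simplical_face_def by (cases "i < k"; cases "i = k") (auto intro!: continuous_intros)
qed (auto simp: face_in_simplex)

lemma continuous_map_codegen:
  "j \<le> n \<Longrightarrow> continuous_map (std_simplex (Suc n)) (std_simplex n) (codegen j)"
  unfolding continuous_map_into_simplex
proof (intro conjI allI)
  fix i show "continuous_map (std_simplex (Suc n)) euclideanreal (\<lambda>x. codegen j x i)"
    unfolding codegen_def by (cases "i < j"; cases "i = j") (auto intro!: continuous_intros)
qed (auto simp: codegen_in_simplex)

lemma continuous_map_push:
  "i \<le> n \<Longrightarrow> continuous_map (std_simplex (Suc n)) (std_simplex n) (push i n)"
  unfolding continuous_map_into_simplex
proof (intro conjI allI)
  fix l show "continuous_map (std_simplex (Suc n)) euclideanreal (\<lambda>x. push i n x l)"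
    unfolding push_def by (cases "l = i"; cases "l = Suc n") (auto intro!: continuous_intros)
qed (auto simp: push_in_simplex)

lemma compact_space_simplex: "compact_space (std_simplex n)"
  by (simp add: compact_space_subtopology compactin_standard_simplex)

lemma Hausdorff_space_simplex: "Hausdorff_space (std_simplex n)"
  by (simp add: Hausdorff_space_subtopology Hausdorff_space_product_topology)

lemma locally_compact_space_simplex: "locally_compact_space (std_simplex n)"
  by (simp add: compact_imp_locally_compact_space compact_space_simplex)

lemma simplex_support: "t \<in> standard_simplex n \<Longrightarrow> n < i \<Longrightarrow> t i = 0"
  by (simp add: standard_simplex_iff)

lemma push_face_last:
  "t \<in> standard_simplex n \<Longrightarrow> i \<le> n \<Longrightarrow> push i n (simplical_face (Suc n) t) = t"
  by (rule ext) (auto simp: push_def simplical_face_def simplex_support)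

lemma push_face:
  assumes "t \<in> standard_simplex (Suc n)" "k \<le> Suc n" "i \<le> Suc n" "i \<noteq> k"
  shows "push i (Suc n) (simplical_face k t) = simplical_face k (push (if i < k then i else i - 1) n t)"
proof
  fix l
  consider "l < k" | "l = k" | "k < l" by linarith
  then show "push i (Suc n) (simplical_face k t) l = simplical_face k (push (if i < k then i else i - 1) n t) l"
    using assms by cases (auto simp: push_def simplical_face_def)
qed

text \<open>The masses at the last two vertices both end up at \<open>i\<close>, whether the very
  last one moves there directly or by way of its neighbour. \<open>W_degen\<close> needs this for
  the last degeneracy.\<close>

lemma push_push:
  "i \<le> n \<Longrightarrow> push i n (push i (Suc n) t) = push i n (codegen (Suc n) t)" if "t \<in> standard_simplex (Suc (Suc n))"
  using simplex_support[OF that]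
  by (intro ext) (auto simp: push_def codegen_def)

lemma push_codegen:
  assumes "k \<le> n" "i \<le> Suc n"
  shows "push (if i \<le> k then i else i - 1) n (codegen k t) = codegen k (push i (Suc n) t)"
proof
  fix l
  consider "l < k" | "l = k" | "k < l" by linarith
  then show "push (if i \<le> k then i else i - 1) n (codegen k t) l = codegen k (push i (Suc n) t) l"
    using assms by cases (auto simp: push_def codegen_def)
qed

section \<open>Trivializations at the vertices of a simplex\<close>

locale topological_group = group G for G :: "'g monoid" (structure) +
  fixes T :: "'g topology"
  assumes topspace_carrier: "topspace T = carrier G"
    and continuous_mult: "continuous_map (prod_topology T T) T (\<lambda>(x, y). x \<otimes> y)"
    and continuous_inv: "continuous_map T T (\<lambda>x. inv x)"
    and Hausdorff_T: "Hausdorff_space T"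
    and locally_compact_T: "locally_compact_space T"
begin

lemma continuous_map_mult:
  assumes "continuous_map X T f" "continuous_map X T g"
  shows "continuous_map X T (\<lambda>x. f x \<otimes> g x)"
  using continuous_map_compose[OF continuous_map_pairedI[OF assms] continuous_mult]
  by (simp add: comp_def)

lemma continuous_map_inv:
  assumes "continuous_map X T f"
  shows "continuous_map X T (\<lambda>x. inv (f x))"
  using continuous_map_compose[OF assms continuous_inv] by (simp add: comp_def)

lemma continuous_map_in_carrier: "continuous_map X T f \<Longrightarrow> x \<in> topspace X \<Longrightarrow> f x \<in> carrier G"
  using topspace_carrier by (auto simp: continuous_map_def)

end

locale simplicial =
  fixes S :: "'s sset"
  assumes sset: "simplicial_set S"
begin

lemma face_in: "\<sigma> \<in> ssimp S (Suc n) \<Longrightarrow> j \<le> Suc n \<Longrightarrow> sface S (Suc n) j \<sigma> \<in> ssimp S n"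
  and degen_in: "\<sigma> \<in> ssimp S n \<Longrightarrow> j \<le> n \<Longrightarrow> sdegen S n j \<sigma> \<in> ssimp S (Suc n)"
  and face_face: "\<sigma> \<in> ssimp S (Suc (Suc n)) \<Longrightarrow> i < j \<Longrightarrow> j \<le> Suc (Suc n) \<Longrightarrow>
     sface S (Suc n) i (sface S (Suc (Suc n)) j \<sigma>) = sface S (Suc n) (j - 1) (sface S (Suc (Suc n)) i \<sigma>)"
  and degen_degen: "\<sigma> \<in> ssimp S n \<Longrightarrow> i \<le> j \<Longrightarrow> j \<le> n \<Longrightarrow>
     sdegen S (Suc n) i (sdegen S n j \<sigma>) = sdegen S (Suc n) (Suc j) (sdegen S n i \<sigma>)"
  and face_degen_less: "\<sigma> \<in> ssimp S n \<Longrightarrow> i < j \<Longrightarrow> j \<le> n \<Longrightarrow>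
     sface S (Suc n) i (sdegen S n j \<sigma>) = sdegen S (n - 1) (j - 1) (sface S n i \<sigma>)"
  and face_degen_eq: "\<sigma> \<in> ssimp S n \<Longrightarrow> j \<le> n \<Longrightarrow> sface S (Suc n) j (sdegen S n j \<sigma>) = \<sigma>"
  and face_degen_Suc: "\<sigma> \<in> ssimp S n \<Longrightarrow> j \<le> n \<Longrightarrow> sface S (Suc n) (Suc j) (sdegen S n j \<sigma>) = \<sigma>"
  and face_degen_greater: "\<sigma> \<in> ssimp S n \<Longrightarrow> Suc j < i \<Longrightarrow> i \<le> Suc n \<Longrightarrow>
     sface S (Suc n) i (sdegen S n j \<sigma>) = sdegen S (n - 1) j (sface S n (i - 1) \<sigma>)"
  using sset unfolding simplicial_set_def simplicial_identities_def by metis+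

end

locale transition_functions = topological_group G T + simplicial S
  for G :: "'g monoid" (structure) and T :: "'g topology" and S :: "'s sset" +
  fixes v :: "nat \<Rightarrow> 's \<Rightarrow> (nat \<Rightarrow> real) \<Rightarrow> 'g"
  assumes compatible: "compatible_transition_functions G T S v"
begin

lemma v_continuous: "\<sigma> \<in> ssimp S (Suc n) \<Longrightarrow> continuous_map (std_simplex n) T (v (Suc n) \<sigma>)"
  and v_face: "\<sigma> \<in> ssimp S (Suc (Suc n)) \<Longrightarrow> t \<in> standard_simplex n \<Longrightarrow> i < Suc n \<Longrightarrow>
     v (Suc (Suc n)) \<sigma> (simplical_face i t) = v (Suc n) (sface S (Suc (Suc n)) i \<sigma>) t"
  and v_face_last: "\<sigma> \<in> ssimp S (Suc (Suc n)) \<Longrightarrow> t \<in> standard_simplex n \<Longrightarrow>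
     v (Suc (Suc n)) \<sigma> (simplical_face (Suc n) t) = v (Suc n) (sface S (Suc (Suc n)) (Suc n) \<sigma>) t
       \<otimes> inv v (Suc n) (sface S (Suc (Suc n)) (Suc (Suc n)) \<sigma>) t"
  and v_degen: "\<sigma> \<in> ssimp S (Suc n) \<Longrightarrow> t \<in> standard_simplex (Suc n) \<Longrightarrow> j \<le> n \<Longrightarrow>
     v (Suc (Suc n)) (sdegen S (Suc n) j \<sigma>) t = v (Suc n) \<sigma> (codegen j t)"
  and v_degen_last: "\<sigma> \<in> ssimp S n \<Longrightarrow> t \<in> standard_simplex n \<Longrightarrow> v (Suc n) (sdegen S n n \<sigma>) t = \<one>"
  using compatible unfolding compatible_transition_functions_def by metis+

lemma v_closed: "\<sigma> \<in> ssimp S (Suc n) \<Longrightarrow> t \<in> standard_simplex n \<Longrightarrow> v (Suc n) \<sigma> t \<in> carrier G"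
  using continuous_map_in_carrier[OF v_continuous] by simp

text \<open>\<open>F\<close> is trivialized over a simplex \<open>\<sigma>\<close> by its last vertex; \<open>W i n \<sigma> t\<close> is the transport from
  there to the vertex \<open>i\<close>, obtained by collapsing the vertices after \<open>i\<close> to \<open>i\<close> one at a time, from
  the last one on, each collapse being parallel for the trivialization by the vertex collapsed.\<close>

fun W :: "nat \<Rightarrow> nat \<Rightarrow> 's \<Rightarrow> (nat \<Rightarrow> real) \<Rightarrow> 'g" where
  "W i 0 \<sigma> t = \<one>"
| "W i (Suc n) \<sigma> t = (if i = Suc n then \<one>
     else W i n (sface S (Suc n) (Suc n) \<sigma>) (push i n t) \<otimes> inv v (Suc n) \<sigma> (push i n t))"

lemma W_last [simp]: "W n n \<sigma> t = \<one>"
  by (cases n) auto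

lemma W_closed [simp]: "\<sigma> \<in> ssimp S n \<Longrightarrow> t \<in> standard_simplex n \<Longrightarrow> i \<le> n \<Longrightarrow> W i n \<sigma> t \<in> carrier G"
  by (induction n arbitrary: \<sigma> t) (auto simp: push_in_simplex v_closed face_in le_Suc_eq)

lemma W_continuous: "\<sigma> \<in> ssimp S n \<Longrightarrow> i \<le> n \<Longrightarrow> continuous_map (std_simplex n) T (W i n \<sigma>)"
proof (induction n arbitrary: \<sigma>)
  case (Suc n)
  show ?case
  proof (cases "i = Suc n")
    case False
    then have i: "i \<le> n" using Suc.prems by simp
    have "continuous_map (std_simplex (Suc n)) T (\<lambda>t. W i n (sface S (Suc n) (Suc n) \<sigma>) (push i n t) \<otimes> inv v (Suc n) \<sigma> (push i n t))"
      by (intro continuous_map_mult continuous_map_inv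
          continuous_map_compose[OF continuous_map_push[OF i], unfolded comp_def]
          Suc.IH face_in Suc.prems v_continuous i) auto
    with False show ?thesis by simp
  qed (use topspace_carrier in simp)
next
  case 0
  have "W i 0 \<sigma> = (\<lambda>_. \<one>)"
    by (rule ext) simp
  then show ?case
    using topspace_carrier by simp
qed

text \<open>\<open>W\<close> starts from the trivialization by the last vertex. A face that keeps
  the last vertex keeps this start, and deleting the last vertex changes it by \<open>v\<close>,
  which is the additional factor. Thus the trivialization at the vertex \<open>i\<close> is the same
  seen from a simplex and from any face containing \<open>i\<close>. Both sides strip the last
  vertex, whence the induction on the dimension.\<close>

lemma W_face:
  assumes "\<sigma> \<in> ssimp S (Suc n)" "t \<in> standard_simplex n" "k \<le> Suc n" "i \<le> Suc n" "i \<noteq> k"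
  shows "W i (Suc n) \<sigma> (simplical_face k t) \<otimes> (if k \<le> n then \<one> else v (Suc n) \<sigma> t)
    = W (if i < k then i else i - 1) n (sface S (Suc n) k \<sigma>) t"
  using assms
proof (induction n arbitrary: \<sigma> t)
  case 0
  then consider "k = 0" "i = 1" | "k = 1" "i = 0" by force
  then show ?case
    using 0 v_closed[of \<sigma> 0 t] by cases (auto simp: push_face_last)
next
  case (Suc m)
  let ?n = "Suc m"
  consider "k = Suc ?n" | "k \<le> ?n" "i = Suc ?n" | "k \<le> ?n" "i \<le> ?n"
    using Suc.prems by linarith
  then show ?case
  proof cases
    case 1
    then show ?thesis
      using Suc.prems v_closed[of \<sigma> ?n t] W_closed[OF face_in[OF Suc.prems(1), of k]]
      by (auto simp: push_face_last m_assoc simp del: W.simps(2)[of _ m])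
  next
    case 2
    then show ?thesis by simp
  next
    case 3
    define i' where "i' = (if i < k then i else i - 1)"
    have i': "i' \<le> m" using 3 Suc.prems by (auto simp: i'_def)
    define u where "u = push i' m t"
    define \<tau> where "\<tau> = sface S (Suc ?n) (Suc ?n) \<sigma>"
    have u: "u \<in> standard_simplex m"
      unfolding u_def using Suc.prems i' by (intro push_in_simplex) auto
    have \<tau>: "\<tau> \<in> ssimp S ?n" "sface S (Suc ?n) k \<sigma> \<in> ssimp S ?n"
      unfolding \<tau>_def using Suc.prems 3 by (auto intro: face_in)
    have push: "push i ?n (simplical_face k t) = simplical_face k u"
      unfolding u_def i'_def using Suc.prems 3 by (intro push_face) auto
    have comm: "sface S ?n ?n (sface S (Suc ?n) k \<sigma>) = sface S ?n k \<tau>"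
      using face_face[of \<sigma> m k "Suc ?n"] Suc.prems 3 by (simp add: \<tau>_def)
    have fu: "simplical_face k u \<in> standard_simplex ?n"
      using u 3 by (auto intro: face_in_simplex)
    have IH: "W i ?n \<tau> (simplical_face k u) \<otimes> (if k \<le> m then \<one> else v ?n \<tau> u)
        = W i' m (sface S ?n k \<tau>) u"
      unfolding i'_def using Suc.IH[OF \<tau>(1) u] 3 Suc.prems by simp
    \<comment> \<open>The compatibility of the \<open>v\<close> enters here. The faces of index at
      most \<open>m\<close> merely restrict \<open>v\<close>; the face opposite the last vertex but
      one, of index \<open>?n\<close>, contributes exactly the inverse that completes the left side
      of \<open>IH\<close>.\<close>
    have vv: "v (Suc ?n) \<sigma> (simplical_face k u)
        = v ?n (sface S (Suc ?n) k \<sigma>) u \<otimes> inv (if k \<le> m then \<one> else v ?n \<tau> u)"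
    proof (cases "k \<le> m")
      case True
      then show ?thesis
        using v_face[OF Suc.prems(1) u, of k] v_closed[OF \<tau>(2) u] by simp
    next
      case False
      with 3 have "k = ?n" by simp
      then show ?thesis
        using v_face_last[OF Suc.prems(1) u] by (simp add: \<tau>_def)
    qed
    have cl: "W i ?n \<tau> (simplical_face k u) \<in> carrier G" "v ?n \<tau> u \<in> carrier G"
      "v ?n (sface S (Suc ?n) k \<sigma>) u \<in> carrier G"
      using \<tau> u fu 3 by (auto simp: v_closed simp del: W.simps)
    have "W i (Suc ?n) \<sigma> (simplical_face k t)
        = W i ?n \<tau> (simplical_face k u) \<otimes> inv v (Suc ?n) \<sigma> (simplical_face k u)"
      using 3 by (simp add: push \<tau>_def del: W.simps) (simp add: push)
    also have "\<dots> = (W i ?n \<tau> (simplical_face k u) \<otimes> (if k \<le> m then \<one> else v ?n \<tau> u))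
        \<otimes> inv v ?n (sface S (Suc ?n) k \<sigma>) u"
      unfolding vv using cl by (simp add: inv_mult_group m_assoc del: W.simps)
    also have "\<dots> = W i' ?n (sface S (Suc ?n) k \<sigma>) t"
      unfolding IH using i' by (simp add: u_def comm)
    finally show ?thesis
      using 3 W_closed[OF \<tau>(2), of t i'] Suc.prems i'
      by (simp add: i'_def del: W.simps)
  qed
qed

lemma W_degen:
  assumes "\<sigma> \<in> ssimp S n" "t \<in> standard_simplex (Suc n)" "k \<le> n" "i \<le> Suc n"
  shows "W i (Suc n) (sdegen S n k \<sigma>) t = W (if i \<le> k then i else i - 1) n \<sigma> (codegen k t)"
  using assms
proof (induction n arbitrary: \<sigma> t)
  case 0
  then show ?case
    using v_degen_last[of \<sigma> 0] push_in_simplex[of t 0 0] by (cases "i = 0") auto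
next
  case (Suc m)
  let ?n = "Suc m"
  have s: "sdegen S ?n k \<sigma> \<in> ssimp S (Suc ?n)"
    using Suc.prems degen_in by simp
  consider "i = Suc ?n" | "i = ?n" "k = ?n" | "i \<le> m" "k = ?n" | "i \<le> ?n" "k \<le> m"
    using Suc.prems by linarith
  then show ?case
  proof cases
    case 1
    then show ?thesis using Suc.prems by simp
  next
    \<comment> \<open>The edge between the last two vertices is degenerate, and
      \<open>v_degen_last\<close> makes the transport along it trivial.\<close>
    case 2
    with Suc.prems have "sface S (Suc ?n) (Suc ?n) (sdegen S ?n k \<sigma>) = \<sigma>"
      by (simp add: face_degen_Suc)
    moreover have "push i ?n t \<in> standard_simplex ?n"
      using 2 Suc.prems by (intro push_in_simplex) auto
    ultimately show ?thesis
      using 2 Suc.prems v_degen_last[of \<sigma> ?n] by simp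
  next
    case 3
    with Suc.prems have f: "sface S (Suc ?n) (Suc ?n) (sdegen S ?n k \<sigma>) = \<sigma>"
      by (simp add: face_degen_Suc)
    have p: "push i ?n t \<in> standard_simplex ?n"
      using 3 Suc.prems by (intro push_in_simplex) auto
    have "W i (Suc ?n) (sdegen S ?n k \<sigma>) t = W i ?n \<sigma> (push i ?n t)"
      using 3 Suc.prems p v_degen_last[of \<sigma> ?n] W_closed[OF Suc.prems(1) p, of i] f
      by (subst W.simps(2)) (simp del: W.simps)
    \<comment> \<open>As \<open>i\<close> is below \<open>?n\<close>, \<open>W i ?n\<close> sees its
      point only through \<open>push i m\<close>, and there the two arguments agree.\<close>
    also have "\<dots> = W i ?n \<sigma> (codegen k t)"
      using 3 push_push[OF Suc.prems(2)] by simp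
    finally show ?thesis using 3 by simp
  next
    case 4
    define i' where "i' = (if i \<le> k then i else i - 1)"
    have i': "i' \<le> m" using 4 by (auto simp: i'_def)
    have f: "sface S (Suc ?n) (Suc ?n) (sdegen S ?n k \<sigma>) = sdegen S m k (sface S ?n ?n \<sigma>)"
      using 4 Suc.prems face_degen_greater[of \<sigma> ?n k "Suc ?n"] by simp
    have p: "push i ?n t \<in> standard_simplex ?n"
      using 4 Suc.prems by (intro push_in_simplex) auto
    have c: "codegen k (push i ?n t) = push i' m (codegen k t)"
      unfolding i'_def using push_codegen[of k m i t] 4 by simp
    have "W i (Suc ?n) (sdegen S ?n k \<sigma>) t
        = W i ?n (sdegen S m k (sface S ?n ?n \<sigma>)) (push i ?n t) \<otimes> inv v ?n \<sigma> (push i' m (codegen k t))"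
      using 4 v_degen[OF Suc.prems(1) p 4(2)] by (subst W.simps(2)) (simp add: f c del: W.simps)
    also have "W i ?n (sdegen S m k (sface S ?n ?n \<sigma>)) (push i ?n t)
        = W i' m (sface S ?n ?n \<sigma>) (push i' m (codegen k t))"
      unfolding i'_def using Suc.IH[OF face_in[OF Suc.prems(1)] p] 4 c by (simp add: i'_def del: W.simps)
    finally show ?thesis
      using i' by (simp add: i'_def[symmetric])
  qed
qed

end

section \<open>Local compactness of Lie groups\<close>

text \<open>Local compactness of finite-dimensional normed spaces, when only a finite spanning set
  is known. On the boundary of the unit cube of coordinates in a basis \<open>C\<close> the norm is
  bounded below by some m > 0. By scaling, the norm then bounds all coordinates, and a closed ball
  lies in the continuous image of a compact cube.\<close>

lemma compact_cball_finite_span: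
  fixes B :: "'e::real_normed_vector set"
  assumes "finite B" "span B = UNIV"
  shows "compact (cball (x :: 'e) r)"
proof -
  obtain C where C: "C \<subseteq> B" "independent C" "B \<subseteq> span C"
    using maximal_independent_subset[of B] by metis
  have fin: "finite C" using C(1) assms(1) finite_subset by blast
  have "span B \<subseteq> span C"
    using C(3) by (simp add: span_minimal)
  then have span: "span C = UNIV" using assms(2) by auto
  define f where "f = (\<lambda>c::'e \<Rightarrow> real. \<Sum>b\<in>C. c b *\<^sub>R b)"
  let ?P = "product_topology (\<lambda>_. euclideanreal) C"
  have "continuous_map ?P euclidean (\<lambda>c. c b *\<^sub>R b)" if "b \<in> C" for b
  proof -
    have "continuous_map ?P euclidean ((\<lambda>r. r *\<^sub>R b) \<circ> (\<lambda>c. c b))"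
      by (rule continuous_map_compose[of _ euclideanreal])
        (auto intro!: continuous_intros continuous_map_product_projection that)
    then show ?thesis by (simp add: comp_def)
  qed
  then have cont: "continuous_map ?P euclidean f"
    unfolding f_def using fin by (intro continuous_map_sum) auto
  have box: "compactin ?P (Pi\<^sub>E C J)" if "\<And>b. b \<in> C \<Longrightarrow> compact (J b)" for J
    using that by (simp add: compactin_PiE)
  \<comment> \<open>The boundary of the cube: some coordinate is 1 or -1. Independence of
    \<open>C\<close> keeps 0 out of its image under \<open>f\<close>.\<close>
  define K where "K = (\<Union>b\<in>C. Pi\<^sub>E C (\<lambda>b'. if b' = b then {-1, 1} else {-1..1::real}))"
  have "compactin ?P K"
    unfolding K_def using fin by (intro compactin_Union) (auto intro!: box)
  then have "compact (f ` K)"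
    using image_compactin[OF _ cont, of K] by simp
  then have closed: "closed (f ` K)" by (rule compact_imp_closed)
  have "0 \<notin> f ` K"
  proof
    assume "0 \<in> f ` K"
    then obtain c b where c: "b \<in> C" "c \<in> Pi\<^sub>E C (\<lambda>b'. if b' = b then {-1, 1} else {-1..1::real})"
      "(\<Sum>b\<in>C. c b *\<^sub>R b) = 0"
      by (auto simp: K_def f_def)
    then have "c b \<in> {-1, 1}"
      using PiE_mem[OF c(2,1)] by simp
    moreover from c
    have "c b = 0"
      using independentD[OF C(2) fin subset_refl, of c b] by simp
    ultimately show False by auto
  qed
  then obtain m where mpos: "m > 0" and m0: "ball 0 m \<subseteq> - f ` K"
    using closed[unfolded closed_def open_contains_ball] by (metis ComplI)
  have m: "m \<le> norm y" if "y \<in> f ` K" for y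
  proof (rule ccontr)
    assume "\<not> m \<le> norm y"
    then have "y \<in> ball 0 m" by simp
    with m0 that show False by blast
  qed
  have bound: "\<bar>c b\<bar> * m \<le> norm (f c)" if c: "c \<in> extensional C" and b: "b \<in> C" for c b
  proof -
    define M where "M = Max ((\<lambda>b. \<bar>c b\<bar>) ` C)"
    have M: "\<bar>c b'\<bar> \<le> M" if "b' \<in> C" for b'
      unfolding M_def using fin that by simp
    have "M \<in> (\<lambda>b. \<bar>c b\<bar>) ` C"
      unfolding M_def using fin b by (intro Max_in) auto
    then obtain b0 where b0: "b0 \<in> C" "\<bar>c b0\<bar> = M" by auto
    show ?thesis
    proof (cases "M = 0")
      case True
      with M[OF b] have "c b = 0" by simp
      then show ?thesis by simp
    next
      case False
      then have pos: "M > 0" using b0 by auto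
      \<comment> \<open>Dividing by the largest absolute coordinate \<open>M\<close> moves
        \<open>c\<close> to the boundary of the cube.\<close>
      define c' where "c' = (\<lambda>b\<in>C. c b / M)"
      have "- 1 \<le> c' b \<and> c' b \<le> 1" if "b \<in> C" for b
        using M[OF that] that pos by (simp add: c'_def field_simps abs_le_iff)
      moreover have "c' b0 = 1 \<or> c' b0 = -1"
        using b0 pos by (auto simp: c'_def abs_eq_iff')
      moreover have "c' x = undefined" if "x \<notin> C" for x
        using that by (simp add: c'_def)
      ultimately have "c' \<in> Pi\<^sub>E C (\<lambda>b'. if b' = b0 then {-1, 1} else {-1..1::real})"
        by (intro PiE_I) auto
      with b0 have "c' \<in> K"
        unfolding K_def by blast
      then have "m \<le> norm (f c')" by (intro m imageI)
      also have "f c' = (1 / M) *\<^sub>R f c"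
        by (simp add: f_def c'_def scaleR_sum_right divide_inverse mult.commute)
      finally have "m * M \<le> norm (f c)"
        using pos by (simp add: field_simps)
      moreover have "\<bar>c b\<bar> * m \<le> M * m"
        using M[OF b] mpos by (simp add: mult_right_mono)
      ultimately show ?thesis by (simp add: mult.commute)
    qed
  qed
  define R where "R = (norm x + r) / m"
  have "cball x r \<subseteq> f ` Pi\<^sub>E C (\<lambda>_. {-R..R})"
  proof
    fix y assume "y \<in> cball x r"
    then have y: "norm y \<le> norm x + r"
      using norm_triangle_ineq4[of x "x - y"] by (simp add: dist_norm)
    obtain u where u: "y = (\<Sum>b\<in>C. u b *\<^sub>R b)"
      using span span_finite[OF fin] by (metis (no_types, lifting) UNIV_I image_iff)
    define c where "c = restrict u C"
    have "y = f c" using u by (simp add: f_def c_def)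
    moreover have "\<bar>c b\<bar> \<le> R" if "b \<in> C" for b
    proof -
      have "\<bar>c b\<bar> * m \<le> norm x + r"
        using bound[of c b] that y \<open>y = f c\<close> by (simp add: c_def)
      then show ?thesis using mpos by (simp add: R_def field_simps)
    qed
    then have "- R \<le> c b \<and> c b \<le> R" if "b \<in> C" for b
      using that by (meson abs_le_D1 abs_le_D2 minus_le_iff)
    then have "c \<in> Pi\<^sub>E C (\<lambda>_. {-R..R})"
      by (intro PiE_I) (simp_all add: c_def)
    ultimately show "y \<in> f ` Pi\<^sub>E C (\<lambda>_. {-R..R})"
      by blast
  qed
  moreover have "compact (f ` Pi\<^sub>E C (\<lambda>_. {-R..R}))"
    using image_compactin[OF box cont, of "\<lambda>_. {-R..R}"] by simp
  ultimately show ?thesis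
    using compact_Int_closed[OF _ closed_cball, of "f ` Pi\<^sub>E C (\<lambda>_. {-R..R})" x r] by (simp add: Int_absorb1)
qed

lemma locally_compact_smooth_atlas:
  fixes A :: "('g set \<times> ('g \<Rightarrow> 'e::real_normed_vector)) set"
  assumes "smooth_atlas T A"
  shows "locally_compact_space T"
  unfolding locally_compact_space_def
proof
  fix x assume "x \<in> topspace T"
  obtain B :: "'e set" where B: "finite B" "span B = UNIV"
    using assms unfolding smooth_atlas_def by (elim conjE exE)
  have "(\<Union>(U, \<phi>)\<in>A. U) = topspace T"
    using assms unfolding smooth_atlas_def by (elim conjE)
  with \<open>x \<in> topspace T\<close> obtain U \<phi> where U: "(U, \<phi>) \<in> A" "x \<in> U"
    by blast
  have chart: "openin T U" "open (\<phi> ` U)" "homeomorphic_map (subtopology T U) (top_of_set (\<phi> ` U)) \<phi>"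
    using assms[unfolded smooth_atlas_def, THEN conjunct2, THEN conjunct2, THEN conjunct1] U(1)
    by (auto simp only: split_beta fst_conv snd_conv)
  have "locally_compact_space (top_of_set (\<phi> ` U))"
    unfolding locally_compact_space_def
  proof
    fix y assume "y \<in> topspace (top_of_set (\<phi> ` U))"
    then obtain r where r: "r > 0" "cball y r \<subseteq> \<phi> ` U"
      using chart(2) open_contains_cball by (metis topspace_euclidean_subtopology)
    have "openin (top_of_set (\<phi> ` U)) (ball y r)"
      using subset_trans[OF ball_subset_cball r(2)] chart(2) by (simp add: openin_open_eq)
    moreover have "compactin (top_of_set (\<phi> ` U)) (cball y r)"
      using r compact_cball_finite_span[OF B] by (simp add: compactin_subtopology)
    ultimately show "\<exists>U' K. openin (top_of_set (\<phi> ` U)) U' \<and> compactin (top_of_set (\<phi> ` U)) K \<and> y \<in> U' \<and> U' \<subseteq> K"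
      using r by (intro exI[of _ "ball y r"] exI[of _ "cball y r"]) auto
  qed
  then have "locally_compact_space (subtopology T U)"
    using chart(3) homeomorphic_locally_compact_space homeomorphic_map_imp_homeomorphic_space by blast
  moreover have "x \<in> topspace (subtopology T U)"
    using U \<open>x \<in> topspace T\<close> by simp
  ultimately obtain V K where "openin (subtopology T U) V \<and> compactin (subtopology T U) K \<and> x \<in> V \<and> V \<subseteq> K"
    unfolding locally_compact_space_def by (metis (no_types))
  then show "\<exists>U K. openin T U \<and> compactin T K \<and> x \<in> U \<and> U \<subseteq> K"
    using chart(1) by (intro exI[of _ V] exI[of _ K]) (simp add: openin_open_subtopology compactin_subtopology)
qed

lemma topological_group_lie_group:
  fixes A :: "('g set \<times> ('g \<Rightarrow> 'e::real_normed_vector)) set"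
  assumes "lie_group G T A"
  shows "topological_group G T"
proof -
  have *: "group G" "topspace T = carrier G" "Hausdorff_space T" "smooth_atlas T A"
     "continuous_map (prod_topology T T) T (\<lambda>(x, y). x \<otimes>\<^bsub>G\<^esub> y)"
     "continuous_map T T (\<lambda>x. inv\<^bsub>G\<^esub> x)"
    using assms unfolding lie_group_def by (simp_all only:)
  interpret group G by fact
  show ?thesis
    by unfold_locales (use * locally_compact_smooth_atlas in auto)
qed

section \<open>Principal spaces\<close>

text \<open>Local triviality is replaced by continuity of the translation function.\<close>

locale principal_space = topological_group G T for G :: "'g monoid" (structure) and T :: "'g topology" +
  fixes X :: "'x topology" and act :: "'x \<Rightarrow> 'g \<Rightarrow> 'x" and pr :: "'x \<Rightarrow> 'b" and tr :: "'x \<Rightarrow> 'x \<Rightarrow> 'g"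
  assumes act_one: "x \<in> topspace X \<Longrightarrow> act x \<one> = x"
    and act_mult: "x \<in> topspace X \<Longrightarrow> g \<in> carrier G \<Longrightarrow> h \<in> carrier G \<Longrightarrow> act (act x g) h = act x (g \<otimes> h)"
    and act_continuous: "continuous_map (prod_topology X T) X (\<lambda>(x, g). act x g)"
    and pr_act: "x \<in> topspace X \<Longrightarrow> g \<in> carrier G \<Longrightarrow> pr (act x g) = pr x"
    and pr_eqD: "x \<in> topspace X \<Longrightarrow> y \<in> topspace X \<Longrightarrow> pr x = pr y \<Longrightarrow> \<exists>g\<in>carrier G. y = act x g"
    and tr_act: "x \<in> topspace X \<Longrightarrow> g \<in> carrier G \<Longrightarrow> tr x (act x g) = g"
    and tr_continuous: "continuous_map (subtopology (prod_topology X X) {(x, y). pr x = pr y}) T (\<lambda>(x, y). tr x y)"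
begin

lemma act_closed: "x \<in> topspace X \<Longrightarrow> g \<in> carrier G \<Longrightarrow> act x g \<in> topspace X"
  using continuous_map_image_subset_topspace[OF act_continuous] topspace_carrier by (force simp: image_subset_iff)

end

section \<open>The universal bundle\<close>

lemma topspace_level_sum: "topspace (level_sum X) = {(n, t, x). t \<in> standard_simplex n \<and> x \<in> topspace (X n)}"
  by (auto simp: level_sum_def)

lemma continuous_map_level: "continuous_map (prod_topology (std_simplex n) (X n)) (level_sum X) (\<lambda>u. (n, u))"
  unfolding level_sum_def by (rule continuous_map_component_injection) simp

lemma open_map_level: "open_map (prod_topology (std_simplex n) (X n)) (level_sum X) (\<lambda>u. (n, u))"
  unfolding level_sum_def by (rule open_map_component_injection) simp

lemma continuous_map_from_level_sum:
  assumes "\<And>n. continuous_map (prod_topology (std_simplex n) (X n)) Y (\<lambda>u. f (n, u))"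
  shows "continuous_map (level_sum X) Y f"
  by (rule continuous_map_open_pieces[where K = UNIV and i = Pair, OF open_map_level _ assms])
    (auto simp: topspace_level_sum)

lemma continuous_map_from_level_sum_prod:
  assumes "\<And>n. continuous_map (prod_topology (prod_topology (std_simplex n) (X n)) B) Y (\<lambda>(u, b). f ((n, u), b))"
  shows "continuous_map (prod_topology (level_sum X) B) Y f"
  by (rule continuous_map_open_pieces[where K = UNIV and i = "\<lambda>n (u, b). ((n, u), b)", OF open_map_prod_id[OF open_map_level]])
    (use assms in \<open>auto simp: topspace_level_sum image_iff case_prod_unfold\<close>)

text \<open>A point \<open>(n, t, a)\<close> of \<open>EG\<close> is regarded as the step function on \<open>[0, 1)\<close> with value \<open>a i\<close> on
  an interval of length \<open>t i\<close>. This removes the identifications, and the translation function is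
  continuous because two step functions that are close in measure to given constants on a short interval
  are simultaneously close to them at some point.\<close>

definition step_index :: "(nat \<Rightarrow> real) \<Rightarrow> real \<Rightarrow> nat" where
  "step_index t x = (LEAST i. x < (\<Sum>l<Suc i. t l))"

lemma partial_sum_mono:
  assumes "\<And>i::nat. 0 \<le> (t i :: real)" "i \<le> j"
  shows "(\<Sum>l<i. t l) \<le> (\<Sum>l<j. t l)"
  using assms by (intro sum_mono2) auto

lemma step_index_eqI:
  assumes "\<And>i. 0 \<le> t i" "(\<Sum>l<j. t l) \<le> x" "x < (\<Sum>l<Suc j. t l)"
  shows "step_index t x = j"
  unfolding step_index_def
proof (rule Least_equality)
  fix i assume "x < (\<Sum>l<Suc i. t l)"
  then show "j \<le> i"
    using assms partial_sum_mono[of t "Suc i" j] by fastforce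
qed (use assms in simp)

lemma step_index_bounds:
  assumes "t \<in> standard_simplex n" "0 \<le> x" "x < 1"
  shows "(\<Sum>l<step_index t x. t l) \<le> x" "x < (\<Sum>l<Suc (step_index t x). t l)" "step_index t x \<le> n"
proof -
  have n: "x < (\<Sum>l<Suc n. t l)"
    using assms by (simp add: standard_simplex_iff lessThan_Suc_atMost del: sum.lessThan_Suc)
  show "x < (\<Sum>l<Suc (step_index t x). t l)" "step_index t x \<le> n"
    unfolding step_index_def by (rule LeastI[of _ n]) (rule n, rule Least_le, rule n)
  show "(\<Sum>l<step_index t x. t l) \<le> x"
  proof (cases "step_index t x")
    case (Suc j)
    then have "\<not> x < (\<Sum>l<Suc j. t l)"
      using not_less_Least[of j "\<lambda>i. x < (\<Sum>l<Suc i. t l)"] by (simp add: step_index_def)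
    then show ?thesis using Suc by simp
  qed (use assms in simp)
qed

lemma partial_sum_face:
  "(\<Sum>l<i. simplical_face k t l) = (\<Sum>l<if i \<le> k then i else i - 1. t l :: real)"
proof (induction i)
  case (Suc i)
  consider "Suc i \<le> k" | "i = k" | "k < i" by linarith
  then show ?case
    using Suc by cases (auto simp: simplical_face_def dest!: less_imp_Suc_add)
qed simp

lemma partial_sum_codegen:
  "(\<Sum>l<i. codegen k t l) = (\<Sum>l<if i \<le> k then i else Suc i. t l)"
proof (induction i)
  case (Suc i)
  consider "Suc i \<le> k" | "i = k" | "k < i" by linarith
  then show ?case
    using Suc by cases (auto simp: codegen_def)
qed simp

text \<open>The intervals are half open and the inequality defining \<open>step_index\<close> is
  strict, so an interval of length zero is never selected. Inserting one only renumbers the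
  intervals after it.\<close>

lemma step_index_face:
  assumes "t \<in> standard_simplex n" "k \<le> Suc n" "0 \<le> x" "x < 1"
  shows "step_index (simplical_face k t) x = (if step_index t x < k then step_index t x else Suc (step_index t x))"
proof (rule step_index_eqI)
  show "0 \<le> simplical_face k t i" for i
    using face_in_simplex[OF assms(1,2)] by (simp add: standard_simplex_iff)
qed (use step_index_bounds[OF assms(1,3,4)] in \<open>auto simp: partial_sum_face simp del: sum.lessThan_Suc\<close>)

lemma step_index_codegen:
  assumes "t \<in> standard_simplex (Suc n)" "k \<le> n" "0 \<le> x" "x < 1"
  shows "step_index (codegen k t) x = (if step_index t x \<le> k then step_index t x else step_index t x - 1)"
proof (rule step_index_eqI)
  define j where "j = step_index t x"
  note b = step_index_bounds[OF assms(1,3,4), folded j_def]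
  have pos: "0 \<le> t i" for i
    using assms(1) by (simp add: standard_simplex_iff)
  show "0 \<le> codegen k t i" for i
    using codegen_in_simplex[OF assms(1,2)] by (simp add: standard_simplex_iff)
  have "(\<Sum>l<Suc j. t l) \<le> (\<Sum>l<Suc (Suc j). t l)" "(\<Sum>l<j - 1. t l) \<le> (\<Sum>l<j. t l)"
    by (rule partial_sum_mono; use pos in simp)+
  moreover have "Suc (j - 1) = j" if "\<not> j \<le> k"
    using that by simp
  ultimately show "(\<Sum>l<if step_index t x \<le> k then step_index t x else step_index t x - 1. codegen k t l) \<le> x"
    "x < (\<Sum>l<Suc (if step_index t x \<le> k then step_index t x else step_index t x - 1). codegen k t l)"
    unfolding partial_sum_codegen j_def[symmetric]
    using b by (auto simp del: sum.lessThan_Suc One_nat_def simp: not_le le_Suc_eq)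
qed

definition step_fun :: "nat \<times> (nat \<Rightarrow> real) \<times> (nat \<Rightarrow> 'g) \<Rightarrow> real \<Rightarrow> 'g" where
  "step_fun = (\<lambda>(n, t, a). \<lambda>x\<in>{0..<1}. a (step_index t x))"

lemma step_fun_EG_rel: "(u, w) \<in> EG_rel T \<Longrightarrow> step_fun u = step_fun w"
  unfolding EG_rel_def realization_rel_def step_fun_def
  by (auto intro!: restrict_ext simp: step_index_face step_index_codegen delete_at_def repeat_at_def)

lemma openin_finite_Ball:
  assumes "finite K" "\<And>i. i \<in> K \<Longrightarrow> openin X {x \<in> topspace X. P i x}"
  shows "openin X {x \<in> topspace X. \<forall>i\<in>K. P i x}"
  using assms
proof (induction K rule: finite_induct)
  case (insert i K)
  have "{x \<in> topspace X. \<forall>j\<in>insert i K. P j x} = {x \<in> topspace X. P i x} \<inter> {x \<in> topspace X. \<forall>j\<in>K. P j x}"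
    by auto
  then show ?case using insert by (simp add: openin_Int)
qed simp

text \<open>The set is a disjoint union of intervals, one for each index in \<open>K\<close>, cut
  off at \<open>e\<close>. Writing the cut with \<open>min\<close> at the end points makes the
  measure visibly continuous in \<open>t\<close> for fixed \<open>K\<close>, as
  \<open>openin_EG_mass\<close> requires.\<close>

lemma measure_step_index:
  assumes t: "t \<in> standard_simplex n" and K: "K \<subseteq> {..n}" and e: "0 \<le> e" "e \<le> 1"
  defines "A \<equiv> {x \<in> {0..<e}. step_index t x \<in> K}"
  shows "A \<in> fmeasurable lborel"
    and "measure lborel A = (\<Sum>i\<in>K. min e (\<Sum>l<Suc i. t l) - min e (\<Sum>l<i. t l))"
proof -
  define F where "F = (\<lambda>i. \<Sum>l<i. t l)"
  define I where "I = (\<lambda>i. {min e (F i)..<min e (F (Suc i))})"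
  have pos: "0 \<le> t i" for i
    using t by (simp add: standard_simplex_iff)
  have mono: "F i \<le> F j" if "i \<le> j" for i j
    unfolding F_def by (rule partial_sum_mono) (use pos that in auto)
  have F0: "0 \<le> F i" for i
    unfolding F_def by (rule sum_nonneg) (use pos in auto)
  have idx: "step_index t x = i \<longleftrightarrow> F i \<le> x \<and> x < F (Suc i)" if "x \<in> {0..<e}" for x i
    using step_index_bounds[OF t, of x] step_index_eqI[of t i x] that pos e
    unfolding F_def by (metis atLeastLessThan_iff less_le_trans)
  have A: "A = (\<Union>i\<in>K. I i)"
  proof (intro equalityI subsetI)
    fix x assume "x \<in> A"
    then have "x \<in> I (step_index t x)" "step_index t x \<in> K"
      using idx[of x "step_index t x"] by (auto simp: A_def I_def)
    then show "x \<in> (\<Union>i\<in>K. I i)" by blast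
  next
    fix x assume "x \<in> (\<Union>i\<in>K. I i)"
    then obtain i where i: "i \<in> K" "min e (F i) \<le> x" "x < min e (F (Suc i))"
      unfolding I_def by auto
    moreover have "F i \<le> x" "x < e"
      using i(2,3) unfolding min_def by (simp_all split: if_splits)
    ultimately have "F i \<le> x" "x \<in> {0..<e}" "x < F (Suc i)"
      using F0[of i] by simp_all
    with i(1) idx[of x i] show "x \<in> A" by (auto simp: A_def)
  qed
  have fin: "finite K" using K finite_subset by blast
  have le: "min e (F i) \<le> min e (F (Suc i))" for i
    using mono[of i "Suc i"] by (simp add: min_le_iff_disj)
  show "A \<in> fmeasurable lborel"
    unfolding A I_def using fin le by (intro fmeasurable.finite_UN) (simp_all add: fmeasurable_def)
  have "disjoint_family_on I K"
    unfolding disjoint_family_on_def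
  proof (intro ballI impI)
    fix i j assume "i \<in> K" "j \<in> K" "i \<noteq> j"
    then consider "Suc i \<le> j" | "Suc j \<le> i" by linarith
    then show "I i \<inter> I j = {}"
      using mono[of "Suc i" j] mono[of "Suc j" i] by cases (auto simp: I_def)
  qed
  then have "measure lborel A = (\<Sum>i\<in>K. measure lborel (I i))"
    unfolding A using fin le by (intro measure_finite_Union) (simp_all add: I_def image_subset_iff)
  also have "\<dots> = (\<Sum>i\<in>K. min e (F (Suc i)) - min e (F i))"
    using le by (simp add: I_def)
  finally show "measure lborel A = (\<Sum>i\<in>K. min e (\<Sum>l<Suc i. t l) - min e (\<Sum>l<i. t l))"
    unfolding F_def .
qed

context topological_group
begin

abbreviation EG_points where "EG_points \<equiv> level_sum (EG_levels T)"

lemma topspace_EG_levels: "topspace (EG_levels T n) = Pi\<^sub>E {..n} (\<lambda>_. carrier G)"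
  by (simp add: EG_levels_def topspace_carrier)

lemma EG_rel_cases:
  assumes "(u, w) \<in> EG_rel T"
  obtains (face) n k t a where "u = (Suc n, simplical_face k t, a)" "w = (n, t, delete_at k a)"
      "k \<le> Suc n" "t \<in> standard_simplex n" "a \<in> topspace (EG_levels T (Suc n))"
  | (degen) n k t a where "u = (n, codegen k t, a)" "w = (Suc n, t, repeat_at k a)"
      "k \<le> n" "t \<in> standard_simplex (Suc n)" "a \<in> topspace (EG_levels T n)"
  using assms unfolding EG_rel_def realization_rel_def by blast

lemma delete_at_in_levels: "a \<in> topspace (EG_levels T (Suc n)) \<Longrightarrow> k \<le> Suc n \<Longrightarrow> delete_at k a \<in> topspace (EG_levels T n)"
  by (auto simp: topspace_EG_levels delete_at_def PiE_iff extensional_def)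

lemma repeat_at_in_levels: "a \<in> topspace (EG_levels T n) \<Longrightarrow> k \<le> n \<Longrightarrow> repeat_at k a \<in> topspace (EG_levels T (Suc n))"
  by (auto simp: topspace_EG_levels repeat_at_def PiE_iff extensional_def)

lemma EG_class_face:
  assumes "t \<in> standard_simplex n" "k \<le> Suc n" "a \<in> topspace (EG_levels T (Suc n))"
  shows "EG_class T (Suc n, simplical_face k t, a) = EG_class T (n, t, delete_at k a)"
  unfolding EG_class_def
proof (rule glue_class_eqI)
  show "((Suc n, simplical_face k t, a), (n, t, delete_at k a)) \<in> EG_rel T"
    unfolding EG_rel_def realization_rel_def using assms by blast
qed (use assms in \<open>auto simp: topspace_level_sum face_in_simplex delete_at_in_levels\<close>)

lemma EG_class_degen:
  assumes "t \<in> standard_simplex (Suc n)" "k \<le> n" "a \<in> topspace (EG_levels T n)"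
  shows "EG_class T (n, codegen k t, a) = EG_class T (Suc n, t, repeat_at k a)"
  unfolding EG_class_def
proof (rule glue_class_eqI)
  show "((n, codegen k t, a), (Suc n, t, repeat_at k a)) \<in> EG_rel T"
    unfolding EG_rel_def realization_rel_def using assms by blast
qed (use assms in \<open>auto simp: topspace_level_sum codegen_in_simplex repeat_at_in_levels\<close>)

lemma topspace_EG: "topspace (EG T) = EG_class T ` topspace EG_points"
  by (simp add: EG_def EG_class_def[abs_def] topspace_glue)

lemma EG_class_in_topspace: "u \<in> topspace EG_points \<Longrightarrow> EG_class T u \<in> topspace (EG T)"
  by (simp add: topspace_EG)

lemma quotient_map_EG: "quotient_map EG_points (EG T) (EG_class T)"
  unfolding EG_def EG_class_def[abs_def] by (rule quotient_map_glue)

definition EG_val :: "(nat \<times> (nat \<Rightarrow> real) \<times> (nat \<Rightarrow> 'g)) set \<Rightarrow> real \<Rightarrow> 'g" where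
  "EG_val = lift step_fun"

lemma EG_val_class: "u \<in> topspace EG_points \<Longrightarrow> EG_val (EG_class T u) = step_fun u"
  unfolding EG_val_def EG_class_def by (rule lift_glue_class) (auto intro: step_fun_EG_rel)

lemma restrict_mult_in_levels:
  "a \<in> topspace (EG_levels T n) \<Longrightarrow> g \<in> carrier G \<Longrightarrow> (\<lambda>j\<in>{..n}. a j \<otimes> g) \<in> topspace (EG_levels T n)"
  by (auto simp: topspace_EG_levels)

lemma EG_act_class:
  assumes "(n, t, a) \<in> topspace EG_points" "g \<in> carrier G"
  shows "EG_act G T (EG_class T (n, t, a)) g = EG_class T (n, t, \<lambda>j\<in>{..n}. a j \<otimes> g)"
proof -
  have c: "EG_class T (n, t, a) = glue_class EG_points (EG_rel T) (n, t, a)"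
    by (simp add: EG_class_def)
  have "EG_act G T (EG_class T (n, t, a)) g = (\<lambda>(p, t, x). EG_class T (p, t, \<lambda>j\<in>{..p}. x j \<otimes> g)) (n, t, a)"
    unfolding EG_act_def c
  proof (rule lift_glue_class[OF assms(1)])
    fix u w assume "(u, w) \<in> EG_rel T"
    then show "(\<lambda>(p, t, x). EG_class T (p, t, \<lambda>j\<in>{..p}. x j \<otimes> g)) u
        = (\<lambda>(p, t, x). EG_class T (p, t, \<lambda>j\<in>{..p}. x j \<otimes> g)) w"
    proof (cases rule: EG_rel_cases)
      case (face n k t a)
      then have "delete_at k (\<lambda>j\<in>{..Suc n}. a j \<otimes> g) = (\<lambda>j\<in>{..n}. delete_at k a j \<otimes> g)"
        by (auto simp: delete_at_def restrict_def)
      with face EG_class_face[of t n k "\<lambda>j\<in>{..Suc n}. a j \<otimes> g"] assms(2) show ?thesis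
        by (simp add: restrict_mult_in_levels del: restrict_apply)
    next
      case (degen n k t a)
      then have "repeat_at k (\<lambda>j\<in>{..n}. a j \<otimes> g) = (\<lambda>j\<in>{..Suc n}. repeat_at k a j \<otimes> g)"
        by (intro ext) (auto simp: repeat_at_def restrict_def)
      with degen EG_class_degen[of t n k "\<lambda>j\<in>{..n}. a j \<otimes> g"] assms(2) show ?thesis
        by (simp add: restrict_mult_in_levels del: restrict_apply)
    qed
  qed
  then show ?thesis by simp
qed

lemma EG_cases:
  assumes "e \<in> topspace (EG T)"
  obtains n t a where "e = EG_class T (n, t, a)" "(n, t, a) \<in> topspace EG_points"
    "t \<in> standard_simplex n" "a \<in> topspace (EG_levels T n)"
proof -
  obtain u where "u \<in> topspace EG_points" "e = EG_class T u"
    using assms unfolding topspace_EG by blast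
  then show thesis using that by (cases u) (auto simp: topspace_level_sum)
qed

lemma EG_act_closed: "e \<in> topspace (EG T) \<Longrightarrow> g \<in> carrier G \<Longrightarrow> EG_act G T e g \<in> topspace (EG T)"
  by (erule EG_cases)
    (simp add: EG_act_class, intro EG_class_in_topspace, simp add: topspace_level_sum restrict_mult_in_levels)

lemma EG_act_one: "e \<in> topspace (EG T) \<Longrightarrow> EG_act G T e \<one> = e"
proof (erule EG_cases)
  fix n t a assume a: "e = EG_class T (n, t, a)" "(n, t, a) \<in> topspace EG_points" "a \<in> topspace (EG_levels T n)"
  then have "(\<lambda>j\<in>{..n}. a j \<otimes> \<one>) = a"
    by (intro extensionalityI[of _ "{..n}"]) (auto simp: topspace_EG_levels PiE_iff)
  with a show "EG_act G T e \<one> = e" by (simp add: EG_act_class)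
qed

lemma EG_act_mult:
  assumes "e \<in> topspace (EG T)" and gh: "g \<in> carrier G" "h \<in> carrier G"
  shows "EG_act G T (EG_act G T e g) h = EG_act G T e (g \<otimes> h)"
  using assms(1)
proof (rule EG_cases)
  fix n t a assume a: "e = EG_class T (n, t, a)" "(n, t, a) \<in> topspace EG_points" "a \<in> topspace (EG_levels T n)"
  have "(\<lambda>j\<in>{..n}. (\<lambda>j\<in>{..n}. a j \<otimes> g) j \<otimes> h) = (\<lambda>j\<in>{..n}. a j \<otimes> (g \<otimes> h))"
    using a gh by (intro restrict_ext) (auto simp: topspace_EG_levels PiE_iff m_assoc)
  moreover have "(n, t, \<lambda>j\<in>{..n}. a j \<otimes> g) \<in> topspace EG_points"
    using a gh by (simp add: topspace_level_sum restrict_mult_in_levels)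
  ultimately show ?thesis
    using a gh by (simp add: EG_act_class)
qed

lemma EG_val_act:
  assumes "e \<in> topspace (EG T)" "g \<in> carrier G" "0 \<le> x" "x < 1"
  shows "EG_val (EG_act G T e g) x = EG_val e x \<otimes> g"
  using assms(1)
proof (rule EG_cases)
  fix n t a assume a: "e = EG_class T (n, t, a)" "(n, t, a) \<in> topspace EG_points" "t \<in> standard_simplex n"
     "a \<in> topspace (EG_levels T n)"
  have "(n, t, \<lambda>j\<in>{..n}. a j \<otimes> g) \<in> topspace EG_points"
    using a assms by (simp add: topspace_level_sum restrict_mult_in_levels)
  with a assms step_index_bounds(3)[OF a(3) assms(3,4)] show ?thesis
    by (simp add: EG_act_class EG_val_class step_fun_def)
qed

lemma EG_val_closed:
  assumes "e \<in> topspace (EG T)" "0 \<le> x" "x < 1"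
  shows "EG_val e x \<in> carrier G"
  using assms(1)
proof (rule EG_cases)
  fix n t a assume a: "e = EG_class T (n, t, a)" "(n, t, a) \<in> topspace EG_points" "t \<in> standard_simplex n"
     "a \<in> topspace (EG_levels T n)"
  with assms step_index_bounds(3)[OF a(3) assms(2,3)] show ?thesis
    by (auto simp: EG_val_class step_fun_def topspace_EG_levels)
qed

lemma EG_act_continuous: "continuous_map (prod_topology (EG T) T) (EG T) (\<lambda>(e, g). EG_act G T e g)"
proof -
  have "continuous_map (prod_topology EG_points T) (EG T) (\<lambda>((n, t, a), g). EG_class T (n, t, \<lambda>j\<in>{..n}. a j \<otimes> g))"
  proof (rule continuous_map_from_level_sum_prod)
    fix n
    let ?P = "prod_topology (prod_topology (std_simplex n) (EG_levels T n)) T"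
    have "continuous_map ?P (EG_levels T n) (\<lambda>((t, a), g). \<lambda>j\<in>{..n}. a j \<otimes> g)"
      unfolding EG_levels_def continuous_map_componentwise
    proof (intro conjI ballI)
      fix j assume j: "j \<in> {..n}"
      have "continuous_map (EG_levels T n) T (\<lambda>a. a j)"
        unfolding EG_levels_def by (rule continuous_map_product_projection[OF j])
      then have "continuous_map ?P T (\<lambda>u. snd (fst u) j)"
        using continuous_map_compose[OF continuous_map_compose[OF continuous_map_fst continuous_map_snd]]
        by (simp add: comp_def)
      then have "continuous_map ?P T (\<lambda>u. snd (fst u) j \<otimes> snd u)"
        by (intro continuous_map_mult continuous_map_snd)
      then show "continuous_map (prod_topology (prod_topology (std_simplex n) (product_topology (\<lambda>_. T) {..n})) T) T
          (\<lambda>x. (case x of (x, g) \<Rightarrow> (case x of (t, a) \<Rightarrow> \<lambda>g. \<lambda>j\<in>{..n}. a j \<otimes> g) g) j)"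
        using j by (simp add: case_prod_unfold EG_levels_def)
    qed auto
    then have "continuous_map ?P (prod_topology (std_simplex n) (EG_levels T n)) (\<lambda>u. (fst (fst u), (\<lambda>((t, a), g). \<lambda>j\<in>{..n}. a j \<otimes> g) u))"
      by (intro continuous_map_pairedI continuous_map_compose[OF continuous_map_fst continuous_map_fst, unfolded comp_def])
    from continuous_map_compose[OF continuous_map_compose[OF this continuous_map_level[of n "EG_levels T"]] quotient_imp_continuous_map[OF quotient_map_EG]]
    show "continuous_map ?P (EG T) (\<lambda>(u, b). (\<lambda>((n, t, a), g). EG_class T (n, t, \<lambda>j\<in>{..n}. a j \<otimes> g)) ((n, u), b))"
      by (simp add: comp_def case_prod_unfold)
  qed
  then have "continuous_map (prod_topology EG_points T) (EG T) ((\<lambda>(e, g). EG_act G T e g) \<circ> (\<lambda>(u, g). (EG_class T u, g)))"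
    by (rule continuous_map_eq) (auto simp: EG_act_class topspace_carrier)
  then show ?thesis
    using continuous_compose_quotient_map[OF quotient_map_prod_left[OF locally_compact_T _ quotient_map_EG]] Hausdorff_T
    by blast
qed

text \<open>The orbits of a group action already form an equivalence relation, so closing up
  \<open>BG_rel\<close> identifies nothing further: a step backwards is undone by the inverse group
  element.\<close>

lemma BG_class_eq_iff:
  assumes "e \<in> topspace (EG T)" "f \<in> topspace (EG T)"
  shows "BG_class G T e = BG_class G T f \<longleftrightarrow> (\<exists>g\<in>carrier G. f = EG_act G T e g)"
proof
  assume "BG_class G T e = BG_class G T f"
  then have "equivclp (\<lambda>a b. (a, b) \<in> BG_rel G T) e f"
    using assms by (simp add: BG_class_def glue_class_eq_iff)
  then show "\<exists>g\<in>carrier G. f = EG_act G T e g"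
  proof (induction rule: equivclp_induct)
    case base
    show ?case using EG_act_one[OF assms(1)] by (intro bexI[of _ \<one>]) auto
  next
    case (step y z)
    then obtain g where g: "g \<in> carrier G" "y = EG_act G T e g" by blast
    from step(2) consider h where "h \<in> carrier G" "z = EG_act G T y h"
      | h where "h \<in> carrier G" "z \<in> topspace (EG T)" "y = EG_act G T z h"
      unfolding BG_rel_def by blast
    then show ?case
    proof cases
      case 1
      then show ?thesis using g assms by (intro bexI[of _ "g \<otimes> h"]) (auto simp: EG_act_mult)
    next
      case 2
      then have "EG_act G T y (inv h) = z"
        by (simp add: EG_act_mult EG_act_one)
      then show ?thesis using g 2 assms by (intro bexI[of _ "g \<otimes> inv h"]) (auto simp: EG_act_mult)
    qed
  qed
next
  assume "\<exists>g\<in>carrier G. f = EG_act G T e g"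
  then have "(e, f) \<in> BG_rel G T" using assms by (auto simp: BG_rel_def)
  then show "BG_class G T e = BG_class G T f"
    unfolding BG_class_def using assms by (rule glue_class_eqI)
qed

text \<open>The value of \<open>EG_val\<close> at a given point may jump when an interval shrinks to
  length zero. The length of time spent in an open set varies lower semicontinuously and serves as a
  substitute; the cut at \<epsilon> localizes near the initial value.\<close>

definition EG_mass :: "'g set \<Rightarrow> real \<Rightarrow> (nat \<times> (nat \<Rightarrow> real) \<times> (nat \<Rightarrow> 'g)) set \<Rightarrow> real" where
  "EG_mass U \<epsilon> e = measure lborel {x \<in> {0..<\<epsilon>}. EG_val e x \<in> U}"

lemma EG_mass_class:
  assumes "(n, t, a) \<in> topspace EG_points" "0 \<le> \<epsilon>" "\<epsilon> \<le> 1"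
  shows "{x \<in> {0..<\<epsilon>}. EG_val (EG_class T (n, t, a)) x \<in> U} \<in> fmeasurable lborel"
    "EG_mass U \<epsilon> (EG_class T (n, t, a)) = (\<Sum>i | i \<le> n \<and> a i \<in> U. min \<epsilon> (\<Sum>l<Suc i. t l) - min \<epsilon> (\<Sum>l<i. t l))"
proof -
  have t: "t \<in> standard_simplex n" using assms by (simp add: topspace_level_sum)
  have "{x \<in> {0..<\<epsilon>}. EG_val (EG_class T (n, t, a)) x \<in> U}
      = {x \<in> {0..<\<epsilon>}. step_index t x \<in> {i. i \<le> n \<and> a i \<in> U}}"
    using assms step_index_bounds(3)[OF t] by (auto simp: EG_val_class step_fun_def)
  then show "{x \<in> {0..<\<epsilon>}. EG_val (EG_class T (n, t, a)) x \<in> U} \<in> fmeasurable lborel"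
    "EG_mass U \<epsilon> (EG_class T (n, t, a)) = (\<Sum>i | i \<le> n \<and> a i \<in> U. min \<epsilon> (\<Sum>l<Suc i. t l) - min \<epsilon> (\<Sum>l<i. t l))"
    using measure_step_index[OF t _ assms(2,3), of "{i. i \<le> n \<and> a i \<in> U}"] by (auto simp: EG_mass_def)
qed

lemma fmeasurable_EG_val:
  assumes "e \<in> topspace (EG T)" "0 \<le> \<epsilon>" "\<epsilon> \<le> 1"
  shows "{x \<in> {0..<\<epsilon>}. EG_val e x \<in> U} \<in> fmeasurable lborel"
  using assms(1) by (rule EG_cases) (simp only: EG_mass_class(1)[OF _ assms(2,3)])

text \<open>Fix the set \<open>K\<close> of indices whose value lies in \<open>U\<close> at a given
  point. Nearby, these indices keep their values in \<open>U\<close> and other indices can only add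
  mass. So the mass is bounded below by the sum over the fixed \<open>K\<close>, which is continuous
  in \<open>t\<close>.\<close>

lemma openin_EG_mass:
  assumes U: "openin T U" and e: "0 \<le> \<epsilon>" "\<epsilon> \<le> 1"
  shows "openin (EG T) {e \<in> topspace (EG T). c < EG_mass U \<epsilon> e}"
proof -
  let ?Q = "{u \<in> topspace EG_points. EG_class T u \<in> {e \<in> topspace (EG T). c < EG_mass U \<epsilon> e}}"
  have "openin EG_points ?Q"
  proof (rule openin_open_pieces[where K = UNIV and i = Pair, OF open_map_level])
    fix n
    let ?P = "prod_topology (std_simplex n) (EG_levels T n)"
    define m where "m = (\<lambda>K (t :: nat \<Rightarrow> real). \<Sum>i\<in>K. min \<epsilon> (\<Sum>l<Suc i. t l) - min \<epsilon> (\<Sum>l<i. t l))"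
    have Q: "{x \<in> topspace ?P. (n, x) \<in> ?Q} = {(t, a) \<in> topspace ?P. c < m {i. i \<le> n \<and> a i \<in> U} t}"
      using EG_mass_class(2)[OF _ e, of n _ _ U]
      by (auto simp: m_def topspace_level_sum EG_class_in_topspace)
    have "\<exists>N. openin ?P N \<and> z \<in> N \<and> N \<subseteq> {(t, a) \<in> topspace ?P. c < m {i. i \<le> n \<and> a i \<in> U} t}"
      if "z \<in> {(t, a) \<in> topspace ?P. c < m {i. i \<le> n \<and> a i \<in> U} t}" for z
    proof -
      define K where "K = {i. i \<le> n \<and> snd z i \<in> U}"
      have fin: "finite K" by (simp add: K_def)
      define N where "N = {y \<in> topspace ?P. m K (fst y) \<in> {c<..}} \<inter> {y \<in> topspace ?P. \<forall>i\<in>K. snd y i \<in> U}"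
      have "continuous_map ?P euclideanreal (\<lambda>y. m K (fst y))"
        unfolding m_def using fin
        by (intro continuous_intros continuous_map_real_min
            continuous_map_compose[OF continuous_map_fst simplex_coordinate, unfolded comp_def]) auto
      then have "openin ?P {y \<in> topspace ?P. m K (fst y) \<in> {c<..}}"
        by (rule openin_continuous_map_preimage) simp
      moreover have "openin ?P {y \<in> topspace ?P. \<forall>i\<in>K. snd y i \<in> U}"
      proof (rule openin_finite_Ball[OF fin])
        fix i assume "i \<in> K"
        then have "continuous_map ?P T (\<lambda>y. snd y i)"
          unfolding EG_levels_def K_def
          by (intro continuous_map_compose[OF continuous_map_snd continuous_map_product_projection, unfolded comp_def]) auto
        then show "openin ?P {y \<in> topspace ?P. snd y i \<in> U}"
          using U by (rule openin_continuous_map_preimage)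
      qed
      ultimately have "openin ?P N" unfolding N_def by (rule openin_Int)
      moreover have "z \<in> N" using that by (auto simp: N_def K_def)
      moreover have "N \<subseteq> {(t, a) \<in> topspace ?P. c < m {i. i \<le> n \<and> a i \<in> U} t}"
      proof
        fix y assume y: "y \<in> N"
        then have t: "fst y \<in> standard_simplex n" by (auto simp: N_def)
        have "m K (fst y) \<le> m {i. i \<le> n \<and> snd y i \<in> U} (fst y)"
          unfolding m_def
        proof (rule sum_mono2)
          show "K \<subseteq> {i. i \<le> n \<and> snd y i \<in> U}" using y by (auto simp: N_def K_def)
          fix i
          have "(\<Sum>l<i. fst y l) \<le> (\<Sum>l<Suc i. fst y l)"
            by (rule partial_sum_mono) (use t in \<open>auto simp: standard_simplex_iff\<close>)
          then show "0 \<le> min \<epsilon> (\<Sum>l<Suc i. fst y l) - min \<epsilon> (\<Sum>l<i. fst y l)"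
            by (simp add: min_def)
        qed simp
        with y show "y \<in> {(t, a) \<in> topspace ?P. c < m {i. i \<le> n \<and> a i \<in> U} t}"
          by (auto simp: N_def case_prod_unfold)
      qed
      ultimately show ?thesis by blast
    qed
    then show "openin ?P {x \<in> topspace ?P. (n, x) \<in> ?Q}"
      unfolding Q by (subst openin_subopen) blast
  qed (auto simp: topspace_level_sum)
  moreover have "{e \<in> topspace (EG T). c < EG_mass U \<epsilon> e} \<subseteq> topspace (EG T)"
    by blast
  ultimately show ?thesis
    using quotient_map_EG[unfolded quotient_map_def, THEN conjunct2, rule_format] by (simp only:)
qed

lemma EG_val_near_0:
  assumes "e \<in> topspace (EG T)"
  obtains \<delta> where "0 < \<delta>" "\<And>x. 0 \<le> x \<Longrightarrow> x < \<delta> \<Longrightarrow> x < 1 \<Longrightarrow> EG_val e x = EG_val e 0"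
  using assms
proof (rule EG_cases)
  fix n t a assume a: "e = EG_class T (n, t, a)" "(n, t, a) \<in> topspace EG_points" "t \<in> standard_simplex n"
  note b = step_index_bounds[OF a(3), of 0, simplified]
  have eq: "step_index t x = step_index t 0" if "0 \<le> x" "x < (\<Sum>l<Suc (step_index t 0). t l)" for x
    by (rule step_index_eqI) (use that b a(3) in \<open>auto simp: standard_simplex_iff\<close>)
  show thesis
  proof (rule that)
    show "0 < (\<Sum>l<Suc (step_index t 0). t l)" using b by simp
    fix x assume x: "0 \<le> x" "x < (\<Sum>l<Suc (step_index t 0). t l)" "x < 1"
    show "EG_val e x = EG_val e 0"
      using a x eq[OF x(1,2)] by (simp add: EG_val_class step_fun_def)
  qed
qed

text \<open>For two points of one fibre every x in [0, 1) gives the same result; 0 is merely a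
  choice. The single values at 0 are in general not continuous on EG, and the continuity proof lives
  on the freedom to move x.\<close>

definition EG_tr where "EG_tr e f = inv EG_val e 0 \<otimes> EG_val f 0"

lemma EG_tr_act: "e \<in> topspace (EG T) \<Longrightarrow> g \<in> carrier G \<Longrightarrow> EG_tr e (EG_act G T e g) = g"
  using EG_val_closed[of e 0] by (simp add: EG_tr_def EG_val_act m_assoc[symmetric])

lemma EG_tr_continuous:
  "continuous_map (subtopology (prod_topology (EG T) (EG T)) {(e, f). BG_class G T e = BG_class G T f}) T (\<lambda>(e, f). EG_tr e f)"
  (is "continuous_map ?X T _")
proof -
  \<comment> \<open>Both values are multiplied by the group element that relates the two points,
    whatever x is.\<close>
  have tr: "EG_tr e f = inv EG_val e x \<otimes> EG_val f x"
    if ef: "e \<in> topspace (EG T)" "f \<in> topspace (EG T)" "BG_class G T e = BG_class G T f" "0 \<le> x" "x < 1" for e f x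
  proof -
    obtain g where g: "g \<in> carrier G" "f = EG_act G T e g"
      using BG_class_eq_iff ef by blast
    then show ?thesis
      using EG_val_closed[of e x] ef by (simp add: EG_tr_act EG_val_act m_assoc[symmetric])
  qed
  show ?thesis
    unfolding continuous_map_def
  proof (intro conjI allI impI)
    show "(\<lambda>(e, f). EG_tr e f) \<in> topspace ?X \<rightarrow> topspace T"
      using EG_val_closed[of _ 0] by (auto simp: EG_tr_def topspace_carrier)
    fix W assume W: "openin T W"
    show "openin ?X {p \<in> topspace ?X. (\<lambda>(e, f). EG_tr e f) p \<in> W}"
    proof (subst openin_subopen, intro ballI)
      fix p assume p: "p \<in> {p \<in> topspace ?X. (\<lambda>(e, f). EG_tr e f) p \<in> W}"
      obtain e f where [simp]: "p = (e, f)" by fastforce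
      have ef: "e \<in> topspace (EG T)" "f \<in> topspace (EG T)" "BG_class G T e = BG_class G T f" "EG_tr e f \<in> W"
        using p by auto
      have "continuous_map (prod_topology T T) T (\<lambda>y. inv (fst y) \<otimes> snd y)"
        by (intro continuous_map_mult continuous_map_inv continuous_map_fst continuous_map_snd)
      then have "openin (prod_topology T T) {y \<in> topspace (prod_topology T T). inv (fst y) \<otimes> snd y \<in> W}"
        using W by (rule openin_continuous_map_preimage)
      moreover have "(EG_val e 0, EG_val f 0) \<in> {y \<in> topspace (prod_topology T T). inv (fst y) \<otimes> snd y \<in> W}"
        using ef EG_val_closed by (simp add: EG_tr_def topspace_carrier)
      ultimately obtain U V where UV: "openin T U" "openin T V" "EG_val e 0 \<in> U" "EG_val f 0 \<in> V"
        "U \<times> V \<subseteq> {y \<in> topspace (prod_topology T T). inv (fst y) \<otimes> snd y \<in> W}"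
        unfolding openin_prod_topology_alt by meson
      obtain \<delta>1 where \<delta>1: "0 < \<delta>1" "\<And>x. 0 \<le> x \<Longrightarrow> x < \<delta>1 \<Longrightarrow> x < 1 \<Longrightarrow> EG_val e x = EG_val e 0"
        using EG_val_near_0[OF ef(1)] by metis
      obtain \<delta>2 where \<delta>2: "0 < \<delta>2" "\<And>x. 0 \<le> x \<Longrightarrow> x < \<delta>2 \<Longrightarrow> x < 1 \<Longrightarrow> EG_val f x = EG_val f 0"
        using EG_val_near_0[OF ef(2)] by metis
      define \<epsilon> where "\<epsilon> = min 1 (min \<delta>1 \<delta>2)"
      have \<epsilon>: "0 < \<epsilon>" "\<epsilon> \<le> 1" "\<epsilon> \<le> \<delta>1" "\<epsilon> \<le> \<delta>2" using \<delta>1(1) \<delta>2(1) by (auto simp: \<epsilon>_def)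
      \<comment> \<open>At \<open>p\<close> both masses are the full \<epsilon>, because \<epsilon>
        is chosen so that both step functions are constant on [0, \<epsilon>). More than half of it
        is what forces the sets \<open>A\<close> and \<open>B\<close> below to overlap.\<close>
      define N where "N = ({e \<in> topspace (EG T). \<epsilon> / 2 < EG_mass U \<epsilon> e} \<times> {e \<in> topspace (EG T). \<epsilon> / 2 < EG_mass V \<epsilon> e})
         \<inter> {(e, f). BG_class G T e = BG_class G T f}"
      have "openin (EG T) {e \<in> topspace (EG T). \<epsilon> / 2 < EG_mass U \<epsilon> e}"
        "openin (EG T) {e \<in> topspace (EG T). \<epsilon> / 2 < EG_mass V \<epsilon> e}"
        by (intro openin_EG_mass UV; use \<epsilon> in simp)+
      then have "openin ?X N"
        unfolding N_def by (intro openin_subtopology_Int) (simp only: openin_prod_Times_iff simp_thms)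
      moreover have "p \<in> N"
      proof -
        have "EG_val e x \<in> U" "EG_val f x \<in> V" if "x \<in> {0..<\<epsilon>}" for x
          using \<delta>1(2)[of x] \<delta>2(2)[of x] UV(3,4) \<epsilon> that by simp_all
        then have "{x \<in> {0..<\<epsilon>}. EG_val e x \<in> U} = {0..<\<epsilon>}" "{x \<in> {0..<\<epsilon>}. EG_val f x \<in> V} = {0..<\<epsilon>}"
          by blast+
        then show ?thesis using ef \<epsilon> by (simp add: N_def EG_mass_def)
      qed
      moreover have "N \<subseteq> {p \<in> topspace ?X. (\<lambda>(e, f). EG_tr e f) p \<in> W}"
      proof
        fix q assume q: "q \<in> N"
        obtain e' f' where [simp]: "q = (e', f')" by fastforce
        have ef': "e' \<in> topspace (EG T)" "f' \<in> topspace (EG T)" "BG_class G T e' = BG_class G T f'"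
          "\<epsilon> / 2 < EG_mass U \<epsilon> e'" "\<epsilon> / 2 < EG_mass V \<epsilon> f'"
          using q by (auto simp: N_def)
        define A where "A = {x \<in> {0..<\<epsilon>}. EG_val e' x \<in> U}"
        define B where "B = {x \<in> {0..<\<epsilon>}. EG_val f' x \<in> V}"
        have meas: "A \<in> fmeasurable lborel" "B \<in> fmeasurable lborel"
          unfolding A_def B_def using ef'(1,2) \<epsilon> by (simp_all only: fmeasurable_EG_val less_imp_le)
        have "A \<inter> B \<noteq> {}"
        proof
          assume "A \<inter> B = {}"
          with meas have "measure lborel (A \<union> B) = measure lborel A + measure lborel B"
            by (intro measure_Union) (auto simp: fmeasurable_def)
          moreover have "measure lborel (A \<union> B) \<le> measure lborel {0..<\<epsilon>}"
            using meas \<epsilon>(1) by (intro measure_mono_fmeasurable) (auto simp: A_def B_def fmeasurable_def)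
          ultimately show False
            using ef'(4,5) \<epsilon> by (simp add: EG_mass_def A_def B_def)
        qed
        then obtain x where x: "x \<in> A" "x \<in> B" by blast
        then have "0 \<le> x" "x < 1" "(EG_val e' x, EG_val f' x) \<in> U \<times> V"
          using \<epsilon> by (auto simp: A_def B_def)
        then have "EG_tr e' f' \<in> W"
          using UV(5) tr[OF ef'(1-3), of x] by auto
        with ef' show "q \<in> {p \<in> topspace ?X. (\<lambda>(e, f). EG_tr e f) p \<in> W}" by simp
      qed
      ultimately show "\<exists>N. openin ?X N \<and> p \<in> N \<and> N \<subseteq> {p \<in> topspace ?X. (\<lambda>(e, f). EG_tr e f) p \<in> W}"
        by blast
    qed
  qed
qed

lemma principal_space_EG: "principal_space G T (EG T) (EG_act G T) (BG_class G T) EG_tr"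
proof unfold_locales
  fix e g assume "e \<in> topspace (EG T)" "g \<in> carrier G"
  then show "BG_class G T (EG_act G T e g) = BG_class G T e"
    using BG_class_eq_iff[of e "EG_act G T e g"] EG_act_closed by auto
next
  fix e f assume "e \<in> topspace (EG T)" "f \<in> topspace (EG T)" "BG_class G T e = BG_class G T f"
  then show "\<exists>g\<in>carrier G. f = EG_act G T e g"
    using BG_class_eq_iff by blast
qed (simp_all add: EG_act_one EG_act_mult EG_act_continuous EG_tr_act EG_tr_continuous)

end

section \<open>The associated bundle\<close>

lemma open_map_discrete_slice_left:
  assumes "d \<in> D"
  shows "open_map B (prod_topology (discrete_topology D) B) (\<lambda>b. (d, b))"
  unfolding open_map_def
proof (intro allI impI)
  fix U assume "openin B U"
  moreover have "(\<lambda>b. (d, b)) ` U = {d} \<times> U"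
    by auto
  ultimately show "openin (prod_topology (discrete_topology D) B) ((\<lambda>b. (d, b)) ` U)"
    using assms by (simp add: openin_prod_Times_iff)
qed

context transition_functions
begin

abbreviation F_points where "F_points \<equiv> level_sum (assoc_levels T S)"
abbreviation F_space where "F_space \<equiv> total (assoc_bundle G T S v)"
abbreviation F_act where "F_act \<equiv> action (assoc_bundle G T S v)"
abbreviation F_pr where "F_pr \<equiv> projection (assoc_bundle G T S v)"
abbreviation F_class where "F_class \<equiv> assoc_class G T S v"

lemma topspace_F_points:
  "(n, t, \<sigma>, g) \<in> topspace F_points \<longleftrightarrow> t \<in> standard_simplex n \<and> \<sigma> \<in> ssimp S n \<and> g \<in> carrier G"
  by (auto simp: topspace_level_sum assoc_levels_def topspace_carrier)

lemma sset_class_face: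
  assumes "\<sigma> \<in> ssimp S (Suc n)" "t \<in> standard_simplex n" "k \<le> Suc n"
  shows "sset_class S (Suc n, simplical_face k t, \<sigma>) = sset_class S (n, t, sface S (Suc n) k \<sigma>)"
  unfolding sset_class_def
proof (rule glue_class_eqI)
  show "((Suc n, simplical_face k t, \<sigma>), (n, t, sface S (Suc n) k \<sigma>))
      \<in> realization_rel (sset_levels S) (sface S) (sdegen S)"
    unfolding realization_rel_def using assms by (auto simp: sset_levels_def)
qed (use assms in \<open>auto simp: topspace_level_sum face_in_simplex sset_levels_def face_in\<close>)

lemma sset_class_degen:
  assumes "\<sigma> \<in> ssimp S n" "t \<in> standard_simplex (Suc n)" "k \<le> n"
  shows "sset_class S (n, codegen k t, \<sigma>) = sset_class S (Suc n, t, sdegen S n k \<sigma>)"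
  unfolding sset_class_def
proof (rule glue_class_eqI)
  show "((n, codegen k t, \<sigma>), (Suc n, t, sdegen S n k \<sigma>))
      \<in> realization_rel (sset_levels S) (sface S) (sdegen S)"
    unfolding realization_rel_def using assms by (auto simp: sset_levels_def)
qed (use assms in \<open>auto simp: topspace_level_sum codegen_in_simplex sset_levels_def degen_in\<close>)

abbreviation transition where
  "transition n k \<sigma> t \<equiv> (if k \<le> n then \<one> else v (Suc n) \<sigma> t)"

lemma transition_closed:
  "\<sigma> \<in> ssimp S (Suc n) \<Longrightarrow> t \<in> standard_simplex n \<Longrightarrow> transition n k \<sigma> t \<in> carrier G"
  by (simp add: v_closed)

lemma assoc_rel_cases:
  assumes "(u, w) \<in> assoc_rel G S v"
  obtains (face) n k t \<sigma> g where "u = (n, t, sface S (Suc n) k \<sigma>, g)"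
      "w = (Suc n, simplical_face k t, \<sigma>, transition n k \<sigma> t \<otimes> g)"
      "k \<le> Suc n" "t \<in> standard_simplex n" "\<sigma> \<in> ssimp S (Suc n)" "g \<in> carrier G"
  | (degen) n k t \<sigma> g where "u = (Suc n, t, sdegen S n k \<sigma>, g)" "w = (n, codegen k t, \<sigma>, g)"
      "k \<le> n" "t \<in> standard_simplex (Suc n)" "\<sigma> \<in> ssimp S n" "g \<in> carrier G"
  using assms unfolding assoc_rel_def by blast

lemma F_class_face:
  assumes "\<sigma> \<in> ssimp S (Suc n)" "t \<in> standard_simplex n" "k \<le> Suc n" "g \<in> carrier G"
  shows "F_class (n, t, sface S (Suc n) k \<sigma>, g) = F_class (Suc n, simplical_face k t, \<sigma>, transition n k \<sigma> t \<otimes> g)"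
  unfolding assoc_class_def
proof (rule glue_class_eqI)
  show "((n, t, sface S (Suc n) k \<sigma>, g), (Suc n, simplical_face k t, \<sigma>, transition n k \<sigma> t \<otimes> g)) \<in> assoc_rel G S v"
    unfolding assoc_rel_def using assms by blast
qed (use assms transition_closed[OF assms(1,2), of k] in \<open>simp_all add: topspace_F_points face_in_simplex face_in\<close>)

lemma F_class_degen:
  assumes "\<sigma> \<in> ssimp S n" "t \<in> standard_simplex (Suc n)" "k \<le> n" "g \<in> carrier G"
  shows "F_class (Suc n, t, sdegen S n k \<sigma>, g) = F_class (n, codegen k t, \<sigma>, g)"
  unfolding assoc_class_def
proof (rule glue_class_eqI)
  show "((Suc n, t, sdegen S n k \<sigma>, g), (n, codegen k t, \<sigma>, g)) \<in> assoc_rel G S v"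
    unfolding assoc_rel_def using assms by blast
qed (use assms in \<open>simp_all add: topspace_F_points codegen_in_simplex degen_in\<close>)

lemma quotient_map_F: "quotient_map F_points F_space F_class"
  unfolding assoc_bundle_def assoc_class_def[abs_def] by (simp add: quotient_map_glue)

lemma topspace_F: "topspace F_space = F_class ` topspace F_points"
  by (simp add: assoc_bundle_def assoc_class_def[abs_def] topspace_glue)

lemma F_class_in_topspace: "u \<in> topspace F_points \<Longrightarrow> F_class u \<in> topspace F_space"
  by (simp add: topspace_F)

lemma F_cases:
  assumes "x \<in> topspace F_space"
  obtains n t \<sigma> g where "x = F_class (n, t, \<sigma>, g)" "t \<in> standard_simplex n" "\<sigma> \<in> ssimp S n" "g \<in> carrier G"
proof -
  obtain u where "u \<in> topspace F_points" "x = F_class u"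
    using assms unfolding topspace_F by blast
  then show thesis using that by (cases u) (auto simp: topspace_F_points)
qed

lemma F_pr_class:
  assumes "t \<in> standard_simplex n" "\<sigma> \<in> ssimp S n" "g \<in> carrier G"
  shows "F_pr (F_class (n, t, \<sigma>, g)) = sset_class S (n, t, \<sigma>)"
proof -
  have "lift (\<lambda>(n, t, \<sigma>, g). sset_class S (n, t, \<sigma>)) (glue_class F_points (assoc_rel G S v) (n, t, \<sigma>, g))
      = (\<lambda>(n, t, \<sigma>, g). sset_class S (n, t, \<sigma>)) (n, t, \<sigma>, g)"
  proof (rule lift_glue_class)
    fix u w assume "(u, w) \<in> assoc_rel G S v"
    then show "(\<lambda>(n, t, \<sigma>, g). sset_class S (n, t, \<sigma>)) u = (\<lambda>(n, t, \<sigma>, g). sset_class S (n, t, \<sigma>)) w"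
      by (cases rule: assoc_rel_cases) (simp_all add: sset_class_face sset_class_degen)
  qed (simp add: topspace_F_points assms)
  then show ?thesis by (simp add: assoc_bundle_def assoc_class_def)
qed

lemma F_act_class:
  assumes "t \<in> standard_simplex n" "\<sigma> \<in> ssimp S n" "g \<in> carrier G" "h \<in> carrier G"
  shows "F_act (F_class (n, t, \<sigma>, g)) h = F_class (n, t, \<sigma>, g \<otimes> h)"
proof -
  have "lift (\<lambda>(n, t, \<sigma>, g). F_class (n, t, \<sigma>, g \<otimes> h)) (glue_class F_points (assoc_rel G S v) (n, t, \<sigma>, g))
      = (\<lambda>(n, t, \<sigma>, g). F_class (n, t, \<sigma>, g \<otimes> h)) (n, t, \<sigma>, g)"
  proof (rule lift_glue_class)
    fix u w assume "(u, w) \<in> assoc_rel G S v"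
    then show "(\<lambda>(n, t, \<sigma>, g). F_class (n, t, \<sigma>, g \<otimes> h)) u = (\<lambda>(n, t, \<sigma>, g). F_class (n, t, \<sigma>, g \<otimes> h)) w"
    proof (cases rule: assoc_rel_cases)
      case (face n k t \<sigma> g)
      then show ?thesis
        using assms(4) F_class_face[of \<sigma> n t k "g \<otimes> h"] transition_closed[of \<sigma> n t k] by (simp add: m_assoc split del: if_split)
    qed (use assms(4) in \<open>simp add: F_class_degen\<close>)
  qed (simp add: topspace_F_points assms)
  then show ?thesis by (simp add: assoc_bundle_def assoc_class_def)
qed

lemma F_act_continuous: "continuous_map (prod_topology F_space T) F_space (\<lambda>(x, g). F_act x g)"
proof -
  have "continuous_map (prod_topology F_points T) F_space (\<lambda>((n, t, \<sigma>, g), h). F_class (n, t, \<sigma>, g \<otimes> h))"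
  proof (rule continuous_map_from_level_sum_prod)
    fix n
    let ?P = "prod_topology (prod_topology (std_simplex n) (assoc_levels T S n)) T"
    have "continuous_map ?P (prod_topology (std_simplex n) (assoc_levels T S n))
        (\<lambda>u. (fst (fst u), fst (snd (fst u)), snd (snd (fst u)) \<otimes> snd u))"
      unfolding assoc_levels_def
      by (intro continuous_map_pairedI continuous_map_mult)
        (intro continuous_map_compose[OF continuous_map_fst continuous_map_fst, unfolded comp_def]
          continuous_map_compose[OF continuous_map_compose[OF continuous_map_fst continuous_map_snd] continuous_map_fst, unfolded comp_def]
          continuous_map_compose[OF continuous_map_compose[OF continuous_map_fst continuous_map_snd] continuous_map_snd, unfolded comp_def]
          continuous_map_snd)+
    from continuous_map_compose[OF continuous_map_compose[OF this continuous_map_level[of n "assoc_levels T S"]] quotient_imp_continuous_map[OF quotient_map_F]]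
    show "continuous_map ?P F_space (\<lambda>(u, b). (\<lambda>((n, t, \<sigma>, g), h). F_class (n, t, \<sigma>, g \<otimes> h)) ((n, u), b))"
      by (simp add: comp_def case_prod_unfold)
  qed
  then have "continuous_map (prod_topology F_points T) F_space ((\<lambda>(e, g). F_act e g) \<circ> (\<lambda>(u, g). (F_class u, g)))"
    by (rule continuous_map_eq) (auto simp: F_act_class topspace_F_points topspace_carrier)
  then show ?thesis
    using continuous_compose_quotient_map[OF quotient_map_prod_left[OF locally_compact_T _ quotient_map_F]] Hausdorff_T
    by blast
qed

text \<open>Each elementary identification in the realization of \<open>S\<close> lifts to
  \<open>F\<close> at the price of multiplying the group coordinate by a transition or its inverse.
  Hence the points of \<open>F\<close> over one point form a single orbit, which is what
  \<open>F_pr_eqD\<close> extracts.\<close>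

lemma F_class_transport:
  assumes "equivclp (\<lambda>a b. (a, b) \<in> realization_rel (sset_levels S) (sface S) (sdegen S)) (n, t, \<sigma>) (n', t', \<sigma>')"
    and "g \<in> carrier G"
  shows "\<exists>g'\<in>carrier G. F_class (n, t, \<sigma>, g) = F_class (n', t', \<sigma>', g')"
proof -
  define c where "c = (\<lambda>((n, t, \<sigma>), g). F_class (n, t, \<sigma>, g))"
  have "\<exists>g'\<in>carrier G. c (u, g) = c (w, g')" if "equivclp (\<lambda>a b. (a, b) \<in> realization_rel (sset_levels S) (sface S) (sdegen S)) u w" for u w
    using that
  proof (induction rule: equivclp_induct)
    case base
    then show ?case using assms(2) by blast
  next
    case (step y z)
    then obtain g1 where g1: "g1 \<in> carrier G" "c (u, g) = c (y, g1)" by blast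
    from step(2) consider
        n k t \<sigma> where "k \<le> Suc n" "t \<in> standard_simplex n" "\<sigma> \<in> ssimp S (Suc n)"
          "y = (Suc n, simplical_face k t, \<sigma>)" "z = (n, t, sface S (Suc n) k \<sigma>)"
      | n k t \<sigma> where "k \<le> Suc n" "t \<in> standard_simplex n" "\<sigma> \<in> ssimp S (Suc n)"
          "z = (Suc n, simplical_face k t, \<sigma>)" "y = (n, t, sface S (Suc n) k \<sigma>)"
      | n k t \<sigma> where "k \<le> n" "t \<in> standard_simplex (Suc n)" "\<sigma> \<in> ssimp S n"
          "{y, z} = {(n, codegen k t, \<sigma>), (Suc n, t, sdegen S n k \<sigma>)}"
      unfolding realization_rel_def by (auto simp: sset_levels_def) blast+
    then have "\<exists>g'\<in>carrier G. c (y, g1) = c (z, g')"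
    proof cases
      case (1 n k t \<sigma>)
      note k = transition_closed[OF 1(3,2), of k]
      have "F_class (n, t, sface S (Suc n) k \<sigma>, inv transition n k \<sigma> t \<otimes> g1) = F_class (Suc n, simplical_face k t, \<sigma>, g1)"
        using F_class_face[OF 1(3,2,1), of "inv transition n k \<sigma> t \<otimes> g1"] k g1
        by (simp add: m_assoc[symmetric] split del: if_split)
      then show ?thesis
        using k g1 1 by (intro bexI[of _ "inv transition n k \<sigma> t \<otimes> g1"]) (simp_all add: c_def split del: if_split)
    next
      case (2 n k t \<sigma>)
      then show ?thesis
        using F_class_face[OF 2(3,2,1) g1(1)] transition_closed[OF 2(3,2), of k] g1
        by (intro bexI[of _ "transition n k \<sigma> t \<otimes> g1"]) (simp_all add: c_def split del: if_split)
    next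
      case (3 n k t \<sigma>)
      then show ?thesis
        using F_class_degen[OF 3(3,2,1) g1(1)] g1
        by (intro bexI[of _ g1]) (auto simp: c_def doubleton_eq_iff)
    qed
    with g1 show ?case by metis
  qed
  from this[OF assms(1)] show ?thesis by (simp add: c_def)
qed

lemma F_pr_eqD:
  assumes "x \<in> topspace F_space" "y \<in> topspace F_space" "F_pr x = F_pr y"
  shows "\<exists>g\<in>carrier G. y = F_act x g"
proof -
  obtain n t \<sigma> g where x: "x = F_class (n, t, \<sigma>, g)" "t \<in> standard_simplex n" "\<sigma> \<in> ssimp S n" "g \<in> carrier G"
    using F_cases[OF assms(1)] .
  obtain n' t' \<sigma>' g' where y: "y = F_class (n', t', \<sigma>', g')" "t' \<in> standard_simplex n'" "\<sigma>' \<in> ssimp S n'" "g' \<in> carrier G"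
    using F_cases[OF assms(2)] .
  have "sset_class S (n, t, \<sigma>) = sset_class S (n', t', \<sigma>')"
    using assms(3) x y by (simp add: F_pr_class)
  then have "equivclp (\<lambda>a b. (a, b) \<in> realization_rel (sset_levels S) (sface S) (sdegen S)) (n, t, \<sigma>) (n', t', \<sigma>')"
    unfolding sset_class_def using x y by (subst (asm) glue_class_eq_iff) (auto simp: topspace_level_sum sset_levels_def)
  from F_class_transport[OF this x(4)] obtain h where h: "h \<in> carrier G" "x = F_class (n', t', \<sigma>', h)"
    using x by blast
  then show ?thesis
    using y by (intro bexI[of _ "inv h \<otimes> g'"]) (simp_all add: F_act_class m_assoc[symmetric])
qed

lemma F_act_one: "x \<in> topspace F_space \<Longrightarrow> F_act x \<one> = x"
  by (erule F_cases) (simp add: F_act_class)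

lemma F_act_mult: "x \<in> topspace F_space \<Longrightarrow> g \<in> carrier G \<Longrightarrow> h \<in> carrier G \<Longrightarrow> F_act (F_act x g) h = F_act x (g \<otimes> h)"
  by (erule F_cases) (simp add: F_act_class m_assoc)

lemma F_pr_act: "x \<in> topspace F_space \<Longrightarrow> g \<in> carrier G \<Longrightarrow> F_pr (F_act x g) = F_pr x"
  by (erule F_cases) (simp add: F_act_class F_pr_class)

text \<open>The i-th coordinate is the coordinate of the point of \<open>F\<close> in the
  trivialization at the vertex \<open>i\<close>. This is the classical equivariant map into EG
  obtained from a family of trivializations, with the barycentric coordinates as partition of
  unity.\<close>

definition F_to_EG :: "(nat \<times> (nat \<Rightarrow> real) \<times> 's \<times> 'g) set \<Rightarrow> (nat \<times> (nat \<Rightarrow> real) \<times> (nat \<Rightarrow> 'g)) set" where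
  "F_to_EG = lift (\<lambda>(n, t, \<sigma>, g). EG_class T (n, t, \<lambda>i\<in>{..n}. W i n \<sigma> t \<otimes> g))"

lemma W_mult_in_levels:
  assumes "t \<in> standard_simplex n" "\<sigma> \<in> ssimp S n" "g \<in> carrier G"
  shows "(\<lambda>i\<in>{..n}. W i n \<sigma> t \<otimes> g) \<in> topspace (EG_levels T n)"
  using assms by (auto simp: topspace_EG_levels)

text \<open>\<open>W_face\<close> and \<open>W_degen\<close> say that the trivialization at a vertex
  does not notice faces and degeneracies. So all that happens to the list of coordinates is that one
  is dropped or repeated, and this is the relation defining EG.\<close>

lemma F_to_EG_rel:
  assumes "(u, w) \<in> assoc_rel G S v"
  shows "(\<lambda>(n, t, \<sigma>, g). EG_class T (n, t, \<lambda>i\<in>{..n}. W i n \<sigma> t \<otimes> g)) u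
    = (\<lambda>(n, t, \<sigma>, g). EG_class T (n, t, \<lambda>i\<in>{..n}. W i n \<sigma> t \<otimes> g)) w"
  using assms
proof (cases rule: assoc_rel_cases)
  case (face n k t \<sigma> g)
  let ?g = "transition n k \<sigma> t \<otimes> g"
  note tr = transition_closed[OF face(5,4), of k]
  have f: "simplical_face k t \<in> standard_simplex (Suc n)"
    using face by (simp add: face_in_simplex)
  have "delete_at k (\<lambda>i\<in>{..Suc n}. W i (Suc n) \<sigma> (simplical_face k t) \<otimes> ?g)
      = (\<lambda>i\<in>{..n}. W i n (sface S (Suc n) k \<sigma>) t \<otimes> g)" (is "?l = ?r")
  proof
    fix i
    define j where "j = (if i < k then i else Suc i)"
    show "?l i = ?r i"
    proof (cases "i \<le> n")
      case True
      then have j: "j \<le> Suc n" "j \<noteq> k" "(if j < k then j else j - 1) = i"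
        using face by (auto simp: j_def)
      have "W i n (sface S (Suc n) k \<sigma>) t = W j (Suc n) \<sigma> (simplical_face k t) \<otimes> transition n k \<sigma> t"
        using W_face[OF face(5,4,3) j(1,2)] j(3) by simp
      moreover have "W j (Suc n) \<sigma> (simplical_face k t) \<in> carrier G"
        using face f j by (intro W_closed)
      ultimately have "W i n (sface S (Suc n) k \<sigma>) t \<otimes> g = W j (Suc n) \<sigma> (simplical_face k t) \<otimes> ?g"
        using tr face by (simp add: m_assoc split del: if_split)
      with True show ?thesis by (simp add: delete_at_def j_def split: if_splits del: W.simps)
    qed (use face in \<open>auto simp: delete_at_def\<close>)
  qed
  then show ?thesis
    using face tr f EG_class_face[of t n k "\<lambda>i\<in>{..Suc n}. W i (Suc n) \<sigma> (simplical_face k t) \<otimes> ?g"]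
    by (simp add: W_mult_in_levels del: W.simps restrict_apply split del: if_split)
next
  case (degen n k t \<sigma> g)
  have "repeat_at k (\<lambda>i\<in>{..n}. W i n \<sigma> (codegen k t) \<otimes> g) = (\<lambda>i\<in>{..Suc n}. W i (Suc n) (sdegen S n k \<sigma>) t \<otimes> g)"
  proof
    fix i
    show "repeat_at k (\<lambda>i\<in>{..n}. W i n \<sigma> (codegen k t) \<otimes> g) i = (\<lambda>i\<in>{..Suc n}. W i (Suc n) (sdegen S n k \<sigma>) t \<otimes> g) i"
      using degen W_degen[OF degen(5,4,3), of i] by (cases "i \<le> Suc n") (auto simp: repeat_at_def simp del: W.simps)
  qed
  then show ?thesis
    using degen EG_class_degen[of t n k "\<lambda>i\<in>{..n}. W i n \<sigma> (codegen k t) \<otimes> g"]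
    by (simp add: W_mult_in_levels codegen_in_simplex del: W.simps restrict_apply)
qed

lemma F_to_EG_class:
  assumes "t \<in> standard_simplex n" "\<sigma> \<in> ssimp S n" "g \<in> carrier G"
  shows "F_to_EG (F_class (n, t, \<sigma>, g)) = EG_class T (n, t, \<lambda>i\<in>{..n}. W i n \<sigma> t \<otimes> g)"
  unfolding F_to_EG_def assoc_class_def
  by (subst lift_glue_class[OF _ F_to_EG_rel]) (auto simp: topspace_F_points assms)

lemma F_to_EG_continuous: "continuous_map F_space (EG T) F_to_EG"
proof -
  have "continuous_map F_points (EG T) (\<lambda>(n, t, \<sigma>, g). EG_class T (n, t, \<lambda>i\<in>{..n}. W i n \<sigma> t \<otimes> g))"
  proof (rule continuous_map_from_level_sum)
    fix n
    show "continuous_map (prod_topology (std_simplex n) (assoc_levels T S n)) (EG T)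
        (\<lambda>u. case (n, u) of (n, t, \<sigma>, g) \<Rightarrow> EG_class T (n, t, \<lambda>i\<in>{..n}. W i n \<sigma> t \<otimes> g))"
      unfolding assoc_levels_def
    proof (rule continuous_map_open_pieces[where K = "ssimp S n" and i = "\<lambda>\<sigma> (t, g). (t, \<sigma>, g)", OF open_map_id_prod[OF open_map_discrete_slice_left]])
      fix \<sigma> assume \<sigma>: "\<sigma> \<in> ssimp S n"
      let ?P = "prod_topology (std_simplex n) T"
      have "continuous_map ?P (EG_levels T n) (\<lambda>u. \<lambda>i\<in>{..n}. W i n \<sigma> (fst u) \<otimes> snd u)"
        unfolding EG_levels_def continuous_map_componentwise
      proof (intro conjI ballI)
        fix i assume i: "i \<in> {..n}"
        then have "continuous_map ?P T (\<lambda>u. W i n \<sigma> (fst u) \<otimes> snd u)"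
          using \<sigma> by (intro continuous_map_mult continuous_map_snd
              continuous_map_compose[OF continuous_map_fst W_continuous, unfolded comp_def]) auto
        then show "continuous_map ?P T (\<lambda>x. (\<lambda>i\<in>{..n}. W i n \<sigma> (fst x) \<otimes> snd x) i)"
          using i by simp
      qed auto
      then have "continuous_map ?P (prod_topology (std_simplex n) (EG_levels T n)) (\<lambda>u. (fst u, \<lambda>i\<in>{..n}. W i n \<sigma> (fst u) \<otimes> snd u))"
        by (intro continuous_map_pairedI continuous_map_fst)
      from continuous_map_compose[OF continuous_map_compose[OF this continuous_map_level[of n "EG_levels T"]] quotient_imp_continuous_map[OF quotient_map_EG]]
      show "continuous_map ?P (EG T) (\<lambda>a. case (n, case a of (t, g) \<Rightarrow> (t, \<sigma>, g)) of (n, t, \<sigma>, g) \<Rightarrow> EG_class T (n, t, \<lambda>i\<in>{..n}. W i n \<sigma> t \<otimes> g))"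
        by (simp add: comp_def case_prod_unfold)
    qed (auto simp: image_iff)
  qed
  then show ?thesis
    unfolding F_to_EG_def assoc_bundle_def using F_to_EG_rel by (simp add: continuous_map_lift)
qed

lemma F_to_EG_act:
  assumes "x \<in> topspace F_space" "g \<in> carrier G"
  shows "F_to_EG (F_act x g) = EG_act G T (F_to_EG x) g"
  using assms(1)
proof (rule F_cases)
  fix n t \<sigma> h assume x: "x = F_class (n, t, \<sigma>, h)" "t \<in> standard_simplex n" "\<sigma> \<in> ssimp S n" "h \<in> carrier G"
  have "(\<lambda>i\<in>{..n}. (\<lambda>i\<in>{..n}. W i n \<sigma> t \<otimes> h) i \<otimes> g) = (\<lambda>i\<in>{..n}. W i n \<sigma> t \<otimes> (h \<otimes> g))"
    using x assms by (intro restrict_ext) (simp add: m_assoc)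
  moreover have "(n, t, \<lambda>i\<in>{..n}. W i n \<sigma> t \<otimes> h) \<in> topspace EG_points"
    using x W_mult_in_levels by (simp add: topspace_level_sum del: restrict_apply)
  ultimately show ?thesis
    using x assms by (simp add: F_act_class F_to_EG_class EG_act_class)
qed

text \<open>Borrowed from EG: if y = x g, then equivariance makes the images of x and y differ by
  the same g.\<close>

definition F_tr where "F_tr x y = EG_tr (F_to_EG x) (F_to_EG y)"

lemma F_to_EG_in: "x \<in> topspace F_space \<Longrightarrow> F_to_EG x \<in> topspace (EG T)"
  using F_to_EG_continuous by (auto simp: continuous_map_def)

lemma principal_space_F: "principal_space G T F_space F_act F_pr F_tr"
proof unfold_locales
  interpret EG: principal_space G T "EG T" "EG_act G T" "BG_class G T" EG_tr
    by (rule principal_space_EG)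
  show "F_tr x (F_act x g) = g" if "x \<in> topspace F_space" "g \<in> carrier G" for x g
    using that by (simp add: F_tr_def F_to_EG_act F_to_EG_in EG_tr_act)
  let ?X = "subtopology (prod_topology F_space F_space) {(x, y). F_pr x = F_pr y}"
  have "continuous_map ?X (prod_topology (EG T) (EG T)) (\<lambda>p. (F_to_EG (fst p), F_to_EG (snd p)))"
    by (intro continuous_map_pairedI continuous_map_from_subtopology
        continuous_map_compose[OF continuous_map_fst F_to_EG_continuous, unfolded comp_def]
        continuous_map_compose[OF continuous_map_snd F_to_EG_continuous, unfolded comp_def])
  moreover have "(F_to_EG (fst p), F_to_EG (snd p)) \<in> {(e, f). BG_class G T e = BG_class G T f}" if "p \<in> topspace ?X" for p
  proof -
    have p: "fst p \<in> topspace F_space" "snd p \<in> topspace F_space" "F_pr (fst p) = F_pr (snd p)"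
      using that by auto
    then obtain g where "g \<in> carrier G" "snd p = F_act (fst p) g"
      using F_pr_eqD[OF p] by blast
    then show ?thesis
      using p by (auto simp: F_to_EG_act F_to_EG_in EG.pr_act)
  qed
  ultimately have "continuous_map ?X (subtopology (prod_topology (EG T) (EG T)) {(e, f). BG_class G T e = BG_class G T f})
      (\<lambda>p. (F_to_EG (fst p), F_to_EG (snd p)))"
    by (auto simp: continuous_map_in_subtopology)
  from continuous_map_compose[OF this EG_tr_continuous]
  show "continuous_map ?X T (\<lambda>(x, y). F_tr x y)"
    by (simp add: comp_def F_tr_def case_prod_unfold)
qed (simp_all add: F_act_one F_act_mult F_act_continuous F_pr_act F_pr_eqD)

text \<open>The point of the fibre at which the trivialization by the vertex \<open>i\<close> reads
  1. The coordinate at \<open>i\<close> is \<open>W\<close> times the coordinate at the last vertex,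
  whence the inverse.\<close>

definition frame :: "nat \<Rightarrow> nat \<Rightarrow> (nat \<Rightarrow> real) \<Rightarrow> 's \<Rightarrow> (nat \<times> (nat \<Rightarrow> real) \<times> 's \<times> 'g) set" where
  "frame i n t \<sigma> = F_class (n, t, \<sigma>, inv W i n \<sigma> t)"

text \<open>The correction factor of \<open>W_face\<close> cancels against the transition in the
  gluing of \<open>F\<close>. In this way a frame at a surviving vertex is independent of the
  simplex used to describe it.\<close>

lemma frame_face:
  assumes "\<sigma> \<in> ssimp S (Suc n)" "t \<in> standard_simplex n" "k \<le> Suc n" "i \<le> Suc n" "i \<noteq> k"
  shows "frame i (Suc n) (simplical_face k t) \<sigma> = frame (if i < k then i else i - 1) n t (sface S (Suc n) k \<sigma>)"
proof -
  let ?W = "W i (Suc n) \<sigma> (simplical_face k t)" and ?g = "transition n k \<sigma> t"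
  have c: "?W \<in> carrier G" "?g \<in> carrier G"
    using assms transition_closed by (auto intro!: W_closed face_in_simplex simp del: W.simps)
  have "frame (if i < k then i else i - 1) n t (sface S (Suc n) k \<sigma>) = F_class (n, t, sface S (Suc n) k \<sigma>, inv (?W \<otimes> ?g))"
    unfolding frame_def by (subst W_face[OF assms]) simp
  also have "\<dots> = F_class (Suc n, simplical_face k t, \<sigma>, ?g \<otimes> inv (?W \<otimes> ?g))"
    using c by (intro F_class_face assms) (simp del: W.simps split del: if_split)
  also have "?g \<otimes> inv (?W \<otimes> ?g) = inv ?W"
    using c by (simp add: inv_mult_group m_assoc[symmetric] del: W.simps split del: if_split)
  finally show ?thesis by (simp add: frame_def)
qed

lemma frame_degen:
  assumes "\<sigma> \<in> ssimp S n" "t \<in> standard_simplex (Suc n)" "k \<le> n" "i \<le> Suc n"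
  shows "frame i (Suc n) t (sdegen S n k \<sigma>) = frame (if i \<le> k then i else i - 1) n (codegen k t) \<sigma>"
  unfolding frame_def W_degen[OF assms]
  by (rule F_class_degen) (use assms codegen_in_simplex in \<open>auto simp del: W.simps\<close>)

end

section \<open>The prismatic star is a prismatic set\<close>

lemma block_start_Suc: "block_start qs (Suc i) = block_start qs i + qs ! i + 2"
  by (simp add: block_start_def)

lemma block_start_0 [simp]: "block_start qs 0 = 0"
  by (simp add: block_start_def)

lemma block_start_mono: "i \<le> j \<Longrightarrow> block_start qs i \<le> block_start qs j"
  unfolding block_start_def by (rule sum_mono2) auto

lemma block_start_less: "i < j \<Longrightarrow> block_start qs i + qs ! i + 2 \<le> block_start qs j"
  using block_start_mono[of "Suc i" j qs] by (simp add: block_start_Suc)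

lemma Suc_star_dim: "qs \<noteq> [] \<Longrightarrow> Suc (star_dim qs) = block_start qs (length qs)"
proof -
  assume "qs \<noteq> []"
  have "block_start qs (length qs) = sum_list qs + 2 * length qs"
    unfolding block_start_def by (simp only: sum.distrib) (simp add: sum_list_sum_nth atLeast0LessThan)
  with \<open>qs \<noteq> []\<close> show ?thesis
    by (cases qs) (simp_all add: star_dim_def)
qed

lemma block_le_star_dim: "i < length qs \<Longrightarrow> block_start qs i + qs ! i + 1 \<le> star_dim qs"
  using Suc_star_dim[of qs] block_start_less[of i "length qs" qs] by fastforce

lemma block_start_update:
  assumes "i < length qs"
  shows "block_start (qs[i := n]) j = (if j \<le> i then block_start qs j else block_start qs j + n - qs ! i)"
proof (induction j)
  case (Suc j)
  have "qs ! i \<le> block_start qs j" if "i < j"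
    using block_start_less[OF that, of qs] by simp
  then show ?case
    using Suc assms by (auto simp: block_start_Suc nth_list_update)
qed simp

lemma star_dim_update:
  assumes "i < length qs"
  shows "star_dim (qs[i := n]) = star_dim qs + n - qs ! i"
  using Suc_star_dim[of "qs[i := n]"] Suc_star_dim[of qs] block_start_update[OF assms, of n "length qs"]
    block_start_less[OF assms] assms by fastforce

lemma length_remove_nth [simp]: "k < length qs \<Longrightarrow> length (remove_nth k qs) = length qs - 1"
  by (simp add: remove_nth_def)

lemma nth_remove_nth: "k < length qs \<Longrightarrow> Suc i < length qs \<Longrightarrow> remove_nth k qs ! i = (if i < k then qs ! i else qs ! Suc i)"
  by (simp add: remove_nth_def nth_append min_def)

lemma remove_nth_nonempty: "2 \<le> length qs \<Longrightarrow> k < length qs \<Longrightarrow> remove_nth k qs \<noteq> []"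
  using length_remove_nth[of k qs] by (metis One_nat_def diff_is_0_eq list.size(3) not_less_eq_eq numeral_2_eq_2)

lemma block_start_remove_nth:
  assumes "k < length qs" "i < length qs"
  shows "block_start (remove_nth k qs) i = (if i \<le> k then block_start qs i else block_start qs (Suc i) - (qs ! k + 2))"
  using assms(2)
proof (induction i)
  case (Suc i)
  have *: "qs ! k + 2 \<le> block_start qs (Suc i)" if "k \<le> i"
    using block_start_less[of k "Suc i" qs] that by simp
  consider "Suc i \<le> k" | "i = k" | "k < i" by linarith
  then show ?case
    using Suc assms(1) * by cases (auto simp: block_start_Suc nth_remove_nth)
qed simp

lemma star_dim_remove_nth:
  assumes "k < length qs" "2 \<le> length qs"
  shows "star_dim qs = star_dim (remove_nth k qs) + (qs ! k + 2)"
proof -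
  obtain p where p: "length qs = Suc (Suc p)"
    using assms(2) by (metis Suc_le_D numeral_2_eq_2 Suc_le_mono)
  have "block_start (remove_nth k qs) (Suc p) + (qs ! k + 2) = block_start qs (Suc (Suc p))"
    using block_start_remove_nth[OF assms(1), of "Suc p"] block_start_less[of k "Suc (Suc p)" qs] assms(1) p
    by (cases "k = Suc p") (auto simp: block_start_Suc)
  moreover have "qs \<noteq> []" using p by auto
  ultimately show ?thesis
    using Suc_star_dim[of qs] Suc_star_dim[OF remove_nth_nonempty[OF assms(2,1)]] assms p by auto
qed

section \<open>Deletion of consecutive vertices\<close>

context simplicial
begin

text \<open>The vertices are deleted from the highest down, so that the indices still to be deleted
  keep their meaning.\<close>

definition del :: "nat \<Rightarrow> nat \<Rightarrow> nat \<Rightarrow> 's \<Rightarrow> 's" where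
  "del n b m x = sfaces S n (rev [b..<b + m]) x"

lemma del_0 [simp]: "del n b 0 x = x"
  by (simp add: del_def)

lemma del_Suc: "del n b (Suc m) x = del (n - 1) b m (sface S n (b + m) x)"
  by (simp add: del_def)

lemma del_in: "x \<in> ssimp S (n + m) \<Longrightarrow> b \<le> Suc n \<Longrightarrow> del (n + m) b m x \<in> ssimp S n"
  by (induction m arbitrary: x) (auto simp: face_in del_Suc)

lemma face_del_less:
  assumes "x \<in> ssimp S (Suc n + m)" "j < b" "b \<le> Suc (Suc n)"
  shows "sface S (Suc n) j (del (Suc n + m) b m x) = del (n + m) (b - 1) m (sface S (Suc n + m) j x)"
  using assms
proof (induction m arbitrary: x)
  case (Suc m)
  then have "sface S (Suc (n + m)) j (sface S (Suc (Suc (n + m))) (b + m) x)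
      = sface S (Suc (n + m)) (b + m - 1) (sface S (Suc (Suc (n + m))) j x)"
    by (intro face_face) auto
  moreover have "b + m - 1 = b - 1 + m" using Suc.prems by simp
  ultimately show ?case
    using Suc.IH[of "sface S (Suc n + Suc m) (b + m) x"] Suc.prems
    by (simp add: face_in del_Suc)
qed simp

lemma face_del_ge:
  assumes "x \<in> ssimp S (Suc n + m)" "b \<le> j" "j \<le> Suc n"
  shows "sface S (Suc n) j (del (Suc n + m) b m x) = del (n + m) b m (sface S (Suc n + m) (j + m) x)"
  using assms
proof (induction m arbitrary: x)
  case (Suc m)
  then have "sface S (Suc (n + m)) (b + m) (sface S (Suc (Suc (n + m))) (Suc (j + m)) x)
      = sface S (Suc (n + m)) (j + m) (sface S (Suc (Suc (n + m))) (b + m) x)"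
    using face_face[of x "n + m" "b + m" "Suc (j + m)"] by simp
  then show ?case
    using Suc.IH[of "sface S (Suc n + Suc m) (b + m) x"] Suc.prems
    by (simp add: face_in del_Suc)
qed simp

text \<open>Whichever vertex of the block goes first, the same block is gone in the end. This
  becomes the identity d_k d^k_j = d_k.\<close>

lemma del_face:
  assumes "x \<in> ssimp S (n + Suc m)" "b \<le> j" "j \<le> b + m" "b \<le> Suc n"
  shows "del (n + m) b m (sface S (n + Suc m) j x) = del (n + Suc m) b (Suc m) x"
  using assms
proof (induction m arbitrary: x)
  case (Suc m)
  show ?case
  proof (cases "j = b + Suc m")
    case False
    then have "sface S (Suc (n + m)) (b + m) (sface S (Suc (Suc (n + m))) j x)
        = sface S (Suc (n + m)) j (sface S (Suc (Suc (n + m))) (b + Suc m) x)"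
      using Suc.prems face_face[of x "n + m" j "b + Suc m"] by simp
    then show ?thesis
      using Suc.IH[of "sface S (n + Suc (Suc m)) (b + Suc m) x"] Suc.prems False
      by (simp add: face_in del_Suc)
  qed (simp add: del_Suc)
qed (simp add: del_Suc)

lemma degen_del_less:
  assumes "x \<in> ssimp S (n + m)" "j < b" "b \<le> Suc n"
  shows "sdegen S n j (del (n + m) b m x) = del (Suc n + m) (Suc b) m (sdegen S (n + m) j x)"
  using assms
proof (induction m arbitrary: x)
  case (Suc m)
  then have "sface S (Suc (Suc (n + m))) (Suc b + m) (sdegen S (Suc (n + m)) j x)
      = sdegen S (n + m) j (sface S (Suc (n + m)) (b + m) x)"
    using face_degen_greater[of x "Suc (n + m)" j "Suc b + m"] by simp
  then show ?case
    using Suc.IH[of "sface S (n + Suc m) (b + m) x"] Suc.prems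
    by (simp add: face_in del_Suc)
qed simp

lemma degen_del_ge:
  assumes "x \<in> ssimp S (n + m)" "b \<le> j" "j \<le> n"
  shows "sdegen S n j (del (n + m) b m x) = del (Suc n + m) b m (sdegen S (n + m) (j + m) x)"
  using assms
proof (induction m arbitrary: x)
  case (Suc m)
  then have "sface S (Suc (Suc (n + m))) (b + m) (sdegen S (Suc (n + m)) (Suc (j + m)) x)
      = sdegen S (n + m) (j + m) (sface S (Suc (n + m)) (b + m) x)"
    using face_degen_less[of x "Suc (n + m)" "b + m" "Suc (j + m)"] by simp
  then show ?case
    using Suc.IH[of "sface S (n + Suc m) (b + m) x"] Suc.prems
    by (simp add: face_in del_Suc)
qed simp

text \<open>The degeneracy makes the block longer by one, and removing the vertex \<open>j\<close>
  first undoes it. This becomes the identity d_k s^k_j = d_k.\<close>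

lemma del_degen:
  assumes "x \<in> ssimp S (n + m)" "b \<le> j" "j < b + m" "b \<le> Suc n" "j \<le> n + m"
  shows "del (n + Suc m) b (Suc m) (sdegen S (n + m) j x) = del (n + m) b m x"
  using del_face[of "sdegen S (n + m) j x" n m b j] assms by (simp add: degen_in face_degen_eq)

lemma del_del:
  assumes "x \<in> ssimp S (n + m1 + m2)" "b1 + m1 \<le> b2" "b2 \<le> Suc (n + m1)"
  shows "del (n + m1) b1 m1 (del (n + m1 + m2) b2 m2 x) = del (n + m2) (b2 - m1) m2 (del (n + m1 + m2) b1 m1 x)"
  using assms
proof (induction m1 arbitrary: x b2)
  case (Suc m1)
  have "del (n + Suc m1) b1 (Suc m1) (del (n + Suc m1 + m2) b2 m2 x)
      = del (n + m1) b1 m1 (sface S (Suc (n + m1)) (b1 + m1) (del (Suc (n + m1) + m2) b2 m2 x))"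
    by (simp add: del_Suc)
  also have "\<dots> = del (n + m1) b1 m1 (del (n + m1 + m2) (b2 - 1) m2 (sface S (Suc (n + m1) + m2) (b1 + m1) x))"
    using Suc.prems by (subst face_del_less) auto
  also have "\<dots> = del (n + m2) (b2 - 1 - m1) m2 (del (n + m1 + m2) b1 m1 (sface S (Suc (n + m1) + m2) (b1 + m1) x))"
    using Suc.prems by (intro Suc.IH) (auto intro: face_in)
  finally show ?case by (simp add: del_Suc)
qed simp

text \<open>Here \<open>n\<close> is the dimension within one block: the operators touch
  \<open>n + 1\<close> consecutive vertices, the simplex has \<open>N\<close> further ones, and
  \<open>b\<close> of these lie in front.\<close>

lemma simplicial_identities_shift:
  assumes "b \<le> N"
  shows "simplicial_identities (\<lambda>n. ssimp S (N + n)) (\<lambda>n j. sface S (N + n) (b + j)) (\<lambda>n j. sdegen S (N + n) (b + j))"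
  unfolding simplicial_identities_def
proof (intro conjI allI ballI impI)
  fix n x i j
  show "sface S (N + Suc n) (b + j) x \<in> ssimp S (N + n)" if "x \<in> ssimp S (N + Suc n)" "j \<le> Suc n"
    using that assms by (simp add: face_in)
  show "sdegen S (N + n) (b + j) x \<in> ssimp S (N + Suc n)" if "x \<in> ssimp S (N + n)" "j \<le> n"
    using that assms by (simp add: degen_in)
  show "sface S (N + Suc n) (b + i) (sface S (N + Suc (Suc n)) (b + j) x)
      = sface S (N + Suc n) (b + (j - 1)) (sface S (N + Suc (Suc n)) (b + i) x)"
    if "x \<in> ssimp S (N + Suc (Suc n))" "i < j \<and> j \<le> Suc (Suc n)"
    using face_face[of x "N + n" "b + i" "b + j"] that assms by simp
  show "sdegen S (N + Suc n) (b + i) (sdegen S (N + n) (b + j) x)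
      = sdegen S (N + Suc n) (b + Suc j) (sdegen S (N + n) (b + i) x)"
    if "x \<in> ssimp S (N + n)" "i \<le> j \<and> j \<le> n"
    using degen_degen[of x "N + n" "b + i" "b + j"] that assms by simp
  show "sface S (N + Suc n) (b + i) (sdegen S (N + n) (b + j) x)
      = sdegen S (N + (n - 1)) (b + (j - 1)) (sface S (N + n) (b + i) x)"
    if "x \<in> ssimp S (N + n)" "i < j \<and> j \<le> n"
    using face_degen_less[of x "N + n" "b + i" "b + j"] that assms by simp
  show "sface S (N + Suc n) (b + j) (sdegen S (N + n) (b + j) x) = x"
    "sface S (N + Suc n) (b + Suc j) (sdegen S (N + n) (b + j) x) = x"
    if "x \<in> ssimp S (N + n)" "j \<le> n"
    using that assms by (simp_all add: face_degen_eq face_degen_Suc)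
  show "sface S (N + Suc n) (b + i) (sdegen S (N + n) (b + j) x)
      = sdegen S (N + (n - 1)) (b + j) (sface S (N + n) (b + (i - 1)) x)"
    if "x \<in> ssimp S (N + n)" "Suc j < i \<and> i \<le> Suc n"
    using face_degen_greater[of x "N + n" "b + j" "b + i"] that assms by simp
qed

lemma cells_star: "x \<in> cells (prism_star S) qs \<longleftrightarrow> qs \<noteq> [] \<and> x \<in> ssimp S (star_dim qs)"
  by (simp add: prism_star_def)

lemma dface_star: "dface (prism_star S) qs i j = sface S (star_dim qs) (block_start qs i + j)"
  and ddegen_star: "ddegen (prism_star S) qs i j = sdegen S (star_dim qs) (block_start qs i + j)"
  and bface_star: "bface (prism_star S) qs k = del (star_dim qs) (block_start qs k) (qs ! k + 2)"
  by (simp_all add: prism_star_def fun_eq_iff del_def ac_simps)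

lemma multisimplicial_star: "multisimplicial (prism_star S)"
  unfolding multisimplicial_def
proof (intro conjI allI ballI impI)
  fix qs :: "nat list" and i assume i: "i < length qs"
  define N where "N = star_dim (qs[i := 0])"
  have N: "star_dim (qs[i := n]) = N + n" for n
    using star_dim_update[OF i] block_le_star_dim[OF i] by (simp add: N_def)
  have b: "block_start (qs[i := n]) i = block_start qs i" for n
    using i by (simp add: block_start_update)
  have "block_start qs i \<le> N"
    using block_le_star_dim[of i "qs[i := 0]"] i by (simp add: N_def b)
  moreover have "qs \<noteq> []" using i by auto
  ultimately show "simplicial_identities (\<lambda>n. cells (prism_star S) (qs[i := n]))
      (\<lambda>n j. dface (prism_star S) (qs[i := n]) i j) (\<lambda>n j. ddegen (prism_star S) (qs[i := n]) i j)"
    using simplicial_identities_shift by (simp add: prism_star_def N b)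
next
  fix qs :: "nat list" and x i i' j j'
  assume x: "x \<in> cells (prism_star S) qs" and i: "i < length qs" "i' < length qs" "i \<noteq> i'"
    and j: "j \<le> qs ! i" "j' \<le> qs ! i'"
  let ?N = "star_dim qs" and ?b = "block_start qs i" and ?b' = "block_start qs i'"
  have x': "x \<in> ssimp S ?N" using x by (simp add: cells_star)
  have le: "?b + qs ! i + 1 \<le> ?N" "?b' + qs ! i' + 1 \<le> ?N"
    using i block_le_star_dim by auto
  obtain M where M: "?N = Suc M" using le by (cases ?N) auto
  have up: "star_dim (up qs l) = Suc ?N" if "l < length qs" for l
    using that block_le_star_dim[OF that] by (simp add: star_dim_update)
  have down: "star_dim (down qs l) = M" if "l < length qs" "1 \<le> qs ! l" for l
    using that block_le_star_dim[OF that(1)] M by (simp add: star_dim_update)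
  \<comment> \<open>The extra vertex at the end of each block keeps indices from different blocks at
    least two apart. This excludes the cases in which a face cancels a degeneracy.\<close>
  have order: "i < i' \<and> ?b + qs ! i + 2 \<le> ?b' \<or> i' < i \<and> ?b' + qs ! i' + 2 \<le> ?b"
    using i(3) block_start_less[of i i' qs] block_start_less[of i' i qs] by linarith
  note start = block_start_update[OF i(1)] block_start_update[OF i(2)]
  show "dface (prism_star S) (down qs i') i j (dface (prism_star S) qs i' j' x)
      = dface (prism_star S) (down qs i) i' j' (dface (prism_star S) qs i j x)" if q: "1 \<le> qs ! i \<and> 1 \<le> qs ! i'"
  proof -
    obtain M' where M': "M = Suc M'" using le q M by (cases M) auto
    have *: "x \<in> ssimp S (Suc (Suc M'))" using x' M M' by simp
    from order show ?thesis
      using face_face[OF *, of "?b + j" "?b' + j'"] face_face[OF *, of "?b' + j'" "?b + j"] j le i q M'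
      by (elim disjE) (auto simp: dface_star start down[simplified] M)
  qed
  show "dface (prism_star S) (up qs i') i j (ddegen (prism_star S) qs i' j' x)
      = ddegen (prism_star S) (down qs i) i' j' (dface (prism_star S) qs i j x)" if q: "1 \<le> qs ! i"
    using order face_degen_less[OF x', of "?b + j" "?b' + j'"] face_degen_greater[OF x', of "?b' + j'" "Suc (?b + j)"] j le i q M
    by (elim disjE) (auto simp: dface_star ddegen_star start down[simplified] up M)
  show "ddegen (prism_star S) (up qs i') i j (ddegen (prism_star S) qs i' j' x)
      = ddegen (prism_star S) (up qs i) i' j' (ddegen (prism_star S) qs i j x)"
    using order degen_degen[OF x', of "?b + j" "?b' + j'"] degen_degen[OF x', of "?b' + j'" "?b + j"] j le i
    by (elim disjE) (auto simp: ddegen_star start up)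
qed

lemma prismatic_set_star: "prismatic_set (prism_star S)"
  unfolding prismatic_set_def
proof (intro conjI allI ballI impI)
  show "multisimplicial (prism_star S)" by (rule multisimplicial_star)
next
  fix qs :: "nat list" and x k
  assume qs: "2 \<le> length qs" and x: "x \<in> cells (prism_star S) qs" and k: "k < length qs"
  show "bface (prism_star S) qs k x \<in> cells (prism_star S) (remove_nth k qs)"
    using x del_in[of x "star_dim (remove_nth k qs)" "qs ! k + 2" "block_start qs k"] block_le_star_dim[OF k]
    by (simp add: cells_star bface_star star_dim_remove_nth[OF k qs] remove_nth_nonempty[OF qs k])
next
  fix qs :: "nat list" and x k l
  assume qs: "3 \<le> length qs" and x: "x \<in> cells (prism_star S) qs" and kl: "k < l \<and> l < length qs"
  have N: "star_dim qs = star_dim (remove_nth l qs) + (qs ! l + 2)" "star_dim qs = star_dim (remove_nth k qs) + (qs ! k + 2)"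
    using star_dim_remove_nth qs kl by auto
  define n where "n = star_dim (remove_nth k (remove_nth l qs))"
  have n: "star_dim (remove_nth l qs) = n + (qs ! k + 2)"
  proof -
    have "k < length (remove_nth l qs)" "2 \<le> length (remove_nth l qs)"
      using qs kl by auto
    from star_dim_remove_nth[OF this] show ?thesis
      using kl by (simp add: n_def nth_remove_nth)
  qed
  have b: "block_start (remove_nth l qs) k = block_start qs k"
    "block_start (remove_nth k qs) (l - 1) = block_start qs l - (qs ! k + 2)"
    using kl by (cases l; cases "k = l - 1"; auto simp: block_start_remove_nth block_start_Suc)+
  have bl: "block_start qs k + (qs ! k + 2) \<le> block_start qs l" "block_start qs l \<le> Suc (n + (qs ! k + 2))"
    using block_start_less[of k l qs] block_le_star_dim[of l qs] kl N n by auto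
  have nth: "remove_nth l qs ! k = qs ! k" "remove_nth k qs ! (l - 1) = qs ! l"
    using kl by (auto simp: nth_remove_nth)
  show "bface (prism_star S) (remove_nth l qs) k (bface (prism_star S) qs l x)
      = bface (prism_star S) (remove_nth k qs) (l - 1) (bface (prism_star S) qs k x)"
    using del_del[of x n "qs ! k + 2" "qs ! l + 2", OF _ bl] x N n
    by (simp only: cells_star bface_star b nth) (simp add: ac_simps)
next
  fix qs :: "nat list" and x k i j
  assume qs: "2 \<le> length qs" and x: "x \<in> cells (prism_star S) qs" and k: "k < length qs" and i: "i < length qs"
    and j: "j \<le> qs ! i"
  define n where "n = star_dim (remove_nth k qs)"
  define m where "m = qs ! k + 2"
  have N: "star_dim qs = n + m"
    using star_dim_remove_nth[OF k qs] by (simp add: n_def m_def)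
  have x': "x \<in> ssimp S (n + m)" using x N by (simp add: cells_star)
  let ?b = "block_start qs i" and ?B = "block_start qs k"
  have le: "?b + qs ! i + 1 \<le> n + m" "?B + m \<le> Suc (n + m)"
    using block_le_star_dim[OF i] block_le_star_dim[OF k] N by (simp_all add: m_def)
  have order: "i < k \<Longrightarrow> ?b + qs ! i + 2 \<le> ?B" "k < i \<Longrightarrow> ?B + m \<le> ?b"
    using block_start_less[of i k qs] block_start_less[of k i qs] by (auto simp: m_def)
  have rem: "block_start (remove_nth k qs) (if i < k then i else i - 1) = (if i < k then ?b else ?b - m)" if "i \<noteq> k"
    using that i k by (cases i; cases "k = i - 1"; auto simp: block_start_remove_nth block_start_Suc m_def)
  note start = block_start_update[OF i]
  show "bface (prism_star S) (down qs i) k (dface (prism_star S) qs i j x)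
      = (if i = k then bface (prism_star S) qs k x
         else dface (prism_star S) (remove_nth k qs) (if i < k then i else i - 1) j (bface (prism_star S) qs k x))" if q: "1 \<le> qs ! i"
  proof -
    have dn: "star_dim (down qs i) = n + m - 1"
      using i q block_le_star_dim[OF i] N by (simp add: star_dim_update)
    consider "i = k" | "i < k" | "k < i" by linarith
    then show ?thesis
    proof cases
      case 1
      then have "del (n + Suc (qs ! k)) ?B (Suc (qs ! k)) (sface S (n + Suc (Suc (qs ! k))) (?B + j) x)
          = del (n + Suc (Suc (qs ! k))) ?B (Suc (Suc (qs ! k))) x"
        using x' j le by (intro del_face) (auto simp: m_def)
      with 1 q dn N i show ?thesis
        by (simp add: bface_star dface_star block_start_update[OF k] m_def)
    next
      case 2
      obtain n' where n': "n = Suc n'" using le order(1)[OF 2] 2 q by (cases n) auto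
      have "sface S (Suc n') (?b + j) (del (Suc n' + m) ?B m x) = del (n' + m) (?B - 1) m (sface S (Suc n' + m) (?b + j) x)"
        using x' n' order(1)[OF 2] j le by (intro face_del_less) auto
      then show ?thesis
        using 2 rem dn n' N q i by (simp add: bface_star dface_star start m_def n_def[symmetric])
    next
      case 3
      obtain n' where n': "n = Suc n'" using le order(2)[OF 3] 3 q by (cases n) auto
      obtain c where c: "?b = c + m" using order(2)[OF 3] by (metis add_leD2 le_Suc_ex add.commute)
      have "sface S (Suc n') (c + j) (del (Suc n' + m) ?B m x) = del (n' + m) ?B m (sface S (Suc n' + m) (c + j + m) x)"
        using x' n' order(2)[OF 3] j le c by (intro face_del_ge) auto
      then show ?thesis
        using 3 rem dn n' N q i c by (simp add: bface_star dface_star start m_def n_def[symmetric] ac_simps)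
    qed
  qed
  show "bface (prism_star S) (up qs i) k (ddegen (prism_star S) qs i j x)
      = (if i = k then bface (prism_star S) qs k x
         else ddegen (prism_star S) (remove_nth k qs) (if i < k then i else i - 1) j (bface (prism_star S) qs k x))"
  proof -
    have dn: "star_dim (up qs i) = Suc (n + m)"
      using i block_le_star_dim[OF i] N by (simp add: star_dim_update)
    consider "i = k" | "i < k" | "k < i" by linarith
    then show ?thesis
    proof cases
      case 1
      then have "del (n + Suc m) ?B (Suc m) (sdegen S (n + m) (?B + j) x) = del (n + m) ?B m x"
        using x' j le by (intro del_degen) (auto simp: m_def)
      with 1 dn N i show ?thesis
        by (simp add: bface_star ddegen_star block_start_update[OF k] m_def)
    next
      case 2
      have "sdegen S n (?b + j) (del (n + m) ?B m x) = del (Suc n + m) (Suc ?B) m (sdegen S (n + m) (?b + j) x)"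
        using x' order(1)[OF 2] j le by (intro degen_del_less) auto
      then show ?thesis
        using 2 rem dn N i by (simp add: bface_star ddegen_star start m_def n_def[symmetric])
    next
      case 3
      obtain c where c: "?b = c + m" using order(2)[OF 3] by (metis add_leD2 le_Suc_ex add.commute)
      have "sdegen S n (c + j) (del (n + m) ?B m x) = del (Suc n + m) ?B m (sdegen S (n + m) (c + j + m) x)"
        using x' order(2)[OF 3] j le c by (intro degen_del_ge) auto
      then show ?thesis
        using 3 rem dn N i c by (simp add: bface_star ddegen_star start m_def n_def[symmetric] ac_simps)
    qed
  qed
qed

end

section \<open>Quotients of prismatic sets\<close>

lemma simplicial_identities_image:
  assumes P: "simplicial_identities C d s"
    and C': "\<And>n. C' n = q n ` C n"
    and d': "\<And>n j x. x \<in> C (Suc n) \<Longrightarrow> j \<le> Suc n \<Longrightarrow> d' (Suc n) j (q (Suc n) x) = q n (d (Suc n) j x)"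
    and s': "\<And>n j x. x \<in> C n \<Longrightarrow> j \<le> n \<Longrightarrow> s' n j (q n x) = q (Suc n) (s n j x)"
  shows "simplicial_identities C' d' s'"
proof -
  have dC: "x \<in> C (Suc n) \<Longrightarrow> j \<le> Suc n \<Longrightarrow> d (Suc n) j x \<in> C n" for n j x
    using P unfolding simplicial_identities_def by metis
  have sC: "x \<in> C n \<Longrightarrow> j \<le> n \<Longrightarrow> s n j x \<in> C (Suc n)" for n j x
    using P unfolding simplicial_identities_def by metis
  note id = P[unfolded simplicial_identities_def, THEN conjunct2, THEN conjunct2]
  show ?thesis
    unfolding simplicial_identities_def C'
  proof (intro conjI allI ballI impI; elim imageE; hypsubst)
    fix n i j x
    show "d' (Suc n) j (q (Suc n) x) \<in> q n ` C n" if "j \<le> Suc n" "x \<in> C (Suc n)"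
      using that by (simp add: d' dC)
    show "s' n j (q n x) \<in> q (Suc n) ` C (Suc n)" if "j \<le> n" "x \<in> C n"
      using that by (simp add: s' sC)
    show "d' (Suc n) i (d' (Suc (Suc n)) j (q (Suc (Suc n)) x)) = d' (Suc n) (j - 1) (d' (Suc (Suc n)) i (q (Suc (Suc n)) x))"
      if "i < j \<and> j \<le> Suc (Suc n)" "x \<in> C (Suc (Suc n))"
    proof -
      have "j - 1 \<le> Suc n" "i \<le> Suc n" "i \<le> Suc (Suc n)" "j \<le> Suc (Suc n)" using that by auto
      then show ?thesis using that id by (simp add: d' dC)
    qed
    show "s' (Suc n) i (s' n j (q n x)) = s' (Suc n) (Suc j) (s' n i (q n x))" if "i \<le> j \<and> j \<le> n" "x \<in> C n"
    proof -
      have "i \<le> n" "i \<le> Suc n" "j \<le> n" "Suc j \<le> Suc n" using that by auto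
      then show ?thesis using that id by (simp add: s' sC)
    qed
    show "d' (Suc n) i (s' n j (q n x)) = s' (n - 1) (j - 1) (d' n i (q n x))" if ij: "i < j \<and> j \<le> n" "x \<in> C n"
    proof -
      obtain m where n: "n = Suc m" using ij by (cases n) auto
      have "i \<le> Suc m" "i \<le> Suc n" "j \<le> n" "j - 1 \<le> m" using that n by auto
      moreover have "d (Suc n) i (s n j x) = s (n - 1) (j - 1) (d n i x)"
        using that id by blast
      ultimately show ?thesis using that n by (simp add: s' d' sC dC)
    qed
    show "d' (Suc n) j (s' n j (q n x)) = q n x" "d' (Suc n) (Suc j) (s' n j (q n x)) = q n x" if "j \<le> n" "x \<in> C n"
      using that id by (simp_all add: s' d' sC)
    show "d' (Suc n) i (s' n j (q n x)) = s' (n - 1) j (d' n (i - 1) (q n x))" if ij: "Suc j < i \<and> i \<le> Suc n" "x \<in> C n"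
    proof -
      obtain m where n: "n = Suc m" using ij by (cases n) auto
      have "i - 1 \<le> Suc m" "i \<le> Suc n" "j \<le> n" "j \<le> m" using that n by auto
      moreover have "d (Suc n) i (s n j x) = s (n - 1) j (d n (i - 1) x)"
        using that id by blast
      ultimately show ?thesis using that n by (simp add: s' d' sC dC)
    qed
  qed
qed

lemma multisimplicial_direction:
  assumes "multisimplicial P" "i < length qs"
  shows "simplicial_identities (\<lambda>n. cells P (qs[i := n])) (\<lambda>n j. dface P (qs[i := n]) i j) (\<lambda>n j. ddegen P (qs[i := n]) i j)"
  using assms(1)[unfolded multisimplicial_def, THEN conjunct1, rule_format, OF assms(2)] .

lemma prismatic_set_dface_in:
  assumes "multisimplicial P" "x \<in> cells P qs" "i < length qs" "1 \<le> qs ! i" "j \<le> qs ! i"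
  shows "dface P qs i j x \<in> cells P (down qs i)"
  using multisimplicial_direction[OF assms(1,3), unfolded simplicial_identities_def, THEN conjunct1,
      rule_format, of x "qs ! i - 1" j] assms by simp

lemma prismatic_set_ddegen_in:
  assumes "multisimplicial P" "x \<in> cells P qs" "i < length qs" "j \<le> qs ! i"
  shows "ddegen P qs i j x \<in> cells P (up qs i)"
  using multisimplicial_direction[OF assms(1,3), unfolded simplicial_identities_def, THEN conjunct2, THEN conjunct1,
      rule_format, of x "qs ! i" j] assms by simp

text \<open>Every cell of \<open>P'\<close> has a preimage and the operators commute with
  \<open>q\<close>, so all identities descend. It is applied with \<open>q\<close> the class map
  from \<open>prism_EG\<close> to \<open>prism_BG\<close>.\<close>

lemma prismatic_set_image:
  assumes P: "prismatic_set P"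
    and cells: "\<And>qs. cells P' qs = q qs ` cells P qs"
    and df: "\<And>qs i j x. x \<in> cells P qs \<Longrightarrow> i < length qs \<Longrightarrow> 1 \<le> qs ! i \<Longrightarrow> j \<le> qs ! i \<Longrightarrow>
      dface P' qs i j (q qs x) = q (down qs i) (dface P qs i j x)"
    and dd: "\<And>qs i j x. x \<in> cells P qs \<Longrightarrow> i < length qs \<Longrightarrow> j \<le> qs ! i \<Longrightarrow>
      ddegen P' qs i j (q qs x) = q (up qs i) (ddegen P qs i j x)"
    and bf: "\<And>qs k x. x \<in> cells P qs \<Longrightarrow> 2 \<le> length qs \<Longrightarrow> k < length qs \<Longrightarrow>
      bface P' qs k (q qs x) = q (remove_nth k qs) (bface P qs k x)"
  shows "prismatic_set P'"
proof -
  note P' = P[unfolded prismatic_set_def]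
  note M = P'[THEN conjunct1]
    and bin = P'[THEN conjunct2, THEN conjunct1, rule_format]
    and bb = P'[THEN conjunct2, THEN conjunct2, THEN conjunct1, rule_format]
    and bd = P'[THEN conjunct2, THEN conjunct2, THEN conjunct2, rule_format, THEN conjunct1, rule_format]
    and bg = P'[THEN conjunct2, THEN conjunct2, THEN conjunct2, rule_format, THEN conjunct2]
  note din = prismatic_set_dface_in[OF M] and gin = prismatic_set_ddegen_in[OF M]
  show ?thesis
    unfolding prismatic_set_def cells
  proof (intro conjI allI impI ballI; (elim imageE)?; (hypsubst)?)
    show "multisimplicial P'"
      unfolding multisimplicial_def cells
    proof (intro conjI allI impI ballI; (elim imageE)?; (hypsubst)?)
      fix qs :: "nat list" and i assume i: "i < length qs"
      show "simplicial_identities (\<lambda>n. q (qs[i := n]) ` cells P (qs[i := n])) (\<lambda>n j. dface P' (qs[i := n]) i j) (\<lambda>n j. ddegen P' (qs[i := n]) i j)"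
      proof (rule simplicial_identities_image[OF multisimplicial_direction[OF M i] refl])
        show "dface P' (qs[i := Suc n]) i j (q (qs[i := Suc n]) x) = q (qs[i := n]) (dface P (qs[i := Suc n]) i j x)"
          if "x \<in> cells P (qs[i := Suc n])" "j \<le> Suc n" for n j x
          using df[OF that(1), of i j] that i by simp
        show "ddegen P' (qs[i := n]) i j (q (qs[i := n]) x) = q (qs[i := Suc n]) (ddegen P (qs[i := n]) i j x)"
          if "x \<in> cells P (qs[i := n])" "j \<le> n" for n j x
          using dd[OF that(1), of i j] that i by simp
      qed
    next
      fix qs :: "nat list" and i i' j j' x
      assume *: "i < length qs" "i' < length qs" "i \<noteq> i'" "j \<le> qs ! i" "j' \<le> qs ! i'" "x \<in> cells P qs"
      note mm = M[unfolded multisimplicial_def, THEN conjunct2, rule_format, OF *(6,1,2,3,4,5)]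
      show "dface P' (down qs i') i j (dface P' qs i' j' (q qs x)) = dface P' (down qs i) i' j' (dface P' qs i j (q qs x))"
        if q: "1 \<le> qs ! i \<and> 1 \<le> qs ! i'"
      proof -
        have "dface P' (down qs i') i j (q (down qs i') (dface P qs i' j' x)) = q (down (down qs i') i) (dface P (down qs i') i j (dface P qs i' j' x))"
          by (rule df) (use * q din in auto)
        moreover have "dface P' (down qs i) i' j' (q (down qs i) (dface P qs i j x)) = q (down (down qs i) i') (dface P (down qs i) i' j' (dface P qs i j x))"
          by (rule df) (use * q din in auto)
        moreover have "down (down qs i') i = down (down qs i) i'"
          using * by (simp add: list_update_swap)
        ultimately show ?thesis using mm q * by (simp add: df)
      qed
      show "dface P' (up qs i') i j (ddegen P' qs i' j' (q qs x)) = ddegen P' (down qs i) i' j' (dface P' qs i j (q qs x))"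
        if q: "1 \<le> qs ! i"
      proof -
        have "dface P' (up qs i') i j (q (up qs i') (ddegen P qs i' j' x)) = q (down (up qs i') i) (dface P (up qs i') i j (ddegen P qs i' j' x))"
          by (rule df) (use * q gin in auto)
        moreover have "ddegen P' (down qs i) i' j' (q (down qs i) (dface P qs i j x)) = q (up (down qs i) i') (ddegen P (down qs i) i' j' (dface P qs i j x))"
          by (rule dd) (use * q din in auto)
        moreover have "down (up qs i') i = up (down qs i) i'"
          using * by (simp add: list_update_swap)
        ultimately show ?thesis using mm q * by (simp add: df dd)
      qed
      show "ddegen P' (up qs i') i j (ddegen P' qs i' j' (q qs x)) = ddegen P' (up qs i) i' j' (ddegen P' qs i j (q qs x))"
      proof -
        have "ddegen P' (up qs i') i j (q (up qs i') (ddegen P qs i' j' x)) = q (up (up qs i') i) (ddegen P (up qs i') i j (ddegen P qs i' j' x))"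
          by (rule dd) (use * gin in auto)
        moreover have "ddegen P' (up qs i) i' j' (q (up qs i) (ddegen P qs i j x)) = q (up (up qs i) i') (ddegen P (up qs i) i' j' (ddegen P qs i j x))"
          by (rule dd) (use * gin in auto)
        moreover have "up (up qs i') i = up (up qs i) i'"
          using * by (simp add: list_update_swap)
        ultimately show ?thesis using mm * by (simp add: dd)
      qed
    qed
  next
    fix qs x k assume "2 \<le> length qs" "k < length qs" "x \<in> cells P qs"
    then show "bface P' qs k (q qs x) \<in> q (remove_nth k qs) ` cells P (remove_nth k qs)"
      by (simp add: bf bin)
  next
    fix qs x k l assume *: "3 \<le> length qs" "k < l \<and> l < length qs" "x \<in> cells P qs"
    have "bface P' (remove_nth l qs) k (q (remove_nth l qs) (bface P qs l x))
        = q (remove_nth k (remove_nth l qs)) (bface P (remove_nth l qs) k (bface P qs l x))"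
      by (rule bf) (use * bin in auto)
    moreover have "bface P' (remove_nth k qs) (l - 1) (q (remove_nth k qs) (bface P qs k x))
        = q (remove_nth (l - 1) (remove_nth k qs)) (bface P (remove_nth k qs) (l - 1) (bface P qs k x))"
      by (rule bf) (use * bin in auto)
    moreover have "remove_nth k (remove_nth l qs) = remove_nth (l - 1) (remove_nth k qs)"
      by (rule nth_equalityI) (use * in \<open>auto simp: nth_remove_nth\<close>)
    ultimately show "bface P' (remove_nth l qs) k (bface P' qs l (q qs x)) = bface P' (remove_nth k qs) (l - 1) (bface P' qs k (q qs x))"
      using * bb[OF *(1,3,2)] by (simp add: bf)
  next
    fix qs x k i j assume *: "2 \<le> length qs" "k < length qs" "i < length qs" "j \<le> qs ! i" "x \<in> cells P qs"
    let ?i = "if i < k then i else i - 1"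
    have i: "?i < length (remove_nth k qs)" "remove_nth k qs ! ?i = qs ! i" if "i \<noteq> k"
      using * that by (auto simp: nth_remove_nth)
    show "bface P' (down qs i) k (dface P' qs i j (q qs x)) =
        (if i = k then bface P' qs k (q qs x) else dface P' (remove_nth k qs) ?i j (bface P' qs k (q qs x)))"
      if q: "1 \<le> qs ! i"
    proof -
      have 1: "bface P' (down qs i) k (q (down qs i) (dface P qs i j x)) = q (remove_nth k (down qs i)) (bface P (down qs i) k (dface P qs i j x))"
        by (rule bf) (use * q din in auto)
      show ?thesis
      proof (cases "i = k")
        case True
        have "remove_nth k (down qs i) = remove_nth k qs"
          using True by (simp add: remove_nth_def)
        with True 1 q * bd[OF *(1,5,2,3,4) q] show ?thesis by (simp add: df bf)
      next
        case False
        have "dface P' (remove_nth k qs) ?i j (q (remove_nth k qs) (bface P qs k x)) = q (down (remove_nth k qs) ?i) (dface P (remove_nth k qs) ?i j (bface P qs k x))"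
          using * q bin i[OF False] by (intro df) (auto simp del: length_remove_nth split del: if_split)
        moreover have "remove_nth k (down qs i) = down (remove_nth k qs) ?i"
          by (rule nth_equalityI) (use * False in \<open>auto simp: nth_remove_nth nth_list_update\<close>)
        ultimately show ?thesis
          using False 1 q * bd[OF *(1,5,2,3,4) q] by (simp add: df bf split del: if_split)
      qed
    qed
    show "bface P' (up qs i) k (ddegen P' qs i j (q qs x)) =
        (if i = k then bface P' qs k (q qs x) else ddegen P' (remove_nth k qs) ?i j (bface P' qs k (q qs x)))"
    proof -
      have 1: "bface P' (up qs i) k (q (up qs i) (ddegen P qs i j x)) = q (remove_nth k (up qs i)) (bface P (up qs i) k (ddegen P qs i j x))"
        by (rule bf) (use * gin in auto)
      show ?thesis
      proof (cases "i = k")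
        case True
        have "remove_nth k (up qs i) = remove_nth k qs"
          using True by (simp add: remove_nth_def)
        with True 1 * bg[OF *(1,5,2,3,4)] show ?thesis by (simp add: dd bf)
      next
        case False
        have "ddegen P' (remove_nth k qs) ?i j (q (remove_nth k qs) (bface P qs k x)) = q (up (remove_nth k qs) ?i) (ddegen P (remove_nth k qs) ?i j (bface P qs k x))"
          using * bin i[OF False] by (intro dd) (auto simp del: length_remove_nth split del: if_split)
        moreover have "remove_nth k (up qs i) = up (remove_nth k qs) ?i"
          by (rule nth_equalityI) (use * False in \<open>auto simp: nth_remove_nth nth_list_update\<close>)
        ultimately show ?thesis
          using False 1 * bg[OF *(1,5,2,3,4)] by (simp add: dd bf split del: if_split)
      qed
    qed
  qed
qed

section \<open>The prismatic classifying space is a prismatic set\<close>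

lemma face_face_simplex: "i < j \<Longrightarrow> simplical_face j (simplical_face i u) = simplical_face i (simplical_face (j - 1) u)"
  by (rule ext) (auto simp: simplical_face_def)

lemma codegen_codegen: "i \<le> j \<Longrightarrow> codegen j (codegen i u) = codegen i (codegen (Suc j) u)"
  by (rule ext) (auto simp: codegen_def add.assoc)

lemma codegen_face_less: "i < j \<Longrightarrow> codegen j (simplical_face i u) = simplical_face i (codegen (j - 1) u)"
  by (rule ext) (auto simp: simplical_face_def codegen_def)

lemma codegen_face_eq: "codegen j (simplical_face j u) = u" "codegen j (simplical_face (Suc j) u) = u"
  by (rule ext, auto simp: simplical_face_def codegen_def)+

lemma codegen_face_greater: "Suc j < i \<Longrightarrow> codegen j (simplical_face i u) = simplical_face (i - 1) (codegen j u)"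
  by (rule ext) (auto simp: simplical_face_def codegen_def)

section \<open>Maps between products of simplices\<close>

definition vertex :: "nat \<Rightarrow> nat \<Rightarrow> real" where
  "vertex q = (\<lambda>n. if n = q then 1 else 0)"

lemma vertex_in_simplex: "q \<le> n \<Longrightarrow> vertex q \<in> standard_simplex n"
  by (simp add: vertex_def)

lemma topspace_multisimplex: "topspace (multisimplex qs) = Pi\<^sub>E {..<length qs} (\<lambda>i. standard_simplex (qs ! i))"
  by (simp add: multisimplex_def)

lemma continuous_map_into_multisimplex:
  "continuous_map X (multisimplex qs) f \<longleftrightarrow>
     f ` topspace X \<subseteq> extensional {..<length qs} \<and> (\<forall>i<length qs. continuous_map X (std_simplex (qs ! i)) (\<lambda>x. f x i))"
  by (auto simp: multisimplex_def continuous_map_componentwise)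

lemma continuous_map_multisimplex_coordinate:
  "i < length qs \<Longrightarrow> continuous_map (multisimplex qs) (std_simplex (qs ! i)) (\<lambda>s. s i)"
  unfolding multisimplex_def by (rule continuous_map_product_projection) simp

lemma face_in_multisimplex:
  assumes "s \<in> topspace (multisimplex (down qs i))" "i < length qs" "1 \<le> qs ! i" "j \<le> qs ! i"
  shows "s(i := simplical_face j (s i)) \<in> topspace (multisimplex qs)"
proof -
  have "s i \<in> standard_simplex (qs ! i - 1)"
    using PiE_mem[OF assms(1)[unfolded topspace_multisimplex], of i] assms by simp
  then have "simplical_face j (s i) \<in> standard_simplex (qs ! i)"
    using assms face_in_simplex[of "s i" "qs ! i - 1" j] by simp
  then show ?thesis
    using assms by (auto simp: topspace_multisimplex PiE_iff extensional_def nth_list_update split: if_splits)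
qed

lemma codegen_in_multisimplex:
  assumes "s \<in> topspace (multisimplex (up qs i))" "i < length qs" "j \<le> qs ! i"
  shows "s(i := codegen j (s i)) \<in> topspace (multisimplex qs)"
proof -
  have "s i \<in> standard_simplex (Suc (qs ! i))"
    using PiE_mem[OF assms(1)[unfolded topspace_multisimplex], of i] assms by simp
  then have "codegen j (s i) \<in> standard_simplex (qs ! i)"
    using assms codegen_in_simplex by blast
  then show ?thesis
    using assms by (auto simp: topspace_multisimplex PiE_iff extensional_def nth_list_update split: if_splits)
qed

lemma insert_at_in_multisimplex:
  assumes s: "s \<in> topspace (multisimplex (remove_nth k qs))" and k: "k < length qs" and u: "u \<in> standard_simplex (qs ! k)"
  shows "insert_at k u s \<in> topspace (multisimplex qs)"
  unfolding topspace_multisimplex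
proof (rule PiE_I)
  fix i assume i: "i \<in> {..<length qs}"
  have s': "s j \<in> standard_simplex (remove_nth k qs ! j)" if "Suc j < length qs" for j
    using s k that by (auto simp: topspace_multisimplex PiE_iff)
  consider "i < k" | "i = k" | j where "i = Suc j" "k \<le> j"
    by (metis Suc_pred less_Suc_eq_le linorder_neqE_nat not_gr0 not_less0)
  then show "insert_at k u s i \<in> standard_simplex (qs ! i)"
    using s'[of i] s'[of "i - 1"] i k u by cases (auto simp: insert_at_def nth_remove_nth)
next
  fix i assume "i \<notin> {..<length qs}"
  then have "i - 1 \<notin> {..<length (remove_nth k qs)}" "k < i" using k by auto
  then show "insert_at k u s i = undefined"
    using s by (auto simp: topspace_multisimplex PiE_iff extensional_def insert_at_def)
qed

lemma delete_at_in_multisimplex: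
  assumes s: "s \<in> topspace (multisimplex qs)" and k: "k < length qs"
  shows "delete_at k s \<in> topspace (multisimplex (remove_nth k qs))"
  using s k by (auto simp: topspace_multisimplex PiE_iff extensional_def delete_at_def nth_remove_nth)

lemma continuous_map_insert_at:
  assumes k: "k < length qs" and u: "u \<in> standard_simplex (qs ! k)"
  shows "continuous_map (multisimplex (remove_nth k qs)) (multisimplex qs) (insert_at k u)"
  unfolding continuous_map_into_multisimplex
proof (intro conjI allI impI)
  show "insert_at k u ` topspace (multisimplex (remove_nth k qs)) \<subseteq> extensional {..<length qs}"
    using insert_at_in_multisimplex[OF _ k u] by (auto simp: topspace_multisimplex PiE_iff)
  fix i assume i: "i < length qs"
  note c = continuous_map_multisimplex_coordinate[of _ "remove_nth k qs"]
  consider "i < k" | "i = k" | j where "i = Suc j" "k \<le> j"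
    by (metis Suc_pred less_Suc_eq_le linorder_neqE_nat not_gr0 not_less0)
  then show "continuous_map (multisimplex (remove_nth k qs)) (std_simplex (qs ! i)) (\<lambda>x. insert_at k u x i)"
    using c[of i] c[of "i - 1"] i k u by cases (auto simp: insert_at_def nth_remove_nth)
qed

lemma continuous_map_update_face:
  assumes "i < length qs" "1 \<le> qs ! i" "j \<le> qs ! i"
  shows "continuous_map (multisimplex (down qs i)) (multisimplex qs) (\<lambda>s. s(i := simplical_face j (s i)))"
  unfolding continuous_map_into_multisimplex
proof (intro conjI allI impI)
  show "(\<lambda>s. s(i := simplical_face j (s i))) ` topspace (multisimplex (down qs i)) \<subseteq> extensional {..<length qs}"
    using face_in_multisimplex[OF _ assms] by (auto simp: topspace_multisimplex PiE_iff)
  fix l assume l: "l < length qs"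
  show "continuous_map (multisimplex (down qs i)) (std_simplex (qs ! l)) (\<lambda>x. (x(i := simplical_face j (x i))) l)"
  proof (cases "l = i")
    case True
    have "continuous_map (multisimplex (down qs i)) (std_simplex (qs ! i - 1)) (\<lambda>x. x i)"
      using continuous_map_multisimplex_coordinate[of i "down qs i"] assms by simp
    from continuous_map_compose[OF this continuous_map_face[of j]] show ?thesis
      using True assms by (simp add: comp_def)
  next
    case False
    then show ?thesis
      using continuous_map_multisimplex_coordinate[of l "down qs i"] l by simp
  qed
qed

lemma continuous_map_update_codegen:
  assumes "i < length qs" "j \<le> qs ! i"
  shows "continuous_map (multisimplex (up qs i)) (multisimplex qs) (\<lambda>s. s(i := codegen j (s i)))"
  unfolding continuous_map_into_multisimplex
proof (intro conjI allI impI)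
  show "(\<lambda>s. s(i := codegen j (s i))) ` topspace (multisimplex (up qs i)) \<subseteq> extensional {..<length qs}"
    using codegen_in_multisimplex[OF _ assms] by (auto simp: topspace_multisimplex PiE_iff)
  fix l assume l: "l < length qs"
  show "continuous_map (multisimplex (up qs i)) (std_simplex (qs ! l)) (\<lambda>x. (x(i := codegen j (x i))) l)"
  proof (cases "l = i")
    case True
    have "continuous_map (multisimplex (up qs i)) (std_simplex (Suc (qs ! i))) (\<lambda>x. x i)"
      using continuous_map_multisimplex_coordinate[of i "up qs i"] assms by simp
    from continuous_map_compose[OF this continuous_map_codegen[of j]] show ?thesis
      using True assms by (simp add: comp_def)
  next
    case False
    then show ?thesis
      using continuous_map_multisimplex_coordinate[of l "up qs i"] l by simp
  qed
qed

section \<open>Cells of \<open>prism_EG\<close> and their operators\<close>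

context topological_group
begin

abbreviation D where "D qs \<equiv> topspace (pdomain qs)"

lemma PEG_cellsD:
  assumes "a \<in> PEG_cells T qs"
  shows "qs \<noteq> []" "a \<in> extensional (D qs)" "continuous_map (pdomain qs) (EG_levels T (length qs - 1)) a"
    and "\<And>t s s' j. t \<in> standard_simplex (length qs - 1) \<Longrightarrow> s \<in> topspace (multisimplex qs) \<Longrightarrow>
      s' \<in> topspace (multisimplex qs) \<Longrightarrow> j < length qs \<Longrightarrow> (\<And>i. i \<le> j \<Longrightarrow> s i = s' i) \<Longrightarrow> a (t, s) j = a (t, s') j"
    and "\<And>t s s' i j. 2 \<le> length qs \<Longrightarrow> t \<in> standard_simplex (length qs - 2) \<Longrightarrow> s \<in> topspace (multisimplex qs) \<Longrightarrow>
      s' \<in> topspace (multisimplex qs) \<Longrightarrow> i < length qs \<Longrightarrow> (\<And>l. l \<noteq> i \<Longrightarrow> s l = s' l) \<Longrightarrow> j < length qs \<Longrightarrow> j \<noteq> i \<Longrightarrow>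
      a (simplical_face i t, s) j = a (simplical_face i t, s') j"
proof -
  note c = assms[unfolded PEG_cells_def mem_Collect_eq]
  note c' = c[THEN conjunct2, THEN conjunct2, THEN conjunct2]
  show "qs \<noteq> []" by (rule c[THEN conjunct1])
  show "a \<in> extensional (D qs)" by (rule c[THEN conjunct2, THEN conjunct1])
  show "continuous_map (pdomain qs) (EG_levels T (length qs - 1)) a"
    by (rule c[THEN conjunct2, THEN conjunct2, THEN conjunct1])
  show "a (t, s) j = a (t, s') j"
    if "t \<in> standard_simplex (length qs - 1)" "s \<in> topspace (multisimplex qs)"
      "s' \<in> topspace (multisimplex qs)" "j < length qs" "\<And>i. i \<le> j \<Longrightarrow> s i = s' i" for t s s' j
    by (rule c'[THEN conjunct1, rule_format]) (fact that)+
  show "a (simplical_face i t, s) j = a (simplical_face i t, s') j"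
    if "2 \<le> length qs" "t \<in> standard_simplex (length qs - 2)" "s \<in> topspace (multisimplex qs)"
      "s' \<in> topspace (multisimplex qs)" "i < length qs" "\<And>l. l \<noteq> i \<Longrightarrow> s l = s' l" "j < length qs" "j \<noteq> i" for t s s' i j
    by (rule c'[THEN conjunct2, rule_format]) (fact that)+
qed

lemma PEG_cellsI:
  assumes "qs \<noteq> []" "a \<in> extensional (D qs)" "continuous_map (pdomain qs) (EG_levels T (length qs - 1)) a"
    and "\<And>t s s' j. t \<in> standard_simplex (length qs - 1) \<Longrightarrow> s \<in> topspace (multisimplex qs) \<Longrightarrow>
      s' \<in> topspace (multisimplex qs) \<Longrightarrow> j < length qs \<Longrightarrow> \<forall>i\<le>j. s i = s' i \<Longrightarrow> a (t, s) j = a (t, s') j"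
    and "\<And>t s s' i j. 2 \<le> length qs \<Longrightarrow> t \<in> standard_simplex (length qs - 2) \<Longrightarrow> s \<in> topspace (multisimplex qs) \<Longrightarrow>
      s' \<in> topspace (multisimplex qs) \<Longrightarrow> i < length qs \<Longrightarrow> \<forall>l. l \<noteq> i \<longrightarrow> s l = s' l \<Longrightarrow> j < length qs \<Longrightarrow> j \<noteq> i \<Longrightarrow>
      a (simplical_face i t, s) j = a (simplical_face i t, s') j"
  shows "a \<in> PEG_cells T qs"
  unfolding PEG_cells_def mem_Collect_eq
  by (intro conjI impI ballI allI; rule assms; assumption?)

lemma cells_EG: "cells (prism_EG T) = PEG_cells T"
  by (simp add: prism_EG_def)

lemma dface_EG: "dface (prism_EG T) qs i j a = (\<lambda>(t, s)\<in>D (down qs i). a (t, s(i := simplical_face j (s i))))"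
  and ddegen_EG: "ddegen (prism_EG T) qs i j a = (\<lambda>(t, s)\<in>D (up qs i). a (t, s(i := codegen j (s i))))"
  and bface_EG: "bface (prism_EG T) qs k a = (\<lambda>(t, s)\<in>D (remove_nth k qs). delete_at k (a (simplical_face k t, insert_at k (vertex 0) s)))"
  by (simp_all add: prism_EG_def vertex_def)

lemma dface_EG_in:
  assumes a: "a \<in> PEG_cells T qs" and i: "i < length qs" "1 \<le> qs ! i" "j \<le> qs ! i"
  shows "dface (prism_EG T) qs i j a \<in> PEG_cells T (down qs i)"
proof (rule PEG_cellsI)
  note mem = face_in_multisimplex[OF _ i]
  show "down qs i \<noteq> []" using PEG_cellsD(1)[OF a] by simp
  show "dface (prism_EG T) qs i j a \<in> extensional (D (down qs i))"
    by (simp add: dface_EG)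
  have "continuous_map (pdomain (down qs i)) (pdomain qs) (\<lambda>x. (fst x, (snd x)(i := simplical_face j (snd x i))))"
    using continuous_map_compose[OF continuous_map_snd continuous_map_update_face[OF i]]
    by (intro continuous_map_pairedI) (simp_all add: comp_def continuous_map_fst)
  from continuous_map_compose[OF this PEG_cellsD(3)[OF a]]
  have c: "continuous_map (pdomain (down qs i)) (EG_levels T (length (down qs i) - 1)) (\<lambda>x. a (fst x, (snd x)(i := simplical_face j (snd x i))))"
    by (simp add: comp_def)
  show "continuous_map (pdomain (down qs i)) (EG_levels T (length (down qs i) - 1)) (dface (prism_EG T) qs i j a)"
    by (rule continuous_map_eq[OF c]) (auto simp: dface_EG)
  fix t s s' l assume *: "s \<in> topspace (multisimplex (down qs i))" "s' \<in> topspace (multisimplex (down qs i))"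
    "l < length (down qs i)"
  show "dface (prism_EG T) qs i j a (t, s) l = dface (prism_EG T) qs i j a (t, s') l"
    if "t \<in> standard_simplex (length (down qs i) - 1)" "\<forall>n\<le>l. s n = s' n"
    using * that mem PEG_cellsD(4)[OF a, of t "s(i := simplical_face j (s i))" "s'(i := simplical_face j (s' i))" l]
    by (simp add: dface_EG)
  show "dface (prism_EG T) qs i j a (simplical_face k t, s) l = dface (prism_EG T) qs i j a (simplical_face k t, s') l"
    if "2 \<le> length (down qs i)" "t \<in> standard_simplex (length (down qs i) - 2)" "k < length (down qs i)"
      "\<forall>l. l \<noteq> k \<longrightarrow> s l = s' l" "l \<noteq> k" for k
    using * that mem face_in_simplex[of t "length qs - 2" k]
      PEG_cellsD(5)[OF a, of t "s(i := simplical_face j (s i))" "s'(i := simplical_face j (s' i))" k l]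
    by (simp add: dface_EG Suc_diff_Suc numeral_2_eq_2)
qed

lemma ddegen_EG_in:
  assumes a: "a \<in> PEG_cells T qs" and i: "i < length qs" "j \<le> qs ! i"
  shows "ddegen (prism_EG T) qs i j a \<in> PEG_cells T (up qs i)"
proof (rule PEG_cellsI)
  note mem = codegen_in_multisimplex[OF _ i]
  show "up qs i \<noteq> []" using PEG_cellsD(1)[OF a] by simp
  show "ddegen (prism_EG T) qs i j a \<in> extensional (D (up qs i))"
    by (simp add: ddegen_EG)
  have "continuous_map (pdomain (up qs i)) (pdomain qs) (\<lambda>x. (fst x, (snd x)(i := codegen j (snd x i))))"
    using continuous_map_compose[OF continuous_map_snd continuous_map_update_codegen[OF i]]
    by (intro continuous_map_pairedI) (simp_all add: comp_def continuous_map_fst)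
  from continuous_map_compose[OF this PEG_cellsD(3)[OF a]]
  have c: "continuous_map (pdomain (up qs i)) (EG_levels T (length (up qs i) - 1)) (\<lambda>x. a (fst x, (snd x)(i := codegen j (snd x i))))"
    by (simp add: comp_def)
  show "continuous_map (pdomain (up qs i)) (EG_levels T (length (up qs i) - 1)) (ddegen (prism_EG T) qs i j a)"
    by (rule continuous_map_eq[OF c]) (auto simp: ddegen_EG)
  fix t s s' l assume *: "s \<in> topspace (multisimplex (up qs i))" "s' \<in> topspace (multisimplex (up qs i))"
    "l < length (up qs i)"
  show "ddegen (prism_EG T) qs i j a (t, s) l = ddegen (prism_EG T) qs i j a (t, s') l"
    if "t \<in> standard_simplex (length (up qs i) - 1)" "\<forall>n\<le>l. s n = s' n"
    using * that mem PEG_cellsD(4)[OF a, of t "s(i := codegen j (s i))" "s'(i := codegen j (s' i))" l]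
    by (simp add: ddegen_EG)
  show "ddegen (prism_EG T) qs i j a (simplical_face k t, s) l = ddegen (prism_EG T) qs i j a (simplical_face k t, s') l"
    if "2 \<le> length (up qs i)" "t \<in> standard_simplex (length (up qs i) - 2)" "k < length (up qs i)"
      "\<forall>l. l \<noteq> k \<longrightarrow> s l = s' l" "l \<noteq> k" for k
    using * that mem face_in_simplex[of t "length qs - 2" k]
      PEG_cellsD(5)[OF a, of t "s(i := codegen j (s i))" "s'(i := codegen j (s' i))" k l]
    by (simp add: ddegen_EG Suc_diff_Suc numeral_2_eq_2)
qed

lemma bface_EG_in:
  assumes a: "a \<in> PEG_cells T qs" and k: "2 \<le> length qs" "k < length qs"
  shows "bface (prism_EG T) qs k a \<in> PEG_cells T (remove_nth k qs)"
proof (rule PEG_cellsI)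
  obtain p where p: "length qs = Suc (Suc p)"
    using k by (metis Suc_le_D numeral_2_eq_2 Suc_le_mono)
  note mem = insert_at_in_multisimplex[OF _ k(2) vertex_in_simplex[OF le0]]
  note fc = face_in_simplex[of _ p k]
  show "remove_nth k qs \<noteq> []" using remove_nth_nonempty k by blast
  show "bface (prism_EG T) qs k a \<in> extensional (D (remove_nth k qs))"
    by (simp add: bface_EG)
  have "continuous_map (pdomain (remove_nth k qs)) (std_simplex (Suc p)) (\<lambda>x. simplical_face k (fst x))"
    using continuous_map_compose[OF continuous_map_fst[of "std_simplex p" "multisimplex (remove_nth k qs)"] continuous_map_face[of k p]] p k
    by (simp add: comp_def)
  moreover have "continuous_map (pdomain (remove_nth k qs)) (multisimplex qs) (\<lambda>x. insert_at k (vertex 0) (snd x))"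
    using continuous_map_compose[OF continuous_map_snd continuous_map_insert_at[OF k(2) vertex_in_simplex[OF le0]]]
    by (simp add: comp_def)
  ultimately have "continuous_map (pdomain (remove_nth k qs)) (pdomain qs) (\<lambda>x. (simplical_face k (fst x), insert_at k (vertex 0) (snd x)))"
    using p by (simp add: continuous_map_pairedI)
  from continuous_map_compose[OF this PEG_cellsD(3)[OF a]]
  have c: "continuous_map (pdomain (remove_nth k qs)) (EG_levels T (Suc p)) (\<lambda>x. a (simplical_face k (fst x), insert_at k (vertex 0) (snd x)))"
    using p by (simp add: comp_def)
  have c': "continuous_map (pdomain (remove_nth k qs)) (EG_levels T p) (\<lambda>x. delete_at k (a (simplical_face k (fst x), insert_at k (vertex 0) (snd x))))"
    unfolding EG_levels_def continuous_map_componentwise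
  proof (intro conjI ballI)
    have "delete_at k (a (simplical_face k (fst x), insert_at k (vertex 0) (snd x))) \<in> topspace (EG_levels T p)" if "x \<in> D (remove_nth k qs)" for x
      using continuous_map_image_subset_topspace[OF c] that k p by (intro delete_at_in_levels) auto
    then show "(\<lambda>x. delete_at k (a (simplical_face k (fst x), insert_at k (vertex 0) (snd x)))) ` D (remove_nth k qs) \<subseteq> extensional {..p}"
      by (auto simp: topspace_EG_levels PiE_iff)
    fix j assume "j \<in> {..p}"
    then have "continuous_map (pdomain (remove_nth k qs)) T (\<lambda>x. a (simplical_face k (fst x), insert_at k (vertex 0) (snd x)) l)" if "l \<le> Suc p" for l
      using c that unfolding EG_levels_def continuous_map_componentwise by simp
    with \<open>j \<in> {..p}\<close> show "continuous_map (pdomain (remove_nth k qs)) T (\<lambda>x. delete_at k (a (simplical_face k (fst x), insert_at k (vertex 0) (snd x))) j)"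
      by (simp add: delete_at_def)
  qed
  have "continuous_map (pdomain (remove_nth k qs)) (EG_levels T p) (bface (prism_EG T) qs k a)"
    by (rule continuous_map_eq[OF c']) (auto simp: bface_EG)
  then show "continuous_map (pdomain (remove_nth k qs)) (EG_levels T (length (remove_nth k qs) - 1)) (bface (prism_EG T) qs k a)"
    using p k by simp
  fix t s s' l assume *: "s \<in> topspace (multisimplex (remove_nth k qs))" "s' \<in> topspace (multisimplex (remove_nth k qs))"
    "l < length (remove_nth k qs)"
  define l' where "l' = (if l < k then l else Suc l)"
  have l': "l' < length qs" "l' \<noteq> k" using * k p by (auto simp: l'_def)
  have val: "bface (prism_EG T) qs k a (t, s) l = a (simplical_face k t, insert_at k (vertex 0) s) l'"
    if "t \<in> standard_simplex p" "s \<in> topspace (multisimplex (remove_nth k qs))" for t s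
    using that p k by (simp add: bface_EG delete_at_def l'_def)
  show "bface (prism_EG T) qs k a (t, s) l = bface (prism_EG T) qs k a (t, s') l"
    if "t \<in> standard_simplex (length (remove_nth k qs) - 1)" "\<forall>n\<le>l. s n = s' n"
  proof -
    have "insert_at k (vertex 0) s n = insert_at k (vertex 0) s' n" if "n \<le> l'" for n
      using that \<open>\<forall>n\<le>l. s n = s' n\<close> by (auto simp: insert_at_def l'_def split: if_splits)
    then show ?thesis
      using * that mem fc l' k p PEG_cellsD(4)[OF a, of "simplical_face k t" "insert_at k (vertex 0) s" "insert_at k (vertex 0) s'" l']
      by (simp add: val)
  qed
  show "bface (prism_EG T) qs k a (simplical_face i t, s) l = bface (prism_EG T) qs k a (simplical_face i t, s') l"
    if **: "2 \<le> length (remove_nth k qs)" "t \<in> standard_simplex (length (remove_nth k qs) - 2)" "i < length (remove_nth k qs)"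
      "\<forall>l. l \<noteq> i \<longrightarrow> s l = s' l" "l \<noteq> i" for i
  proof -
    obtain p' where p': "p = Suc p'" using ** p k by (cases p) auto
    have t: "t \<in> standard_simplex p'" using ** p p' k by simp
    \<comment> \<open>The face \<open>i\<close> of the face \<open>k\<close> is also the face
      \<open>k'\<close> of the face \<open>i'\<close>. The independence condition on
      \<open>a\<close> can therefore be applied to the direction \<open>i'\<close>, the original
      number of direction \<open>i\<close>.\<close>
    define i' where "i' = (if i < k then i else Suc i)"
    define k' where "k' = (if i < k then k - 1 else k)"
    have i': "i' < length qs" "l' \<noteq> i'" "k' \<le> p" using **(3,5) k p by (auto simp: i'_def l'_def k'_def)
    have ff: "simplical_face k (simplical_face i t) = simplical_face i' (simplical_face k' t)"
      using face_face_simplex[of i k t] face_face_simplex[of k "Suc i" t] by (auto simp: i'_def k'_def)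
    have "insert_at k (vertex 0) s n = insert_at k (vertex 0) s' n" if "n \<noteq> i'" for n
      using that **(4) by (auto simp: insert_at_def i'_def split: if_splits)
    moreover have "simplical_face k' t \<in> standard_simplex p" "simplical_face i t \<in> standard_simplex p"
      using t p' i' **(3) k p by (auto intro!: face_in_simplex)
    ultimately show ?thesis
      using * mem l' i' k p PEG_cellsD(5)[OF a, of "simplical_face k' t" "insert_at k (vertex 0) s" "insert_at k (vertex 0) s'" i' l']
      by (simp add: val ff)
  qed
qed

text \<open>The vertex inserted by \<open>bface\<close> is immaterial: on the face \<open>k\<close>
  the components other than \<open>k\<close> do not depend on the k-th factor, and component
  \<open>k\<close> is dropped. Beyond the last component both sides take the default value.\<close>

lemma bface_EG_eval:
  assumes a: "a \<in> PEG_cells T qs" and p: "length qs = Suc (Suc p)" and k: "k < length qs"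
    and t: "t \<in> standard_simplex p" and s: "s \<in> topspace (multisimplex qs)"
  shows "bface (prism_EG T) qs k a (t, delete_at k s) = delete_at k (a (simplical_face k t, s))"
proof
  fix l
  let ?s = "insert_at k (vertex 0) (delete_at k s)"
  have mem: "delete_at k s \<in> topspace (multisimplex (remove_nth k qs))" "?s \<in> topspace (multisimplex qs)"
    using delete_at_in_multisimplex[OF s k] insert_at_in_multisimplex[OF _ k vertex_in_simplex[OF le0]] by auto
  have ft: "simplical_face k t \<in> standard_simplex (Suc p)"
    using t k p by (auto intro!: face_in_simplex)
  have ext: "a (simplical_face k t, s') \<in> extensional {..Suc p}" if "s' \<in> topspace (multisimplex qs)" for s'
    using continuous_map_image_subset_topspace[OF PEG_cellsD(3)[OF a]] that ft p
    by (auto simp: topspace_EG_levels PiE_iff image_subset_iff)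
  define l' where "l' = (if l < k then l else Suc l)"
  have "bface (prism_EG T) qs k a (t, delete_at k s) l = a (simplical_face k t, ?s) l'"
    using mem t p k by (simp add: bface_EG delete_at_def l'_def)
  also have "\<dots> = a (simplical_face k t, s) l'"
  proof (cases "l' < length qs")
    case True
    show ?thesis
      using p t mem s k True by (intro PEG_cellsD(5)[OF a]) (auto simp: l'_def insert_at_def delete_at_def)
  next
    case False
    then show ?thesis
      using ext[OF mem(2)] ext[OF s] p by (simp add: extensional_def)
  qed
  finally show "bface (prism_EG T) qs k a (t, delete_at k s) l = delete_at k (a (simplical_face k t, s)) l"
    by (simp add: delete_at_def l'_def)
qed

lemma multisimplicial_EG: "multisimplicial (prism_EG T)"
  unfolding multisimplicial_def cells_EG
proof (intro conjI allI ballI impI)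
  fix qs :: "nat list" and i assume i: "i < length qs"
  show "simplicial_identities (\<lambda>n. PEG_cells T (qs[i := n])) (\<lambda>n j. dface (prism_EG T) (qs[i := n]) i j) (\<lambda>n j. ddegen (prism_EG T) (qs[i := n]) i j)"
    unfolding simplicial_identities_def
  proof (intro conjI allI ballI impI)
    fix n a j l
    note mem = face_in_multisimplex[of _ "qs[i := Suc n]" i for n] codegen_in_multisimplex[of _ "qs[i := n]" i for n]
    show "dface (prism_EG T) (qs[i := Suc n]) i j a \<in> PEG_cells T (qs[i := n])" if "a \<in> PEG_cells T (qs[i := Suc n])" "j \<le> Suc n"
      using dface_EG_in[OF that(1), of i j] that i by simp
    show "ddegen (prism_EG T) (qs[i := n]) i j a \<in> PEG_cells T (qs[i := Suc n])" if "a \<in> PEG_cells T (qs[i := n])" "j \<le> n"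
      using ddegen_EG_in[OF that(1), of i j] that i by simp
    show "dface (prism_EG T) (qs[i := Suc n]) i l (dface (prism_EG T) (qs[i := Suc (Suc n)]) i j a)
        = dface (prism_EG T) (qs[i := Suc n]) i (j - 1) (dface (prism_EG T) (qs[i := Suc (Suc n)]) i l a)"
      if "a \<in> PEG_cells T (qs[i := Suc (Suc n)])" "l < j \<and> j \<le> Suc (Suc n)"
      unfolding dface_EG using that i mem(1)[of _ n]
      by (intro restrict_ext) (auto simp: face_face_simplex)
    show "ddegen (prism_EG T) (qs[i := Suc n]) i l (ddegen (prism_EG T) (qs[i := n]) i j a)
        = ddegen (prism_EG T) (qs[i := Suc n]) i (Suc j) (ddegen (prism_EG T) (qs[i := n]) i l a)"
      if "a \<in> PEG_cells T (qs[i := n])" "l \<le> j \<and> j \<le> n"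
      unfolding ddegen_EG using that i mem(2)[of _ "Suc n"]
      by (intro restrict_ext) (auto simp: codegen_codegen)
    show "dface (prism_EG T) (qs[i := Suc n]) i l (ddegen (prism_EG T) (qs[i := n]) i j a)
        = ddegen (prism_EG T) (qs[i := n - 1]) i (j - 1) (dface (prism_EG T) (qs[i := n]) i l a)"
      if *: "a \<in> PEG_cells T (qs[i := n])" "l < j \<and> j \<le> n"
    proof -
      obtain n' where n: "n = Suc n'" using * by (cases n) auto
      have e: "down (qs[i := Suc n]) i = qs[i := n]" "up (qs[i := n - 1]) i = qs[i := n]"
        using i n by simp_all
      show ?thesis
        unfolding ddegen_EG dface_EG e using n * i mem(1)[of _ n] mem(2)[of _ n']
        by (intro restrict_ext) (auto simp: codegen_face_less)
    qed
    show "dface (prism_EG T) (qs[i := Suc n]) i j (ddegen (prism_EG T) (qs[i := n]) i j a) = a"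
       "dface (prism_EG T) (qs[i := Suc n]) i (Suc j) (ddegen (prism_EG T) (qs[i := n]) i j a) = a"
      if *: "a \<in> PEG_cells T (qs[i := n])" "j \<le> n"
      unfolding ddegen_EG dface_EG using * i mem(1)[of _ n] PEG_cellsD(2)[OF *(1)]
      by (intro extensionalityI[of _ "D (qs[i := n])"]; auto simp: codegen_face_eq)+
    show "dface (prism_EG T) (qs[i := Suc n]) i l (ddegen (prism_EG T) (qs[i := n]) i j a)
        = ddegen (prism_EG T) (qs[i := n - 1]) i j (dface (prism_EG T) (qs[i := n]) i (l - 1) a)"
      if *: "a \<in> PEG_cells T (qs[i := n])" "Suc j < l \<and> l \<le> Suc n"
    proof -
      obtain n' where n: "n = Suc n'" using * by (cases n) auto
      have e: "down (qs[i := Suc n]) i = qs[i := n]" "up (qs[i := n - 1]) i = qs[i := n]"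
        using i n by simp_all
      show ?thesis
        unfolding ddegen_EG dface_EG e using n * i mem(1)[of _ n] mem(2)[of _ n']
        by (intro restrict_ext) (auto simp: codegen_face_greater)
    qed
  qed
next
  fix qs :: "nat list" and a i i' j j'
  assume *: "i < length qs" "i' < length qs" "i \<noteq> i'" "j \<le> qs ! i" "j' \<le> qs ! i'"
  note f = face_in_multisimplex[OF _ *(1) _ *(4)] face_in_multisimplex[OF _ *(2) _ *(5)]
  note swap = list_update_swap[OF *(3)] fun_upd_twist[OF *(3)]
  show "dface (prism_EG T) (down qs i') i j (dface (prism_EG T) qs i' j' a) = dface (prism_EG T) (down qs i) i' j' (dface (prism_EG T) qs i j a)"
    if q: "1 \<le> qs ! i \<and> 1 \<le> qs ! i'"
    unfolding dface_EG using * q face_in_multisimplex[of _ "down qs i'" i j] face_in_multisimplex[of _ "down qs i" i' j']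
    by (auto simp: swap intro!: restrict_ext)
  show "dface (prism_EG T) (up qs i') i j (ddegen (prism_EG T) qs i' j' a) = ddegen (prism_EG T) (down qs i) i' j' (dface (prism_EG T) qs i j a)"
    if q: "1 \<le> qs ! i"
    unfolding dface_EG ddegen_EG using * q face_in_multisimplex[of _ "up qs i'" i j] codegen_in_multisimplex[of _ "down qs i" i' j']
    by (auto simp: swap intro!: restrict_ext)
  show "ddegen (prism_EG T) (up qs i') i j (ddegen (prism_EG T) qs i' j' a) = ddegen (prism_EG T) (up qs i) i' j' (ddegen (prism_EG T) qs i j a)"
    unfolding ddegen_EG using * codegen_in_multisimplex[of _ "up qs i'" i j] codegen_in_multisimplex[of _ "up qs i" i' j']
    by (auto simp: swap intro!: restrict_ext)
qed

end

lemma remove_nth_remove_nth: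
  assumes "k < l" "l < length qs"
  shows "remove_nth k (remove_nth l qs) = remove_nth (l - 1) (remove_nth k qs)"
  by (rule nth_equalityI) (use assms in \<open>auto simp: nth_remove_nth\<close>)

lemma remove_nth_update_same: "remove_nth k (qs[k := n]) = remove_nth k qs"
  by (simp add: remove_nth_def)

lemma remove_nth_update:
  assumes "k < length qs" "i < length qs" "i \<noteq> k"
  shows "remove_nth k (qs[i := n]) = (remove_nth k qs)[if i < k then i else i - 1 := n]"
  by (rule nth_equalityI) (use assms in \<open>auto simp: nth_remove_nth nth_list_update\<close>)

lemma insert_at_insert_at: "k < l \<Longrightarrow> insert_at l c (insert_at k c s) = insert_at k c (insert_at (l - 1) c s)"
  by (rule ext) (auto simp: insert_at_def)

lemma delete_at_delete_at: "k < l \<Longrightarrow> delete_at k (delete_at l f) = delete_at (l - 1) (delete_at k f)"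
  by (rule ext) (auto simp: delete_at_def)

lemma delete_at_insert_at: "delete_at k ((insert_at k c s)(k := c')) = s" "delete_at k (insert_at k c s) = s"
  by (rule ext, auto simp: delete_at_def insert_at_def)+

lemma insert_at_update:
  assumes "i \<noteq> k"
  shows "(insert_at k c s)(i := f (insert_at k c s i)) = insert_at k c (s((if i < k then i else i - 1) := f (s (if i < k then i else i - 1))))"
  using assms by (intro ext) (auto simp: insert_at_def)

context topological_group
begin

text \<open>The point to watch is d_k after an operator in the same direction \<open>k\<close>: the
  operator only alters the point inserted at place \<open>k\<close>, and
  \<open>bface_EG_eval\<close> makes this invisible. In the other directions insertion and operator
  act on different factors and commute.\<close>

lemma prismatic_set_EG: "prismatic_set (prism_EG T)"
  unfolding prismatic_set_def cells_EG
proof (intro conjI allI impI ballI)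
  show "multisimplicial (prism_EG T)" by (rule multisimplicial_EG)
  fix qs :: "nat list" and a k
  show "bface (prism_EG T) qs k a \<in> PEG_cells T (remove_nth k qs)"
    if "2 \<le> length qs" "a \<in> PEG_cells T qs" "k < length qs"
    using bface_EG_in that by blast
  show "bface (prism_EG T) (remove_nth l qs) k (bface (prism_EG T) qs l a)
      = bface (prism_EG T) (remove_nth k qs) (l - 1) (bface (prism_EG T) qs k a)"
    if qs: "3 \<le> length qs" and kl: "k < l \<and> l < length qs" for l
  proof -
    obtain p where p: "length qs = Suc (Suc (Suc p))"
      using qs by (metis Suc_le_D numeral_3_eq_3 Suc_le_mono)
    have e: "remove_nth (l - 1) (remove_nth k qs) = remove_nth k (remove_nth l qs)"
      using remove_nth_remove_nth[of k l qs] kl by simp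
    have len: "length (remove_nth k (remove_nth l qs)) = Suc p" "length (remove_nth l qs) = Suc (Suc p)" "length (remove_nth k qs) = Suc (Suc p)"
      using p kl by simp_all
    show ?thesis
      unfolding bface_EG e
    proof (rule restrict_ext, clarify)
      fix t s assume ts: "(t, s) \<in> D (remove_nth k (remove_nth l qs))"
      then have t: "t \<in> standard_simplex p" using len by simp
      have "insert_at k (vertex 0) s \<in> topspace (multisimplex (remove_nth l qs))"
        by (rule insert_at_in_multisimplex) (use ts kl p in \<open>auto simp: vertex_in_simplex\<close>)
      moreover have "insert_at (l - 1) (vertex 0) s \<in> topspace (multisimplex (remove_nth k qs))"
        by (rule insert_at_in_multisimplex) (use ts kl p e in \<open>auto simp: vertex_in_simplex\<close>)
      moreover have "simplical_face k t \<in> standard_simplex (Suc p)" "simplical_face (l - 1) t \<in> standard_simplex (Suc p)"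
        using t kl p by (auto intro!: face_in_simplex)
      ultimately show "delete_at k ((\<lambda>(t, s)\<in>D (remove_nth l qs). delete_at l (a (simplical_face l t, insert_at l (vertex 0) s))) (simplical_face k t, insert_at k (vertex 0) s))
          = delete_at (l - 1) ((\<lambda>(t, s)\<in>D (remove_nth k qs). delete_at k (a (simplical_face k t, insert_at k (vertex 0) s))) (simplical_face (l - 1) t, insert_at (l - 1) (vertex 0) s))"
        using len kl by (simp add: delete_at_delete_at insert_at_insert_at face_face_simplex)
    qed
  qed
  assume qs: "2 \<le> length qs" and a: "a \<in> PEG_cells T qs" and k: "k < length qs"
  obtain p where p: "length qs = Suc (Suc p)"
    using qs by (metis Suc_le_D numeral_2_eq_2 Suc_le_mono)
  fix i j assume i: "i < length qs" and j: "j \<le> qs ! i"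
  let ?i = "if i < k then i else i - 1"
  show "bface (prism_EG T) (down qs i) k (dface (prism_EG T) qs i j a)
      = (if i = k then bface (prism_EG T) qs k a else dface (prism_EG T) (remove_nth k qs) ?i j (bface (prism_EG T) qs k a))"
    if q: "1 \<le> qs ! i"
  proof -
    have step: "(\<lambda>(t, s)\<in>D (down qs i). a (t, s(i := simplical_face j (s i)))) (simplical_face k t, insert_at k (vertex 0) s)
        = a (simplical_face k t, (insert_at k (vertex 0) s)(i := simplical_face j (insert_at k (vertex 0) s i)))"
      if "(t, s) \<in> D (remove_nth k (down qs i))" for t s
      using that p k insert_at_in_multisimplex[of s k "down qs i" "vertex 0"] by (auto simp: vertex_in_simplex intro!: face_in_simplex)
    show ?thesis
    proof (cases "i = k")
      case True
      have "bface (prism_EG T) (down qs i) k (dface (prism_EG T) qs i j a) = bface (prism_EG T) qs k a"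
      proof (rule extensionalityI)
        fix x assume "x \<in> D (remove_nth k qs)"
        then obtain t s where x: "x = (t, s)" "(t, s) \<in> D (remove_nth k qs)" by (cases x) auto
        then have ts: "t \<in> standard_simplex p" "s \<in> topspace (multisimplex (remove_nth k qs))"
          using p k by auto
        have "insert_at k (vertex 0) s \<in> topspace (multisimplex (down qs i))"
          by (rule insert_at_in_multisimplex) (use ts k True in \<open>auto simp: remove_nth_update_same vertex_in_simplex\<close>)
        then have "(insert_at k (vertex 0) s)(i := simplical_face j (insert_at k (vertex 0) s i)) \<in> topspace (multisimplex qs)"
          using i q j by (intro face_in_multisimplex)
        note ev = bface_EG_eval[OF a p k ts(1) this]
        have mem: "(t, s) \<in> D (remove_nth k (down qs i))"
          using x True by (simp add: remove_nth_update_same)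
        have "bface (prism_EG T) (down qs i) k (dface (prism_EG T) qs i j a) (t, s)
            = delete_at k (dface (prism_EG T) qs i j a (simplical_face k t, insert_at k (vertex 0) s))"
          unfolding bface_EG using mem by (simp only: restrict_apply if_True prod.case)
        also have "\<dots> = bface (prism_EG T) qs k a (t, delete_at k ((insert_at k (vertex 0) s)(i := simplical_face j (insert_at k (vertex 0) s i))))"
          unfolding dface_EG step[OF mem] ev ..
        finally show "bface (prism_EG T) (down qs i) k (dface (prism_EG T) qs i j a) x = bface (prism_EG T) qs k a x"
          using x(1) True by (simp add: delete_at_insert_at)
      qed (simp_all add: bface_EG True remove_nth_update_same)
      with True show ?thesis by simp
    next
      case False
      note r = remove_nth_update[OF k i False]
      have nth: "remove_nth k qs ! ?i = qs ! i" "?i < length (remove_nth k qs)"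
        using k i False p by (auto simp: nth_remove_nth)
      have "bface (prism_EG T) (down qs i) k (dface (prism_EG T) qs i j a) = dface (prism_EG T) (remove_nth k qs) ?i j (bface (prism_EG T) qs k a)"
        unfolding bface_EG dface_EG r nth
      proof (rule restrict_ext, clarify)
        fix t s assume ts: "(t, s) \<in> D ((remove_nth k qs)[?i := qs ! i - 1])"
        have "s(?i := simplical_face j (s ?i)) \<in> topspace (multisimplex (remove_nth k qs))"
          using ts nth q j by (intro face_in_multisimplex) (auto split del: if_split)
        then show "delete_at k ((\<lambda>(t, s)\<in>D (down qs i). a (t, s(i := simplical_face j (s i)))) (simplical_face k t, insert_at k (vertex 0) s))
            = (\<lambda>(t, s)\<in>D (remove_nth k qs). delete_at k (a (simplical_face k t, insert_at k (vertex 0) s))) (t, s(?i := simplical_face j (s ?i)))"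
          using step[of t s] ts r p k False by (simp add: insert_at_update[of i k "vertex 0" s "simplical_face j"] split del: if_split)
      qed
      with False show ?thesis by simp
    qed
  qed
  show "bface (prism_EG T) (up qs i) k (ddegen (prism_EG T) qs i j a)
      = (if i = k then bface (prism_EG T) qs k a else ddegen (prism_EG T) (remove_nth k qs) ?i j (bface (prism_EG T) qs k a))"
  proof -
    have step: "(\<lambda>(t, s)\<in>D (up qs i). a (t, s(i := codegen j (s i)))) (simplical_face k t, insert_at k (vertex 0) s)
        = a (simplical_face k t, (insert_at k (vertex 0) s)(i := codegen j (insert_at k (vertex 0) s i)))"
      if "(t, s) \<in> D (remove_nth k (up qs i))" for t s
      using that p k insert_at_in_multisimplex[of s k "up qs i" "vertex 0"] by (auto simp: vertex_in_simplex intro!: face_in_simplex)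
    show ?thesis
    proof (cases "i = k")
      case True
      have "bface (prism_EG T) (up qs i) k (ddegen (prism_EG T) qs i j a) = bface (prism_EG T) qs k a"
      proof (rule extensionalityI)
        fix x assume "x \<in> D (remove_nth k qs)"
        then obtain t s where x: "x = (t, s)" "(t, s) \<in> D (remove_nth k qs)" by (cases x) auto
        then have ts: "t \<in> standard_simplex p" "s \<in> topspace (multisimplex (remove_nth k qs))"
          using p k by auto
        have "insert_at k (vertex 0) s \<in> topspace (multisimplex (up qs i))"
          by (rule insert_at_in_multisimplex) (use ts k True in \<open>auto simp: remove_nth_update_same vertex_in_simplex\<close>)
        then have "(insert_at k (vertex 0) s)(i := codegen j (insert_at k (vertex 0) s i)) \<in> topspace (multisimplex qs)"
          using i j by (intro codegen_in_multisimplex)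
        note ev = bface_EG_eval[OF a p k ts(1) this]
        have mem: "(t, s) \<in> D (remove_nth k (up qs i))"
          using x True by (simp add: remove_nth_update_same)
        have "bface (prism_EG T) (up qs i) k (ddegen (prism_EG T) qs i j a) (t, s)
            = delete_at k (ddegen (prism_EG T) qs i j a (simplical_face k t, insert_at k (vertex 0) s))"
          unfolding bface_EG using mem by (simp only: restrict_apply if_True prod.case)
        also have "\<dots> = bface (prism_EG T) qs k a (t, delete_at k ((insert_at k (vertex 0) s)(i := codegen j (insert_at k (vertex 0) s i))))"
          unfolding ddegen_EG step[OF mem] ev ..
        finally show "bface (prism_EG T) (up qs i) k (ddegen (prism_EG T) qs i j a) x = bface (prism_EG T) qs k a x"
          using x(1) True by (simp add: delete_at_insert_at)
      qed (simp_all add: bface_EG True remove_nth_update_same)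
      with True show ?thesis by simp
    next
      case False
      note r = remove_nth_update[OF k i False]
      have nth: "remove_nth k qs ! ?i = qs ! i" "?i < length (remove_nth k qs)"
        using k i False p by (auto simp: nth_remove_nth)
      have "bface (prism_EG T) (up qs i) k (ddegen (prism_EG T) qs i j a) = ddegen (prism_EG T) (remove_nth k qs) ?i j (bface (prism_EG T) qs k a)"
        unfolding bface_EG ddegen_EG r nth
      proof (rule restrict_ext, clarify)
        fix t s assume ts: "(t, s) \<in> D ((remove_nth k qs)[?i := Suc (qs ! i)])"
        have "s(?i := codegen j (s ?i)) \<in> topspace (multisimplex (remove_nth k qs))"
          using ts nth j by (intro codegen_in_multisimplex) (auto split del: if_split)
        then show "delete_at k ((\<lambda>(t, s)\<in>D (up qs i). a (t, s(i := codegen j (s i)))) (simplical_face k t, insert_at k (vertex 0) s))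
            = (\<lambda>(t, s)\<in>D (remove_nth k qs). delete_at k (a (simplical_face k t, insert_at k (vertex 0) s))) (t, s(?i := codegen j (s ?i)))"
          using step[of t s] ts r p k False by (simp add: insert_at_update[of i k "vertex 0" s "codegen j"] split del: if_split)
      qed
      with False show ?thesis by simp
    qed
  qed
qed

section \<open>Dividing by the action of Map(Delta^p, G)\<close>

lemma PEG_act_eval:
  "(t, s) \<in> D qs \<Longrightarrow> j < length qs \<Longrightarrow> PEG_act G qs a g (t, s) j = a (t, s) j \<otimes> g t"
  by (simp add: PEG_act_def)

lemma PEG_carrier:
  assumes "a \<in> PEG_cells T qs" "(t, s) \<in> D qs"
  shows "a (t, s) \<in> extensional {..<length qs}" "j < length qs \<Longrightarrow> a (t, s) j \<in> carrier G"
proof -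
  have "a (t, s) \<in> topspace (EG_levels T (length qs - 1))"
    using continuous_map_image_subset_topspace[OF PEG_cellsD(3)[OF assms(1)]] assms(2) by blast
  moreover have "{..length qs - 1} = {..<length qs}"
    using PEG_cellsD(1)[OF assms(1)] by (cases qs) auto
  ultimately show "a (t, s) \<in> extensional {..<length qs}" "j < length qs \<Longrightarrow> a (t, s) j \<in> carrier G"
    by (auto simp: topspace_EG_levels PiE_iff)
qed

lemma simplex_map_closed:
  "continuous_map (std_simplex n) T g \<Longrightarrow> t \<in> standard_simplex n \<Longrightarrow> g t \<in> carrier G"
  by (erule continuous_map_in_carrier) simp

lemma PEG_act_in:
  assumes a: "a \<in> PEG_cells T qs" and g: "continuous_map (std_simplex (length qs - 1)) T g"
  shows "PEG_act G qs a g \<in> PEG_cells T qs"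
proof (rule PEG_cellsI)
  show ne: "qs \<noteq> []" using PEG_cellsD(1)[OF a] .
  show "PEG_act G qs a g \<in> extensional (D qs)" by (simp add: PEG_act_def)
  have ix: "{..<length qs} = {..length qs - 1}" using ne by (cases qs) auto
  have "continuous_map (pdomain qs) (EG_levels T (length qs - 1)) (\<lambda>x. \<lambda>j\<in>{..<length qs}. a x j \<otimes> g (fst x))"
    unfolding EG_levels_def continuous_map_componentwise ix
  proof (intro conjI ballI)
    fix j assume j: "j \<in> {..length qs - 1}"
    have "continuous_map (pdomain qs) T (\<lambda>x. a x j)"
      using PEG_cellsD(3)[OF a] j unfolding EG_levels_def continuous_map_componentwise by simp
    moreover have "continuous_map (pdomain qs) T (\<lambda>x. g (fst x))"
      using continuous_map_compose[OF continuous_map_fst g] by (simp add: comp_def)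
    ultimately have "continuous_map (pdomain qs) T (\<lambda>x. a x j \<otimes> g (fst x))"
      by (rule continuous_map_mult)
    then show "continuous_map (pdomain qs) T (\<lambda>x. (\<lambda>j\<in>{..length qs - 1}. a x j \<otimes> g (fst x)) j)"
      using j by simp
  qed auto
  then show "continuous_map (pdomain qs) (EG_levels T (length qs - 1)) (PEG_act G qs a g)"
    by (rule continuous_map_eq) (auto simp: PEG_act_def)
  fix t s s' j assume *: "s \<in> topspace (multisimplex qs)" "s' \<in> topspace (multisimplex qs)" "j < length qs"
  show "PEG_act G qs a g (t, s) j = PEG_act G qs a g (t, s') j"
    if "t \<in> standard_simplex (length qs - 1)" "\<forall>i\<le>j. s i = s' i"
    using PEG_cellsD(4)[OF a that(1) *] that * by (simp add: PEG_act_eval)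
  show "PEG_act G qs a g (simplical_face i t, s) j = PEG_act G qs a g (simplical_face i t, s') j"
    if **: "2 \<le> length qs" "t \<in> standard_simplex (length qs - 2)" "i < length qs" "\<forall>l. l \<noteq> i \<longrightarrow> s l = s' l" "j \<noteq> i" for i
  proof -
    obtain p where p: "length qs = Suc (Suc p)"
      using **(1) by (metis Suc_le_D numeral_2_eq_2 Suc_le_mono)
    have "simplical_face i t \<in> standard_simplex (length qs - 1)"
      using face_in_simplex[of t p i] ** p by simp
    moreover have "a (simplical_face i t, s) j = a (simplical_face i t, s') j"
      using PEG_cellsD(5)[OF a **(1,2) *(1,2) **(3) _ *(3) **(5)] **(4) by blast
    ultimately show ?thesis using * by (simp add: PEG_act_eval)
  qed
qed

lemma PEG_eqI:
  assumes "a \<in> PEG_cells T qs" "b \<in> PEG_cells T qs"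
    and "\<And>t s j. (t, s) \<in> D qs \<Longrightarrow> j < length qs \<Longrightarrow> a (t, s) j = b (t, s) j"
  shows "a = b"
proof (rule extensionalityI[OF PEG_cellsD(2)[OF assms(1)] PEG_cellsD(2)[OF assms(2)]])
  fix x assume "x \<in> D qs"
  then obtain t s where x: "x = (t, s)" "(t, s) \<in> D qs" by (cases x) auto
  show "a x = b x"
    unfolding x(1) by (rule extensionalityI[OF PEG_carrier(1)[OF assms(1) x(2)] PEG_carrier(1)[OF assms(2) x(2)]])
      (use assms(3)[OF x(2)] in auto)
qed

lemma continuous_map_one: "continuous_map X T (\<lambda>_. \<one>)"
  by (simp add: topspace_carrier)

lemma PEG_act_one: "a \<in> PEG_cells T qs \<Longrightarrow> PEG_act G qs a (\<lambda>_. \<one>) = a"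
  by (rule PEG_eqI[OF PEG_act_in[OF _ continuous_map_one]]) (auto simp: PEG_act_eval PEG_carrier)

lemma PEG_act_act:
  assumes "a \<in> PEG_cells T qs" "continuous_map (std_simplex (length qs - 1)) T g" "continuous_map (std_simplex (length qs - 1)) T h"
  shows "PEG_act G qs (PEG_act G qs a g) h = PEG_act G qs a (\<lambda>t. g t \<otimes> h t)"
proof (rule PEG_eqI)
  show "PEG_act G qs (PEG_act G qs a g) h \<in> PEG_cells T qs"
    by (intro PEG_act_in assms)
  show "PEG_act G qs a (\<lambda>t. g t \<otimes> h t) \<in> PEG_cells T qs"
    by (intro PEG_act_in continuous_map_mult assms)
  fix t s j assume ts: "(t, s) \<in> D qs" and j: "j < length qs"
  then have "g t \<in> carrier G" "h t \<in> carrier G"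
    using simplex_map_closed[OF assms(2), of t] simplex_map_closed[OF assms(3), of t] by simp_all
  then show "PEG_act G qs (PEG_act G qs a g) h (t, s) j = PEG_act G qs a (\<lambda>t. g t \<otimes> h t) (t, s) j"
    unfolding PEG_act_eval[OF ts j] using PEG_carrier(2)[OF assms(1) ts j] by (simp only: m_assoc)
qed

lemma PBG_class_self: "a \<in> PEG_cells T qs \<Longrightarrow> a \<in> PBG_class G T qs a"
  unfolding PBG_class_def mem_Collect_eq
  by (rule exI[of _ "\<lambda>_. \<one>"]) (simp only: PEG_act_one continuous_map_one simp_thms)

lemma mult_inv_mult:
  assumes "x \<in> carrier G" "g \<in> carrier G" "h \<in> carrier G"
  shows "x \<otimes> g \<otimes> (inv g \<otimes> h) = x \<otimes> h"
proof -
  have "x \<otimes> g \<otimes> (inv g \<otimes> h) = x \<otimes> (g \<otimes> inv g) \<otimes> h"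
    using assms by (simp only: m_assoc inv_closed m_closed)
  with assms show ?thesis by simp
qed

lemma PBG_class_act:
  assumes a: "a \<in> PEG_cells T qs" and g: "continuous_map (std_simplex (length qs - 1)) T g"
  shows "PBG_class G T qs (PEG_act G qs a g) = PBG_class G T qs a"
proof (intro equalityI subsetI)
  fix b assume "b \<in> PBG_class G T qs (PEG_act G qs a g)"
  then obtain h where "b = PEG_act G qs (PEG_act G qs a g) h" "continuous_map (std_simplex (length qs - 1)) T h"
    unfolding PBG_class_def by blast
  then show "b \<in> PBG_class G T qs a"
    unfolding PBG_class_def using PEG_act_act[OF a g] continuous_map_mult[OF g] by blast
next
  fix b assume "b \<in> PBG_class G T qs a"
  then obtain h where h: "b = PEG_act G qs a h" "continuous_map (std_simplex (length qs - 1)) T h"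
    unfolding PBG_class_def by blast
  have c: "continuous_map (std_simplex (length qs - 1)) T (\<lambda>t. inv g t \<otimes> h t)"
    by (intro continuous_map_mult continuous_map_inv g h)
  have "PEG_act G qs (PEG_act G qs a g) (\<lambda>t. inv g t \<otimes> h t) = b"
    unfolding h(1)
  proof (rule PEG_eqI)
    show "PEG_act G qs (PEG_act G qs a g) (\<lambda>t. inv g t \<otimes> h t) \<in> PEG_cells T qs" "PEG_act G qs a h \<in> PEG_cells T qs"
      by (intro PEG_act_in a g h c)+
    fix t s j assume ts: "(t, s) \<in> D qs" and j: "j < length qs"
    then have "g t \<in> carrier G" "h t \<in> carrier G"
      using simplex_map_closed[OF g, of t] simplex_map_closed[OF h(2), of t] by simp_all
    then show "PEG_act G qs (PEG_act G qs a g) (\<lambda>t. inv g t \<otimes> h t) (t, s) j = PEG_act G qs a h (t, s) j"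
      unfolding PEG_act_eval[OF ts j] using PEG_carrier(2)[OF a ts j] by (simp only: mult_inv_mult)
  qed
  moreover have "PEG_act G qs (PEG_act G qs a g) (\<lambda>t. inv g t \<otimes> h t) \<in> PBG_class G T qs (PEG_act G qs a g)"
    unfolding PBG_class_def using c by blast
  ultimately show "b \<in> PBG_class G T qs (PEG_act G qs a g)" by simp
qed

lemma lift_PBG_class:
  assumes "a \<in> PEG_cells T qs"
    and "\<And>g. continuous_map (std_simplex (length qs - 1)) T g \<Longrightarrow> f (PEG_act G qs a g) = f a"
  shows "lift f (PBG_class G T qs a) = f a"
proof -
  have "f b = f a" if "b \<in> PBG_class G T qs a" for b
    using that assms(2) unfolding PBG_class_def by blast
  then have "f ` PBG_class G T qs a = {f a}"
    using PBG_class_self[OF assms(1)] by blast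
  then show ?thesis by (simp add: lift_def)
qed

lemma cells_BG: "cells (prism_BG G T) qs = PBG_class G T qs ` PEG_cells T qs"
  by (simp add: prism_BG_def)

lemma dface_BG:
  assumes a: "a \<in> PEG_cells T qs" and i: "i < length qs" "1 \<le> qs ! i" "j \<le> qs ! i"
  shows "dface (prism_BG G T) qs i j (PBG_class G T qs a) = PBG_class G T (down qs i) (dface (prism_EG T) qs i j a)"
proof -
  have act: "dface (prism_EG T) qs i j (PEG_act G qs a g) = PEG_act G (down qs i) (dface (prism_EG T) qs i j a) g"
    if g: "continuous_map (std_simplex (length qs - 1)) T g" for g
  proof (rule PEG_eqI)
    show "dface (prism_EG T) qs i j (PEG_act G qs a g) \<in> PEG_cells T (down qs i)"
      by (intro dface_EG_in PEG_act_in a g i)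
    show "PEG_act G (down qs i) (dface (prism_EG T) qs i j a) g \<in> PEG_cells T (down qs i)"
      using g by (intro dface_EG_in PEG_act_in a i) simp
    fix t s l assume ts: "(t, s) \<in> D (down qs i)" and l: "l < length (down qs i)"
    have "(t, s(i := simplical_face j (s i))) \<in> D qs"
      using ts face_in_multisimplex[OF _ i, of s] by simp
    then show "dface (prism_EG T) qs i j (PEG_act G qs a g) (t, s) l = PEG_act G (down qs i) (dface (prism_EG T) qs i j a) g (t, s) l"
      using ts l unfolding PEG_act_eval[OF ts l] dface_EG by (simp add: PEG_act_eval del: topspace_prod_topology)
  qed
  have "PBG_class G T (down qs i) (dface (prism_EG T) qs i j (PEG_act G qs a g)) = PBG_class G T (down qs i) (dface (prism_EG T) qs i j a)"
    if g: "continuous_map (std_simplex (length qs - 1)) T g" for g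
    unfolding act[OF g] using g by (intro PBG_class_act dface_EG_in a i) simp
  from lift_PBG_class[OF a this] show ?thesis
    by (simp add: prism_BG_def)
qed

lemma ddegen_BG:
  assumes a: "a \<in> PEG_cells T qs" and i: "i < length qs" "j \<le> qs ! i"
  shows "ddegen (prism_BG G T) qs i j (PBG_class G T qs a) = PBG_class G T (up qs i) (ddegen (prism_EG T) qs i j a)"
proof -
  have act: "ddegen (prism_EG T) qs i j (PEG_act G qs a g) = PEG_act G (up qs i) (ddegen (prism_EG T) qs i j a) g"
    if g: "continuous_map (std_simplex (length qs - 1)) T g" for g
  proof (rule PEG_eqI)
    show "ddegen (prism_EG T) qs i j (PEG_act G qs a g) \<in> PEG_cells T (up qs i)"
      by (intro ddegen_EG_in PEG_act_in a g i)
    show "PEG_act G (up qs i) (ddegen (prism_EG T) qs i j a) g \<in> PEG_cells T (up qs i)"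
      using g by (intro ddegen_EG_in PEG_act_in a i) simp
    fix t s l assume ts: "(t, s) \<in> D (up qs i)" and l: "l < length (up qs i)"
    have "(t, s(i := codegen j (s i))) \<in> D qs"
      using ts codegen_in_multisimplex[OF _ i, of s] by simp
    then show "ddegen (prism_EG T) qs i j (PEG_act G qs a g) (t, s) l = PEG_act G (up qs i) (ddegen (prism_EG T) qs i j a) g (t, s) l"
      using ts l unfolding PEG_act_eval[OF ts l] ddegen_EG by (simp add: PEG_act_eval del: topspace_prod_topology)
  qed
  have "PBG_class G T (up qs i) (ddegen (prism_EG T) qs i j (PEG_act G qs a g)) = PBG_class G T (up qs i) (ddegen (prism_EG T) qs i j a)"
    if g: "continuous_map (std_simplex (length qs - 1)) T g" for g
    unfolding act[OF g] using g by (intro PBG_class_act ddegen_EG_in a i) simp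
  from lift_PBG_class[OF a this] show ?thesis
    by (simp add: prism_BG_def)
qed

text \<open>Restriction to the face \<open>k\<close> turns the action of g into the action of g
  composed with the coface, so it carries orbits into orbits.\<close>

lemma bface_BG:
  assumes a: "a \<in> PEG_cells T qs" and k: "2 \<le> length qs" "k < length qs"
  shows "bface (prism_BG G T) qs k (PBG_class G T qs a) = PBG_class G T (remove_nth k qs) (bface (prism_EG T) qs k a)"
proof -
  obtain p where p: "length qs = Suc (Suc p)"
    using k by (metis Suc_le_D numeral_2_eq_2 Suc_le_mono)
  have cont: "continuous_map (std_simplex (length (remove_nth k qs) - 1)) T (\<lambda>t. g (simplical_face k t))"
    if "continuous_map (std_simplex (length qs - 1)) T g" for g
    using continuous_map_compose[OF continuous_map_face[of k p], of T g] that k p by (simp add: comp_def)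
  have act: "bface (prism_EG T) qs k (PEG_act G qs a g) = PEG_act G (remove_nth k qs) (bface (prism_EG T) qs k a) (\<lambda>t. g (simplical_face k t))"
    if g: "continuous_map (std_simplex (length qs - 1)) T g" for g
  proof (rule PEG_eqI)
    show "bface (prism_EG T) qs k (PEG_act G qs a g) \<in> PEG_cells T (remove_nth k qs)"
      by (intro bface_EG_in PEG_act_in a g k)
    show "PEG_act G (remove_nth k qs) (bface (prism_EG T) qs k a) (\<lambda>t. g (simplical_face k t)) \<in> PEG_cells T (remove_nth k qs)"
      by (intro bface_EG_in PEG_act_in a k cont g)
    fix t s j assume ts: "(t, s) \<in> D (remove_nth k qs)" and j: "j < length (remove_nth k qs)"
    have "(simplical_face k t, insert_at k (vertex 0) s) \<in> D qs"
      using ts p k insert_at_in_multisimplex[of s k qs "vertex 0"] by (auto simp: vertex_in_simplex intro!: face_in_simplex)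
    then show "bface (prism_EG T) qs k (PEG_act G qs a g) (t, s) j
        = PEG_act G (remove_nth k qs) (bface (prism_EG T) qs k a) (\<lambda>t. g (simplical_face k t)) (t, s) j"
      using ts j p k by (simp add: PEG_act_eval bface_EG delete_at_def del: topspace_prod_topology)
  qed
  have "PBG_class G T (remove_nth k qs) (bface (prism_EG T) qs k (PEG_act G qs a g)) = PBG_class G T (remove_nth k qs) (bface (prism_EG T) qs k a)"
    if g: "continuous_map (std_simplex (length qs - 1)) T g" for g
    unfolding act[OF g] by (intro PBG_class_act bface_EG_in a k cont g)
  from lift_PBG_class[OF a this] show ?thesis
    by (simp add: prism_BG_def)
qed

lemma prismatic_set_BG: "prismatic_set (prism_BG G T)"
  by (rule prismatic_set_image[OF prismatic_set_EG, where q = "PBG_class G T"])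
    (simp_all add: cells_EG cells_BG dface_BG ddegen_BG bface_BG)

end

section \<open>The prismatic map\<close>

definition shift :: "nat \<Rightarrow> (nat \<Rightarrow> real) \<Rightarrow> nat \<Rightarrow> real" where
  "shift b u = (\<lambda>n. if b \<le> n then u (n - b) else 0)"

text \<open>The vertices of the simplex of dimension \<open>star_dim qs\<close> come in blocks of \<open>q\<^sub>i + 2\<close>; the last
  vertex of a block is its extra vertex. Stage \<open>j\<close> of the point \<open>\<Sum> t\<^sub>i s\<^sup>i\<close> has \<open>s\<^sup>i\<close> replaced by the
  extra vertex for \<open>i \<ge> j\<close>.\<close>

definition stage_point :: "nat list \<Rightarrow> nat \<Rightarrow> (nat \<Rightarrow> real) \<Rightarrow> (nat \<Rightarrow> nat \<Rightarrow> real) \<Rightarrow> nat \<Rightarrow> real" where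
  "stage_point qs j t s = (\<lambda>n. \<Sum>i<length qs. t i * shift (block_start qs i) (if i < j then s i else vertex (qs ! i + 1)) n)"

definition extra :: "nat list \<Rightarrow> nat \<Rightarrow> nat" where
  "extra qs l = block_start qs l + qs ! l + 1"

text \<open>The iterated coface dual to \<open>del\<close>: \<open>m\<close> zero coordinates are
  inserted in front of coordinate \<open>b\<close>.\<close>

definition block_face :: "nat \<Rightarrow> nat \<Rightarrow> (nat \<Rightarrow> real) \<Rightarrow> nat \<Rightarrow> real" where
  "block_face b m u = (\<lambda>n. if n < b then u n else if n < b + m then 0 else u (n - m))"

lemma shift_in_simplex:
  assumes "u \<in> standard_simplex q" "b + q \<le> N"
  shows "shift b u \<in> standard_simplex N"
proof -
  have "(\<Sum>n\<le>N. shift b u n) = (\<Sum>n\<in>{b..b + q}. shift b u n)"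
    using assms by (intro sum.mono_neutral_right) (auto simp: shift_def simplex_support)
  also have "\<dots> = (\<Sum>n\<le>q. u n)"
    by (rule sum.reindex_bij_witness[where i = "\<lambda>n. b + n" and j = "\<lambda>n. n - b"]) (auto simp: shift_def)
  finally show ?thesis
    using assms by (auto simp: standard_simplex_iff shift_def)
qed

lemma convex_combination_in_simplex:
  assumes t: "t \<in> standard_simplex p" and u: "\<And>i. i \<le> p \<Longrightarrow> u i \<in> standard_simplex N"
  shows "(\<lambda>n. \<Sum>i\<le>p. t i * u i n) \<in> standard_simplex N"
proof -
  have "(\<Sum>n\<le>N. \<Sum>i\<le>p. t i * u i n) = (\<Sum>i\<le>p. t i * (\<Sum>n\<le>N. u i n))"
    by (subst sum.swap) (simp add: sum_distrib_left)
  also have "\<dots> = 1"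
    using u t by (simp add: standard_simplex_iff)
  finally show ?thesis
    using assms by (auto simp: standard_simplex_iff intro!: sum_nonneg)
qed

lemma multisimplex_component: "s \<in> topspace (multisimplex qs) \<Longrightarrow> i < length qs \<Longrightarrow> s i \<in> standard_simplex (qs ! i)"
  by (auto simp: topspace_multisimplex)

lemma block_point_in_simplex:
  assumes "s \<in> topspace (multisimplex qs)" "i < length qs"
  shows "(if i < j then s i else vertex (qs ! i + 1)) \<in> standard_simplex (qs ! i + 1)"
  using multisimplex_component[OF assms] standard_simplex_mono[of "qs ! i" "qs ! i + 1"]
  by (auto simp: vertex_in_simplex)

lemma stage_point_in_simplex:
  assumes "qs \<noteq> []" "t \<in> standard_simplex (length qs - 1)" "s \<in> topspace (multisimplex qs)"
  shows "stage_point qs j t s \<in> standard_simplex (star_dim qs)"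
proof -
  have ix: "{..<length qs} = {..length qs - 1}" using assms(1) by (cases qs) auto
  show ?thesis
    unfolding stage_point_def ix
  proof (rule convex_combination_in_simplex[OF assms(2)])
    fix i assume "i \<le> length qs - 1"
    then have i: "i < length qs" using assms(1) by (cases qs) auto
    show "shift (block_start qs i) (if i < j then s i else vertex (qs ! i + 1)) \<in> standard_simplex (star_dim qs)"
      by (rule shift_in_simplex[OF block_point_in_simplex[OF assms(3) i]]) (use block_le_star_dim[OF i] in simp)
  qed
qed

lemma continuous_map_stage_point:
  assumes "qs \<noteq> []"
  shows "continuous_map (pdomain qs) (std_simplex (star_dim qs)) (\<lambda>x. stage_point qs j (fst x) (snd x))"
  unfolding continuous_map_into_simplex
proof (intro conjI allI)
  show "(\<lambda>x. stage_point qs j (fst x) (snd x)) \<in> topspace (pdomain qs) \<rightarrow> standard_simplex (star_dim qs)"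
    using stage_point_in_simplex[OF assms] by auto
  fix n
  have "continuous_map (pdomain qs) euclideanreal (\<lambda>x. shift (block_start qs i) (if i < j then snd x i else vertex (qs ! i + 1)) n)"
    if i: "i < length qs" for i
  proof -
    have "continuous_map (pdomain qs) (std_simplex (qs ! i)) (\<lambda>x. snd x i)"
      using continuous_map_compose[OF continuous_map_snd continuous_map_multisimplex_coordinate[OF i]] by (simp add: comp_def)
    then have "continuous_map (pdomain qs) euclideanreal (\<lambda>x. snd x i (n - block_start qs i))"
      by (rule continuous_map_simplex_coordinate)
    then show ?thesis
      by (cases "i < j"; cases "block_start qs i \<le> n") (simp_all add: shift_def)
  qed
  moreover have "continuous_map (pdomain qs) euclideanreal (\<lambda>x. fst x i)" for i
    using continuous_map_compose[OF continuous_map_fst simplex_coordinate] by (simp add: comp_def)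
  ultimately show "continuous_map (pdomain qs) euclideanreal (\<lambda>x. stage_point qs j (fst x) (snd x) n)"
    unfolding stage_point_def by (intro continuous_map_sum continuous_map_real_mult) auto
qed

section \<open>Behaviour of the stages under cofaces and codegeneracies\<close>

lemma face_sum: "simplical_face k (\<lambda>n. \<Sum>i\<in>I. t i * u i n) = (\<lambda>n. \<Sum>i\<in>I. (t i :: real) * simplical_face k (u i) n)"
  by (rule ext) (simp add: simplical_face_def)

lemma codegen_sum: "codegen k (\<lambda>n. \<Sum>i\<in>I. t i * u i n) = (\<lambda>n. \<Sum>i\<in>I. t i * codegen k (u i) n)"
  by (rule ext) (simp add: codegen_def sum.distrib distrib_left)

lemma block_face_sum: "block_face b m (\<lambda>n. \<Sum>i\<in>I. t i * u i n) = (\<lambda>n. \<Sum>i\<in>I. t i * block_face b m (u i) n)"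
  by (rule ext) (simp add: block_face_def)

lemma face_shift_below: "u \<in> standard_simplex q \<Longrightarrow> b + q < k \<Longrightarrow> simplical_face k (shift b u) = shift b u"
  by (rule ext) (auto simp: simplical_face_def shift_def simplex_support)

lemma face_shift_above: "k \<le> b \<Longrightarrow> simplical_face k (shift b u) = shift (Suc b) u"
  by (rule ext) (auto simp: simplical_face_def shift_def)

lemma face_shift_inside: "simplical_face (b + j) (shift b u) = shift b (simplical_face j u)"
  by (rule ext) (auto simp: simplical_face_def shift_def)

lemma codegen_shift_below: "u \<in> standard_simplex q \<Longrightarrow> b + q \<le> k \<Longrightarrow> codegen k (shift b u) = shift b u"
  by (rule ext) (auto simp: codegen_def shift_def simplex_support)

lemma codegen_shift_above: "k \<le> b \<Longrightarrow> codegen k (shift (Suc b) u) = shift b u"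
  by (rule ext) (auto simp: codegen_def shift_def le_Suc_eq)

lemma codegen_shift_inside: "codegen (b + j) (shift b u) = shift b (codegen j u)"
  by (rule ext) (auto simp: codegen_def shift_def Suc_diff_le)

lemma block_face_shift_below: "u \<in> standard_simplex q \<Longrightarrow> b + q < k \<Longrightarrow> block_face k m (shift b u) = shift b u"
  by (rule ext) (auto simp: block_face_def shift_def simplex_support)

lemma block_face_shift_above: "k \<le> b \<Longrightarrow> block_face k m (shift b u) = shift (b + m) u"
  by (rule ext) (auto simp: block_face_def shift_def ac_simps)

lemma face_vertex: "m \<le> q \<Longrightarrow> simplical_face m (vertex q) = vertex (Suc q)"
  by (rule ext) (auto simp: simplical_face_def vertex_def)

lemma codegen_vertex: "m < q \<Longrightarrow> codegen m (vertex (Suc q)) = vertex q"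
  by (rule ext) (auto simp: codegen_def vertex_def)

text \<open>Checked block by block on the convex combination. Blocks before \<open>i\<close> lie
  below the inserted coordinate and later ones move up by one. Block \<open>i\<close> either shows
  \<open>s i\<close>, to which the coface is applied, or its extra vertex; since \<open>m\<close> is
  at most \<open>qs ! i\<close>, the extra vertex goes to the extra vertex.\<close>

lemma stage_point_face:
  assumes i: "i < length qs" "1 \<le> qs ! i" "m \<le> qs ! i" and s: "s \<in> topspace (multisimplex (down qs i))"
  shows "stage_point qs j t (s(i := simplical_face m (s i))) = simplical_face (block_start qs i + m) (stage_point (down qs i) j t s)"
proof -
  have eq: "shift (block_start qs l) (if l < j then (s(i := simplical_face m (s i))) l else vertex (qs ! l + 1))
      = simplical_face (block_start qs i + m) (shift (block_start (down qs i) l) (if l < j then s l else vertex (down qs i ! l + 1)))"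
    if l: "l < length qs" for l
  proof -
    note bp = block_point_in_simplex[OF s, of l j]
    consider "l < i" | "l = i" | "i < l" by linarith
    then show ?thesis
    proof cases
      case 1
      then show ?thesis
        using face_shift_below[OF bp, of "block_start qs l" "block_start qs i + m"] block_start_less[OF 1, of qs] l i
        by (simp add: block_start_update)
    next
      case 2
      then show ?thesis
        using i face_vertex[of m "qs ! i"] by (simp add: block_start_update face_shift_inside)
    next
      case 3
      then have "block_start (down qs i) l = block_start qs l - 1" "block_start qs i + m \<le> block_start qs l - 1" "Suc (block_start qs l - 1) = block_start qs l"
        using block_start_less[OF 3, of qs] i by (simp_all add: block_start_update)
      then show ?thesis
        using 3 by (simp add: face_shift_above)
    qed
  qed
  show ?thesis
    unfolding stage_point_def face_sum length_list_update
    by (intro ext sum.cong refl) (simp only: lessThan_iff eq)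
qed

lemma stage_point_codegen:
  assumes i: "i < length qs" "m \<le> qs ! i" and s: "s \<in> topspace (multisimplex (up qs i))"
  shows "stage_point qs j t (s(i := codegen m (s i))) = codegen (block_start qs i + m) (stage_point (up qs i) j t s)"
proof -
  have eq: "shift (block_start qs l) (if l < j then (s(i := codegen m (s i))) l else vertex (qs ! l + 1))
      = codegen (block_start qs i + m) (shift (block_start (up qs i) l) (if l < j then s l else vertex (up qs i ! l + 1)))"
    if l: "l < length qs" for l
  proof -
    note bp = block_point_in_simplex[OF s, of l j]
    consider "l < i" | "l = i" | "i < l" by linarith
    then show ?thesis
    proof cases
      case 1
      then show ?thesis
        using codegen_shift_below[OF bp, of "block_start qs l" "block_start qs i + m"] block_start_less[OF 1, of qs] l i
        by (simp add: block_start_update)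
    next
      case 2
      then show ?thesis
        using i codegen_vertex[of m "Suc (qs ! i)"] by (simp add: block_start_update codegen_shift_inside)
    next
      case 3
      then have "block_start (up qs i) l = Suc (block_start qs l)" "block_start qs i + m \<le> block_start qs l"
        using block_start_less[OF 3, of qs] i by (simp_all add: block_start_update)
      then show ?thesis
        using 3 by (simp add: codegen_shift_above)
    qed
  qed
  show ?thesis
    unfolding stage_point_def codegen_sum length_list_update
    by (intro ext sum.cong refl) (simp only: lessThan_iff eq)
qed

lemma sum_face:
  assumes "k \<le> n"
  shows "(\<Sum>i<Suc n. simplical_face k t i * X i) = (\<Sum>i<n. t i * (X (if i < k then i else Suc i) :: real))"
proof -
  have "(\<Sum>i<Suc n. simplical_face k t i * X i) = (\<Sum>i\<in>{..<Suc n} - {k}. simplical_face k t i * X i)"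
    by (rule sum.mono_neutral_right) (auto simp: simplical_face_def)
  also have "\<dots> = (\<Sum>i<n. t i * X (if i < k then i else Suc i))"
    using assms
    by (intro sum.reindex_bij_witness[where i = "\<lambda>i. if i < k then i else Suc i" and j = "\<lambda>i. if i < k then i else i - 1"])
      (auto simp: simplical_face_def)
  finally show ?thesis .
qed

text \<open>On the face t_k = 0 block \<open>k\<close> has weight zero, so it is irrelevant whether
  it is collapsed. The stages \<open>k\<close> and \<open>k + 1\<close> coincide there, and the
  later stages are renumbered; hence the index \<open>j\<close> or \<open>j - 1\<close>.\<close>

lemma stage_point_block_face:
  assumes len: "length qs = Suc (Suc p)" and k: "k < length qs" and s: "s \<in> topspace (multisimplex qs)"
  shows "stage_point qs j (simplical_face k t) s
    = block_face (block_start qs k) (qs ! k + 2) (stage_point (remove_nth k qs) (if j \<le> k then j else j - 1) t (delete_at k s))"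
proof -
  have len': "length (remove_nth k qs) = Suc p" using len k by simp
  have eq: "shift (block_start qs (if l < k then l else Suc l)) (if (if l < k then l else Suc l) < j then s (if l < k then l else Suc l) else vertex (qs ! (if l < k then l else Suc l) + 1))
      = block_face (block_start qs k) (qs ! k + 2) (shift (block_start (remove_nth k qs) l)
          (if l < (if j \<le> k then j else j - 1) then delete_at k s l else vertex (remove_nth k qs ! l + 1)))"
    if l: "l < Suc p" for l
  proof -
    have s': "delete_at k s \<in> topspace (multisimplex (remove_nth k qs))"
      using delete_at_in_multisimplex[OF s k] .
    let ?l = "if l < k then l else Suc l" and ?j = "if j \<le> k then j else j - 1"
    have r: "(if ?l < j then s ?l else vertex (qs ! ?l + 1)) = (if l < ?j then delete_at k s l else vertex (remove_nth k qs ! l + 1))"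
      using l k len by (auto simp: delete_at_def nth_remove_nth)
    have start: "block_start (remove_nth k qs) l = (if l < k then block_start qs l else block_start qs (Suc l) - (qs ! k + 2))"
      using block_start_remove_nth[OF k, of l] l len by (auto simp: block_start_Suc)
    show ?thesis
    proof (cases "l < k")
      case True
      have "remove_nth k qs ! l = qs ! l" using True k by (simp add: nth_remove_nth)
      then show ?thesis
        unfolding r start
        using block_face_shift_below[OF block_point_in_simplex[OF s', of l ?j], of "block_start qs l" "block_start qs k"] True block_start_less[OF True, of qs] l len'
        by simp
    next
      case False
      then have "block_start qs k + (qs ! k + 2) \<le> block_start qs (Suc l)"
        using block_start_less[of k "Suc l" qs] by simp
      then show ?thesis
        unfolding r start using False block_face_shift_above[of "block_start qs k" "block_start qs (Suc l) - (qs ! k + 2)"] by simp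
    qed
  qed
  have "k \<le> Suc p" using k len by simp
  then show ?thesis
    unfolding stage_point_def block_face_sum len len'
    by (intro ext, subst sum_face, assumption) (intro sum.cong refl, simp only: lessThan_iff eq)
qed

lemma block_face_Suc: "block_face b (Suc m) u = simplical_face (b + m) (block_face b m u)"
  by (rule ext) (auto simp: block_face_def simplical_face_def)

lemma block_face_0: "block_face b 0 u = u"
  by (rule ext) (auto simp: block_face_def)

lemma block_face_in_simplex: "u \<in> standard_simplex n \<Longrightarrow> b \<le> Suc n \<Longrightarrow> block_face b m u \<in> standard_simplex (n + m)"
  by (induction m) (auto simp: block_face_0 block_face_Suc intro!: face_in_simplex)

lemma stage_point_cong:
  assumes "\<And>i. i < j \<Longrightarrow> i < length qs \<Longrightarrow> t i = 0 \<or> s i = s' i"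
  shows "stage_point qs j t s = stage_point qs j t s'"
  unfolding stage_point_def
proof (intro ext sum.cong refl)
  fix n i assume "i \<in> {..<length qs}"
  then show "t i * shift (block_start qs i) (if i < j then s i else vertex (qs ! i + 1)) n
      = t i * shift (block_start qs i) (if i < j then s' i else vertex (qs ! i + 1)) n"
    using assms[of i] by (cases "i < j") auto
qed

section \<open>Positions of the extra vertices under the operators\<close>

lemma extra_update:
  assumes "i < length qs"
  shows "extra (qs[i := n]) l = (if l < i then extra qs l else extra qs l + n - qs ! i)"
proof (cases "i < l")
  case True
  then show ?thesis
    using assms block_start_less[OF True, of qs] by (simp add: extra_def block_start_update)
qed (use assms in \<open>auto simp: extra_def block_start_update nth_list_update\<close>)

lemma extra_remove_nth:
  assumes "k < length qs" "Suc l < length qs"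
  shows "extra (remove_nth k qs) l = (if l < k then extra qs l else extra qs (Suc l) - (qs ! k + 2))"
proof (cases "l < k")
  case False
  then show ?thesis
    using assms block_start_remove_nth[OF assms(1), of l] block_start_less[of k "Suc l" qs]
    by (auto simp: extra_def nth_remove_nth block_start_Suc)
qed (use assms in \<open>auto simp: extra_def nth_remove_nth block_start_remove_nth\<close>)

lemma extra_le: "l < length qs \<Longrightarrow> extra qs l \<le> star_dim qs"
  using block_le_star_dim[of l qs] by (simp add: extra_def)

lemma extra_outside_block:
  assumes "l \<noteq> k"
  shows "if l < k then extra qs l < block_start qs k else block_start qs k + (qs ! k + 2) \<le> extra qs l"
  using block_start_less[of l k qs] block_start_less[of k l qs] assms by (auto simp: extra_def)

lemma Suc_star_dim_down: "i < length qs \<Longrightarrow> 1 \<le> qs ! i \<Longrightarrow> star_dim qs = Suc (star_dim (down qs i))"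
  using star_dim_update[of i qs "qs ! i - 1"] block_le_star_dim[of i qs] by simp

lemma star_dim_up: "i < length qs \<Longrightarrow> star_dim (up qs i) = Suc (star_dim qs)"
  using star_dim_update[of i qs "Suc (qs ! i)"] block_le_star_dim[of i qs] by simp

text \<open>d^i_m removes one of the first \<open>qs ! i + 1\<close> vertices of block
  \<open>i\<close>, never an extra vertex. So all extra vertices survive and are at most
  renumbered.\<close>

lemma extra_down:
  assumes i: "i < length qs" "1 \<le> qs ! i" "m \<le> qs ! i" and j: "j < length qs"
  shows "extra qs j \<noteq> block_start qs i + m"
    "(if extra qs j < block_start qs i + m then extra qs j else extra qs j - 1) = extra (down qs i) j"
  using block_start_less[of j i qs] block_start_less[of i j qs] i
  by (cases j i rule: linorder_cases; simp add: extra_update; simp add: extra_def)+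

lemma extra_up:
  assumes i: "i < length qs" "m \<le> qs ! i" and j: "j < length qs"
  shows "(if extra (up qs i) j \<le> block_start qs i + m then extra (up qs i) j else extra (up qs i) j - 1) = extra qs j"
  using block_start_less[of j i qs] block_start_less[of i j qs] i
  by (cases j i rule: linorder_cases; simp add: extra_update; simp add: extra_def)

text \<open>The position of a surviving extra vertex relative to the deleted block, phrased in the
  form that \<open>R_block_face\<close> and \<open>frame_block_face\<close> take as
  hypothesis.\<close>

lemma extra_skip:
  assumes len: "length qs = Suc (Suc p)" and k: "k < length qs" and j: "j < Suc p"
  shows "extra qs (if j < k then j else Suc j) \<le> star_dim qs"
    "if extra qs (if j < k then j else Suc j) < block_start qs k then True
     else block_start qs k + (qs ! k + 2) \<le> extra qs (if j < k then j else Suc j)"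
    "(if extra qs (if j < k then j else Suc j) < block_start qs k then extra qs (if j < k then j else Suc j)
      else extra qs (if j < k then j else Suc j) - (qs ! k + 2)) = extra (remove_nth k qs) j"
proof -
  define j' where "j' = (if j < k then j else Suc j)"
  have "j' < length qs" "j' \<noteq> k" using j len by (auto simp: j'_def)
  from extra_outside_block[OF this(2), of qs] extra_le[OF this(1)] extra_remove_nth[OF k, of j] len j
  show "extra qs (if j < k then j else Suc j) \<le> star_dim qs"
    "if extra qs (if j < k then j else Suc j) < block_start qs k then True
     else block_start qs k + (qs ! k + 2) \<le> extra qs (if j < k then j else Suc j)"
    "(if extra qs (if j < k then j else Suc j) < block_start qs k then extra qs (if j < k then j else Suc j)
      else extra qs (if j < k then j else Suc j) - (qs ! k + 2)) = extra (remove_nth k qs) j"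
    unfolding j'_def[symmetric] by (auto simp: j'_def split: if_splits)
qed

context transition_functions
begin

text \<open>Takes the coordinate at the vertex \<open>i'\<close> to the coordinate at
  \<open>i\<close>. The common starting point of the two \<open>W\<close>, the last vertex, cancels,
  so that in contrast to \<open>W\<close> no correction appears even if the last vertex is
  deleted.\<close>

definition R :: "nat \<Rightarrow> nat \<Rightarrow> nat \<Rightarrow> 's \<Rightarrow> (nat \<Rightarrow> real) \<Rightarrow> 'g" where
  "R i i' n \<sigma> u = W i n \<sigma> u \<otimes> inv W i' n \<sigma> u"

lemma R_closed: "\<sigma> \<in> ssimp S n \<Longrightarrow> u \<in> standard_simplex n \<Longrightarrow> i \<le> n \<Longrightarrow> i' \<le> n \<Longrightarrow> R i i' n \<sigma> u \<in> carrier G"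
  by (simp add: R_def)

lemma R_trans:
  assumes "\<sigma> \<in> ssimp S n" "u \<in> standard_simplex n" "i \<le> n" "j \<le> n" "k \<le> n"
  shows "R i j n \<sigma> u \<otimes> R j k n \<sigma> u = R i k n \<sigma> u"
proof -
  have c: "W i n \<sigma> u \<in> carrier G" "W j n \<sigma> u \<in> carrier G" "W k n \<sigma> u \<in> carrier G"
    using assms by simp_all
  have "R i j n \<sigma> u \<otimes> R j k n \<sigma> u = W i n \<sigma> u \<otimes> (inv W j n \<sigma> u \<otimes> W j n \<sigma> u) \<otimes> inv W k n \<sigma> u"
    unfolding R_def using c by (simp only: m_assoc inv_closed m_closed)
  with c show ?thesis by (simp add: R_def)
qed

lemma R_face:
  assumes "\<sigma> \<in> ssimp S (Suc n)" "u \<in> standard_simplex n" "k \<le> Suc n" "i \<le> Suc n" "i' \<le> Suc n" "i \<noteq> k" "i' \<noteq> k"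
  shows "R i i' (Suc n) \<sigma> (simplical_face k u)
    = R (if i < k then i else i - 1) (if i' < k then i' else i' - 1) n (sface S (Suc n) k \<sigma>) u"
proof -
  let ?W = "W i (Suc n) \<sigma> (simplical_face k u)" and ?W' = "W i' (Suc n) \<sigma> (simplical_face k u)" and ?g = "transition n k \<sigma> u"
  have f: "simplical_face k u \<in> standard_simplex (Suc n)"
    using assms by (simp add: face_in_simplex)
  have c: "?W \<in> carrier G" "?W' \<in> carrier G" "?g \<in> carrier G"
    using W_closed[OF assms(1) f] assms transition_closed by simp_all
  have "?W \<otimes> ?g \<otimes> inv (?W' \<otimes> ?g) = ?W \<otimes> ?g \<otimes> (inv ?g \<otimes> inv ?W')"
    using c by (simp only: inv_mult_group)
  also have "\<dots> = ?W \<otimes> inv ?W'"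
    using c by (simp only: mult_inv_mult inv_closed)
  finally show ?thesis
    unfolding R_def W_face[OF assms(1-4,6), symmetric] W_face[OF assms(1-3,5,7), symmetric] by simp
qed

lemma R_degen:
  assumes "\<sigma> \<in> ssimp S n" "u \<in> standard_simplex (Suc n)" "k \<le> n" "i \<le> Suc n" "i' \<le> Suc n"
  shows "R i i' (Suc n) (sdegen S n k \<sigma>) u
    = R (if i \<le> k then i else i - 1) (if i' \<le> k then i' else i' - 1) n \<sigma> (codegen k u)"
  unfolding R_def W_degen[OF assms(1-4)] W_degen[OF assms(1-3,5)] ..

lemma R_block_face:
  assumes "\<sigma> \<in> ssimp S (n + m)" "u \<in> standard_simplex n" "b \<le> Suc n" "i \<le> n + m" "i' \<le> n + m"
    "if i < b then True else b + m \<le> i" "if i' < b then True else b + m \<le> i'"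
  shows "R i i' (n + m) \<sigma> (block_face b m u)
    = R (if i < b then i else i - m) (if i' < b then i' else i' - m) n (del (n + m) b m \<sigma>) u"
  using assms
proof (induction m arbitrary: \<sigma> i i')
  case (Suc m)
  let ?i = "if i < b + m then i else i - 1" and ?i' = "if i' < b + m then i' else i' - 1"
  have "R i i' (n + Suc m) \<sigma> (block_face b (Suc m) u)
      = R ?i ?i' (n + m) (sface S (Suc (n + m)) (b + m) \<sigma>) (block_face b m u)"
    unfolding block_face_Suc add_Suc_right
    by (rule R_face) (use Suc.prems block_face_in_simplex in \<open>auto split: if_splits\<close>)
  also have "\<dots> = R (if ?i < b then ?i else ?i - m) (if ?i' < b then ?i' else ?i' - m) n (del (n + m) b m (sface S (Suc (n + m)) (b + m) \<sigma>)) u"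
    by (rule Suc.IH) (use Suc.prems in \<open>auto simp: face_in split: if_splits\<close>)
  also have "(if ?i < b then ?i else ?i - m) = (if i < b then i else i - Suc m)" using Suc.prems(6) by auto
  also have "(if ?i' < b then ?i' else ?i' - m) = (if i' < b then i' else i' - Suc m)" using Suc.prems(7) by auto
  finally show ?case by (simp add: del_Suc)
qed (simp add: block_face_0)

lemma frame_block_face:
  assumes "\<sigma> \<in> ssimp S (n + m)" "u \<in> standard_simplex n" "b \<le> Suc n" "i \<le> n + m" "if i < b then True else b + m \<le> i"
  shows "frame i (n + m) (block_face b m u) \<sigma> = frame (if i < b then i else i - m) n u (del (n + m) b m \<sigma>)"
  using assms
proof (induction m arbitrary: \<sigma> i)
  case (Suc m)
  let ?i = "if i < b + m then i else i - 1"
  have "frame i (n + Suc m) (block_face b (Suc m) u) \<sigma> = frame ?i (n + m) (block_face b m u) (sface S (Suc (n + m)) (b + m) \<sigma>)"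
    unfolding block_face_Suc add_Suc_right
    by (rule frame_face) (use Suc.prems block_face_in_simplex in \<open>auto split: if_splits\<close>)
  also have "\<dots> = frame (if ?i < b then ?i else ?i - m) n u (del (n + m) b m (sface S (Suc (n + m)) (b + m) \<sigma>))"
    by (rule Suc.IH) (use Suc.prems in \<open>auto simp: face_in split: if_splits\<close>)
  also have "(if ?i < b then ?i else ?i - m) = (if i < b then i else i - Suc m)" using Suc.prems(5) by auto
  finally show ?case by (simp add: del_Suc)
qed (simp add: block_face_0)

text \<open>\<open>coef qs x t s j\<close> is the transport to the \<open>j\<close>-th extra vertex from the \<open>0\<close>-th one, along
  the stages of the point; stage \<open>j\<close> does not involve \<open>s\<^sup>i\<close> for \<open>i \<ge> j\<close>.\<close>

primrec coef :: "nat list \<Rightarrow> 's \<Rightarrow> (nat \<Rightarrow> real) \<Rightarrow> (nat \<Rightarrow> nat \<Rightarrow> real) \<Rightarrow> nat \<Rightarrow> 'g" where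
  "coef qs x t s 0 = \<one>"
| "coef qs x t s (Suc j) = R (extra qs (Suc j)) (extra qs j) (star_dim qs) x (stage_point qs (Suc j) t s) \<otimes> coef qs x t s j"

lemma stage_closed:
  assumes "x \<in> ssimp S (star_dim qs)" "(t, s) \<in> D qs" "l < length qs" "l' < length qs"
  shows "R (extra qs l) (extra qs l') (star_dim qs) x (stage_point qs j t s) \<in> carrier G"
proof -
  have "qs \<noteq> []" using assms by auto
  then show ?thesis
    using assms by (intro R_closed extra_le stage_point_in_simplex) auto
qed

lemma coef_closed:
  "x \<in> ssimp S (star_dim qs) \<Longrightarrow> (t, s) \<in> D qs \<Longrightarrow> j < length qs \<Longrightarrow> coef qs x t s j \<in> carrier G"
proof (induction j)
  case (Suc j)
  then show ?case
    using stage_closed[OF Suc.prems(1,2,3), of j "Suc j"] by simp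
qed simp

text \<open>One statement for both conditions on a cell of \<open>prism_EG\<close>: agreement of the
  early s^i gives the triangular form, and the alternative \<open>t i = 0\<close> gives independence
  of s^i on the i-th face.\<close>

lemma coef_cong:
  assumes "\<And>i. i < j \<Longrightarrow> i < length qs \<Longrightarrow> t i = 0 \<or> s i = s' i"
  shows "coef qs x t s j = coef qs x t s' j"
  using assms
proof (induction j)
  case (Suc j)
  have "stage_point qs (Suc j) t s = stage_point qs (Suc j) t s'"
    using Suc.prems by (intro stage_point_cong) auto
  with Suc show ?case by simp
qed simp

lemma R_dface:
  assumes x: "x \<in> ssimp S (star_dim qs)" and ts: "(t, s) \<in> D (down qs i)" and i: "i < length qs" "1 \<le> qs ! i" "m \<le> qs ! i"
    and l: "l < length qs" "l' < length qs"
  shows "R (extra qs l) (extra qs l') (star_dim qs) x (stage_point qs j t (s(i := simplical_face m (s i))))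
      = R (extra (down qs i) l) (extra (down qs i) l') (star_dim (down qs i)) (sface S (star_dim qs) (block_start qs i + m) x) (stage_point (down qs i) j t s)"
proof -
  define n where "n = star_dim (down qs i)"
  have N: "star_dim qs = Suc n"
    using Suc_star_dim_down[OF i(1,2)] by (simp add: n_def)
  have sp: "stage_point (down qs i) j t s \<in> standard_simplex n"
    unfolding n_def using ts i by (intro stage_point_in_simplex) auto
  show ?thesis
    unfolding stage_point_face[OF i ts[unfolded topspace_prod_topology, THEN SigmaD2]] N n_def[symmetric]
    using R_face[OF _ sp, of x "block_start qs i + m" "extra qs l" "extra qs l'"] extra_down[OF i l(1)] extra_down[OF i l(2)]
      extra_le[OF l(1)] extra_le[OF l(2)] x N block_le_star_dim[OF i(1)] i(3) by simp
qed

lemma coef_dface: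
  assumes x: "x \<in> ssimp S (star_dim qs)" and ts: "(t, s) \<in> D (down qs i)" and i: "i < length qs" "1 \<le> qs ! i" "m \<le> qs ! i"
    and l: "l < length qs"
  shows "coef (down qs i) (sface S (star_dim qs) (block_start qs i + m) x) t s l = coef qs x t (s(i := simplical_face m (s i))) l"
  using l
proof (induction l)
  case (Suc l)
  note R_dface[OF x ts i Suc.prems Suc_lessD[OF Suc.prems], of "Suc l"]
  moreover note Suc.IH[OF Suc_lessD[OF Suc.prems]]
  ultimately show ?case
    by (simp only: coef.simps)
qed simp

lemma R_ddegen:
  assumes x: "x \<in> ssimp S (star_dim qs)" and ts: "(t, s) \<in> D (up qs i)" and i: "i < length qs" "m \<le> qs ! i"
    and l: "l < length qs" "l' < length qs"
  shows "R (extra (up qs i) l) (extra (up qs i) l') (star_dim (up qs i)) (sdegen S (star_dim qs) (block_start qs i + m) x) (stage_point (up qs i) j t s)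
      = R (extra qs l) (extra qs l') (star_dim qs) x (stage_point qs j t (s(i := codegen m (s i))))"
proof -
  note N = star_dim_up[OF i(1)]
  have sp: "stage_point (up qs i) j t s \<in> standard_simplex (Suc (star_dim qs))"
    unfolding N[symmetric] using ts i by (intro stage_point_in_simplex) auto
  show ?thesis
    unfolding stage_point_codegen[OF i ts[unfolded topspace_prod_topology, THEN SigmaD2]] N
    using R_degen[OF x sp, of "block_start qs i + m" "extra (up qs i) l" "extra (up qs i) l'"] extra_up[OF i l(1)] extra_up[OF i l(2)]
      extra_le[of l "up qs i"] extra_le[of l' "up qs i"] l N block_le_star_dim[OF i(1)] i(2) by simp
qed

lemma coef_ddegen:
  assumes x: "x \<in> ssimp S (star_dim qs)" and ts: "(t, s) \<in> D (up qs i)" and i: "i < length qs" "m \<le> qs ! i"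
    and l: "l < length qs"
  shows "coef (up qs i) (sdegen S (star_dim qs) (block_start qs i + m) x) t s l = coef qs x t (s(i := codegen m (s i))) l"
  using l
proof (induction l)
  case (Suc l)
  note R_ddegen[OF x ts i Suc.prems Suc_lessD[OF Suc.prems], of "Suc l"]
  moreover note Suc.IH[OF Suc_lessD[OF Suc.prems]]
  ultimately show ?case
    by (simp only: coef.simps)
qed simp

lemma R_remove_block:
  assumes x: "x \<in> ssimp S (star_dim qs)" and len: "length qs = Suc (Suc p)" and k: "k < length qs"
    and u: "u \<in> standard_simplex (star_dim (remove_nth k qs))" and l: "l < Suc p" "l' < Suc p"
  shows "R (extra qs (if l < k then l else Suc l)) (extra qs (if l' < k then l' else Suc l')) (star_dim qs) x (block_face (block_start qs k) (qs ! k + 2) u)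
    = R (extra (remove_nth k qs) l) (extra (remove_nth k qs) l') (star_dim (remove_nth k qs)) (bface (prism_star S) qs k x) u"
proof -
  let ?n = "star_dim (remove_nth k qs)" and ?m = "qs ! k + 2" and ?B = "block_start qs k"
  have N: "star_dim qs = ?n + ?m" using star_dim_remove_nth[OF k] len by simp
  note e = extra_skip[OF len k]
  have "?B \<le> Suc ?n" using block_le_star_dim[OF k] N by simp
  from R_block_face[OF x[unfolded N] u this e(1)[OF l(1), unfolded N] e(1)[OF l(2), unfolded N] e(2)[OF l(1)] e(2)[OF l(2)]]
  show ?thesis
    unfolding e(3)[OF l(1)] e(3)[OF l(2)] bface_star N .
qed

text \<open>If an intermediate block disappears, the transports into and out of its extra vertex
  take place at the same point and compose by \<open>R_trans\<close>. If the last block disappears,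
  no remaining coefficient involves it. If block 0 disappears, the start moves from the extra vertex
  0 to the extra vertex 1; this multiplies all coefficients on the right by one transport at stage
  0, which does not involve \<open>s\<close>.\<close>

lemma coef_bface:
  assumes x: "x \<in> ssimp S (star_dim qs)" and len: "length qs = Suc (Suc p)" and k: "k < length qs"
    and t: "t \<in> standard_simplex p" and s: "s \<in> topspace (multisimplex qs)" and l: "l < Suc p"
  shows "coef qs x (simplical_face k t) s (if l < k then l else Suc l)
    = coef (remove_nth k qs) (bface (prism_star S) qs k x) t (delete_at k s) l
      \<otimes> (if k = 0 then R (extra qs 1) (extra qs 0) (star_dim qs) x (stage_point qs 0 (simplical_face k t) s) else \<one>)"
    (is "_ = _ \<otimes> ?g")
  using l
proof (induction l)
  case 0
  \<comment> \<open>The first transport is defined at stage 1, the correction factor at stage 0. On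
    this face block 0 has weight zero and the stages agree.\<close>
  have "stage_point qs (Suc 0) (simplical_face k t) s = stage_point qs 0 (simplical_face k t) s" if "k = 0"
    unfolding stage_point_block_face[OF len k s] using that by simp
  moreover have D: "(simplical_face k t, s) \<in> D qs" using t s k len by (auto intro!: face_in_simplex)
  ultimately show ?case
    using stage_closed[OF x D, of 1 0 0] len by auto
next
  case (Suc l)
  let ?rem = "remove_nth k qs" and ?y = "bface (prism_star S) qs k x" and ?s = "delete_at k s" and ?t = "simplical_face k t"
  have D: "(?t, s) \<in> D qs" using t s k len by (auto intro!: face_in_simplex)
  have lenr: "length ?rem = Suc p" using len k by simp
  have D': "(t, ?s) \<in> D ?rem" using t lenr delete_at_in_multisimplex[OF s k] by simp
  have sp: "stage_point ?rem j t ?s \<in> standard_simplex (star_dim ?rem)" for j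
    using D' lenr by (intro stage_point_in_simplex) auto
  have y: "?y \<in> ssimp S (star_dim ?rem)"
  proof -
    have "x \<in> cells (prism_star S) qs" using x len by (auto simp: cells_star)
    then have "?y \<in> cells (prism_star S) ?rem"
      using prismatic_set_star len k unfolding prismatic_set_def by auto
    then show ?thesis by (simp add: cells_star)
  qed
  have cl: "coef ?rem ?y t ?s l \<in> carrier G"
    "R (extra ?rem (Suc l)) (extra ?rem l) (star_dim ?rem) ?y (stage_point ?rem (Suc l) t ?s) \<in> carrier G" "?g \<in> carrier G"
    using coef_closed[OF y D'] stage_closed[OF y D'] stage_closed[OF x D, of 1 0 0] lenr Suc.prems len by auto
  let ?a = "\<lambda>j. if j < k then j else Suc j"
  have "coef qs x ?t s (?a (Suc l))
      = R (extra qs (?a (Suc l))) (extra qs (?a l)) (star_dim qs) x (block_face (block_start qs k) (qs ! k + 2) (stage_point ?rem (Suc l) t ?s))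
        \<otimes> coef qs x ?t s (?a l)"
  proof (cases "Suc l = k")
    case False
    then show ?thesis
      by (auto simp: stage_point_block_face[OF len k s])
  next
    \<comment> \<open>The index jumps over \<open>k\<close>, so two steps of the recursion
      correspond to one on the other side. Their stages \<open>k + 1\<close> and \<open>k\<close>
      are the same point \<open>?P\<close>, and \<open>R_trans\<close> merges them.\<close>
    case True
    let ?P = "block_face (block_start qs k) (qs ! k + 2) (stage_point ?rem (Suc l) t ?s)"
    have P: "stage_point qs (Suc (Suc l)) ?t s = ?P" "stage_point qs (Suc l) ?t s = ?P"
      using True by (simp_all add: stage_point_block_face[OF len k s])
    have Pin: "?P \<in> standard_simplex (star_dim qs)"
      unfolding P(1)[symmetric] using D len by (intro stage_point_in_simplex) auto
    have ex: "extra qs (Suc (Suc l)) \<le> star_dim qs" "extra qs (Suc l) \<le> star_dim qs" "extra qs l \<le> star_dim qs"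
      using extra_le Suc.prems len by auto
    have a: "?a (Suc l) = Suc (Suc l)" "?a l = l" using True by simp_all
    have "coef qs x ?t s l \<in> carrier G"
      using coef_closed[OF x D] Suc.prems len by simp
    from m_assoc[OF R_closed[OF x Pin ex(1,2)] R_closed[OF x Pin ex(2,3)] this]
    show ?thesis
      unfolding a coef.simps P R_trans[OF x Pin ex] by simp
  qed
  also have "\<dots> = R (extra ?rem (Suc l)) (extra ?rem l) (star_dim ?rem) ?y (stage_point ?rem (Suc l) t ?s)
      \<otimes> (coef ?rem ?y t ?s l \<otimes> ?g)"
    unfolding R_remove_block[OF x len k sp Suc.prems Suc_lessD[OF Suc.prems]] using Suc.IH Suc.prems by simp
  also have "\<dots> = coef ?rem ?y t ?s (Suc l) \<otimes> ?g"
    using cl by (simp only: coef.simps m_assoc)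
  finally show ?case .
qed

section \<open>The cells of the prismatic map\<close>

definition star_map :: "nat list \<Rightarrow> 's \<Rightarrow> 'g pmap" where
  "star_map qs x = (\<lambda>(t, s)\<in>D qs. \<lambda>j\<in>{..<length qs}. coef qs x t s j)"

definition prism_m :: "nat list \<Rightarrow> 's \<Rightarrow> 'g pmap set" where
  "prism_m qs x = PBG_class G T qs (star_map qs x)"

lemma star_map_eval: "(t, s) \<in> D qs \<Longrightarrow> j < length qs \<Longrightarrow> star_map qs x (t, s) j = coef qs x t s j"
  by (simp add: star_map_def)

lemma R_continuous:
  assumes "\<sigma> \<in> ssimp S n" "i \<le> n" "i' \<le> n" "continuous_map X (std_simplex n) f"
  shows "continuous_map X T (\<lambda>x. R i i' n \<sigma> (f x))"
  unfolding R_def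
  using continuous_map_compose[OF assms(4) W_continuous[OF assms(1,2)]] continuous_map_compose[OF assms(4) W_continuous[OF assms(1,3)]]
  by (intro continuous_map_mult continuous_map_inv) (simp_all add: comp_def)

lemma coef_continuous:
  assumes "x \<in> ssimp S (star_dim qs)" "j < length qs"
  shows "continuous_map (pdomain qs) T (\<lambda>y. coef qs x (fst y) (snd y) j)"
  using assms(2)
proof (induction j)
  case (Suc j)
  then have "qs \<noteq> []" by auto
  with Suc have "continuous_map (pdomain qs) T (\<lambda>y. R (extra qs (Suc j)) (extra qs j) (star_dim qs) x (stage_point qs (Suc j) (fst y) (snd y)))"
    by (intro R_continuous assms continuous_map_stage_point extra_le) auto
  with Suc show ?case by (simp add: continuous_map_mult)
qed (simp add: topspace_carrier)

lemma star_map_in: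
  assumes "qs \<noteq> []" and x: "x \<in> ssimp S (star_dim qs)"
  shows "star_map qs x \<in> PEG_cells T qs"
proof (rule PEG_cellsI[OF assms(1)])
  show "star_map qs x \<in> extensional (D qs)" by (simp add: star_map_def)
  have ix: "{..<length qs} = {..length qs - 1}" using assms(1) by (cases qs) auto
  have "continuous_map (pdomain qs) (EG_levels T (length qs - 1)) (\<lambda>y. \<lambda>j\<in>{..<length qs}. coef qs x (fst y) (snd y) j)"
    unfolding EG_levels_def continuous_map_componentwise ix
  proof (intro conjI ballI)
    fix j assume "j \<in> {..length qs - 1}"
    then have j: "j < length qs" using ix by blast
    show "continuous_map (pdomain qs) T (\<lambda>y. (\<lambda>j\<in>{..length qs - 1}. coef qs x (fst y) (snd y) j) j)"
      using coef_continuous[OF x j] \<open>j \<in> {..length qs - 1}\<close> by simp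
  qed auto
  then show "continuous_map (pdomain qs) (EG_levels T (length qs - 1)) (star_map qs x)"
    by (rule continuous_map_eq) (auto simp: star_map_def)
  fix t s s' j assume *: "s \<in> topspace (multisimplex qs)" "s' \<in> topspace (multisimplex qs)" "j < length qs"
  show "star_map qs x (t, s) j = star_map qs x (t, s') j" if "t \<in> standard_simplex (length qs - 1)" "\<forall>i\<le>j. s i = s' i"
    using * that coef_cong[of j qs t s s' x] by (simp add: star_map_eval)
  show "star_map qs x (simplical_face i t, s) j = star_map qs x (simplical_face i t, s') j"
    if **: "2 \<le> length qs" "t \<in> standard_simplex (length qs - 2)" "i < length qs" "\<forall>l. l \<noteq> i \<longrightarrow> s l = s' l" for i
  proof -
    obtain p where p: "length qs = Suc (Suc p)"
      using **(1) by (metis Suc_le_D numeral_2_eq_2 Suc_le_mono)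
    have "simplical_face i t \<in> standard_simplex (length qs - 1)"
      using face_in_simplex[of t p i] ** p by simp
    moreover have "coef qs x (simplical_face i t) s j = coef qs x (simplical_face i t) s' j"
      using **(4) by (intro coef_cong) (auto simp: simplical_face_def)
    ultimately show ?thesis using * by (simp add: star_map_eval)
  qed
qed

lemma star_map_dface:
  assumes x: "x \<in> cells (prism_star S) qs" and i: "i < length qs" "1 \<le> qs ! i" "j \<le> qs ! i"
  shows "star_map (down qs i) (dface (prism_star S) qs i j x) = dface (prism_EG T) qs i j (star_map qs x)"
proof (rule PEG_eqI)
  have x': "qs \<noteq> []" "x \<in> ssimp S (star_dim qs)" using x by (auto simp: cells_star)
  have "dface (prism_star S) qs i j x \<in> cells (prism_star S) (down qs i)"
    by (rule prismatic_set_dface_in[OF multisimplicial_star x i])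
  then show "star_map (down qs i) (dface (prism_star S) qs i j x) \<in> PEG_cells T (down qs i)"
    by (intro star_map_in) (auto simp: cells_star)
  show "dface (prism_EG T) qs i j (star_map qs x) \<in> PEG_cells T (down qs i)"
    by (intro dface_EG_in star_map_in x' i)
  fix t s l assume ts: "(t, s) \<in> D (down qs i)" and l: "l < length (down qs i)"
  have "(t, s(i := simplical_face j (s i))) \<in> D qs"
    using ts face_in_multisimplex[OF _ i, of s] by simp
  then show "star_map (down qs i) (dface (prism_star S) qs i j x) (t, s) l = dface (prism_EG T) qs i j (star_map qs x) (t, s) l"
    using ts l coef_dface[OF x'(2) ts i, of l] unfolding star_map_eval[OF ts l] dface_EG dface_star
    by (simp add: star_map_eval del: topspace_prod_topology)
qed

lemma star_map_ddegen:
  assumes x: "x \<in> cells (prism_star S) qs" and i: "i < length qs" "j \<le> qs ! i"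
  shows "star_map (up qs i) (ddegen (prism_star S) qs i j x) = ddegen (prism_EG T) qs i j (star_map qs x)"
proof (rule PEG_eqI)
  have x': "qs \<noteq> []" "x \<in> ssimp S (star_dim qs)" using x by (auto simp: cells_star)
  have "ddegen (prism_star S) qs i j x \<in> cells (prism_star S) (up qs i)"
    by (rule prismatic_set_ddegen_in[OF multisimplicial_star x i])
  then show "star_map (up qs i) (ddegen (prism_star S) qs i j x) \<in> PEG_cells T (up qs i)"
    by (intro star_map_in) (auto simp: cells_star)
  show "ddegen (prism_EG T) qs i j (star_map qs x) \<in> PEG_cells T (up qs i)"
    by (intro ddegen_EG_in star_map_in x' i)
  fix t s l assume ts: "(t, s) \<in> D (up qs i)" and l: "l < length (up qs i)"
  have "(t, s(i := codegen j (s i))) \<in> D qs"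
    using ts codegen_in_multisimplex[OF _ i, of s] by simp
  then show "star_map (up qs i) (ddegen (prism_star S) qs i j x) (t, s) l = ddegen (prism_EG T) qs i j (star_map qs x) (t, s) l"
    using ts l coef_ddegen[OF x'(2) ts i, of l] unfolding star_map_eval[OF ts l] ddegen_EG ddegen_star
    by (simp add: star_map_eval del: topspace_prod_topology)
qed

lemma bface_star_in:
  "x \<in> cells (prism_star S) qs \<Longrightarrow> 2 \<le> length qs \<Longrightarrow> k < length qs \<Longrightarrow> bface (prism_star S) qs k x \<in> cells (prism_star S) (remove_nth k qs)"
  using prismatic_set_star[unfolded prismatic_set_def, THEN conjunct2, THEN conjunct1, rule_format] .

text \<open>The correction in \<open>coef_bface\<close> depends on \<open>t\<close> alone and is
  continuous in it, so it is a legitimate element of Map(Delta^p, G). It is 1 unless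
  \<open>k = 0\<close>.\<close>

lemma star_map_bface:
  assumes x: "x \<in> cells (prism_star S) qs" and k: "2 \<le> length qs" "k < length qs"
  obtains g where "continuous_map (std_simplex (length (remove_nth k qs) - 1)) T g"
    "bface (prism_EG T) qs k (star_map qs x) = PEG_act G (remove_nth k qs) (star_map (remove_nth k qs) (bface (prism_star S) qs k x)) g"
proof -
  have x': "qs \<noteq> []" "x \<in> ssimp S (star_dim qs)" using x by (auto simp: cells_star)
  obtain p where p: "length qs = Suc (Suc p)"
    using k by (metis Suc_le_D numeral_2_eq_2 Suc_le_mono)
  \<comment> \<open>An arbitrary base point: stage 0 has all blocks collapsed and ignores
    \<open>s\<close>. Fixing it displays the correction as a function of \<open>t\<close>.\<close>
  define s0 where "s0 = (\<lambda>i\<in>{..<length qs}. vertex 0)"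
  have s0: "s0 \<in> topspace (multisimplex qs)"
    by (auto simp: s0_def topspace_multisimplex vertex_in_simplex)
  define g where "g = (\<lambda>t. if k = 0 then R (extra qs 1) (extra qs 0) (star_dim qs) x (stage_point qs 0 (simplical_face k t) s0) else \<one>)"
  have "continuous_map (std_simplex p) (pdomain qs) (\<lambda>t. (simplical_face k t, s0))"
    using continuous_map_face[of k p] s0 p k by (intro continuous_map_pairedI) auto
  from continuous_map_compose[OF this continuous_map_stage_point[OF x'(1), of 0]]
  have "continuous_map (std_simplex p) (std_simplex (star_dim qs)) (\<lambda>t. stage_point qs 0 (simplical_face k t) s0)"
    by (simp add: comp_def)
  then have g: "continuous_map (std_simplex p) T g"
    unfolding g_def using p by (cases "k = 0") (auto intro!: R_continuous x' extra_le simp: topspace_carrier)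
  have y: "bface (prism_star S) qs k x \<in> cells (prism_star S) (remove_nth k qs)"
    by (rule bface_star_in[OF x k])
  have yin: "star_map (remove_nth k qs) (bface (prism_star S) qs k x) \<in> PEG_cells T (remove_nth k qs)"
    using y by (intro star_map_in) (auto simp: cells_star)
  have "bface (prism_EG T) qs k (star_map qs x) = PEG_act G (remove_nth k qs) (star_map (remove_nth k qs) (bface (prism_star S) qs k x)) g"
  proof (rule PEG_eqI)
    show "bface (prism_EG T) qs k (star_map qs x) \<in> PEG_cells T (remove_nth k qs)"
      by (intro bface_EG_in star_map_in x' k)
    show "PEG_act G (remove_nth k qs) (star_map (remove_nth k qs) (bface (prism_star S) qs k x)) g \<in> PEG_cells T (remove_nth k qs)"
      using g p k by (intro PEG_act_in yin) simp
    fix t s l assume ts: "(t, s) \<in> D (remove_nth k qs)" and l: "l < length (remove_nth k qs)"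
    let ?s = "insert_at k (vertex 0) s"
    have t: "t \<in> standard_simplex p" and s: "?s \<in> topspace (multisimplex qs)"
      using ts p k by (auto intro!: insert_at_in_multisimplex vertex_in_simplex)
    have D: "(simplical_face k t, ?s) \<in> D qs"
      using t s p k by (auto intro!: face_in_simplex)
    have l': "l < Suc p" using l p k by simp
    have "bface (prism_EG T) qs k (star_map qs x) (t, s) l = coef qs x (simplical_face k t) ?s (if l < k then l else Suc l)"
      using ts D l' p by (simp add: bface_EG delete_at_def star_map_eval del: topspace_prod_topology)
    also have "\<dots> = coef (remove_nth k qs) (bface (prism_star S) qs k x) t s l \<otimes> g t"
    proof -
      have st: "stage_point qs 0 (simplical_face k t) ?s = stage_point qs 0 (simplical_face k t) s0"
        by (rule stage_point_cong) simp
      show ?thesis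
        unfolding coef_bface[OF x'(2) p k(2) t s l'] delete_at_insert_at g_def st ..
    qed
    finally show "bface (prism_EG T) qs k (star_map qs x) (t, s) l
        = PEG_act G (remove_nth k qs) (star_map (remove_nth k qs) (bface (prism_star S) qs k x)) g (t, s) l"
      using ts l by (simp only: PEG_act_eval star_map_eval)
  qed
  moreover have "continuous_map (std_simplex (length (remove_nth k qs) - 1)) T g"
    using g p k by simp
  ultimately show thesis using that by blast
qed

text \<open>\<open>star_map\<close> commutes strictly with the operators d^i_j and s^i_j, but with
  d_k only up to a function of \<open>t\<close>. Passing to the classes in \<open>prism_BG\<close>
  repairs this.\<close>

lemma prismatic_map_prism_m: "prismatic_map (prism_star S) (prism_BG G T) prism_m"
  unfolding prismatic_map_def
proof (intro conjI allI impI ballI)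
  show "prismatic_set (prism_star S)" by (rule prismatic_set_star)
  show "prismatic_set (prism_BG G T)" by (rule prismatic_set_BG)
  fix qs :: "nat list" and x
  assume x: "x \<in> cells (prism_star S) qs"
  then have a: "star_map qs x \<in> PEG_cells T qs"
    by (intro star_map_in) (auto simp: cells_star)
  show "prism_m qs x \<in> cells (prism_BG G T) qs"
    using a by (simp add: cells_BG prism_m_def)
  show "prism_m (down qs i) (dface (prism_star S) qs i j x) = dface (prism_BG G T) qs i j (prism_m qs x)"
    if "i < length qs" "j \<le> qs ! i" "1 \<le> qs ! i" for i j
    unfolding prism_m_def dface_BG[OF a that(1,3,2)] star_map_dface[OF x that(1,3,2)] ..
  show "prism_m (up qs i) (ddegen (prism_star S) qs i j x) = ddegen (prism_BG G T) qs i j (prism_m qs x)"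
    if "i < length qs" "j \<le> qs ! i" for i j
    unfolding prism_m_def ddegen_BG[OF a that] star_map_ddegen[OF x that] ..
  show "prism_m (remove_nth k qs) (bface (prism_star S) qs k x) = bface (prism_BG G T) qs k (prism_m qs x)"
    if k: "2 \<le> length qs" "k < length qs" for k
  proof -
    have b: "star_map (remove_nth k qs) (bface (prism_star S) qs k x) \<in> PEG_cells T (remove_nth k qs)"
      using bface_star_in[OF x k] by (intro star_map_in) (auto simp: cells_star)
    obtain g where g: "continuous_map (std_simplex (length (remove_nth k qs) - 1)) T g"
      "bface (prism_EG T) qs k (star_map qs x) = PEG_act G (remove_nth k qs) (star_map (remove_nth k qs) (bface (prism_star S) qs k x)) g"
      using star_map_bface[OF x k] .
    show ?thesis
      unfolding prism_m_def bface_BG[OF a k] g(2) PBG_class_act[OF b g(1)] ..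
  qed
qed

end

section \<open>Comparison of pullbacks of principal spaces\<close>

context principal_space
begin

lemma tr_closed:
  assumes "x \<in> topspace X" "y \<in> topspace X" "pr x = pr y"
  shows "tr x y \<in> carrier G" "act x (tr x y) = y"
  using pr_eqD[OF assms] assms by (auto simp: tr_act)

lemma tr_act_left:
  assumes "x \<in> topspace X" "y \<in> topspace X" "pr x = pr y" "g \<in> carrier G"
  shows "tr (act x g) y = inv g \<otimes> tr x y"
proof -
  obtain k where k: "k \<in> carrier G" "y = act x k"
    using pr_eqD[OF assms(1-3)] by blast
  then have "y = act (act x g) (inv g \<otimes> k)"
    using assms by (simp add: act_mult m_assoc[symmetric])
  then have "tr (act x g) y = inv g \<otimes> k"
    using assms k by (simp add: tr_act act_closed)
  then show ?thesis
    using assms k by (simp add: tr_act)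
qed

lemma tr_act_right:
  assumes "x \<in> topspace X" "y \<in> topspace X" "pr x = pr y" "g \<in> carrier G"
  shows "tr x (act y g) = tr x y \<otimes> g"
proof -
  obtain k where k: "k \<in> carrier G" "y = act x k"
    using pr_eqD[OF assms(1-3)] by blast
  then show ?thesis
    using assms by (simp add: act_mult tr_act)
qed

lemma act_inv_cancel:
  assumes "x \<in> topspace X" "g \<in> carrier G" "k \<in> carrier G"
  shows "act (act x g) (inv g \<otimes> k) = act x k"
  using assms by (simp add: act_mult m_assoc[symmetric])

end

text \<open>The lifts \<open>\<xi>\<close> and \<open>\<beta>\<close> to \<open>Z0\<close> are defined only up to a common gauge transformation; the \<open>\<gamma> c\<close>
  fix the gauge over an open cover of \<open>Z\<close> and so provide local sections of both pullbacks.\<close>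

locale common_lift =
  X: principal_space G T X actX prX trX + Y: principal_space G T Y actY prY trY
  for G :: "'g monoid" (structure) and T :: "'g topology"
    and X :: "'x topology" and actX and prX :: "'x \<Rightarrow> 'b" and trX
    and Y :: "'y topology" and actY and prY :: "'y \<Rightarrow> 'c" and trY +
  fixes Z0 :: "'w topology" and Z :: "'z topology" and \<zeta> and \<xi> and \<beta> and bX and bY
    and C :: "'i set" and U and \<gamma>
  assumes quotient: "quotient_map Z0 Z \<zeta>"
    and \<xi>: "continuous_map Z0 X \<xi>" and \<beta>: "continuous_map Z0 Y \<beta>"
    and bX: "\<And>w. w \<in> topspace Z0 \<Longrightarrow> bX (\<zeta> w) = prX (\<xi> w)"
    and bY: "\<And>w. w \<in> topspace Z0 \<Longrightarrow> bY (\<zeta> w) = prY (\<beta> w)"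
    and U: "\<And>c. c \<in> C \<Longrightarrow> openin Z0 (U c)"
    and \<gamma>: "\<And>c. c \<in> C \<Longrightarrow> continuous_map (subtopology Z0 (U c)) T (\<gamma> c)"
    and saturated: "\<And>c w w'. c \<in> C \<Longrightarrow> w \<in> U c \<Longrightarrow> w' \<in> topspace Z0 \<Longrightarrow> \<zeta> w = \<zeta> w' \<Longrightarrow> w' \<in> U c"
    and gauge_X: "\<And>c w w'. c \<in> C \<Longrightarrow> w \<in> U c \<Longrightarrow> w' \<in> topspace Z0 \<Longrightarrow> \<zeta> w = \<zeta> w' \<Longrightarrow>
      actX (\<xi> w) (\<gamma> c w) = actX (\<xi> w') (\<gamma> c w')"
    and gauge_Y: "\<And>c w w'. c \<in> C \<Longrightarrow> w \<in> U c \<Longrightarrow> w' \<in> topspace Z0 \<Longrightarrow> \<zeta> w = \<zeta> w' \<Longrightarrow>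
      actY (\<beta> w) (\<gamma> c w) = actY (\<beta> w') (\<gamma> c w')"
    and cover: "\<And>w. w \<in> topspace Z0 \<Longrightarrow> \<exists>c\<in>C. w \<in> U c"
begin

definition rep where "rep z = (SOME w. w \<in> topspace Z0 \<and> \<zeta> w = z)"

lemma rep:
  assumes "z \<in> topspace Z"
  shows "rep z \<in> topspace Z0" "\<zeta> (rep z) = z"
proof -
  have "z \<in> \<zeta> ` topspace Z0"
    using assms quotient[unfolded quotient_map_def, THEN conjunct1] by simp
  then have "\<exists>w. w \<in> topspace Z0 \<and> \<zeta> w = z" by blast
  then show "rep z \<in> topspace Z0" "\<zeta> (rep z) = z"
    unfolding rep_def by (metis (mono_tags, lifting) someI_ex)+
qed

abbreviation PX where "PX \<equiv> subtopology (prod_topology Z X) {(z, x). bX z = prX x}"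
abbreviation PY where "PY \<equiv> subtopology (prod_topology Z Y) {(z, y). bY z = prY y}"

text \<open>\<open>rep\<close> picks arbitrary preimages, without any continuity. The value does not
  depend on the pick, because along a fibre of \<open>\<zeta>\<close> the lifts \<open>\<xi>\<close>
  and \<open>\<beta>\<close> change by the same group element.\<close>

definition compare where
  "compare = (\<lambda>(z, y). (z, actX (\<xi> (rep z)) (trY (\<beta> (rep z)) y)))"

lemma lift_closed:
  "w \<in> topspace Z0 \<Longrightarrow> \<xi> w \<in> topspace X" "w \<in> topspace Z0 \<Longrightarrow> \<beta> w \<in> topspace Y"
  using \<xi> \<beta> by (auto simp: continuous_map_def)

lemma PY_D:
  assumes "(z, y) \<in> topspace PY"
  shows "z \<in> topspace Z" "y \<in> topspace Y" "prY (\<beta> (rep z)) = prY y" "rep z \<in> topspace Z0"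
  using assms rep[of z] bY[of "rep z"] by auto

lemma compare_in:
  assumes "(z, y) \<in> topspace PY"
  shows "compare (z, y) \<in> topspace PX"
proof -
  note d = PY_D[OF assms]
  have "trY (\<beta> (rep z)) y \<in> carrier G"
    using Y.tr_closed(1) d lift_closed by blast
  then show ?thesis
    using d lift_closed[OF d(4)] rep[OF d(1)] bX[OF d(4)]
    by (simp add: compare_def X.act_closed X.pr_act)
qed

lemma \<gamma>_closed: "c \<in> C \<Longrightarrow> w \<in> U c \<Longrightarrow> \<gamma> c w \<in> carrier G"
  using X.continuous_map_in_carrier[OF \<gamma>, of c w] openin_subset[OF U, of c] by auto

text \<open>Over a saturated open set the gauged lifts are constant on the fibres of
  \<open>\<zeta>\<close>, by \<open>gauge_X\<close> and \<open>gauge_Y\<close>. So they descend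
  along the restricted quotient map and do not see the discontinuity of \<open>rep\<close>.\<close>

lemma section_continuous:
  assumes c: "c \<in> C"
  shows "openin Z (\<zeta> ` U c)"
    and "continuous_map (subtopology Z (\<zeta> ` U c)) X (\<lambda>z. actX (\<xi> (rep z)) (\<gamma> c (rep z)))"
    and "continuous_map (subtopology Z (\<zeta> ` U c)) Y (\<lambda>z. actY (\<beta> (rep z)) (\<gamma> c (rep z)))"
proof -
  have sub: "U c \<subseteq> topspace Z0" using openin_subset[OF U[OF c]] .
  have pre: "{w \<in> topspace Z0. \<zeta> w \<in> \<zeta> ` U c} = U c"
  proof (intro equalityI subsetI)
    fix w assume "w \<in> {w \<in> topspace Z0. \<zeta> w \<in> \<zeta> ` U c}"
    then obtain w' where "w \<in> topspace Z0" "w' \<in> U c" "\<zeta> w' = \<zeta> w" by auto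
    then show "w \<in> U c" using saturated[OF c] by metis
  qed (use sub in auto)
  have "\<zeta> ` U c \<subseteq> topspace Z"
    using sub quotient[unfolded quotient_map_def, THEN conjunct1] by blast
  then have "openin Z0 {w \<in> topspace Z0. \<zeta> w \<in> \<zeta> ` U c} = openin Z (\<zeta> ` U c)"
    by (rule quotient[unfolded quotient_map_def, THEN conjunct2, rule_format])
  then show op: "openin Z (\<zeta> ` U c)"
    unfolding pre using U[OF c] by (rule iffD1)
  have q: "quotient_map (subtopology Z0 (U c)) (subtopology Z (\<zeta> ` U c)) \<zeta>"
    by (rule quotient_map_restriction[OF quotient pre]) (simp add: op)
  have r: "rep (\<zeta> w) \<in> topspace Z0" "\<zeta> w = \<zeta> (rep (\<zeta> w))" if "w \<in> U c" for w
    using rep[of "\<zeta> w"] that sub \<open>\<zeta> ` U c \<subseteq> topspace Z\<close> by auto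
  have top: "topspace (subtopology Z0 (U c)) = U c" using sub by auto
  have "continuous_map (subtopology Z0 (U c)) X (\<lambda>w. actX (\<xi> w) (\<gamma> c w))"
    using continuous_map_compose[OF continuous_map_pairedI[OF continuous_map_from_subtopology[OF \<xi>] \<gamma>[OF c]] X.act_continuous]
    by (simp add: comp_def)
  then have "continuous_map (subtopology Z0 (U c)) X ((\<lambda>z. actX (\<xi> (rep z)) (\<gamma> c (rep z))) \<circ> \<zeta>)"
    by (rule continuous_map_eq) (use gauge_X[OF c _ r] top in simp)
  then show "continuous_map (subtopology Z (\<zeta> ` U c)) X (\<lambda>z. actX (\<xi> (rep z)) (\<gamma> c (rep z)))"
    by (rule continuous_compose_quotient_map[OF q])
  have "continuous_map (subtopology Z0 (U c)) Y (\<lambda>w. actY (\<beta> w) (\<gamma> c w))"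
    using continuous_map_compose[OF continuous_map_pairedI[OF continuous_map_from_subtopology[OF \<beta>] \<gamma>[OF c]] Y.act_continuous]
    by (simp add: comp_def)
  then have "continuous_map (subtopology Z0 (U c)) Y ((\<lambda>z. actY (\<beta> (rep z)) (\<gamma> c (rep z))) \<circ> \<zeta>)"
    by (rule continuous_map_eq) (use gauge_Y[OF c _ r] top in simp)
  then show "continuous_map (subtopology Z (\<zeta> ` U c)) Y (\<lambda>z. actY (\<beta> (rep z)) (\<gamma> c (rep z)))"
    by (rule continuous_compose_quotient_map[OF q])
qed

text \<open>Locally the bare lifts in \<open>compare\<close> may be replaced by the gauged ones: the
  gauge enters once through \<open>actX\<close> and once, inverted, through \<open>trY\<close>, and
  it cancels. Every ingredient of the rewritten formula is continuous.\<close>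

lemma compare_continuous: "continuous_map PY PX compare"
proof -
  have A: "continuous_map PY (prod_topology Z X) compare"
  proof (rule continuous_map_local)
    fix p assume p: "p \<in> topspace PY"
    then have "rep (fst p) \<in> topspace Z0" and z: "\<zeta> (rep (fst p)) = fst p"
      using rep[of "fst p"] by auto
    then obtain c where c: "c \<in> C" "rep (fst p) \<in> U c" using cover by blast
    let ?V = "\<zeta> ` U c"
    let ?E = "subtopology PY {q \<in> topspace PY. fst q \<in> ?V}"
    have "continuous_map PY Z fst"
      by (simp add: continuous_map_from_subtopology continuous_map_fst)
    then have "openin PY {q \<in> topspace PY. fst q \<in> ?V}"
      using section_continuous(1)[OF c(1)] by (rule openin_continuous_map_preimage)
    moreover have "p \<in> {q \<in> topspace PY. fst q \<in> ?V}"
      using p z c(2) by (auto intro!: rev_image_eqI[of "rep (fst p)"])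
    moreover have "continuous_map ?E (prod_topology Z X) compare"
    proof -
      have rV: "rep z \<in> U c" if zV: "z \<in> ?V" for z
      proof -
        obtain w where w: "w \<in> U c" "z = \<zeta> w" using zV by blast
        have "z \<in> topspace Z"
          using openin_subset[OF section_continuous(1)[OF c(1)]] zV by blast
        then show ?thesis using saturated[OF c(1) w(1)] rep[of z] w(2) by simp
      qed
      have f: "continuous_map ?E (subtopology Z ?V) fst"
        by (auto simp: continuous_map_in_subtopology intro!: continuous_map_from_subtopology continuous_map_fst)
      have s: "continuous_map ?E Y snd"
        by (intro continuous_map_from_subtopology continuous_map_snd)
      note sX = continuous_map_compose[OF f section_continuous(2)[OF c(1)], unfolded comp_def]
      note sY = continuous_map_compose[OF f section_continuous(3)[OF c(1)], unfolded comp_def]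
      have d: "fst q \<in> ?V" "(fst q, snd q) \<in> topspace PY" if "q \<in> topspace ?E" for q
        using that by auto
      have "continuous_map ?E (subtopology (prod_topology Y Y) {(x, y). prY x = prY y})
          (\<lambda>q. (actY (\<beta> (rep (fst q))) (\<gamma> c (rep (fst q))), snd q))"
        unfolding continuous_map_in_subtopology
      proof (intro conjI continuous_map_pairedI sY s Pi_I)
        fix q assume q: "q \<in> topspace ?E"
        note e = PY_D[OF d(2)[OF q]]
        show "(actY (\<beta> (rep (fst q))) (\<gamma> c (rep (fst q))), snd q) \<in> {(x, y). prY x = prY y}"
          using e lift_closed(2)[OF e(4)] \<gamma>_closed[OF c(1) rV[OF d(1)[OF q]]] by (simp add: Y.pr_act)
      qed
      from continuous_map_compose[OF this Y.tr_continuous]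
      have t: "continuous_map ?E T (\<lambda>q. trY (actY (\<beta> (rep (fst q))) (\<gamma> c (rep (fst q)))) (snd q))"
        by (simp add: comp_def)
      from continuous_map_compose[OF continuous_map_pairedI[OF sX t] X.act_continuous]
      have a: "continuous_map ?E X (\<lambda>q. actX (actX (\<xi> (rep (fst q))) (\<gamma> c (rep (fst q))))
          (trY (actY (\<beta> (rep (fst q))) (\<gamma> c (rep (fst q)))) (snd q)))"
        by (simp add: comp_def)
      have "continuous_map ?E (prod_topology Z X) (\<lambda>q. (fst q, actX (actX (\<xi> (rep (fst q))) (\<gamma> c (rep (fst q))))
          (trY (actY (\<beta> (rep (fst q))) (\<gamma> c (rep (fst q)))) (snd q))))"
        using f a by (intro continuous_map_pairedI) (simp_all add: continuous_map_in_subtopology)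
      then show ?thesis
      proof (rule continuous_map_eq)
        fix q assume q: "q \<in> topspace ?E"
        note e = PY_D[OF d(2)[OF q]]
        note g = \<gamma>_closed[OF c(1) rV[OF d(1)[OF q]]]
        note l = lift_closed[OF e(4)]
        have "trY (actY (\<beta> (rep (fst q))) (\<gamma> c (rep (fst q)))) (snd q) = inv \<gamma> c (rep (fst q)) \<otimes> trY (\<beta> (rep (fst q))) (snd q)"
          by (rule Y.tr_act_left[OF l(2) e(2,3) g])
        then show "(fst q, actX (actX (\<xi> (rep (fst q))) (\<gamma> c (rep (fst q))))
          (trY (actY (\<beta> (rep (fst q))) (\<gamma> c (rep (fst q)))) (snd q))) = compare q"
          using X.act_inv_cancel[OF l(1) g Y.tr_closed(1)[OF l(2) e(2,3)]]
          by (simp add: compare_def case_prod_unfold)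
      qed
    qed
    ultimately show "\<exists>N. openin PY N \<and> p \<in> N \<and> continuous_map (subtopology PY N) (prod_topology Z X) compare"
      by blast
  qed
  have B: "compare q \<in> {(z, x). bX z = prX x}" if "q \<in> topspace PY" for q
    using compare_in[of "fst q" "snd q"] that by auto
  show ?thesis
    unfolding continuous_map_in_subtopology by (intro conjI A Pi_I B)
qed

text \<open>The hypotheses are symmetric in the two sides. So the inverse of \<open>compare\<close>
  is the same construction with the roles exchanged, and its continuity comes for free.\<close>

lemma common_lift_swap: "common_lift G T Y actY prY trY X actX prX trX Z0 Z \<zeta> \<beta> \<xi> bY bX C U \<gamma>"
  by (intro common_lift.intro common_lift_axioms.intro X.principal_space_axioms Y.principal_space_axioms)
    (fact quotient \<xi> \<beta> bX bY U \<gamma> saturated gauge_X gauge_Y cover)+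

lemma homeomorphic_map_compare: "homeomorphic_map PY PX compare"
proof -
  interpret swap: common_lift G T Y actY prY trY X actX prX trX Z0 Z \<zeta> \<beta> \<xi> bY bX C U \<gamma>
    by (rule common_lift_swap)
  have 1: "swap.compare (compare q) = q" if q: "q \<in> topspace PY" for q
  proof -
    obtain z y where [simp]: "q = (z, y)" by fastforce
    note e = PY_D[of z y] and l = lift_closed[of "rep z"]
    have e: "z \<in> topspace Z" "y \<in> topspace Y" "prY (\<beta> (rep z)) = prY y" "rep z \<in> topspace Z0"
      using PY_D[of z y] q by auto
    note l = lift_closed[OF e(4)]
    show ?thesis
      using X.tr_act[OF l(1) Y.tr_closed(1)[OF l(2) e(2,3)]] Y.tr_closed(2)[OF l(2) e(2,3)]
      by (simp add: compare_def swap.compare_def)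
  qed
  have 2: "compare (swap.compare q) = q" if q: "q \<in> topspace PX" for q
  proof -
    obtain z x where [simp]: "q = (z, x)" by fastforce
    have e: "z \<in> topspace Z" "x \<in> topspace X" "prX (\<xi> (rep z)) = prX x" "rep z \<in> topspace Z0"
      using swap.PY_D[of z x] q by auto
    note l = lift_closed[OF e(4)]
    show ?thesis
      using Y.tr_act[OF l(2) X.tr_closed(1)[OF l(1) e(2,3)]] X.tr_closed(2)[OF l(1) e(2,3)]
      by (simp add: compare_def swap.compare_def)
  qed
  have "homeomorphic_maps PY PX compare swap.compare"
    unfolding homeomorphic_maps_def
    using compare_continuous swap.compare_continuous 1 2 by blast
  then show ?thesis
    by (rule homeomorphic_maps_imp_map)
qed

lemma compare_act:
  assumes "(z, y) \<in> topspace PY" "g \<in> carrier G"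
  shows "compare (z, actY y g) = (z, actX (snd (compare (z, y))) g)" "fst (compare (z, y)) = z"
proof -
  note e = PY_D[OF assms(1)]
  note l = lift_closed[OF e(4)]
  show "compare (z, actY y g) = (z, actX (snd (compare (z, y))) g)"
    using Y.tr_act_right[OF l(2) e(2,3) assms(2)] X.act_mult[OF l(1) Y.tr_closed(1)[OF l(2) e(2,3)] assms(2)]
    by (simp add: compare_def)
qed (simp add: compare_def)

lemma bundle_isomorphic_pullbacks:
  assumes "total BX = X" "projection BX = prX" "action BX = actX"
    and "total BY = Y" "projection BY = prY" "action BY = actY"
  shows "bundle_isomorphic G (pullback_bundle Z bY BY) (pullback_bundle Z bX BX)"
  unfolding bundle_isomorphic_def
proof (intro conjI exI[of _ compare] ballI)
  show "homeomorphic_map (total (pullback_bundle Z bY BY)) (total (pullback_bundle Z bX BX)) compare"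
    using homeomorphic_map_compare by (simp add: pullback_bundle_def assms)
  fix e assume e: "e \<in> topspace (total (pullback_bundle Z bY BY))"
  obtain z y where [simp]: "e = (z, y)" by fastforce
  have zy: "(z, y) \<in> topspace PY" using e by (simp add: pullback_bundle_def assms)
  show "projection (pullback_bundle Z bX BX) (compare e) = projection (pullback_bundle Z bY BY) e"
    by (simp add: pullback_bundle_def compare_def)
  fix g assume "g \<in> carrier G"
  then show "compare (action (pullback_bundle Z bY BY) e g) = action (pullback_bundle Z bX BX) (compare e) g"
    using compare_act[OF zy] by (simp add: pullback_bundle_def assms case_prod_unfold prod_eq_iff)
qed (simp add: pullback_bundle_def)

end

section \<open>The realization of a prismatic set as a quotient\<close>

abbreviation prism_point :: "'x prismatic \<Rightarrow> nat \<times> (nat \<Rightarrow> real) \<times> 'x mpoint \<Rightarrow> 'x ppoint set" where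
  "prism_point P \<equiv> \<lambda>(p, t, w). prism_class P (p, t, multi_class P p w)"

abbreviation prism_points :: "'x prismatic \<Rightarrow> (nat \<times> (nat \<Rightarrow> real) \<times> 'x mpoint) topology" where
  "prism_points P \<equiv> level_sum (multi_sum P)"

lemma topspace_multi_sum:
  "(qs, s, x) \<in> topspace (multi_sum P p) \<longleftrightarrow> length qs = Suc p \<and> s \<in> topspace (multisimplex qs) \<and> x \<in> cells P qs"
  by (auto simp: multi_sum_def)

lemma topspace_prism_points:
  "(p, t, qs, s, x) \<in> topspace (prism_points P) \<longleftrightarrow>
     length qs = Suc p \<and> t \<in> standard_simplex p \<and> s \<in> topspace (multisimplex qs) \<and> x \<in> cells P qs"
  by (auto simp: topspace_level_sum topspace_multi_sum)

text \<open>Turns the realization in two steps into a single quotient of a sum of prisms. Maps out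
  of the realization can then be described and tested on points \<open>(p, t, qs, s, x)\<close>
  without touching the intermediate classes.\<close>

lemma quotient_map_prism_point: "quotient_map (prism_points P) (prism_real P) (prism_point P)"
proof -
  have "quotient_map (prism_points P) (level_sum (multi_real P)) (\<lambda>(p, x). (p, (\<lambda>(t, w). (t, multi_class P p w)) x))"
    unfolding level_sum_def
  proof (rule quotient_map_sum_topology)
    fix p
    have "quotient_map (multi_sum P p) (multi_real P p) (multi_class P p)"
      unfolding multi_real_def multi_class_def[abs_def] by (rule quotient_map_glue)
    then show "quotient_map (prod_topology (std_simplex p) (multi_sum P p)) (prod_topology (std_simplex p) (multi_real P p)) (\<lambda>(t, w). (t, multi_class P p w))"
      by (intro quotient_map_prod_right locally_compact_space_simplex) (simp_all add: Hausdorff_space_simplex)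
  qed
  moreover have "quotient_map (level_sum (multi_real P)) (prism_real P) (prism_class P)"
    unfolding prism_real_def prism_class_def[abs_def] by (rule quotient_map_glue)
  ultimately have "quotient_map (prism_points P) (prism_real P) (prism_class P \<circ> (\<lambda>(p, x). (p, (\<lambda>(t, w). (t, multi_class P p w)) x)))"
    by (rule quotient_map_compose)
  then show ?thesis
    by (rule quotient_map_eq) (auto simp: comp_def)
qed

text \<open>What the two nested lifts in \<open>lift_prism\<close> need in order to be well defined:
  invariance under the identifications within level \<open>p\<close> for each fixed
  \<open>t\<close>, and under those between neighbouring levels.\<close>

definition prism_invariant :: "'x prismatic \<Rightarrow> (nat \<Rightarrow> (nat \<Rightarrow> real) \<Rightarrow> 'x mpoint \<Rightarrow> 'b) \<Rightarrow> bool" where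
  "prism_invariant P f \<longleftrightarrow>
     (\<forall>p. \<forall>t\<in>standard_simplex p. \<forall>(w, w')\<in>multi_rel P p. f p t w = f p t w') \<and>
     (\<forall>p. \<forall>t\<in>standard_simplex p. \<forall>qs s x k. length qs = Suc (Suc p) \<and> k \<le> Suc p \<and> s \<in> topspace (multisimplex qs) \<and> x \<in> cells P qs \<longrightarrow>
        f (Suc p) (simplical_face k t) (qs, s, x) = f p t (remove_nth k qs, delete_at k s, bface P qs k x))"

lemma prism_invariantI:
  assumes "\<And>p t qs s x i j. t \<in> standard_simplex p \<Longrightarrow> length qs = Suc p \<Longrightarrow> i < length qs \<Longrightarrow> 1 \<le> qs ! i \<Longrightarrow> j \<le> qs ! i \<Longrightarrow>
      s \<in> topspace (multisimplex (down qs i)) \<Longrightarrow> x \<in> cells P qs \<Longrightarrow>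
      f p t (qs, s(i := simplical_face j (s i)), x) = f p t (down qs i, s, dface P qs i j x)"
    and "\<And>p t qs s x i j. t \<in> standard_simplex p \<Longrightarrow> length qs = Suc p \<Longrightarrow> i < length qs \<Longrightarrow> j \<le> qs ! i \<Longrightarrow>
      s \<in> topspace (multisimplex (up qs i)) \<Longrightarrow> x \<in> cells P qs \<Longrightarrow>
      f p t (qs, s(i := codegen j (s i)), x) = f p t (up qs i, s, ddegen P qs i j x)"
    and "\<And>p t qs s x k. t \<in> standard_simplex p \<Longrightarrow> length qs = Suc (Suc p) \<Longrightarrow> k < length qs \<Longrightarrow>
      s \<in> topspace (multisimplex qs) \<Longrightarrow> x \<in> cells P qs \<Longrightarrow>
      f (Suc p) (simplical_face k t) (qs, s, x) = f p t (remove_nth k qs, delete_at k s, bface P qs k x)"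
  shows "prism_invariant P f"
  unfolding prism_invariant_def multi_rel_def
  using assms by (auto simp: less_Suc_eq_le)

lemma lift_prism_point:
  assumes P: "prismatic_set P" and inv: "prism_invariant P f"
    and u: "(p, t, w) \<in> topspace (prism_points P)"
  shows "lift_prism f (prism_point P (p, t, w)) = f p t w"
proof -
  have inner: "lift (f p t) (multi_class P p w) = f p t w"
    if "t \<in> standard_simplex p" "w \<in> topspace (multi_sum P p)" for p t w
    unfolding multi_class_def
    by (rule lift_glue_class[OF that(2)]) (use inv that(1) in \<open>fastforce simp: prism_invariant_def\<close>)
  have tw: "t \<in> standard_simplex p" "w \<in> topspace (multi_sum P p)"
    using u by (auto simp: topspace_level_sum)
  have "lift (\<lambda>(p, t, z). lift (f p t) z) (glue_class (level_sum (multi_real P)) (prism_rel P) (p, t, multi_class P p w))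
      = (\<lambda>(p, t, z). lift (f p t) z) (p, t, multi_class P p w)"
  proof (rule lift_glue_class)
    show "(p, t, multi_class P p w) \<in> topspace (level_sum (multi_real P))"
      using tw by (simp add: topspace_level_sum multi_real_def multi_class_def glue_class_in_topspace)
    fix a b assume "(a, b) \<in> prism_rel P"
    then obtain p k t qs s x where ab: "a = (Suc p, simplical_face k t, multi_class P (Suc p) (qs, s, x))"
       "b = (p, t, multi_class P p (remove_nth k qs, delete_at k s, bface P qs k x))"
       and *: "length qs = Suc (Suc p)" "k \<le> Suc p" "t \<in> standard_simplex p" "s \<in> topspace (multisimplex qs)" "x \<in> cells P qs"
      unfolding prism_rel_def by blast
    have "bface P qs k x \<in> cells P (remove_nth k qs)"
      using P[unfolded prismatic_set_def, THEN conjunct2, THEN conjunct1, rule_format, of qs x k] * by simp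
    then have "lift (f p t) (multi_class P p (remove_nth k qs, delete_at k s, bface P qs k x)) = f p t (remove_nth k qs, delete_at k s, bface P qs k x)"
      using * delete_at_in_multisimplex[of s qs k] by (intro inner) (auto simp: topspace_multi_sum)
    moreover have "lift (f (Suc p) (simplical_face k t)) (multi_class P (Suc p) (qs, s, x)) = f (Suc p) (simplical_face k t) (qs, s, x)"
      using * by (intro inner) (auto simp: topspace_multi_sum face_in_simplex)
    moreover have "f (Suc p) (simplical_face k t) (qs, s, x) = f p t (remove_nth k qs, delete_at k s, bface P qs k x)"
      using inv * unfolding prism_invariant_def by blast
    ultimately show "(\<lambda>(p, t, z). lift (f p t) z) a = (\<lambda>(p, t, z). lift (f p t) z) b"
      by (simp add: ab)
  qed
  then show ?thesis
    using inner[OF tw] by (simp add: lift_prism_def prism_class_def)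
qed

text \<open>The way equality of classes is exploited: every invariant function takes equal values,
  so the generated equivalence relation never has to be unwound.\<close>

lemma prism_point_eqD:
  assumes "prismatic_set P" "prism_invariant P f"
    and "(p, t, w) \<in> topspace (prism_points P)" "(p', t', w') \<in> topspace (prism_points P)"
    and "prism_point P (p, t, w) = prism_point P (p', t', w')"
  shows "f p t w = f p' t' w'"
  using lift_prism_point[OF assms(1,2,3)] lift_prism_point[OF assms(1,2,4)] assms(5) by simp

lemma prism_point_face:
  assumes P: "prismatic_set P" and t: "t \<in> standard_simplex p"
    and qs: "length qs = Suc p" "i < length qs" "1 \<le> qs ! i" "j \<le> qs ! i"
    and s: "s \<in> topspace (multisimplex (down qs i))" and x: "x \<in> cells P qs"
  shows "prism_point P (p, t, qs, s(i := simplical_face j (s i)), x) = prism_point P (p, t, down qs i, s, dface P qs i j x)"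
proof -
  have "multi_class P p (qs, s(i := simplical_face j (s i)), x) = multi_class P p (down qs i, s, dface P qs i j x)"
    unfolding multi_class_def
  proof (rule glue_class_eqI)
    show "((qs, s(i := simplical_face j (s i)), x), (down qs i, s, dface P qs i j x)) \<in> multi_rel P p"
      unfolding multi_rel_def using assms by (auto simp: less_Suc_eq_le)
    show "(qs, s(i := simplical_face j (s i)), x) \<in> topspace (multi_sum P p)"
      using face_in_multisimplex[OF s qs(2-4)] qs x by (simp add: topspace_multi_sum)
    show "(down qs i, s, dface P qs i j x) \<in> topspace (multi_sum P p)"
      using prismatic_set_dface_in[OF P[unfolded prismatic_set_def, THEN conjunct1] x qs(2-4)] qs s by (simp add: topspace_multi_sum)
  qed
  then show ?thesis by simp
qed

lemma prism_point_degen: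
  assumes P: "prismatic_set P" and t: "t \<in> standard_simplex p"
    and qs: "length qs = Suc p" "i < length qs" "j \<le> qs ! i"
    and s: "s \<in> topspace (multisimplex (up qs i))" and x: "x \<in> cells P qs"
  shows "prism_point P (p, t, qs, s(i := codegen j (s i)), x) = prism_point P (p, t, up qs i, s, ddegen P qs i j x)"
proof -
  have "multi_class P p (qs, s(i := codegen j (s i)), x) = multi_class P p (up qs i, s, ddegen P qs i j x)"
    unfolding multi_class_def
  proof (rule glue_class_eqI)
    show "((qs, s(i := codegen j (s i)), x), (up qs i, s, ddegen P qs i j x)) \<in> multi_rel P p"
      unfolding multi_rel_def using assms by (auto simp: less_Suc_eq_le)
    show "(qs, s(i := codegen j (s i)), x) \<in> topspace (multi_sum P p)"
      using codegen_in_multisimplex[OF s qs(2,3)] qs x by (simp add: topspace_multi_sum)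
    show "(up qs i, s, ddegen P qs i j x) \<in> topspace (multi_sum P p)"
      using prismatic_set_ddegen_in[OF P[unfolded prismatic_set_def, THEN conjunct1] x qs(2,3)] qs s by (simp add: topspace_multi_sum)
  qed
  then show ?thesis by simp
qed

lemma prism_point_bface:
  assumes P: "prismatic_set P" and t: "t \<in> standard_simplex p"
    and qs: "length qs = Suc (Suc p)" "k < length qs"
    and s: "s \<in> topspace (multisimplex qs)" and x: "x \<in> cells P qs"
  shows "prism_point P (Suc p, simplical_face k t, qs, s, x) = prism_point P (p, t, remove_nth k qs, delete_at k s, bface P qs k x)"
proof -
  have y: "bface P qs k x \<in> cells P (remove_nth k qs)"
    using P[unfolded prismatic_set_def, THEN conjunct2, THEN conjunct1, rule_format, of qs x k] qs x by simp
  have m: "multi_class P (Suc p) (qs, s, x) \<in> topspace (multi_real P (Suc p))"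
    "multi_class P p (remove_nth k qs, delete_at k s, bface P qs k x) \<in> topspace (multi_real P p)"
    unfolding multi_class_def multi_real_def using assms y delete_at_in_multisimplex[OF s qs(2)]
    by (auto intro!: glue_class_in_topspace simp: topspace_multi_sum)
  have "prism_class P (Suc p, simplical_face k t, multi_class P (Suc p) (qs, s, x))
      = prism_class P (p, t, multi_class P p (remove_nth k qs, delete_at k s, bface P qs k x))"
    unfolding prism_class_def
  proof (rule glue_class_eqI)
    have "k \<le> Suc p" using qs by simp
    then show "((Suc p, simplical_face k t, multi_class P (Suc p) (qs, s, x)),
        (p, t, multi_class P p (remove_nth k qs, delete_at k s, bface P qs k x))) \<in> prism_rel P"
      unfolding prism_rel_def using assms by blast
  qed (use m t qs in \<open>auto simp: topspace_level_sum face_in_simplex\<close>)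
  then show ?thesis by simp
qed

lemma prism_real_map_point:
  assumes "prismatic_map P P' m" "(p, t, qs, s, x) \<in> topspace (prism_points P)"
  shows "prism_real_map P' m (prism_point P (p, t, qs, s, x)) = prism_point P' (p, t, qs, s, m qs x)"
    and "(p, t, qs, s, m qs x) \<in> topspace (prism_points P')"
proof -
  note c = assms(1)[unfolded prismatic_map_def]
  note P = c[THEN conjunct1] and P' = c[THEN conjunct2, THEN conjunct1]
    and m = c[THEN conjunct2, THEN conjunct2, rule_format]
  have mc: "m qs x \<in> cells P' qs" if "length qs = Suc p" "x \<in> cells P qs" for qs x p
    using m[of qs x, THEN conjunct1] that by force
  have "prism_invariant P (\<lambda>p t (qs, s, x). prism_class P' (p, t, multi_class P' p (qs, s, m qs x)))"
  proof (rule prism_invariantI; unfold prod.case)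
    fix p t qs s x i j
    assume *: "t \<in> standard_simplex p" "length qs = Suc p" "i < length qs" "1 \<le> qs ! i" "j \<le> qs ! i"
      "s \<in> topspace (multisimplex (down qs i))" "x \<in> cells P qs"
    then have "m (down qs i) (dface P qs i j x) = dface P' qs i j (m qs x)"
      using m[of qs x, THEN conjunct2, THEN conjunct1, rule_format, of i j] by force
    then show "prism_class P' (p, t, multi_class P' p (qs, s(i := simplical_face j (s i)), m qs x))
        = prism_class P' (p, t, multi_class P' p (down qs i, s, m (down qs i) (dface P qs i j x)))"
      using prism_point_face[OF P' *(1-6) mc[OF *(2,7)]] by simp
  next
    fix p t qs s x i j
    assume *: "t \<in> standard_simplex p" "length qs = Suc p" "i < length qs" "j \<le> qs ! i"
      "s \<in> topspace (multisimplex (up qs i))" "x \<in> cells P qs"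
    then have "m (up qs i) (ddegen P qs i j x) = ddegen P' qs i j (m qs x)"
      using m[of qs x, THEN conjunct2, THEN conjunct1, rule_format, of i j] by force
    then show "prism_class P' (p, t, multi_class P' p (qs, s(i := codegen j (s i)), m qs x))
        = prism_class P' (p, t, multi_class P' p (up qs i, s, m (up qs i) (ddegen P qs i j x)))"
      using prism_point_degen[OF P' *(1-5) mc[OF *(2,6)]] by simp
  next
    fix p t qs s x k
    assume *: "t \<in> standard_simplex p" "length qs = Suc (Suc p)" "k < length qs" "s \<in> topspace (multisimplex qs)" "x \<in> cells P qs"
    then have "m (remove_nth k qs) (bface P qs k x) = bface P' qs k (m qs x)"
      using m[of qs x, THEN conjunct2, THEN conjunct2, rule_format, of k] by force
    then show "prism_class P' (Suc p, simplical_face k t, multi_class P' (Suc p) (qs, s, m qs x))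
        = prism_class P' (p, t, multi_class P' p (remove_nth k qs, delete_at k s, m (remove_nth k qs) (bface P qs k x)))"
      using prism_point_bface[OF P' *(1-4) mc[OF *(2,5)]] by simp
  qed
  from lift_prism_point[OF P this assms(2)]
  show "prism_real_map P' m (prism_point P (p, t, qs, s, x)) = prism_point P' (p, t, qs, s, m qs x)"
    by (simp add: prism_real_map_def)
  show "(p, t, qs, s, m qs x) \<in> topspace (prism_points P')"
    using assms(2) mc by (simp add: topspace_prism_points)
qed

section \<open>The two lifts\<close>

lemma extra_last: "qs \<noteq> [] \<Longrightarrow> extra qs (length qs - 1) = star_dim qs"
  using Suc_star_dim[of qs] block_start_Suc[of qs "length qs - 1"] by (simp add: extra_def)

context transition_functions
begin

text \<open>After the transports along the stages up to the last extra vertex, the closing transport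
  back to the extra vertex \<open>j\<close> is taken at the full point, the one over which
  \<open>F\<close> is considered.\<close>

definition coef_end :: "nat list \<Rightarrow> 's \<Rightarrow> (nat \<Rightarrow> real) \<Rightarrow> (nat \<Rightarrow> nat \<Rightarrow> real) \<Rightarrow> nat \<Rightarrow> 'g" where
  "coef_end qs x t s j = R (extra qs j) (extra qs (length qs - 1)) (star_dim qs) x (stage_point qs (length qs) t s)
     \<otimes> coef qs x t s (length qs - 1)"

text \<open>Lifts to \<open>F\<close> and to EG, both referred to the extra vertex \<open>j\<close>.
  The same normalization in the two components is what makes them invariant together under all
  identifications that leave block \<open>j\<close> in place.\<close>

definition framed :: "nat \<Rightarrow> nat \<Rightarrow> (nat \<Rightarrow> real) \<Rightarrow> 's mpoint
    \<Rightarrow> (nat \<times> (nat \<Rightarrow> real) \<times> 's \<times> 'g) set \<times> (nat \<times> (nat \<Rightarrow> real) \<times> (nat \<Rightarrow> 'g)) set" where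
  "framed j p t = (\<lambda>(qs, s, x). (frame (extra qs j) (star_dim qs) (stage_point qs (length qs) t s) x,
     EG_class T (p, t, \<lambda>i\<in>{..p}. coef qs x t s i \<otimes> inv coef_end qs x t s j)))"

lemma coef_end_closed:
  "x \<in> ssimp S (star_dim qs) \<Longrightarrow> (t, s) \<in> D qs \<Longrightarrow> j < length qs \<Longrightarrow> coef_end qs x t s j \<in> carrier G"
  unfolding coef_end_def by (intro m_closed stage_closed coef_closed) auto

lemma framed_dface:
  assumes x: "x \<in> ssimp S (star_dim qs)" and ts: "(t, s) \<in> D (down qs i)" and i: "i < length qs" "1 \<le> qs ! i" "m \<le> qs ! i"
    and p: "length qs = Suc p" and j: "j \<le> p"
  shows "framed j p t (qs, s(i := simplical_face m (s i)), x)
    = framed j p t (down qs i, s, sface S (star_dim qs) (block_start qs i + m) x)"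
proof -
  define n where "n = star_dim (down qs i)"
  have N: "star_dim qs = Suc n"
    using Suc_star_dim_down[OF i(1,2)] by (simp add: n_def)
  have sp: "stage_point (down qs i) (length qs) t s \<in> standard_simplex n"
    unfolding n_def using ts i by (intro stage_point_in_simplex) auto
  have j': "j < length qs" using j p by simp
  have le: "block_start qs i + m \<le> Suc n" "extra qs j \<le> Suc n"
    using block_le_star_dim[OF i(1)] i(3) extra_le[OF j'] N by auto
  have f: "frame (extra qs j) (Suc n) (simplical_face (block_start qs i + m) (stage_point (down qs i) (length qs) t s)) x
      = frame (extra (down qs i) j) n (stage_point (down qs i) (length qs) t s) (sface S (Suc n) (block_start qs i + m) x)"
    unfolding extra_down(2)[OF i j', symmetric]
    by (rule frame_face[OF x[unfolded N] sp le extra_down(1)[OF i j']])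
  have e: "coef_end qs x t (s(i := simplical_face m (s i))) j
      = coef_end (down qs i) (sface S (star_dim qs) (block_start qs i + m) x) t s j"
    unfolding coef_end_def length_list_update
    using R_dface[OF x ts i j', of p "length qs"] coef_dface[OF x ts i, of p] p by simp
  have c: "coef qs x t (s(i := simplical_face m (s i))) l = coef (down qs i) (sface S (star_dim qs) (block_start qs i + m) x) t s l"
    if "l \<le> p" for l
    using coef_dface[OF x ts i, of l] that p by simp
  show ?thesis
    unfolding framed_def prod.case e stage_point_face[OF i ts[unfolded topspace_prod_topology, THEN SigmaD2]] length_list_update
    using f c by (simp add: N n_def cong: restrict_cong)
qed

lemma framed_ddegen:
  assumes x: "x \<in> ssimp S (star_dim qs)" and ts: "(t, s) \<in> D (up qs i)" and i: "i < length qs" "m \<le> qs ! i"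
    and p: "length qs = Suc p" and j: "j \<le> p"
  shows "framed j p t (qs, s(i := codegen m (s i)), x)
    = framed j p t (up qs i, s, sdegen S (star_dim qs) (block_start qs i + m) x)"
proof -
  note N = star_dim_up[OF i(1)]
  have sp: "stage_point (up qs i) (length qs) t s \<in> standard_simplex (Suc (star_dim qs))"
    unfolding N[symmetric] using ts i by (intro stage_point_in_simplex) auto
  have j': "j < length qs" using j p by simp
  have le: "block_start qs i + m \<le> star_dim qs" "extra (up qs i) j \<le> Suc (star_dim qs)"
    using block_le_star_dim[OF i(1)] i(2) extra_le[of j "up qs i"] j' N by auto
  have f: "frame (extra qs j) (star_dim qs) (codegen (block_start qs i + m) (stage_point (up qs i) (length qs) t s)) x
      = frame (extra (up qs i) j) (Suc (star_dim qs)) (stage_point (up qs i) (length qs) t s) (sdegen S (star_dim qs) (block_start qs i + m) x)"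
    unfolding frame_degen[OF x sp le] extra_up[OF i j'] ..
  have e: "coef_end qs x t (s(i := codegen m (s i))) j
      = coef_end (up qs i) (sdegen S (star_dim qs) (block_start qs i + m) x) t s j"
    unfolding coef_end_def length_list_update
    using R_ddegen[OF x ts i j', of p "length qs"] coef_ddegen[OF x ts i, of p] p by simp
  have c: "coef qs x t (s(i := codegen m (s i))) l = coef (up qs i) (sdegen S (star_dim qs) (block_start qs i + m) x) t s l"
    if "l \<le> p" for l
    using coef_ddegen[OF x ts i, of l] that p by simp
  show ?thesis
    unfolding framed_def prod.case e stage_point_codegen[OF i ts[unfolded topspace_prod_topology, THEN SigmaD2]] length_list_update
    using f c by (simp add: N cong: restrict_cong)
qed

text \<open>All coefficients and \<open>coef_end\<close> acquire the same right factor
  \<open>?g\<close>, so their quotients do not change, and the frame at a surviving vertex is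
  preserved by \<open>frame_block_face\<close>. In EG the loss of the k-th coordinate is the face
  relation.\<close>

lemma framed_bface:
  assumes x: "x \<in> ssimp S (star_dim qs)" and len: "length qs = Suc (Suc p)" and k: "k < length qs"
    and t: "t \<in> standard_simplex p" and s: "s \<in> topspace (multisimplex qs)" and j: "j \<le> p"
  shows "framed (if j < k then j else Suc j) (Suc p) (simplical_face k t) (qs, s, x)
    = framed j p t (remove_nth k qs, delete_at k s, bface (prism_star S) qs k x)"
proof -
  let ?a = "\<lambda>j. if j < k then j else Suc j"
  let ?rem = "remove_nth k qs" and ?y = "bface (prism_star S) qs k x" and ?s = "delete_at k s" and ?t = "simplical_face k t"
  let ?g = "if k = 0 then R (extra qs 1) (extra qs 0) (star_dim qs) x (stage_point qs 0 (simplical_face k t) s) else \<one>"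
  let ?P = "stage_point qs (length qs) ?t s" and ?Q = "stage_point ?rem (Suc p) t ?s"
  have D: "(?t, s) \<in> D qs" using t s k len by (auto intro!: face_in_simplex)
  have lenr: "length ?rem = Suc p" using len k by simp
  have D': "(t, ?s) \<in> D ?rem" using t lenr delete_at_in_multisimplex[OF s k] by simp
  have Q: "?Q \<in> standard_simplex (star_dim ?rem)"
    using D' lenr by (intro stage_point_in_simplex) auto
  have y: "?y \<in> ssimp S (star_dim ?rem)"
    using bface_star_in[of x qs k] x len k unfolding cells_star by (cases "qs = []") auto
  have PQ: "?P = block_face (block_start qs k) (qs ! k + 2) ?Q"
    unfolding stage_point_block_face[OF len k s] using len k by simp
  have P: "?P \<in> standard_simplex (star_dim qs)"
    using D len by (intro stage_point_in_simplex) auto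
  have j': "j < Suc p" "?a j < length qs" using j len by auto
  have g: "?g \<in> carrier G" using stage_closed[OF x D, of 1 0 0] len by auto
  have c: "coef qs x ?t s (?a l) = coef ?rem ?y t ?s l \<otimes> ?g" if "l \<le> p" for l
    using coef_bface[OF x len k t s, of l] that by simp
  have e: "coef_end qs x ?t s (?a j) = coef_end ?rem ?y t ?s j \<otimes> ?g"
  proof -
    have "coef_end qs x ?t s (?a j) = R (extra qs (?a j)) (extra qs (?a p)) (star_dim qs) x ?P \<otimes> coef qs x ?t s (?a p)"
    proof (cases "k = Suc p")
      case False
      then show ?thesis using k len by (simp add: coef_end_def)
    next
      \<comment> \<open>The last block is deleted, and with it the vertex from which the closing
        transport starts. On this face the last stage before the full point already equals
        \<open>?P\<close>, so arriving at the lost vertex and leaving it again compose to a direct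
        transport from the extra vertex \<open>p\<close>.\<close>
      case True
      have st: "stage_point qs (Suc p) ?t s = ?P"
        unfolding stage_point_block_face[OF len k s] using True len by simp
      have ex: "extra qs (?a j) \<le> star_dim qs" "extra qs (Suc p) \<le> star_dim qs" "extra qs p \<le> star_dim qs"
        using extra_le j' len by auto
      have "coef qs x ?t s p \<in> carrier G"
        using coef_closed[OF x D] len by simp
      from m_assoc[OF R_closed[OF x P ex(1,2)] R_closed[OF x P ex(2,3)] this]
      show ?thesis
        unfolding coef_end_def len diff_Suc_1 coef.simps st using True len R_trans[OF x P ex] by simp
    qed
    also have "\<dots> = R (extra ?rem j) (extra ?rem p) (star_dim ?rem) ?y ?Q \<otimes> (coef ?rem ?y t ?s p \<otimes> ?g)"
      unfolding PQ R_remove_block[OF x len k Q j'(1) lessI] c[OF order_refl] ..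
    also have "\<dots> = coef_end ?rem ?y t ?s j \<otimes> ?g"
      unfolding coef_end_def lenr using g stage_closed[OF y D', of j p "Suc p"] coef_closed[OF y D', of p] lenr j
      by (simp add: m_assoc)
    finally show ?thesis .
  qed
  have fr: "frame (extra qs (?a j)) (star_dim qs) ?P x = frame (extra ?rem j) (star_dim ?rem) ?Q ?y"
  proof -
    let ?n = "star_dim ?rem" and ?m = "qs ! k + 2" and ?B = "block_start qs k"
    have N: "star_dim qs = ?n + ?m" using star_dim_remove_nth[OF k] len by simp
    note e = extra_skip[OF len k j'(1)]
    have "?B \<le> Suc ?n" using block_le_star_dim[OF k] N by simp
    from frame_block_face[OF x[unfolded N] Q this e(1)[unfolded N] e(2)]
    show ?thesis unfolding e(3) PQ bface_star N .
  qed
  have "EG_class T (Suc p, ?t, \<lambda>i\<in>{..Suc p}. coef qs x ?t s i \<otimes> inv coef_end qs x ?t s (?a j))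
      = EG_class T (p, t, delete_at k (\<lambda>i\<in>{..Suc p}. coef qs x ?t s i \<otimes> inv coef_end qs x ?t s (?a j)))"
    using coef_closed[OF x D] coef_end_closed[OF x D j'(2)] t k len
    by (intro EG_class_face) (auto simp: topspace_EG_levels)
  also have "delete_at k (\<lambda>i\<in>{..Suc p}. coef qs x ?t s i \<otimes> inv coef_end qs x ?t s (?a j))
      = (\<lambda>i\<in>{..p}. coef ?rem ?y t ?s i \<otimes> inv coef_end ?rem ?y t ?s j)"
  proof
    fix i
    show "delete_at k (\<lambda>i\<in>{..Suc p}. coef qs x ?t s i \<otimes> inv coef_end qs x ?t s (?a j)) i
        = (\<lambda>i\<in>{..p}. coef ?rem ?y t ?s i \<otimes> inv coef_end ?rem ?y t ?s j) i"
    proof (cases "i \<le> p")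
      case True
      have cl: "coef ?rem ?y t ?s i \<in> carrier G" "coef_end ?rem ?y t ?s j \<in> carrier G"
        using coef_closed[OF y D'] coef_end_closed[OF y D'] True j lenr by auto
      have "delete_at k (\<lambda>i\<in>{..Suc p}. coef qs x ?t s i \<otimes> inv coef_end qs x ?t s (?a j)) i
          = coef qs x ?t s (?a i) \<otimes> inv coef_end qs x ?t s (?a j)"
        using True by (simp add: delete_at_def)
      also have "\<dots> = coef ?rem ?y t ?s i \<otimes> ?g \<otimes> (inv ?g \<otimes> inv coef_end ?rem ?y t ?s j)"
        unfolding e c[OF True] inv_mult_group[OF cl(2) g] ..
      also have "\<dots> = coef ?rem ?y t ?s i \<otimes> inv coef_end ?rem ?y t ?s j"
        by (rule mult_inv_mult[OF cl(1) g inv_closed[OF cl(2)]])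
      finally show ?thesis using True by simp
    qed (use k len in \<open>simp add: delete_at_def\<close>)
  qed
  finally show ?thesis
    unfolding framed_def prod.case using fr by (simp only: lenr)
qed

end

section \<open>The projection to the realization of the simplicial set\<close>

text \<open>Interpolates between the point \<open>(t\<^sub>0 s\<^sup>0, \<dots>, t\<^sub>p s\<^sup>p)\<close> of the join and its image in the simplex of
  dimension \<open>star_dim qs\<close>: the extra vertices of the first \<open>j\<close> blocks have been inserted.\<close>

definition join_stage :: "nat list \<Rightarrow> nat \<Rightarrow> (nat \<Rightarrow> real) \<Rightarrow> (nat \<Rightarrow> nat \<Rightarrow> real) \<Rightarrow> nat \<Rightarrow> real" where
  "join_stage qs j t s = (\<lambda>n. \<Sum>i<length qs. t i * shift (block_start qs i - i + min i j) (s i) n)"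

lemma block_start_minus: "block_start qs i - i = (\<Sum>l<i. qs ! l + 1)" "i \<le> block_start qs i"
proof -
  have "block_start qs i = (\<Sum>l<i. qs ! l + 1) + i"
    by (induction i) (simp_all add: block_start_Suc)
  then show "block_start qs i - i = (\<Sum>l<i. qs ! l + 1)" "i \<le> block_start qs i" by simp_all
qed

lemma block_start_minus_le:
  assumes "i < j"
  shows "block_start qs i - i + qs ! i + 1 \<le> block_start qs j - j"
  using assms
proof (induction j)
  case (Suc j)
  then show ?case
    unfolding block_start_minus by (cases "i = j") auto
qed simp

lemma block_start_length: "block_start qs (length qs) - length qs = sum_list qs + length qs"
  unfolding block_start_minus sum.distrib by (simp add: sum_list_sum_nth atLeast0LessThan)

lemma join_stage_0:
  assumes "s \<in> topspace (multisimplex qs)"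
  shows "join_stage qs 0 t s = join_point qs t s"
  unfolding join_stage_def join_point_def Let_def block_start_minus
proof (intro ext sum.cong refl)
  fix n i assume "i \<in> {..<length qs}"
  then have "s i l = 0" if "qs ! i < l" for l
    using simplex_support[OF multisimplex_component[OF assms]] that by simp
  then show "t i * shift ((\<Sum>l<i. qs ! l + 1) + min i 0) (s i) n
      = (if (\<Sum>l<i. qs ! l + 1) \<le> n \<and> n \<le> (\<Sum>l<i. qs ! l + 1) + qs ! i then t i * s i (n - (\<Sum>l<i. qs ! l + 1)) else 0)"
    by (auto simp: shift_def)
qed

lemma join_stage_length: "join_stage qs (length qs) t s = stage_point qs (length qs) t s"
  unfolding join_stage_def stage_point_def
  by (intro ext sum.cong refl) (use block_start_minus(2) in simp)

lemma join_stage_in_simplex: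
  assumes "length qs = Suc p" "t \<in> standard_simplex p" "s \<in> topspace (multisimplex qs)"
  shows "join_stage qs j t s \<in> standard_simplex (sum_list qs + p + j)"
  unfolding join_stage_def assms(1) lessThan_Suc_atMost
proof (rule convex_combination_in_simplex[OF assms(2)])
  fix i assume "i \<le> p"
  then have i: "i < length qs" using assms by simp
  show "shift (block_start qs i - i + min i j) (s i) \<in> standard_simplex (sum_list qs + p + j)"
    by (rule shift_in_simplex[OF multisimplex_component[OF assms(3) i]])
      (use block_start_minus_le[OF i, of qs] block_start_length[of qs] assms(1) in simp)
qed

text \<open>Blocks up to \<open>j\<close> lie below the inserted extra vertex and stay; later blocks
  move up by one. This is the change from \<open>min i j\<close> to \<open>min i (Suc j)\<close> in
  the shift.\<close>

lemma join_stage_face: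
  assumes j: "j < length qs" and s: "s \<in> topspace (multisimplex qs)"
  shows "simplical_face (extra qs j) (join_stage qs j t s) = join_stage qs (Suc j) t s"
  unfolding join_stage_def face_sum
proof (intro ext sum.cong refl)
  fix n i assume "i \<in> {..<length qs}"
  then have i: "i < length qs" by simp
  have "simplical_face (extra qs j) (shift (block_start qs i - i + min i j) (s i)) = shift (block_start qs i - i + min i (Suc j)) (s i)"
  proof (cases "i \<le> j")
    case True
    then have "block_start qs i + qs ! i < extra qs j"
      using block_start_less[of i j qs] by (cases "i = j") (auto simp: extra_def)
    then show ?thesis
      using True face_shift_below[OF multisimplex_component[OF s i], of "block_start qs i" "extra qs j"] block_start_minus(2)[of i qs] by simp
  next
    case False
    then have "extra qs j \<le> block_start qs i - i + j"
      using block_start_minus_le[of j i qs] block_start_minus(2)[of j qs] by (simp add: extra_def)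
    then show ?thesis
      using False face_shift_above[of "extra qs j" "block_start qs i - i + j" "s i"] by simp
  qed
  then show "t i * simplical_face (extra qs j) (shift (block_start qs i - i + min i j) (s i)) n
      = t i * shift (block_start qs i - i + min i (Suc j)) (s i) n" by simp
qed

lemma sfaces_append: "sfaces S n (is @ [i]) x = sface S (n - length is) i (sfaces S n is x)"
  by (induction "is" arbitrary: n x) auto

context transition_functions
begin

text \<open>The formula for proj L deletes the extra vertices of \<open>x\<close>. As the point
  gives them weight zero, the face relation allows them to be reinserted one at a time, and the
  class is that of the full stage point in the undeleted simplex.\<close>

lemma join_class:
  assumes p: "length qs = Suc p" and t: "t \<in> standard_simplex p" and s: "s \<in> topspace (multisimplex qs)"
    and x: "x \<in> ssimp S (star_dim qs)"
  shows "sset_class S (sum_list qs + p, join_point qs t s,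
       sfaces S (star_dim qs) (rev (map (\<lambda>i. block_start qs i + qs ! i + 1) [0..<Suc p])) x)
    = sset_class S (star_dim qs, stage_point qs (length qs) t s, x)"
proof -
  let ?y = "\<lambda>j. sfaces S (star_dim qs) (rev (map (extra qs) [j..<Suc p])) x"
  have N: "star_dim qs = sum_list qs + p + Suc p" using p by (simp add: star_dim_def)
  have "?y 0 \<in> ssimp S (sum_list qs + p + 0) \<and>
      sset_class S (sum_list qs + p + 0, join_stage qs 0 t s, ?y 0) = sset_class S (star_dim qs, stage_point qs (length qs) t s, x)"
  \<comment> \<open>Downward induction: at \<open>j\<close> the extra vertices of the blocks from
    \<open>j\<close> on have been deleted. The highest go first, so \<open>extra qs j\<close> still
    is the correct index when its turn comes.\<close>
  proof (rule inc_induct[of 0 "Suc p"])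
    show "?y (Suc p) \<in> ssimp S (sum_list qs + p + Suc p) \<and>
      sset_class S (sum_list qs + p + Suc p, join_stage qs (Suc p) t s, ?y (Suc p)) = sset_class S (star_dim qs, stage_point qs (length qs) t s, x)"
      using x join_stage_length[of qs t s] by (simp add: N p)
  next
    fix j assume j: "j < Suc p" and IH: "?y (Suc j) \<in> ssimp S (sum_list qs + p + Suc j) \<and>
      sset_class S (sum_list qs + p + Suc j, join_stage qs (Suc j) t s, ?y (Suc j)) = sset_class S (star_dim qs, stage_point qs (length qs) t s, x)"
    have y: "?y j = sface S (Suc (sum_list qs + p + j)) (extra qs j) (?y (Suc j))"
    proof -
      have l: "rev (map (extra qs) [j..<Suc p]) = rev (map (extra qs) [Suc j..<Suc p]) @ [extra qs j]"
        using j by (simp add: upt_conv_Cons del: upt_Suc)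
      have n: "star_dim qs - length (rev (map (extra qs) [Suc j..<Suc p])) = Suc (sum_list qs + p + j)"
        using j by (simp add: N del: upt_Suc)
      show ?thesis unfolding l sfaces_append n ..
    qed
    have "extra qs j \<le> Suc (sum_list qs + p + j)"
      using block_start_minus_le[of j "length qs" qs] block_start_length[of qs] block_start_minus(2)[of j qs] j p by (simp add: extra_def)
    then show "?y j \<in> ssimp S (sum_list qs + p + j) \<and>
      sset_class S (sum_list qs + p + j, join_stage qs j t s, ?y j) = sset_class S (star_dim qs, stage_point qs (length qs) t s, x)"
      unfolding y
      using face_in[of "?y (Suc j)" "sum_list qs + p + j" "extra qs j"] IH join_stage_face[of j qs s t] j p s
        sset_class_face[OF _ join_stage_in_simplex[OF p t s, of j], of "?y (Suc j)" "extra qs j"] by simp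
  qed simp
  then show ?thesis
    unfolding join_stage_0[OF s] extra_def[abs_def] by simp
qed

text \<open>The coordinate 1 refers to the last vertex of the simplex, which by
  \<open>extra_last\<close> is the last extra vertex.\<close>

definition F_lift where
  "F_lift = (\<lambda>(p::nat, t, qs, s, x). F_class (star_dim qs, stage_point qs (length qs) t s, x, \<one>))"

text \<open>Dividing by the last coefficient refers the point of EG to the last extra vertex as
  well, in accordance with \<open>F_lift\<close>.\<close>

definition EG_lift where
  "EG_lift = (\<lambda>(p, t, qs, s, x). EG_class T (p, t, \<lambda>i\<in>{..p}. coef qs x t s i \<otimes> inv coef qs x t s p))"

definition lift_gauge where
  "lift_gauge j = (\<lambda>(p::nat, t, qs, s, x). inv W (extra qs j) (star_dim qs) x (stage_point qs (length qs) t s))"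

abbreviation star_points where "star_points \<equiv> prism_points (prism_star S)"

lemma star_points_iff:
  "(p, t, qs, s, x) \<in> topspace star_points \<longleftrightarrow> length qs = Suc p \<and> (t, s) \<in> D qs \<and> x \<in> ssimp S (star_dim qs)"
  unfolding topspace_prism_points cells_star by auto

lemma stage_in:
  "(p, t, qs, s, x) \<in> topspace star_points \<Longrightarrow> stage_point qs j t s \<in> standard_simplex (star_dim qs)"
  unfolding star_points_iff by (intro stage_point_in_simplex) auto

lemma EG_lift_in_levels:
  assumes "(p, t, qs, s, x) \<in> topspace star_points"
  shows "(\<lambda>i\<in>{..p}. coef qs x t s i \<otimes> inv coef qs x t s p) \<in> topspace (EG_levels T p)"
proof -
  have "coef qs x t s i \<in> carrier G" if "i \<le> p" for i
    using coef_closed[of x qs t s i] assms that unfolding star_points_iff by auto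
  then show ?thesis by (simp add: topspace_EG_levels)
qed

lemma lifts_in:
  assumes "z \<in> topspace star_points"
  shows "F_lift z \<in> topspace F_space" "EG_lift z \<in> topspace (EG T)"
proof -
  obtain p t qs s x where z: "z = (p, t, qs, s, x)" by (cases z) auto
  show "F_lift z \<in> topspace F_space"
    using assms stage_in[OF assms[unfolded z]] unfolding z F_lift_def prod.case star_points_iff
    by (intro F_class_in_topspace) (simp add: topspace_F_points)
  show "EG_lift z \<in> topspace (EG T)"
    using EG_lift_in_levels[of p t qs s x] assms unfolding z EG_lift_def prod.case star_points_iff
    by (intro EG_class_in_topspace) (auto simp: topspace_level_sum)
qed

lemma lift_gauge_closed:
  assumes z: "(p, t, qs, s, x) \<in> topspace star_points" and j: "j \<le> p"
  shows "lift_gauge j (p, t, qs, s, x) \<in> carrier G"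
proof -
  have "j < length qs" using z j by (auto simp: star_points_iff)
  then show ?thesis
    using stage_in[OF z] z extra_le[of j qs] by (simp add: lift_gauge_def star_points_iff)
qed

text \<open>The last extra vertex is the last vertex, where \<open>W\<close> is 1. Therefore
  \<open>coef_end\<close> is \<open>W\<close> at the extra vertex \<open>j\<close> times the last
  coefficient, and passing from the last extra vertex to \<open>j\<close> acts on both lifts by the
  same element, \<open>lift_gauge j\<close>.\<close>

lemma framed_eq:
  assumes z: "(p, t, qs, s, x) \<in> topspace star_points" and j: "j \<le> p"
  shows "framed j p t (qs, s, x) = (F_act (F_lift (p, t, qs, s, x)) (lift_gauge j (p, t, qs, s, x)), EG_act G T (EG_lift (p, t, qs, s, x)) (lift_gauge j (p, t, qs, s, x)))"
proof -
  have p: "length qs = Suc p" and ts: "(t, s) \<in> D qs" and x: "x \<in> ssimp S (star_dim qs)"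
    using z by (auto simp: star_points_iff)
  let ?P = "stage_point qs (length qs) t s" and ?W = "W (extra qs j) (star_dim qs) x (stage_point qs (length qs) t s)"
  have j': "j < length qs" using j p by simp
  have last: "extra qs p = star_dim qs" using extra_last[of qs] p by force
  note P = stage_in[OF z]
  have W: "?W \<in> carrier G" using extra_le[OF j'] P x by simp
  have c: "coef qs x t s i \<in> carrier G" if "i \<le> p" for i
    using coef_closed[OF x ts] that p by simp
  have "coef_end qs x t s j = ?W \<otimes> coef qs x t s p"
    unfolding coef_end_def R_def using W p by (simp add: last)
  then have e: "inv coef_end qs x t s j = inv coef qs x t s p \<otimes> inv ?W"
    using inv_mult_group[OF W c[OF order_refl]] by simp
  have "frame (extra qs j) (star_dim qs) ?P x = F_act (F_lift (p, t, qs, s, x)) (lift_gauge j (p, t, qs, s, x))"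
    unfolding frame_def F_lift_def lift_gauge_def prod.case using F_act_class[OF P x one_closed inv_closed[OF W]] W by simp
  moreover have "EG_act G T (EG_lift (p, t, qs, s, x)) (lift_gauge j (p, t, qs, s, x))
      = EG_class T (p, t, \<lambda>i\<in>{..p}. coef qs x t s i \<otimes> inv coef_end qs x t s j)"
  proof -
    have "(p, t, \<lambda>i\<in>{..p}. coef qs x t s i \<otimes> inv coef qs x t s p) \<in> topspace EG_points"
      using EG_lift_in_levels[OF z] ts p by (simp add: topspace_level_sum)
    from EG_act_class[OF this inv_closed[OF W]] show ?thesis
      unfolding EG_lift_def lift_gauge_def prod.case e using c W by (simp add: m_assoc cong: restrict_cong)
  qed
  ultimately show ?thesis
    unfolding framed_def prod.case by simp
qed

lemma star_points_dface:
  assumes "length qs = Suc p" "t \<in> standard_simplex p" "i < length qs" "1 \<le> qs ! i" "j \<le> qs ! i" "s \<in> topspace (multisimplex (down qs i))" "x \<in> cells (prism_star S) qs"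
  shows "(p, t, qs, s(i := simplical_face j (s i)), x) \<in> topspace star_points"
    "(p, t, down qs i, s, dface (prism_star S) qs i j x) \<in> topspace star_points"
  using assms face_in_multisimplex[OF assms(6,3-5)] prismatic_set_dface_in[OF multisimplicial_star assms(7,3-5)]
  by (simp_all add: topspace_prism_points)

lemma star_points_ddegen:
  assumes "length qs = Suc p" "t \<in> standard_simplex p" "i < length qs" "j \<le> qs ! i" "s \<in> topspace (multisimplex (up qs i))" "x \<in> cells (prism_star S) qs"
  shows "(p, t, qs, s(i := codegen j (s i)), x) \<in> topspace star_points"
    "(p, t, up qs i, s, ddegen (prism_star S) qs i j x) \<in> topspace star_points"
  using assms codegen_in_multisimplex[OF assms(5,3-4)] prismatic_set_ddegen_in[OF multisimplicial_star assms(6,3-4)]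
  by (simp_all add: topspace_prism_points)

lemma star_points_bface:
  assumes "length qs = Suc (Suc p)" "t \<in> standard_simplex p" "k < length qs" "s \<in> topspace (multisimplex qs)" "x \<in> cells (prism_star S) qs"
  shows "(Suc p, simplical_face k t, qs, s, x) \<in> topspace star_points"
    "(p, t, remove_nth k qs, delete_at k s, bface (prism_star S) qs k x) \<in> topspace star_points"
  using assms delete_at_in_multisimplex[OF assms(4,3)] bface_star_in[OF assms(5) _ assms(3)]
  by (auto simp: topspace_prism_points intro!: face_in_simplex)

lemma F_pr_F_lift:
  assumes z: "(p, t, qs, s, x) \<in> topspace star_points"
  shows "F_pr (F_lift (p, t, qs, s, x)) = sset_class S (sum_list qs + p, join_point qs t s,
       sfaces S (star_dim qs) (rev (map (\<lambda>i. block_start qs i + qs ! i + 1) [0..<Suc p])) x)"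
proof -
  have "length qs = Suc p" "t \<in> standard_simplex p" "s \<in> topspace (multisimplex qs)" "x \<in> ssimp S (star_dim qs)"
    using z by (auto simp: topspace_prism_points cells_star)
  then show ?thesis
    unfolding F_lift_def prod.case by (simp only: join_class F_pr_class[OF stage_in[OF z] _ one_closed])
qed

lemma F_pr_framed:
  assumes z: "(p, t, qs, s, x) \<in> topspace star_points" and j: "j \<le> p"
  shows "F_pr (fst (framed j p t (qs, s, x))) = F_pr (F_lift (p, t, qs, s, x))"
  using framed_eq[OF z j] F_pr_act[OF lifts_in(1)[OF z] lift_gauge_closed[OF z j]] by simp

text \<open>That the defining formula respects the identifications is not checked directly: it is
  the projection of a framed lift, and framed lifts have been shown to be invariant.\<close>

lemma proj_L_point:
  assumes "(p, t, qs, s, x) \<in> topspace star_points"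
  shows "proj_L S (prism_point (prism_star S) (p, t, qs, s, x)) = F_pr (F_lift (p, t, qs, s, x))"
proof -
  let ?f = "\<lambda>p t (qs, s, x). sset_class S (sum_list qs + p, join_point qs t s,
       sfaces S (star_dim qs) (rev (map (\<lambda>i. block_start qs i + qs ! i + 1) [0..<Suc p])) x)"
  \<comment> \<open>The projection forgets the frame, so \<open>j\<close> is free. This is used for
    d_0, where the extra vertex 0 disappears and the extra vertex 1 takes over.\<close>
  have f: "?f p t (qs, s, x) = F_pr (fst (framed j p t (qs, s, x)))" if "(p, t, qs, s, x) \<in> topspace star_points" "j \<le> p" for p t qs s x j
    unfolding prod.case F_pr_framed[OF that] F_pr_F_lift[OF that(1)] ..
  have inv: "prism_invariant (prism_star S) ?f"
  proof (rule prism_invariantI)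
    fix p t qs s x i j
    assume *: "t \<in> standard_simplex p" "length qs = Suc p" "i < length qs" "1 \<le> qs ! i" "j \<le> qs ! i"
      "s \<in> topspace (multisimplex (down qs i))" "x \<in> cells (prism_star S) qs"
    note v = star_points_dface[OF *(2,1,3-7)]
    have "framed 0 p t (qs, s(i := simplical_face j (s i)), x) = framed 0 p t (down qs i, s, dface (prism_star S) qs i j x)"
      unfolding dface_star using * v by (intro framed_dface) (auto simp: cells_star)
    then show "?f p t (qs, s(i := simplical_face j (s i)), x) = ?f p t (down qs i, s, dface (prism_star S) qs i j x)"
      unfolding f[OF v(1) le0] f[OF v(2) le0] by simp
  next
    fix p t qs s x i j
    assume *: "t \<in> standard_simplex p" "length qs = Suc p" "i < length qs" "j \<le> qs ! i"
      "s \<in> topspace (multisimplex (up qs i))" "x \<in> cells (prism_star S) qs"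
    note v = star_points_ddegen[OF *(2,1,3-6)]
    have "framed 0 p t (qs, s(i := codegen j (s i)), x) = framed 0 p t (up qs i, s, ddegen (prism_star S) qs i j x)"
      unfolding ddegen_star using * v by (intro framed_ddegen) (auto simp: cells_star)
    then show "?f p t (qs, s(i := codegen j (s i)), x) = ?f p t (up qs i, s, ddegen (prism_star S) qs i j x)"
      unfolding f[OF v(1) le0] f[OF v(2) le0] by simp
  next
    fix p t qs s x k
    assume *: "t \<in> standard_simplex p" "length qs = Suc (Suc p)" "k < length qs" "s \<in> topspace (multisimplex qs)" "x \<in> cells (prism_star S) qs"
    note v = star_points_bface[OF *(2,1,3-5)]
    have "framed (if 0 < k then 0 else Suc 0) (Suc p) (simplical_face k t) (qs, s, x)
        = framed 0 p t (remove_nth k qs, delete_at k s, bface (prism_star S) qs k x)"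
      using * by (intro framed_bface) (auto simp: cells_star)
    then show "?f (Suc p) (simplical_face k t) (qs, s, x) = ?f p t (remove_nth k qs, delete_at k s, bface (prism_star S) qs k x)"
      unfolding f[OF v(2) le0] using f[OF v(1), of "if 0 < k then 0 else Suc 0"] by simp
  qed
  show ?thesis
    using lift_prism_point[OF prismatic_set_star inv assms] F_pr_F_lift[OF assms] by (simp add: proj_L_def)
qed

end

section \<open>The evaluation map\<close>

context topological_group
begin

lemma ev_value:
  assumes a: "a \<in> PEG_cells T qs" and p: "length qs = Suc p" and ts: "(t, s) \<in> D qs"
  shows "lift (\<lambda>a. BG_class G T (EG_class T (p, t, a (t, s)))) (PBG_class G T qs a) = BG_class G T (EG_class T (p, t, a (t, s)))"
    and "(p, t, a (t, s)) \<in> topspace EG_points"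
proof -
  have "a (t, s) \<in> topspace (EG_levels T p)"
    using continuous_map_image_subset_topspace[OF PEG_cellsD(3)[OF a]] ts p by auto
  then show e: "(p, t, a (t, s)) \<in> topspace EG_points"
    using ts p by (simp add: topspace_level_sum)
  show "lift (\<lambda>a. BG_class G T (EG_class T (p, t, a (t, s)))) (PBG_class G T qs a) = BG_class G T (EG_class T (p, t, a (t, s)))"
  proof (rule lift_PBG_class[OF a])
    fix g assume g: "continuous_map (std_simplex (length qs - 1)) T g"
    have gt: "g t \<in> carrier G"
      by (rule simplex_map_closed[OF g]) (use ts in simp)
    have "PEG_act G qs a g (t, s) = (\<lambda>j\<in>{..p}. a (t, s) j \<otimes> g t)"
      using ts p by (simp add: PEG_act_def lessThan_Suc_atMost del: topspace_prod_topology)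
    then have "EG_class T (p, t, PEG_act G qs a g (t, s)) = EG_act G T (EG_class T (p, t, a (t, s))) (g t)"
      using EG_act_class[OF e gt] by simp
    then show "BG_class G T (EG_class T (p, t, PEG_act G qs a g (t, s))) = BG_class G T (EG_class T (p, t, a (t, s)))"
      using BG_class_eq_iff[OF EG_class_in_topspace[OF e] EG_act_closed[OF EG_class_in_topspace[OF e] gt]] gt by metis
  qed
qed

lemma ev_point:
  assumes a: "a \<in> PEG_cells T qs" and p: "length qs = Suc p" and ts: "(t, s) \<in> D qs"
  shows "ev G T (prism_point (prism_BG G T) (p, t, qs, s, PBG_class G T qs a)) = BG_class G T (EG_class T (p, t, a (t, s)))"
proof -
  let ?f = "\<lambda>p t (qs, s, c). lift (\<lambda>a. BG_class G T (EG_class T (p, t, a (t, s)))) c"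
  have "prism_invariant (prism_BG G T) ?f"
  proof (rule prism_invariantI; unfold prod.case)
    fix p t qs s c i j
    assume *: "t \<in> standard_simplex p" "length qs = Suc p" "i < length qs" "1 \<le> qs ! i" "j \<le> qs ! i"
      "s \<in> topspace (multisimplex (down qs i))" "c \<in> cells (prism_BG G T) qs"
    then obtain a where a: "a \<in> PEG_cells T qs" "c = PBG_class G T qs a" by (auto simp: cells_BG)
    have 1: "(t, s) \<in> D (down qs i)" "(t, s(i := simplical_face j (s i))) \<in> D qs"
      using * face_in_multisimplex[OF *(6,3-5)] by simp_all
    have 2: "length (down qs i) = Suc p" using * by simp
    show "lift (\<lambda>a. BG_class G T (EG_class T (p, t, a (t, s(i := simplical_face j (s i)))))) c
        = lift (\<lambda>a. BG_class G T (EG_class T (p, t, a (t, s)))) (dface (prism_BG G T) qs i j c)"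
      unfolding a(2) dface_BG[OF a(1) *(3-5)] ev_value(1)[OF a(1) *(2) 1(2)] ev_value(1)[OF dface_EG_in[OF a(1) *(3-5)] 2 1(1)]
      using 1 by (simp add: dface_EG del: topspace_prod_topology)
  next
    fix p t qs s c i j
    assume *: "t \<in> standard_simplex p" "length qs = Suc p" "i < length qs" "j \<le> qs ! i"
      "s \<in> topspace (multisimplex (up qs i))" "c \<in> cells (prism_BG G T) qs"
    then obtain a where a: "a \<in> PEG_cells T qs" "c = PBG_class G T qs a" by (auto simp: cells_BG)
    have 1: "(t, s) \<in> D (up qs i)" "(t, s(i := codegen j (s i))) \<in> D qs"
      using * codegen_in_multisimplex[OF *(5,3-4)] by simp_all
    have 2: "length (up qs i) = Suc p" using * by simp
    show "lift (\<lambda>a. BG_class G T (EG_class T (p, t, a (t, s(i := codegen j (s i)))))) c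
        = lift (\<lambda>a. BG_class G T (EG_class T (p, t, a (t, s)))) (ddegen (prism_BG G T) qs i j c)"
      unfolding a(2) ddegen_BG[OF a(1) *(3-4)] ev_value(1)[OF a(1) *(2) 1(2)] ev_value(1)[OF ddegen_EG_in[OF a(1) *(3-4)] 2 1(1)]
      using 1 by (simp add: ddegen_EG del: topspace_prod_topology)
  next
    fix p t qs s c k
    assume *: "t \<in> standard_simplex p" "length qs = Suc (Suc p)" "k < length qs" "s \<in> topspace (multisimplex qs)" "c \<in> cells (prism_BG G T) qs"
    then obtain a where a: "a \<in> PEG_cells T qs" "c = PBG_class G T qs a" by (auto simp: cells_BG)
    have k: "2 \<le> length qs" "k \<le> Suc p" using * by simp_all
    have 1: "(t, delete_at k s) \<in> D (remove_nth k qs)" "(simplical_face k t, s) \<in> D qs"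
      using * delete_at_in_multisimplex[OF *(4,3)] by (auto intro!: face_in_simplex)
    have 2: "length (remove_nth k qs) = Suc p" using * by simp
    have lev: "a (simplical_face k t, s) \<in> topspace (EG_levels T (Suc p))"
      using ev_value(2)[OF a(1) *(2) 1(2)] by (simp add: topspace_level_sum)
    show "lift (\<lambda>a. BG_class G T (EG_class T (Suc p, simplical_face k t, a (simplical_face k t, s)))) c
        = lift (\<lambda>a. BG_class G T (EG_class T (p, t, a (t, delete_at k s)))) (bface (prism_BG G T) qs k c)"
      unfolding a(2) bface_BG[OF a(1) k(1) *(3)] ev_value(1)[OF a(1) *(2) 1(2)] ev_value(1)[OF bface_EG_in[OF a(1) k(1) *(3)] 2 1(1)]
      bface_EG_eval[OF a(1) *(2,3,1,4)] EG_class_face[OF *(1) k(2) lev] ..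
  qed
  moreover have "(p, t, qs, s, PBG_class G T qs a) \<in> topspace (prism_points (prism_BG G T))"
    using a p ts by (auto simp: topspace_prism_points cells_BG)
  ultimately have "ev G T (prism_point (prism_BG G T) (p, t, qs, s, PBG_class G T qs a)) = ?f p t (qs, s, PBG_class G T qs a)"
    unfolding ev_def by (rule lift_prism_point[OF prismatic_set_BG])
  then show ?thesis
    unfolding prod.case ev_value(1)[OF assms] .
qed

end

context transition_functions
begin

text \<open>The value of \<open>star_map\<close> and \<open>EG_lift\<close> differ by the action of
  the inverse of the last coefficient, which BG forgets.\<close>

lemma ev_prism_m_point:
  assumes z: "(p, t, qs, s, x) \<in> topspace star_points"
  shows "(ev G T \<circ> prism_real_map (prism_BG G T) prism_m) (prism_point (prism_star S) (p, t, qs, s, x)) = BG_class G T (EG_lift (p, t, qs, s, x))"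
proof -
  have p: "length qs = Suc p" and ts: "(t, s) \<in> D qs" and x: "x \<in> ssimp S (star_dim qs)"
    using z by (auto simp: star_points_iff)
  have a: "star_map qs x \<in> PEG_cells T qs" using p x by (intro star_map_in) auto
  have c: "coef qs x t s i \<in> carrier G" if "i \<le> p" for i
    using coef_closed[OF x ts] that p by simp
  note e = ev_value(2)[OF a p ts]
  have ic: "inv coef qs x t s p \<in> carrier G" using c by simp
  have "EG_lift (p, t, qs, s, x) = EG_act G T (EG_class T (p, t, star_map qs x (t, s))) (inv coef qs x t s p)"
    unfolding EG_act_class[OF e ic] EG_lift_def prod.case
    using ts p by (simp add: star_map_def del: topspace_prod_topology cong: restrict_cong)
  then have "BG_class G T (EG_class T (p, t, star_map qs x (t, s))) = BG_class G T (EG_lift (p, t, qs, s, x))"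
    using BG_class_eq_iff[OF EG_class_in_topspace[OF e] lifts_in(2)[OF z]] ic by blast
  then show ?thesis
    unfolding comp_def prism_real_map_point(1)[OF prismatic_map_prism_m z] unfolding prism_m_def ev_point[OF a p ts] .
qed

end

section \<open>Local sections\<close>

text \<open>Cells carry the discrete topology, so each single prism, for fixed \<open>p\<close>,
  \<open>qs\<close> and \<open>x\<close>, is an open piece of the sum. Continuity is thereby reduced
  to one prism at a time.\<close>

lemma open_map_prism_piece:
  assumes "length qs = Suc p" "x \<in> cells P qs"
  shows "open_map (pdomain qs) (prism_points P) (\<lambda>(t, s). (p, t, qs, s, x))"
proof -
  have "open_map (pdomain qs) (prod_topology (std_simplex p) (prod_topology (multisimplex qs) (discrete_topology (cells P qs)))) (\<lambda>(t, s). (t, s, x))"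
    using open_map_id_prod[OF open_map_discrete_slice_right[OF assms(2)], of "std_simplex p"] assms(1) by simp
  moreover have "open_map (prod_topology (std_simplex p) (prod_topology (multisimplex qs) (discrete_topology (cells P qs))))
      (prod_topology (std_simplex p) (multi_sum P p)) (\<lambda>(t, w). (t, qs, w))"
    unfolding multi_sum_def by (intro open_map_id_prod open_map_component_injection) (simp add: assms(1))
  ultimately have "open_map (pdomain qs) (prism_points P) ((\<lambda>u. (p, u)) \<circ> ((\<lambda>(t, w). (t, qs, w)) \<circ> (\<lambda>(t, s). (t, s, x))))"
    by (intro open_map_compose[OF _ open_map_level] open_map_compose)
  then show ?thesis
    by (simp add: comp_def case_prod_unfold)
qed

lemma continuous_map_prism_points:
  assumes "\<And>p qs x. length qs = Suc p \<Longrightarrow> x \<in> cells P qs \<Longrightarrow> continuous_map (pdomain qs) Y (\<lambda>(t, s). f (p, t, qs, s, x))"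
  shows "continuous_map (prism_points P) Y f"
proof (rule continuous_map_open_pieces[where K = "{(p, qs, x). length qs = Suc p \<and> x \<in> cells P qs}"
      and A = "\<lambda>(p, qs, x). pdomain qs" and i = "\<lambda>(p, qs, x) (t, s). (p, t, qs, s, x)"])
  show "topspace (prism_points P) \<subseteq> (\<Union>k\<in>{(p, qs, x). length qs = Suc p \<and> x \<in> cells P qs}.
      (case k of (p, qs, x) \<Rightarrow> \<lambda>(t, s). (p, t, qs, s, x)) ` topspace (case k of (p, qs, x) \<Rightarrow> pdomain qs))"
  proof
    fix z assume z: "z \<in> topspace (prism_points P)"
    obtain p t qs s x where [simp]: "z = (p, t, qs, s, x)" by (cases z) auto
    show "z \<in> (\<Union>k\<in>{(p, qs, x). length qs = Suc p \<and> x \<in> cells P qs}.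
      (case k of (p, qs, x) \<Rightarrow> \<lambda>(t, s). (p, t, qs, s, x)) ` topspace (case k of (p, qs, x) \<Rightarrow> pdomain qs))"
      using z by (intro UN_I[of "(p, qs, x)"]) (auto simp: topspace_prism_points image_iff)
  qed
qed (use assms open_map_prism_piece in \<open>auto simp: case_prod_unfold\<close>)

text \<open>Apart from the points with a coordinate equal to \<open>c\<close>, the first coordinate exceeding \<open>c\<close>
  depends continuously on \<open>t\<close> and is compatible with deleting vanishing coordinates.\<close>

definition above :: "real \<Rightarrow> (nat \<Rightarrow> real) \<Rightarrow> bool" where
  "above c t \<longleftrightarrow> (\<forall>i. t i \<noteq> c) \<and> (\<exists>i. c < t i)"

definition first_above :: "real \<Rightarrow> (nat \<Rightarrow> real) \<Rightarrow> nat" where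
  "first_above c t = (LEAST i. c < t i)"

lemma first_above:
  assumes "above c t"
  shows "c < t (first_above c t)" "i < first_above c t \<Longrightarrow> t i < c"
proof -
  show "c < t (first_above c t)"
    using assms[unfolded above_def, THEN conjunct2] unfolding first_above_def by (rule LeastI_ex)
  show "t i < c" if "i < first_above c t"
    using not_less_Least[OF that[unfolded first_above_def]] assms[unfolded above_def, THEN conjunct1, rule_format, of i] by linarith
qed

lemma first_above_eqI: "c < t j \<Longrightarrow> (\<And>i. i < j \<Longrightarrow> t i < c) \<Longrightarrow> first_above c t = j"
  unfolding first_above_def by (rule Least_equality) (auto simp: not_less[symmetric] dest: less_trans intro: leI)

lemma first_above_le: "above c t \<Longrightarrow> 0 < c \<Longrightarrow> t \<in> standard_simplex p \<Longrightarrow> first_above c t \<le> p"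
  using first_above(1)[of c t] simplex_support[of t p "first_above c t"] by (metis leI less_asym)

text \<open>Since c is positive, an inserted zero neither equals nor exceeds it.\<close>

lemma above_face:
  assumes "0 < c"
  shows "above c (simplical_face k t) \<longleftrightarrow> above c t"
proof -
  have skip: "simplical_face k t (if l < k then l else Suc l) = t l" for l
    by (auto simp: simplical_face_def)
  have val: "simplical_face k t i = 0 \<or> (\<exists>l. simplical_face k t i = t l)" for i
    by (auto simp: simplical_face_def)
  show ?thesis
    unfolding above_def using assms skip val by (metis less_irrefl less_asym)
qed

lemma first_above_face:
  assumes "0 < c" "above c t"
  shows "first_above c (simplical_face k t) = (if first_above c t < k then first_above c t else Suc (first_above c t))"
proof (rule first_above_eqI)
  show "c < simplical_face k t (if first_above c t < k then first_above c t else Suc (first_above c t))"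
    using first_above(1)[OF assms(2)] by (auto simp: simplical_face_def)
  show "simplical_face k t i < c" if "i < (if first_above c t < k then first_above c t else Suc (first_above c t))" for i
    using that assms first_above(2)[OF assms(2), of i] first_above(2)[OF assms(2), of "i - 1"]
    by (auto simp: simplical_face_def split: if_splits)
qed

lemma ex_above:
  assumes "t \<in> standard_simplex p"
  shows "\<exists>c>0. above c t"
proof -
  have "(\<Sum>i\<le>p. t i) = 1" using assms by (simp add: standard_simplex_iff)
  then obtain i where i: "0 < t i"
    using assms unfolding standard_simplex_iff by (metis less_eq_real_def sum.neutral zero_neq_one)
  \<comment> \<open>The threshold must lie below some positive coordinate and avoid the finitely
    many values of \<open>t\<close>; the coordinates beyond \<open>p\<close> vanish and are avoided
    by positivity.\<close>
  have "infinite ({0<..<t i} - t ` {..p})"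
    using i by (simp add: infinite_Ioo Diff_infinite_finite)
  then obtain c where c: "0 < c" "c < t i" "c \<notin> t ` {..p}"
    by (metis DiffE greaterThanLessThan_iff infinite_imp_nonempty all_not_in_conv)
  have "t l \<noteq> c" for l
    using c simplex_support[OF assms, of l] by (cases "l \<le> p") auto
  with c show ?thesis unfolding above_def by blast
qed

context transition_functions
begin

lemma continuous_map_F_class:
  assumes "continuous_map X (std_simplex n) f" "continuous_map X T g" "x \<in> ssimp S n"
  shows "continuous_map X F_space (\<lambda>u. F_class (n, f u, x, g u))"
proof -
  have "continuous_map X (prod_topology (std_simplex n) (assoc_levels T S n)) (\<lambda>u. (f u, x, g u))"
    unfolding assoc_levels_def using assms by (intro continuous_map_pairedI) simp_all
  from continuous_map_compose[OF continuous_map_compose[OF this continuous_map_level[of n "assoc_levels T S"]] quotient_imp_continuous_map[OF quotient_map_F]]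
  show ?thesis by (simp add: comp_def)
qed

lemma F_lift_continuous: "continuous_map star_points F_space F_lift"
proof (rule continuous_map_prism_points)
  fix p qs x assume *: "length qs = Suc p" "x \<in> cells (prism_star S) qs"
  then have "continuous_map (pdomain qs) F_space (\<lambda>u. F_class (star_dim qs, stage_point qs (length qs) (fst u) (snd u), x, \<one>))"
    by (intro continuous_map_F_class continuous_map_stage_point continuous_map_one) (auto simp: cells_star)
  then show "continuous_map (pdomain qs) F_space (\<lambda>(t, s). F_lift (p, t, qs, s, x))"
    by (simp add: F_lift_def case_prod_unfold)
qed

lemma EG_lift_continuous: "continuous_map star_points (EG T) EG_lift"
proof (rule continuous_map_prism_points)
  fix p qs x assume *: "length qs = Suc p" "x \<in> cells (prism_star S) qs"
  then have x: "x \<in> ssimp S (star_dim qs)" by (simp add: cells_star)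
  have "continuous_map (pdomain qs) (EG_levels T p) (\<lambda>u. \<lambda>i\<in>{..p}. coef qs x (fst u) (snd u) i \<otimes> inv coef qs x (fst u) (snd u) p)"
    unfolding EG_levels_def continuous_map_componentwise
    using coef_continuous[OF x] *(1) by (auto intro!: continuous_map_mult continuous_map_inv)
  moreover have "continuous_map (pdomain qs) (std_simplex p) fst"
    using continuous_map_fst *(1) by simp
  ultimately have "continuous_map (pdomain qs) (prod_topology (std_simplex p) (EG_levels T p))
      (\<lambda>u. (fst u, \<lambda>i\<in>{..p}. coef qs x (fst u) (snd u) i \<otimes> inv coef qs x (fst u) (snd u) p))"
    by (rule continuous_map_pairedI[rotated])
  from continuous_map_compose[OF continuous_map_compose[OF this continuous_map_level[of p "EG_levels T"]] quotient_imp_continuous_map[OF quotient_map_EG]]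
  show "continuous_map (pdomain qs) (EG T) (\<lambda>(t, s). EG_lift (p, t, qs, s, x))"
    by (simp add: EG_lift_def case_prod_unfold comp_def)
qed

lemma lift_gauge_continuous:
  assumes "length qs = Suc p" "x \<in> ssimp S (star_dim qs)" "j \<le> p"
  shows "continuous_map (pdomain qs) T (\<lambda>u. lift_gauge j (p, fst u, qs, snd u, x))"
proof -
  have "qs \<noteq> []" "j < length qs" using assms by auto
  from continuous_map_inv[OF continuous_map_compose[OF continuous_map_stage_point[OF this(1)] W_continuous[OF assms(2) extra_le[OF this(2)]]]]
  show ?thesis by (simp add: lift_gauge_def comp_def)
qed

definition section_domain where "section_domain c = {z \<in> topspace star_points. above c (fst (snd z))}"

definition section_gauge where "section_gauge c z = lift_gauge (first_above c (fst (snd z))) z"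

text \<open>\<open>above c\<close> together with \<open>first_above c = j\<close>, expressed by
  finitely many open conditions on coordinates. On such a piece the chosen extra vertex is constant,
  so \<open>section_gauge\<close> is a single \<open>lift_gauge j\<close> and continuous.\<close>

definition section_piece :: "real \<Rightarrow> nat list \<Rightarrow> nat \<Rightarrow> ((nat \<Rightarrow> real) \<times> (nat \<Rightarrow> nat \<Rightarrow> real)) set" where
  "section_piece c qs j = {u \<in> D qs. \<forall>i\<in>{..<length qs}. fst u i \<in> (if i < j then {..<c} else if i = j then {c<..} else - {c})}"

lemma openin_section_piece: "openin (pdomain qs) (section_piece c qs j)"
  unfolding section_piece_def
proof (rule openin_finite_Ball)
  fix i
  have "continuous_map (pdomain qs) euclideanreal (\<lambda>u. fst u i)"
    using continuous_map_compose[OF continuous_map_fst simplex_coordinate] by (simp add: comp_def)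
  then show "openin (pdomain qs) {u \<in> D qs. fst u i \<in> (if i < j then {..<c} else if i = j then {c<..} else - {c})}"
    by (rule openin_continuous_map_preimage) (auto simp: open_delete simp flip: open_openin)
qed simp

lemma section_piece_iff:
  assumes "0 < c" "length qs = Suc p" "(t, s) \<in> D qs" "j \<le> p"
  shows "(t, s) \<in> section_piece c qs j \<longleftrightarrow> above c t \<and> first_above c t = j"
proof
  assume "(t, s) \<in> section_piece c qs j"
  then have *: "t i \<in> (if i < j then {..<c} else if i = j then {c<..} else - {c})" if "i \<le> p" for i
    using that assms by (simp add: section_piece_def)
  have less: "t i < c" if "i < j" for i using *[of i] that assms(4) by simp
  have gt: "c < t j" using *[of j] assms(4) by simp
  have "t i \<noteq> c" for i
  proof (cases "i \<le> p")
    case True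
    then show ?thesis using *[of i] by (auto split: if_splits)
  next
    case False
    then have "t i = 0" using simplex_support[of t p i] assms by simp
    then show ?thesis using assms(1) by simp
  qed
  then show "above c t \<and> first_above c t = j"
    using first_above_eqI[of c t j, OF gt less] gt unfolding above_def by blast
next
  assume "above c t \<and> first_above c t = j"
  then show "(t, s) \<in> section_piece c qs j"
    using first_above[of c t] assms(3) unfolding section_piece_def above_def by auto
qed

lemma section_domain_pieces:
  assumes "0 < c"
  shows "section_domain c = (\<Union>(p, qs, x, j)\<in>{(p, qs, x, j). length qs = Suc p \<and> x \<in> cells (prism_star S) qs \<and> j \<le> p}.
    (\<lambda>(t, s). (p, t, qs, s, x)) ` section_piece c qs j)" (is "_ = ?U")
proof (intro equalityI subsetI)
  fix z assume z: "z \<in> section_domain c"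
  obtain p t qs s x where [simp]: "z = (p, t, qs, s, x)" by (cases z) auto
  have *: "length qs = Suc p" "x \<in> cells (prism_star S) qs" "(t, s) \<in> D qs" "above c t"
    using z by (auto simp: section_domain_def topspace_prism_points)
  have j: "first_above c t \<le> p"
    using first_above_le[OF *(4) assms, of p] *(1,3) by simp
  have "(t, s) \<in> section_piece c qs (first_above c t)"
    using section_piece_iff[OF assms *(1,3) j] *(4) by simp
  then have "z \<in> (\<lambda>(t, s). (p, t, qs, s, x)) ` section_piece c qs (first_above c t)"
    by (rule rev_image_eqI) simp
  then show "z \<in> ?U" using * j by blast
next
  fix z assume "z \<in> ?U"
  then obtain p qs x j t s where *: "length qs = Suc p" "x \<in> cells (prism_star S) qs" "j \<le> p" "(t, s) \<in> section_piece c qs j"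
    and [simp]: "z = (p, t, qs, s, x)" by auto
  then have "(t, s) \<in> D qs" by (simp add: section_piece_def)
  then show "z \<in> section_domain c"
    using section_piece_iff[OF assms *(1) _ *(3)] * by (auto simp: section_domain_def topspace_prism_points)
qed

lemma openin_section_domain:
  assumes "0 < c"
  shows "openin star_points (section_domain c)"
  unfolding section_domain_pieces[OF assms]
proof (rule openin_Union, clarify)
  fix p qs x j assume "length qs = Suc p" "x \<in> cells (prism_star S) qs"
  then show "openin star_points ((\<lambda>(t, s). (p, t, qs, s, x)) ` section_piece c qs j)"
    by (intro open_map_prism_piece[unfolded open_map_def, rule_format] openin_section_piece)
qed

lemma section_gauge_continuous:
  assumes c: "0 < c"
  shows "continuous_map (subtopology star_points (section_domain c)) T (section_gauge c)"
proof (rule continuous_map_open_pieces[where K = "{(p, qs, x, j). length qs = Suc p \<and> x \<in> cells (prism_star S) qs \<and> j \<le> p}"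
      and A = "\<lambda>(p, qs, x, j). subtopology (pdomain qs) (section_piece c qs j)" and i = "\<lambda>(p, qs, x, j) (t, s). (p, t, qs, s, x)"])
  have top: "topspace (subtopology (pdomain qs) (section_piece c qs j)) = section_piece c qs j" for qs j
    using openin_subset[OF openin_section_piece] by (simp add: Int_absorb1)
  let ?K = "{(p, qs, x, j). length qs = Suc p \<and> x \<in> cells (prism_star S) qs \<and> j \<le> p}"
  show "topspace (subtopology star_points (section_domain c)) \<subseteq> (\<Union>k\<in>?K.
      (case k of (p, qs, x, j) \<Rightarrow> \<lambda>(t, s). (p, t, qs, s, x)) ` topspace (case k of (p, qs, x, j) \<Rightarrow> subtopology (pdomain qs) (section_piece c qs j)))"
  proof
    fix z assume "z \<in> topspace (subtopology star_points (section_domain c))"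
    then have "z \<in> section_domain c" by simp
    then obtain p qs x j where "(p, qs, x, j) \<in> ?K" "z \<in> (\<lambda>(t, s). (p, t, qs, s, x)) ` section_piece c qs j"
      unfolding section_domain_pieces[OF c] by blast
    then show "z \<in> (\<Union>k\<in>?K. (case k of (p, qs, x, j) \<Rightarrow> \<lambda>(t, s). (p, t, qs, s, x)) `
        topspace (case k of (p, qs, x, j) \<Rightarrow> subtopology (pdomain qs) (section_piece c qs j)))"
      by (intro UN_I[of "(p, qs, x, j)"]) (simp_all only: prod.case top)
  qed
  fix k assume "k \<in> ?K"
  then obtain p qs x j where k [simp]: "k = (p, qs, x, j)" and *: "length qs = Suc p" "x \<in> cells (prism_star S) qs" "j \<le> p" by blast
  have "open_map (subtopology (pdomain qs) (section_piece c qs j)) (subtopology star_points (section_domain c)) (\<lambda>(t, s). (p, t, qs, s, x))"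
    by (rule open_map_into_subtopology[OF open_map_from_subtopology[OF open_map_prism_piece[OF *(1,2)] openin_section_piece]])
      (unfold top section_domain_pieces[OF c], use * in blast)
  then show "open_map (case k of (p, qs, x, j) \<Rightarrow> subtopology (pdomain qs) (section_piece c qs j)) (subtopology star_points (section_domain c))
      (case k of (p, qs, x, j) \<Rightarrow> \<lambda>(t, s). (p, t, qs, s, x))" by simp
  have x: "x \<in> ssimp S (star_dim qs)" using * by (simp add: cells_star)
  have "continuous_map (subtopology (pdomain qs) (section_piece c qs j)) T (\<lambda>u. lift_gauge j (p, fst u, qs, snd u, x))"
    by (rule continuous_map_from_subtopology[OF lift_gauge_continuous[OF *(1) x *(3)]])
  then have "continuous_map (subtopology (pdomain qs) (section_piece c qs j)) T (\<lambda>u. section_gauge c ((\<lambda>(t, s). (p, t, qs, s, x)) u))"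
  proof (rule continuous_map_eq)
    fix u assume "u \<in> topspace (subtopology (pdomain qs) (section_piece c qs j))"
    then have u: "(fst u, snd u) \<in> section_piece c qs j" unfolding top by simp
    then have "(fst u, snd u) \<in> D qs" by (simp add: section_piece_def)
    from section_piece_iff[OF c *(1) this *(3)] u
    show "lift_gauge j (p, fst u, qs, snd u, x) = section_gauge c ((\<lambda>(t, s). (p, t, qs, s, x)) u)"
      by (simp add: section_gauge_def case_prod_unfold)
  qed
  then show "continuous_map (case k of (p, qs, x, j) \<Rightarrow> subtopology (pdomain qs) (section_piece c qs j)) T
      (\<lambda>a. section_gauge c ((case k of (p, qs, x, j) \<Rightarrow> \<lambda>(t, s). (p, t, qs, s, x)) a))" by simp
qed

text \<open>The option type packs two facts into one invariant function: whether a point belongs to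
  the section domain, which gives saturation, and the value of the framed lifts there, which gives
  both gauge conditions.\<close>

lemma framed_invariant:
  assumes "0 < c"
  shows "prism_invariant (prism_star S) (\<lambda>p t w. if above c t then Some (framed (first_above c t) p t w) else None)"
proof (rule prism_invariantI)
  fix p t qs s x i j
  assume *: "t \<in> standard_simplex p" "length qs = Suc p" "i < length qs" "1 \<le> qs ! i" "j \<le> qs ! i"
    "s \<in> topspace (multisimplex (down qs i))" "x \<in> cells (prism_star S) qs"
  have "framed (first_above c t) p t (qs, s(i := simplical_face j (s i)), x) = framed (first_above c t) p t (down qs i, s, dface (prism_star S) qs i j x)"
    if "above c t"
    unfolding dface_star using * first_above_le[OF that assms *(1)] by (intro framed_dface) (auto simp: cells_star)
  then show "(if above c t then Some (framed (first_above c t) p t (qs, s(i := simplical_face j (s i)), x)) else None)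
      = (if above c t then Some (framed (first_above c t) p t (down qs i, s, dface (prism_star S) qs i j x)) else None)" by simp
next
  fix p t qs s x i j
  assume *: "t \<in> standard_simplex p" "length qs = Suc p" "i < length qs" "j \<le> qs ! i"
    "s \<in> topspace (multisimplex (up qs i))" "x \<in> cells (prism_star S) qs"
  have "framed (first_above c t) p t (qs, s(i := codegen j (s i)), x) = framed (first_above c t) p t (up qs i, s, ddegen (prism_star S) qs i j x)"
    if "above c t"
    unfolding ddegen_star using * first_above_le[OF that assms *(1)] by (intro framed_ddegen) (auto simp: cells_star)
  then show "(if above c t then Some (framed (first_above c t) p t (qs, s(i := codegen j (s i)), x)) else None)
      = (if above c t then Some (framed (first_above c t) p t (up qs i, s, ddegen (prism_star S) qs i j x)) else None)" by simp
next
  fix p t qs s x k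
  assume *: "t \<in> standard_simplex p" "length qs = Suc (Suc p)" "k < length qs" "s \<in> topspace (multisimplex qs)" "x \<in> cells (prism_star S) qs"
  have "framed (first_above c (simplical_face k t)) (Suc p) (simplical_face k t) (qs, s, x)
      = framed (first_above c t) p t (remove_nth k qs, delete_at k s, bface (prism_star S) qs k x)"
    if "above c t"
    unfolding first_above_face[OF assms that] using * first_above_le[OF that assms *(1)] by (intro framed_bface) (auto simp: cells_star)
  then show "(if above c (simplical_face k t) then Some (framed (first_above c (simplical_face k t)) (Suc p) (simplical_face k t) (qs, s, x)) else None)
      = (if above c t then Some (framed (first_above c t) p t (remove_nth k qs, delete_at k s, bface (prism_star S) qs k x)) else None)"
    using above_face[OF assms, of k t] by simp
qed

lemma section_invariant:
  assumes c: "0 < c" and z: "z \<in> section_domain c" "z' \<in> topspace star_points"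
    and eq: "prism_point (prism_star S) z = prism_point (prism_star S) z'"
  shows "z' \<in> section_domain c"
    and "F_act (F_lift z) (section_gauge c z) = F_act (F_lift z') (section_gauge c z')"
    and "EG_act G T (EG_lift z) (section_gauge c z) = EG_act G T (EG_lift z') (section_gauge c z')"
proof -
  obtain p t qs s x where [simp]: "z = (p, t, qs, s, x)" by (cases z) auto
  obtain p' t' qs' s' x' where [simp]: "z' = (p', t', qs', s', x')" by (cases z') auto
  have zz: "(p, t, qs, s, x) \<in> topspace star_points" "(p', t', qs', s', x') \<in> topspace star_points" and a: "above c t"
    using z by (simp_all add: section_domain_def)
  have "Some (framed (first_above c t) p t (qs, s, x))
      = (if above c t' then Some (framed (first_above c t') p' t' (qs', s', x')) else None)"
    using prism_point_eqD[OF prismatic_set_star framed_invariant[OF c] zz] eq a by simp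
  then have a': "above c t'" and f: "framed (first_above c t) p t (qs, s, x) = framed (first_above c t') p' t' (qs', s', x')"
    by (auto split: if_splits)
  show "z' \<in> section_domain c" using z(2) a' by (simp add: section_domain_def)
  have j: "first_above c t \<le> p" "first_above c t' \<le> p'"
    using first_above_le[OF a c, of p] first_above_le[OF a' c, of p'] zz by (simp_all add: topspace_prism_points)
  show "F_act (F_lift z) (section_gauge c z) = F_act (F_lift z') (section_gauge c z')"
    "EG_act G T (EG_lift z) (section_gauge c z) = EG_act G T (EG_lift z') (section_gauge c z')"
    using f unfolding framed_eq[OF zz(1) j(1)] framed_eq[OF zz(2) j(2)] by (simp_all add: section_gauge_def)
qed

lemma classifying_map_prism_m:
  "classifying_map G (universal_bundle G T)
     (pullback_bundle (prism_real (prism_star S)) (proj_L S) (assoc_bundle G T S v))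
     (ev G T \<circ> prism_real_map (prism_BG G T) prism_m)"
proof -
  let ?Z = "prism_real (prism_star S)" and ?\<zeta> = "prism_point (prism_star S)" and ?b = "ev G T \<circ> prism_real_map (prism_BG G T) prism_m"
  have proj: "proj_L S (?\<zeta> z) = F_pr (F_lift z)" and ev: "?b (?\<zeta> z) = BG_class G T (EG_lift z)" if "z \<in> topspace star_points" for z
  proof -
    obtain p t qs s x where [simp]: "z = (p, t, qs, s, x)" by (cases z) auto
    show "proj_L S (?\<zeta> z) = F_pr (F_lift z)" "?b (?\<zeta> z) = BG_class G T (EG_lift z)"
      using proj_L_point[of p t qs s x] ev_prism_m_point[of p t qs s x] that by simp_all
  qed
  have "continuous_map star_points (BG G T) (BG_class G T \<circ> EG_lift)"
    by (rule continuous_map_compose[OF EG_lift_continuous]) (unfold BG_def BG_class_def[abs_def], rule continuous_map_glue_class)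
  then have "continuous_map star_points (BG G T) (?b \<circ> ?\<zeta>)"
    by (rule continuous_map_eq) (simp add: ev[unfolded comp_def])
  then have cont: "continuous_map ?Z (BG G T) ?b"
    by (rule continuous_compose_quotient_map[OF quotient_map_prism_point])
  \<comment> \<open>The open cover is indexed by all thresholds c > 0. The two gauge conditions are
    the two components of the invariance of \<open>framed\<close>, rewritten by
    \<open>framed_eq\<close>.\<close>
  interpret common_lift G T F_space F_act F_pr F_tr "EG T" "EG_act G T" "BG_class G T" EG_tr star_points ?Z ?\<zeta> F_lift EG_lift "proj_L S" ?b
    "{0<..}" section_domain section_gauge
  proof (intro common_lift.intro common_lift_axioms.intro principal_space_F principal_space_EG)
    show "quotient_map star_points ?Z ?\<zeta>" by (rule quotient_map_prism_point)
    show "\<exists>c\<in>{0<..}. z \<in> section_domain c" if z: "z \<in> topspace star_points" for z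
    proof -
      obtain p t qs s x where [simp]: "z = (p, t, qs, s, x)" by (cases z) auto
      have "t \<in> standard_simplex p" using z by (simp add: topspace_prism_points)
      from ex_above[OF this] z show ?thesis by (auto simp: section_domain_def)
    qed
    fix c :: real assume "c \<in> {0<..}"
    then have c: "0 < c" by simp
    show "openin star_points (section_domain c)" "continuous_map (subtopology star_points (section_domain c)) T (section_gauge c)"
      by (rule openin_section_domain[OF c], rule section_gauge_continuous[OF c])
    fix z z' assume "z \<in> section_domain c" "z' \<in> topspace star_points" "?\<zeta> z = ?\<zeta> z'"
    note inv = section_invariant[OF c this]
    show "z' \<in> section_domain c" "F_act (F_lift z) (section_gauge c z) = F_act (F_lift z') (section_gauge c z')"
      "EG_act G T (EG_lift z) (section_gauge c z) = EG_act G T (EG_lift z') (section_gauge c z')"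
      by (fact inv)+
  qed (fact F_lift_continuous EG_lift_continuous proj ev)+
  have "bundle_isomorphic G (pullback_bundle ?Z ?b (universal_bundle G T)) (pullback_bundle ?Z (proj_L S) (assoc_bundle G T S v))"
    by (rule bundle_isomorphic_pullbacks) (simp_all add: universal_bundle_def)
  with cont show ?thesis
    by (simp add: classifying_map_def pullback_bundle_def universal_bundle_def)
qed

end

section \<open>Naturality\<close>

text \<open>That m is canonical is made precise as naturality: a simplicial map that is compatible
  with the transition functions carries one m to the other.\<close>

locale transition_functions_map = A: transition_functions G T S v + B: transition_functions G T S' v'
  for G :: "'g monoid" (structure) and T :: "'g topology" and S :: "'s sset" and v and S' :: "'s sset" and v' +
  fixes f :: "nat \<Rightarrow> 's \<Rightarrow> 's"
  assumes map: "simplicial_map S S' f"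
    and v_eq: "\<And>n \<sigma> t. \<sigma> \<in> ssimp S (Suc n) \<Longrightarrow> t \<in> standard_simplex n \<Longrightarrow> v (Suc n) \<sigma> t = v' (Suc n) (f (Suc n) \<sigma>) t"
begin

lemma map_face: "\<sigma> \<in> ssimp S (Suc n) \<Longrightarrow> j \<le> Suc n \<Longrightarrow> f n (sface S (Suc n) j \<sigma>) = sface S' (Suc n) j (f (Suc n) \<sigma>)"
  using map unfolding simplicial_map_def by blast

text \<open>\<open>W\<close> is built from last faces and from \<open>v\<close> alone, and
  \<open>f\<close> respects both. The remaining constructions inherit naturality from it.\<close>

lemma W_natural:
  "\<sigma> \<in> ssimp S n \<Longrightarrow> t \<in> standard_simplex n \<Longrightarrow> i \<le> n \<Longrightarrow> A.W i n \<sigma> t = B.W i n (f n \<sigma>) t"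
proof (induction n arbitrary: \<sigma> t)
  case (Suc n)
  show ?case
  proof (cases "i = Suc n")
    case False
    then have "push i n t \<in> standard_simplex n" using Suc.prems by (intro push_in_simplex) auto
    then show ?thesis
      using Suc.IH[OF A.face_in[OF Suc.prems(1) order_refl]] Suc.prems False map_face[OF Suc.prems(1) order_refl] v_eq[OF Suc.prems(1)]
      by simp
  qed simp
qed simp

lemma R_natural:
  "\<sigma> \<in> ssimp S n \<Longrightarrow> t \<in> standard_simplex n \<Longrightarrow> i \<le> n \<Longrightarrow> j \<le> n \<Longrightarrow> A.R i j n \<sigma> t = B.R i j n (f n \<sigma>) t"
  unfolding A.R_def B.R_def by (simp only: W_natural)

lemma coef_natural:
  assumes "x \<in> ssimp S (star_dim qs)" "t \<in> standard_simplex (length qs - 1)" "s \<in> topspace (multisimplex qs)"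
  shows "j < length qs \<Longrightarrow> A.coef qs x t s j = B.coef qs (f (star_dim qs) x) t s j"
proof (induction j)
  case (Suc j)
  have "qs \<noteq> []" using Suc.prems by auto
  from R_natural[OF assms(1) stage_point_in_simplex[OF this assms(2,3)] extra_le[OF Suc.prems] extra_le[OF Suc_lessD[OF Suc.prems]], of "Suc j"]
  show ?case using Suc by simp
qed simp

lemma prism_m_natural:
  assumes "x \<in> cells (prism_star S) qs"
  shows "A.prism_m qs x = B.prism_m qs (f (star_dim qs) x)"
proof -
  have x: "x \<in> ssimp S (star_dim qs)" using assms by (simp add: A.cells_star)
  have "A.star_map qs x = B.star_map qs (f (star_dim qs) x)"
    unfolding A.star_map_def B.star_map_def
    by (intro restrict_ext) (use coef_natural[OF x] in \<open>auto intro!: restrict_ext\<close>)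
  then show ?thesis
    by (simp only: A.prism_m_def B.prism_m_def)
qed

end

theorem theorem8p1:
  fixes G :: "'g monoid" and T :: "'g topology"
    and A :: "('g set \<times> ('g \<Rightarrow> 'e::real_normed_vector)) set"
  assumes "lie_group G T A"
  shows "\<exists>m :: 's sset \<Rightarrow> (nat \<Rightarrow> 's \<Rightarrow> (nat \<Rightarrow> real) \<Rightarrow> 'g) \<Rightarrow> nat list \<Rightarrow> 's \<Rightarrow> 'g pmap set.
    (\<forall>S v. simplicial_set S \<and> compatible_transition_functions G T S v \<longrightarrow>
       prismatic_map (prism_star S) (prism_BG G T) (m S v) \<and>
       classifying_map G (universal_bundle G T)
         (pullback_bundle (prism_real (prism_star S)) (proj_L S) (assoc_bundle G T S v))
         (ev G T \<circ> prism_real_map (prism_BG G T) (m S v))) \<and>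
    (\<forall>S v S' v' f.
       simplicial_set S \<and> compatible_transition_functions G T S v \<and>
       simplicial_set S' \<and> compatible_transition_functions G T S' v' \<and>
       simplicial_map S S' f \<and>
       (\<forall>n. \<forall>\<sigma>\<in>ssimp S (Suc n). \<forall>t\<in>standard_simplex n. v (Suc n) \<sigma> t = v' (Suc n) (f (Suc n) \<sigma>) t) \<longrightarrow>
       (\<forall>qs. \<forall>x\<in>cells (prism_star S) qs. m S v qs x = m S' v' qs (f (star_dim qs) x)))"
proof (intro exI[of _ "\<lambda>S v. transition_functions.prism_m G T S v"] conjI allI impI ballI; elim conjE)
  have tf: "transition_functions G T S v"
    if "simplicial_set S" "compatible_transition_functions G T S v" for S :: "'s sset" and v
    using topological_group_lie_group[OF assms] that
    by (simp add: transition_functions_def simplicial_def transition_functions_axioms_def)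
  fix S :: "'s sset" and v
  assume S: "simplicial_set S" "compatible_transition_functions G T S v"
  interpret transition_functions G T S v by (rule tf[OF S])
  show "prismatic_map (prism_star S) (prism_BG G T) prism_m" by (rule prismatic_map_prism_m)
  show "classifying_map G (universal_bundle G T)
     (pullback_bundle (prism_real (prism_star S)) (proj_L S) (assoc_bundle G T S v))
     (ev G T \<circ> prism_real_map (prism_BG G T) prism_m)" by (rule classifying_map_prism_m)
  fix S' :: "'s sset" and v' f qs x
  assume S': "simplicial_set S'" "compatible_transition_functions G T S' v'" and f: "simplicial_map S S' f"
    "\<forall>n. \<forall>\<sigma>\<in>ssimp S (Suc n). \<forall>t\<in>standard_simplex n. v (Suc n) \<sigma> t = v' (Suc n) (f (Suc n) \<sigma>) t"
    and x: "x \<in> cells (prism_star S) qs"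
  interpret transition_functions_map G T S v S' v' f
    by (intro transition_functions_map.intro transition_functions_map_axioms.intro tf S S') (use f in auto)
  show "prism_m qs x = transition_functions.prism_m G T S' v' qs (f (star_dim qs) x)"
    by (rule prism_m_natural[OF x])
qed

end
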